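(* Fix integers $a>0$ and $d>a+6$. Let $l\subset\mathbb{P}^3$ be a line, let $C_2\neq l$ be a smooth curve of degree $a$ lying on a plane containing $l$, and let $X\subset\mathbb{P}^3$ be a smooth surface of degree $d$ containing $l$ and $C_2$. Let $P$ be the Hilbert polynomial of the effective divisor $2l+C_2$ on $X$. Let $L$ be an irreducible component of the Hilbert scheme $H_P$ such that a general point of $L$ corresponds to a curve $C_g$ which is an effective divisor on some smooth degree $d$ surface, of the form $C_g=2l_g+C_{2,g}$ with $l_g$ a line and $C_{2,g}$ a curve of degree $a$ coplanar with $l_g$ (such an $L$ exists by a theorem of Martin-Deschamps and Perrin). Then for a general point of $L$, the corresponding curve $C_g$ has the following property: there exists a first order infinitesimal deformation of $C_g$ in $\mathbb{P}^3$ which does not induce a deformation of the associated reduced scheme $C_{g,\mathrm{red}}$; that is, there exists $\xi_0\in H^0(\mathcal{N}_{C_g|\mathbb{P}^3})$ with $\Upsilon^5_{C_{g,\mathrm{red}}\le C_g}(\xi_0)\notin \mathrm{Im}\,\Upsilon^6_{C_{g,\mathrm{red}}\le C_g}$.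
   Context: The base field is $\mathbb{C}$. A curve is a closed subscheme of $\mathbb{P}^3$ of pure dimension $1$ (not necessarily reduced); a surface is a closed subscheme of $\mathbb{P}^3$ of pure dimension $2$. $Y_{\mathrm{red}}$ is the reduced scheme associated to $Y$. $H_P$ is the Hilbert scheme of closed subschemes of $\mathbb{P}^3$ with Hilbert polynomial $P$. A property holds for a general point of $L$ if it holds for all points outside a finite union of proper closed subsets of $L$. For a closed subscheme $Y\subset\mathbb{P}^3$ with ideal sheaf $\mathcal{I}_Y$, $\mathcal{N}_{Y|\mathbb{P}^3}=\mathcal{H}om_{\mathbb{P}^3}(\mathcal{I}_Y,\mathcal{O}_Y)$; elements of $H^0(\mathcal{N}_{Y|\mathbb{P}^3})$ correspond to first order deformations of $Y$ in $\mathbb{P}^3$. For effective divisors $E\le C$ on a smooth surface in $\mathbb{P}^3$, $\Upsilon^5_{E\le C}:H^0(\mathcal{N}_{C|\mathbb{P}^3})\to H^0(\mathcal{N}_{C|\mathbb{P}^3}\otimes\mathcal{O}_E)$ is the restriction map, and $\Upsilon^6_{E\le C}:H^0(\mathcal{N}_{E|\mathbb{P}^3})\to H^0(\mathcal{N}_{C|\mathbb{P}^3}\otimes\mathcal{O}_E)$ is obtained by applying $\mathcal{H}om_{\mathbb{P}^3}(-,\mathcal{O}_E)$ and then global sections to the inclusion $\mathcal{I}_C\hookrightarrow\mathcal{I}_E$. The condition $\Upsilon^5_{E\le C}(\xi)=\Upsilon^6_{E\le C}(\xi')$ says that the first order deformation of $E$ given by $\xi'$ is contained in the first order deformation of $C$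 given by $\xi$. *)

theory Defs
  imports
    "HOL-Analysis.Analysis"
    "HOL-Library.Poly_Mapping"
    "HOL-Library.Set_Algebras"
    "HOL-Library.Extended_Nat"
    "HOL-Computational_Algebra.Polynomial"
    "HOL-Computational_Algebra.Fraction_Field"
begin

section \<open>Polynomials in several variables\<close>

type_synonym 'v mpoly = "('v \<Rightarrow>\<^sub>0 nat) \<Rightarrow>\<^sub>0 complex"

text \<open>The homogeneous coordinate ring of three-dimensional projective space, and its field of
  fractions.\<close>

type_synonym coord_ring = "4 mpoly"
type_synonym coord_field = "coord_ring fract"

definition var :: "'v \<Rightarrow> 'v mpoly" where
  "var i = Poly_Mapping.single (Poly_Mapping.single i 1) 1"

definition mdeg :: "('v \<Rightarrow>\<^sub>0 nat) \<Rightarrow> nat" where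
  "mdeg m = (\<Sum>i\<in>Poly_Mapping.keys m. Poly_Mapping.lookup m i)"

text \<open>The graded piece of degree \<open>n\<close>, which contains \<open>0\<close>.\<close>

definition homog :: "nat \<Rightarrow> 'v mpoly set" where
  "homog n = {f. \<forall>m\<in>Poly_Mapping.keys f. mdeg m = n}"

definition eval_mpoly :: "('v \<Rightarrow> complex) \<Rightarrow> 'v mpoly \<Rightarrow> complex" where
  "eval_mpoly v f = (\<Sum>m\<in>Poly_Mapping.keys f.
     Poly_Mapping.lookup f m * (\<Prod>i\<in>Poly_Mapping.keys m. v i ^ Poly_Mapping.lookup m i))"

text \<open>When \<open>x\<^sub>i\<close> does not occur in \<open>m\<close> the truncated subtraction is harmless, because the
  coefficient vanishes.\<close>

definition partial_deriv :: "'v \<Rightarrow> 'v mpoly \<Rightarrow> 'v mpoly" where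
  "partial_deriv i f = (\<Sum>m\<in>Poly_Mapping.keys f.
     Poly_Mapping.single (m - Poly_Mapping.single i 1)
       (Poly_Mapping.lookup f m * of_nat (Poly_Mapping.lookup m i)))"

definition cscale :: "complex \<Rightarrow> 'v mpoly \<Rightarrow> 'v mpoly" where
  "cscale c f = Poly_Mapping.single 0 c * f"

text \<open>Ideals of a commutative ring are the submodules of the ring over itself.\<close>

global_interpretation ideal: module "(*) :: 'a::comm_ring_1 \<Rightarrow> 'a \<Rightarrow> 'a"
  by standard (simp_all add: algebra_simps)

global_interpretation cvs: vector_space "cscale :: complex \<Rightarrow> 'v mpoly \<Rightarrow> 'v mpoly"
proof
  fix a b :: complex and x y :: "'v mpoly"
  show "cscale a (x + y) = cscale a x + cscale a y"
    by (simp add: cscale_def distrib_left)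
  show "cscale (a + b) x = cscale a x + cscale b x"
    by (simp add: cscale_def single_add distrib_right)
  show "cscale a (cscale b x) = cscale (a * b) x"
    by (simp add: cscale_def mult_single flip: mult.assoc)
  show "cscale 1 x = x"
    by (simp add: cscale_def)
qed

section \<open>Closed subschemes of projective three-space\<close>

text \<open>A closed subscheme \<open>Y\<close> of \<open>\<PP>\<^sup>3 = Proj S\<close>, where \<open>S = \<complex>[x\<^sub>0,\<dots>,x\<^sub>3]\<close>, is represented by its
  saturated homogeneous ideal \<open>\<Oplus>\<^sub>n H\<^sup>0(\<I>\<^sub>Y(n))\<close>; this is a bijection which reverses inclusions.
  Points of \<open>\<PP>\<^sup>3\<close> (not only closed ones) are the relevant homogeneous prime ideals.\<close>

definition homogeneous_ideal :: "coord_ring set \<Rightarrow> bool" where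
  "homogeneous_ideal I \<longleftrightarrow> I = ideal.span (I \<inter> (\<Union>n. homog n))"

definition saturate :: "coord_ring set \<Rightarrow> coord_ring set" where
  "saturate I = {f. \<exists>n. \<forall>g\<in>homog n. g * f \<in> I}"

definition closed_subscheme :: "coord_ring set \<Rightarrow> bool" where
  "closed_subscheme I \<longleftrightarrow> homogeneous_ideal I \<and> saturate I = I"

definition contained_in :: "coord_ring set \<Rightarrow> coord_ring set \<Rightarrow> bool" where
  "contained_in Y Z \<longleftrightarrow> Z \<subseteq> Y"

definition reduction :: "coord_ring set \<Rightarrow> coord_ring set" where
  "reduction I = {f. \<exists>n. f ^ n \<in> I}"

definition proj_points :: "coord_ring set set" where
  "proj_points = {p. homogeneous_ideal p \<and> p \<noteq> UNIV \<and>
     (\<forall>f g. f * g \<in> p \<longrightarrow> f \<in> p \<or> g \<in> p) \<and> (\<exists>i. var i \<notin> p)}"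

text \<open>The dimension of the closure of a point of \<open>\<PP>\<^sup>3\<close>: the supremum of the lengths of chains of
  specializations starting at this point.\<close>

definition point_dim :: "coord_ring set \<Rightarrow> enat" where
  "point_dim p = (SUP n \<in> {n. \<exists>c. c 0 = p \<and> (\<forall>i\<le>n. c i \<in> proj_points) \<and>
     (\<forall>i<n. c i \<subset> c (Suc i))}. enat n)"

definition associated_points :: "coord_ring set \<Rightarrow> coord_ring set set" where
  "associated_points I = {p\<in>proj_points. \<exists>f. p = {g. g * f \<in> I}}"

text \<open>Pure dimension excludes embedded components as well as components of lower dimension.\<close>

definition pure_dim :: "nat \<Rightarrow> coord_ring set \<Rightarrow> bool" where
  "pure_dim r I \<longleftrightarrow> closed_subscheme I \<and> I \<noteq> UNIV \<and>
     (\<forall>p\<in>associated_points I. point_dim p = enat r)"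

text \<open>Smoothness over \<open>\<complex>\<close> in the form of the Jacobian condition of corank \<open>r\<close> at every closed point.\<close>

definition gradient :: "coord_ring \<Rightarrow> complex ^ 4 \<Rightarrow> complex ^ 4" where
  "gradient f p = (\<chi> i. eval_mpoly (($) p) (partial_deriv i f))"

definition smooth_of_dim :: "nat \<Rightarrow> coord_ring set \<Rightarrow> bool" where
  "smooth_of_dim r I \<longleftrightarrow> pure_dim r I \<and>
     (\<forall>p. p \<noteq> 0 \<and> (\<forall>f\<in>I. eval_mpoly (($) p) f = 0) \<longrightarrow>
        vec.dim ((\<lambda>f. gradient f p) ` I) + r = 3)"

definition has_hilbert_poly :: "coord_ring set \<Rightarrow> rat poly \<Rightarrow> bool" where
  "has_hilbert_poly I P \<longleftrightarrow> (\<forall>\<^sub>F n in sequentially.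
     poly P (of_nat n) = of_nat (cvs.dim (homog n :: coord_ring set)) - of_nat (cvs.dim (I \<inter> homog n)))"

definition has_degree :: "coord_ring set \<Rightarrow> nat \<Rightarrow> bool" where
  "has_degree I k \<longleftrightarrow> (\<exists>P. has_hilbert_poly I P \<and>
     fact (degree P) * lead_coeff P = of_nat k)"

definition is_line :: "coord_ring set \<Rightarrow> bool" where
  "is_line I \<longleftrightarrow> (\<exists>f\<in>homog 1. \<exists>g\<in>homog 1.
     f \<noteq> g \<and> \<not> cvs.dependent {f, g} \<and> I = ideal.span {f, g})"

definition is_plane :: "coord_ring set \<Rightarrow> bool" where
  "is_plane I \<longleftrightarrow> (\<exists>f\<in>homog 1. f \<noteq> 0 \<and> I = ideal.span {f})"

definition coplanar_subschemes :: "coord_ring set \<Rightarrow> coord_ring set \<Rightarrow> bool" where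
  "coplanar_subschemes Y Z \<longleftrightarrow> (\<exists>H. is_plane H \<and> contained_in Y H \<and> contained_in Z H)"

definition smooth_surface :: "nat \<Rightarrow> coord_ring set \<Rightarrow> bool" where
  "smooth_surface d X \<longleftrightarrow> smooth_of_dim 2 X \<and> has_degree X d"

section \<open>Sheaves on the standard basis of affine open subsets\<close>

text \<open>The sets \<open>D\<^sub>+(g)\<close> with \<open>g\<close> homogeneous of positive degree form a basis of affine open subsets of
  \<open>\<PP>\<^sup>3\<close>. For a homogeneous ideal \<open>I\<close> the module \<open>sections g I\<close> of sections over \<open>D\<^sub>+(g)\<close> of the
  associated ideal sheaf is the degree \<open>0\<close> part of the localization \<open>I\<^sub>g\<close>; for \<open>I = S\<close> this gives the
  structure sheaf. All of these are subsets of the field of fractions of \<open>S\<close>, and the restriction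
  maps are inclusions.\<close>

definition basis_index :: "coord_ring set" where
  "basis_index = {g. g \<noteq> 0 \<and> (\<exists>e>0. g \<in> homog e)}"

definition D_plus :: "coord_ring \<Rightarrow> coord_ring set set" where
  "D_plus g = {p\<in>proj_points. g \<notin> p}"

definition sections :: "coord_ring \<Rightarrow> coord_ring set \<Rightarrow> coord_field set" where
  "sections g I = {Fract f (g ^ n) | f n. \<exists>e. g \<in> homog e \<and> f \<in> I \<inter> homog (n * e)}"

abbreviation regular :: "coord_ring \<Rightarrow> coord_field set" where
  "regular g \<equiv> sections g UNIV"

text \<open>Sections over \<open>D\<^sub>+(g)\<close> of the structure sheaf of the subscheme with ideal \<open>J\<close>: cosets of the
  sections of the ideal sheaf.\<close>

definition subscheme_sections :: "coord_ring \<Rightarrow> coord_ring set \<Rightarrow> coord_field set set" where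
  "subscheme_sections g J = (\<lambda>x. x +o sections g J) ` regular g"

text \<open>The group \<open>H\<^sup>0(\<H>om(\<I>, \<O>\<^sub>Z))\<close> of \<open>\<O>\<close>-linear sheaf morphisms from the ideal sheaf \<open>\<I>\<close> of \<open>I\<close>
  to \<open>\<O>\<^sub>Z\<close>, where \<open>Z\<close> has ideal \<open>J\<close>. A sheaf morphism is given by its components over the basis
  \<open>D\<^sub>+(g)\<close>. Addition and scalar multiplication of cosets are written with the set operations;
  restriction to a smaller open subset enlarges a coset.\<close>

definition sheaf_hom :: "coord_ring set \<Rightarrow> coord_ring set \<Rightarrow>
    (coord_ring \<Rightarrow> coord_field \<Rightarrow> coord_field set) set" where
  "sheaf_hom I J = {\<phi> \<in> (\<Pi>\<^sub>E g\<in>basis_index. \<Pi>\<^sub>E x\<in>sections g I. subscheme_sections g J).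
     (\<forall>g\<in>basis_index. \<forall>x\<in>sections g I. \<forall>y\<in>sections g I. \<phi> g (x + y) = \<phi> g x + \<phi> g y) \<and>
     (\<forall>g\<in>basis_index. \<forall>r\<in>regular g. \<forall>x\<in>sections g I.
        \<phi> g (r * x) = (r *o \<phi> g x) + sections g J) \<and>
     (\<forall>g\<in>basis_index. \<forall>h\<in>basis_index. D_plus h \<subseteq> D_plus g \<longrightarrow>
        (\<forall>x\<in>sections g I. \<phi> g x \<subseteq> \<phi> h x))}"

definition normal_sections ::
    "coord_ring set \<Rightarrow> (coord_ring \<Rightarrow> coord_field \<Rightarrow> coord_field set) set" where
  "normal_sections Y = sheaf_hom Y Y"

text \<open>For effective divisors \<open>E \<le> C\<close> on a smooth surface the curve \<open>C\<close> is a local complete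
  intersection, so that \<open>\<N>\<^sub>C \<otimes> \<O>\<^sub>E = \<H>om(\<I>\<^sub>C, \<O>\<^sub>E)\<close>. With this identification \<open>Upsilon5 C E\<close> is
  composition with \<open>\<O>\<^sub>C \<rightarrow> \<O>\<^sub>E\<close>, and \<open>Upsilon6 C E\<close> is composition with the inclusion of \<open>\<I>\<^sub>C\<close> in
  \<open>\<I>\<^sub>E\<close>; both take values in \<open>sheaf_hom C E\<close>.\<close>

definition Upsilon5 :: "coord_ring set \<Rightarrow> coord_ring set \<Rightarrow>
    (coord_ring \<Rightarrow> coord_field \<Rightarrow> coord_field set) \<Rightarrow> coord_ring \<Rightarrow> coord_field \<Rightarrow> coord_field set" where
  "Upsilon5 C E \<xi> = (\<lambda>g\<in>basis_index. \<lambda>x\<in>sections g C. \<xi> g x + sections g E)"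

definition Upsilon6 :: "coord_ring set \<Rightarrow> coord_ring set \<Rightarrow>
    (coord_ring \<Rightarrow> coord_field \<Rightarrow> coord_field set) \<Rightarrow> coord_ring \<Rightarrow> coord_field \<Rightarrow> coord_field set" where
  "Upsilon6 C E \<xi> = (\<lambda>g\<in>basis_index. \<lambda>x\<in>sections g C. \<xi> g x)"

section \<open>Effective divisors\<close>

text \<open>Effective Cartier divisors: closed subschemes of \<open>X\<close> whose ideal sheaf in \<open>\<O>\<^sub>X\<close> is locally
  generated by one nonzerodivisor.\<close>

definition effective_divisor :: "coord_ring set \<Rightarrow> coord_ring set \<Rightarrow> bool" where
  "effective_divisor X D \<longleftrightarrow> closed_subscheme D \<and> contained_in D X \<and>
     (\<forall>p\<in>proj_points. X \<subseteq> p \<longrightarrow>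
        (\<exists>g\<in>basis_index. p \<in> D_plus g \<and>
           (\<exists>s\<in>regular g.
              sections g D = {a * s + b | a b. a \<in> regular g \<and> b \<in> sections g X} \<and>
              (\<forall>a\<in>regular g. a * s \<in> sections g X \<longrightarrow> a \<in> sections g X))))"

text \<open>The ideal sheaf in \<open>\<O>\<^sub>X\<close> of a sum of effective divisors is the product of their ideal sheaves.\<close>

definition divisor_add ::
    "coord_ring set \<Rightarrow> coord_ring set \<Rightarrow> coord_ring set \<Rightarrow> coord_ring set" where
  "divisor_add X D E = saturate (ideal.span ({f * g | f g. f \<in> D \<and> g \<in> E} \<union> X))"

section \<open>The Hilbert scheme\<close>

text \<open>The closed points of the Hilbert scheme \<open>H\<^sub>P\<close>.\<close>

definition hilb :: "rat poly \<Rightarrow> coord_ring set set" where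
  "hilb P = {I. closed_subscheme I \<and> has_hilbert_poly I P}"

definition is_basis :: "coord_ring list \<Rightarrow> coord_ring set \<Rightarrow> bool" where
  "is_basis bs W \<longleftrightarrow> distinct bs \<and> \<not> cvs.dependent (set bs) \<and> cvs.span (set bs) = W"

text \<open>The Pluecker coordinates of the space with basis \<open>bs\<close>, indexed by lists \<open>ms\<close> of monomials of the
  same length as \<open>bs\<close>: minors of the matrix of coefficients.\<close>

definition pluecker :: "coord_ring list \<Rightarrow> (4 \<Rightarrow>\<^sub>0 nat) list \<Rightarrow> complex" where
  "pluecker bs ms = (if length ms = length bs then
     (\<Sum>\<pi> | \<pi> permutes {..<length bs}. of_int (sign \<pi>) *
        (\<Prod>i<length bs. Poly_Mapping.lookup (bs ! i) (ms ! \<pi> i))) else 0)"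

text \<open>By Grothendieck's construction the map \<open>I \<mapsto> I\<^sub>r\<close> is, for all sufficiently large \<open>r\<close>, a closed
  embedding of \<open>H\<^sub>P\<close> into the Grassmannian of subspaces of \<open>S\<^sub>r\<close>, of codimension \<open>P(r)\<close>, and this
  defines the Zariski topology of \<open>H\<^sub>P\<close>. The closed subsets of the Grassmannian are given by
  homogeneous equations in the Pluecker coordinates.\<close>

definition hilb_closed :: "rat poly \<Rightarrow> coord_ring set set \<Rightarrow> bool" where
  "hilb_closed P Z \<longleftrightarrow> (\<forall>\<^sub>F r in sequentially.
     \<exists>Q \<subseteq> (\<Union>n. homog n). Z = {I \<in> hilb P. \<forall>F\<in>Q. \<forall>bs. is_basis bs (I \<inter> homog r) \<longrightarrow>
        eval_mpoly (pluecker bs) F = 0})"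

definition hilb_irreducible :: "rat poly \<Rightarrow> coord_ring set set \<Rightarrow> bool" where
  "hilb_irreducible P L \<longleftrightarrow> L \<noteq> {} \<and> L \<subseteq> hilb P \<and>
     (\<forall>Z1 Z2. hilb_closed P Z1 \<and> hilb_closed P Z2 \<and> L \<subseteq> Z1 \<union> Z2 \<longrightarrow> L \<subseteq> Z1 \<or> L \<subseteq> Z2)"

definition hilb_component :: "rat poly \<Rightarrow> coord_ring set set \<Rightarrow> bool" where
  "hilb_component P L \<longleftrightarrow> hilb_irreducible P L \<and>
     (\<forall>M. hilb_irreducible P M \<and> L \<subseteq> M \<longrightarrow> M = L)"

text \<open>A property holds outside a finite union of proper closed subsets \<open>L \<inter> Z\<close> of \<open>L\<close>.\<close>

definition for_general_point ::
    "rat poly \<Rightarrow> coord_ring set set \<Rightarrow> (coord_ring set \<Rightarrow> bool) \<Rightarrow> bool" where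
  "for_general_point P L \<phi> \<longleftrightarrow> (\<exists>\<Z>. finite \<Z> \<and> (\<forall>Z\<in>\<Z>. hilb_closed P Z \<and> \<not> L \<subseteq> Z) \<and>
     (\<forall>C\<in>L - \<Union>\<Z>. \<phi> C))"

end

theory Submission
  imports Defs "HOL-Computational_Algebra.Computational_Algebra" "HOL-Computational_Algebra.Field_as_Ring"
begin

text \<open>Choose coordinates with \<open>l = {x = z = 0}\<close> such that \<open>C\<^sub>2\<close> lies in the plane \<open>z = 0\<close>, with equation \<open>q = 0\<close> there.
  The surface is \<open>F = zA + xg\<close> with \<open>g = qB\<close>, and smoothness means that \<open>A\<close> and \<open>g\<close> have no common zero on \<open>l\<close>.
  The ideal of \<open>C = 2l + C\<^sub>2\<close> is \<open>(z\<^sup>2, xz, x\<^sup>2q, F)\<close> and that of its reduction is \<open>(z, xq)\<close> if \<open>q\<close> is squarefree.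
  Forms \<open>s\<close>, \<open>\<tau>\<close>, \<open>\<nu>\<close> of degrees \<open>1\<close>, \<open>deg B + 1\<close>, \<open>deg q + 1\<close> on \<open>l\<close> with \<open>As = B\<nu> - 2q\<tau>\<close> give a first order
  deformation of \<open>C\<close>. If it induces a deformation of the reduction, then \<open>\<tau> = B c\<^sub>2 - A c\<^sub>1\<close> on \<open>l\<close> with forms \<open>c\<^sub>1\<close>, \<open>c\<^sub>2\<close> of
  degrees \<open>1 - deg q\<close> and \<open>1\<close>. Since \<open>deg B = d - 1 - a \<ge> 2\<close>, some solution \<open>(s, \<tau>, \<nu>)\<close> is not of this form; for coprime
  \<open>q\<close> and \<open>B\<close> one with \<open>s = 1\<close> on an affine chart of \<open>l\<close>, by Bezout.
  If \<open>q\<close> is not squarefree, then \<open>s = \<tau> = 0\<close>, \<open>\<nu> = x\<^bsup>deg q + 1\<^esup>\<close> is an obstruction at a multiple component.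
  The case \<open>l \<subseteq> C\<^sub>2\<close>, where \<open>C\<close> contains a triple line, does not occur in \<open>H\<^sub>P\<close>: the Hilbert polynomials have different
  constant terms.\<close>

text \<open>The relation between s, \<tau>, \<nu> comes from a syzygy. Let E be the curve z = xq =
  0. The kernel of O_C -> O_E is generated by a section t, killed by x and z, with z = Bt and xq =
  -At. The deformation sends z^2, xz, x^2q, F to zs, t\<tau>, x\<nu>, B\<nu> - q\<tau>. Among the
  basic syzygies only zF = A z^2 + qB xz imposes a condition: t B (B\<nu> - 2q\<tau> - As) = 0, an
  equation on l. A lift sends z and xq to some U and V. Comparison on xz and x^2q makes U and V -
  \<nu> multiples of q on l, and F = Az + B xq then gives the shape of \<tau>. The obstacle is that
  t is not a form: its degree 1 + deg q - deg g is negative, so it exists only as a quotient, and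
  the deformation has to be given on every basic open set. It is therefore built from maps on the
  ideal that represent it up to a power of the denominator. Nor are equations given: surface and
  plane curve are known only by purity, degree and smoothness. That their ideals are principal (for
  the curve, modulo z) follows from factoriality and a bound on chains of primes.\<close>

declare ideal.scale_scale [simp del]

section \<open>Polynomial rings\<close>

text \<open>One predicate covers substitutions, constant coefficients, evaluations and embeddings
  between rings of different types, so that \<open>hom_simps\<close> pushes any of them through an
  expression.\<close>

definition ring_hom1 :: "('a::comm_ring_1 \<Rightarrow> 'b::comm_ring_1) \<Rightarrow> bool" where
  "ring_hom1 h \<longleftrightarrow> h 1 = 1 \<and> (\<forall>x y. h (x + y) = h x + h y) \<and> (\<forall>x y. h (x * y) = h x * h y)"

lemma ring_hom1I:
  assumes "h 1 = 1" "\<And>x y. h (x + y) = h x + h y" "\<And>x y. h (x * y) = h x * h y"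
  shows "ring_hom1 h"
  using assms by (simp add: ring_hom1_def)

context
  fixes h :: "'a::comm_ring_1 \<Rightarrow> 'b::comm_ring_1"
  assumes h: "ring_hom1 h"
begin

lemma hom_one: "h 1 = 1" and hom_add: "h (x + y) = h x + h y" and hom_mult: "h (x * y) = h x * h y"
  using h by (simp_all add: ring_hom1_def)

lemma hom_zero: "h 0 = 0"
  using hom_add[of 0 0] by simp

lemma hom_uminus: "h (- x) = - h x"
  using hom_add[of x "- x"] by (simp add: hom_zero eq_neg_iff_add_eq_0 add.commute)

lemma hom_diff: "h (x - y) = h x - h y"
  using hom_add[of x "- y"] by (simp add: hom_uminus)

lemma hom_power: "h (x ^ n) = h x ^ n"
  by (induction n) (simp_all add: hom_one hom_mult)

lemma hom_sum: "h (sum f A) = (\<Sum>x\<in>A. h (f x))"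
  by (induction A rule: infinite_finite_induct) (simp_all add: hom_zero hom_add)

lemma hom_prod: "h (prod f A) = (\<Prod>x\<in>A. h (f x))"
  by (induction A rule: infinite_finite_induct) (simp_all add: hom_one hom_mult)

end

lemmas hom_simps = hom_zero hom_one hom_add hom_mult hom_uminus hom_diff hom_power hom_sum hom_prod

lemma ring_hom1_comp: "ring_hom1 g \<Longrightarrow> ring_hom1 h \<Longrightarrow> ring_hom1 (\<lambda>x. g (h x))"
  by (simp add: ring_hom1_def)

lemma ring_hom1_id: "ring_hom1 (\<lambda>x. x)"
  by (simp add: ring_hom1_def)

lemma ring_hom1_pCons: "ring_hom1 (\<lambda>c. [:c:])"
  by (simp add: ring_hom1_def)

lemma ring_hom1_poly: "ring_hom1 (\<lambda>p. poly p a)"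
  by (simp add: ring_hom1_def)

lemma ring_hom1_coeff_0: "ring_hom1 (\<lambda>p. coeff p 0)"
  by (simp add: ring_hom1_def coeff_mult_0)

definition cst :: "complex \<Rightarrow> 'v mpoly" where
  "cst c = Poly_Mapping.single 0 c"

lemma ring_hom1_cst: "ring_hom1 cst"
  by (simp add: ring_hom1_def cst_def single_add mult_single)

lemma cscale_eq: "cscale c f = cst c * f"
  by (simp add: cscale_def cst_def)

lemma mpoly_sum_monomials:
  "f = (\<Sum>m\<in>Poly_Mapping.keys f. Poly_Mapping.single m (Poly_Mapping.lookup f m))"
proof (rule poly_mapping_eqI)
  fix k
  have "Poly_Mapping.lookup (\<Sum>m\<in>Poly_Mapping.keys f. Poly_Mapping.single m (Poly_Mapping.lookup f m)) k
     = (\<Sum>m\<in>Poly_Mapping.keys f. if m = k then Poly_Mapping.lookup f m else 0)"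
    unfolding lookup_sum by (intro sum.cong) (auto simp: lookup_single when_def)
  also have "\<dots> = Poly_Mapping.lookup f k"
    by (auto simp: in_keys_iff)
  finally show "Poly_Mapping.lookup f k =
    Poly_Mapping.lookup (\<Sum>m\<in>Poly_Mapping.keys f. Poly_Mapping.single m (Poly_Mapping.lookup f m)) k"
    by simp
qed

lemma monomial_eq_prod:
  fixes m :: "'v::finite \<Rightarrow>\<^sub>0 nat"
  shows "Poly_Mapping.single m c = cst c * (\<Prod>i\<in>UNIV. var i ^ Poly_Mapping.lookup m i)"
proof -
  have p: "var i ^ n = (Poly_Mapping.single (Poly_Mapping.single i n) 1 :: 'v mpoly)" for i n
  proof (induction n)
    case (Suc n)
    then show ?case
      by (simp add: var_def mult_single flip: single_add)
  qed simp
  have q: "(\<Prod>i\<in>A. Poly_Mapping.single (g i) 1 :: 'v mpoly) = Poly_Mapping.single (\<Sum>i\<in>A. g i) 1"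
    if "finite A" for A and g :: "'v \<Rightarrow> 'v \<Rightarrow>\<^sub>0 nat"
    using that by (induction A rule: finite_induct) (simp_all add: mult_single)
  have "(\<Sum>i\<in>UNIV. Poly_Mapping.single i (Poly_Mapping.lookup m i)) = m"
  proof (rule poly_mapping_eqI)
    fix k
    have "Poly_Mapping.lookup (\<Sum>i\<in>UNIV. Poly_Mapping.single i (Poly_Mapping.lookup m i)) k
       = (\<Sum>i\<in>UNIV. if i = k then Poly_Mapping.lookup m i else 0)"
      unfolding lookup_sum by (intro sum.cong) (auto simp: lookup_single when_def)
    then show "Poly_Mapping.lookup (\<Sum>i\<in>UNIV. Poly_Mapping.single i (Poly_Mapping.lookup m i)) k
       = Poly_Mapping.lookup m k"
      by simp
  qed
  then show ?thesis
    by (simp add: p q cst_def mult_single)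
qed

lemma mpoly_induct [case_names cst var add mult]:
  fixes f :: "'v::finite mpoly"
  assumes "\<And>c. P (cst c)" "\<And>i. P (var i)" "\<And>f g. P f \<Longrightarrow> P g \<Longrightarrow> P (f + g)"
    and m: "\<And>f g. P f \<Longrightarrow> P g \<Longrightarrow> P (f * g)"
  shows "P f"
proof -
  have P1: "P 1"
    using assms(1)[of 1] by (simp add: cst_def)
  have P0: "P 0"
    using assms(1)[of 0] by (simp add: cst_def)
  have pow: "P g \<Longrightarrow> P (g ^ n)" for g n
    by (induction n) (simp_all add: P1 m)
  have prod: "P (prod g A)" if "\<And>i. P (g i)" for g and A :: "'v set"
    using that by (induction A rule: infinite_finite_induct) (simp_all add: P1 m)
  have sum: "P (sum g A)" if "\<And>i. P (g i)" for g and A :: "('v \<Rightarrow>\<^sub>0 nat) set"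
    using that by (induction A rule: infinite_finite_induct) (simp_all add: P0 assms(3))
  show ?thesis
    by (subst mpoly_sum_monomials, rule sum, subst monomial_eq_prod, intro m assms(1) prod pow assms(2))
qed

text \<open>Coefficients pass through \<iota>, so that values may lie in any commutative ring, in
  particular in nested polynomial rings. With the product over all variables, not just those of the
  support, exponents add under one common index set.\<close>

definition mpsubst :: "(complex \<Rightarrow> 'b::comm_ring_1) \<Rightarrow> ('v \<Rightarrow> 'b) \<Rightarrow> 'v::finite mpoly \<Rightarrow> 'b" where
  "mpsubst \<iota> v f = (\<Sum>m\<in>Poly_Mapping.keys f. \<iota> (Poly_Mapping.lookup f m) * (\<Prod>i\<in>UNIV. v i ^ Poly_Mapping.lookup m i))"

lemma
  assumes i: "ring_hom1 \<iota>"
  shows ring_hom1_mpsubst: "ring_hom1 (mpsubst \<iota> v)"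
    and mpsubst_cst: "mpsubst \<iota> v (cst c) = \<iota> c"
    and mpsubst_var: "mpsubst \<iota> v (var j) = v j"
proof -
  note \<iota> = hom_simps[OF i]
  let ?t = "\<lambda>f m. \<iota> (Poly_Mapping.lookup f m) * (\<Prod>i\<in>UNIV. v i ^ Poly_Mapping.lookup m i)"
  \<comment> \<open>Enlarging the index set adds only zero coefficients; two polynomials can then
    share one index set.\<close>
  have sup: "mpsubst \<iota> v f = sum (?t f) A" if "finite A" "Poly_Mapping.keys f \<subseteq> A" for f A
    unfolding mpsubst_def using that
    by (intro sum.mono_neutral_left) (auto simp: in_keys_iff \<iota>)
  have single: "mpsubst \<iota> v (Poly_Mapping.single m c) = \<iota> c * (\<Prod>i\<in>UNIV. v i ^ Poly_Mapping.lookup m i)" for m c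
    using sup[of "{m}" "Poly_Mapping.single m c"] by simp
  have add: "mpsubst \<iota> v (f + g) = mpsubst \<iota> v f + mpsubst \<iota> v g" for f g
  proof -
    let ?A = "Poly_Mapping.keys f \<union> Poly_Mapping.keys g"
    show ?thesis
      using sup[of ?A f] sup[of ?A g] sup[of ?A "f + g"] Poly_Mapping.keys_add[of f g]
      by (simp add: lookup_add \<iota> distrib_right sum.distrib)
  qed
  have zero: "mpsubst \<iota> v 0 = 0"
    by (simp add: mpsubst_def)
  have sum: "mpsubst \<iota> v (sum f A) = (\<Sum>x\<in>A. mpsubst \<iota> v (f x))" for f and A :: "'x set"
    by (induction A rule: infinite_finite_induct) (simp_all add: add zero)
  have mult: "mpsubst \<iota> v (f * g) = mpsubst \<iota> v f * mpsubst \<iota> v g" for f g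
  proof -
    have "f * g = (\<Sum>m\<in>Poly_Mapping.keys f. Poly_Mapping.single m (Poly_Mapping.lookup f m)) *
        (\<Sum>k\<in>Poly_Mapping.keys g. Poly_Mapping.single k (Poly_Mapping.lookup g k))"
      by (simp flip: mpoly_sum_monomials)
    also have "\<dots> = (\<Sum>m\<in>Poly_Mapping.keys f. \<Sum>k\<in>Poly_Mapping.keys g.
        Poly_Mapping.single (m + k) (Poly_Mapping.lookup f m * Poly_Mapping.lookup g k))"
      by (simp only: sum_product mult_single)
    finally have "mpsubst \<iota> v (f * g) = (\<Sum>m\<in>Poly_Mapping.keys f. \<Sum>k\<in>Poly_Mapping.keys g. ?t f m * ?t g k)"
      by (simp only: sum single lookup_add power_add prod.distrib \<iota> mult_ac)
    then show ?thesis
      by (simp only: mpsubst_def sum_product)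
  qed
  show "ring_hom1 (mpsubst \<iota> v)"
    using single[of 0 1] by (intro ring_hom1I add mult) (simp add: \<iota>)
  show "mpsubst \<iota> v (cst c) = \<iota> c"
    using single[of 0 c] by (simp add: cst_def)
  have "(\<Prod>i\<in>UNIV. v i ^ Poly_Mapping.lookup (Poly_Mapping.single j (Suc 0)) i) = (\<Prod>i\<in>UNIV. if i = j then v i else 1)"
    by (intro prod.cong) (auto simp: lookup_single when_def)
  then show "mpsubst \<iota> v (var j) = v j"
    using single[of "Poly_Mapping.single j 1" 1] by (simp add: var_def \<iota>)
qed

lemma eval_mpoly_eq_mpsubst: "eval_mpoly v f = mpsubst (\<lambda>c. c) v f" for v :: "'v::finite \<Rightarrow> complex"
  unfolding eval_mpoly_def mpsubst_def
  by (intro sum.cong refl arg_cong2[where f = "(*)"] prod.mono_neutral_left) (auto simp: in_keys_iff)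

lemma ring_hom1_eval_mpoly: "ring_hom1 (eval_mpoly v)" for v :: "'v::finite \<Rightarrow> complex"
  using ring_hom1_mpsubst[OF ring_hom1_id, of v] by (simp add: eval_mpoly_eq_mpsubst[abs_def])

lemma eval_mpoly_cst: "eval_mpoly v (cst c) = c" for v :: "'v::finite \<Rightarrow> complex"
  by (simp add: eval_mpoly_eq_mpsubst mpsubst_cst ring_hom1_id)

lemma eval_mpoly_var: "eval_mpoly v (var i) = v i" for v :: "'v::finite \<Rightarrow> complex"
  by (simp add: eval_mpoly_eq_mpsubst mpsubst_var ring_hom1_id)

lemma hom_eqI:
  fixes g h :: "'v::finite mpoly \<Rightarrow> 'b::comm_ring_1"
  assumes "ring_hom1 g" "ring_hom1 h" "\<And>c. g (cst c) = h (cst c)" "\<And>i. g (var i) = h (var i)"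
  shows "g f = h f"
  by (induction f rule: mpoly_induct) (simp_all add: assms hom_simps)

section \<open>The grading\<close>

lemma mdeg_eq: "mdeg m = (\<Sum>i\<in>UNIV. Poly_Mapping.lookup m i)" for m :: "'v::finite \<Rightarrow>\<^sub>0 nat"
  unfolding mdeg_def by (intro sum.mono_neutral_left) (auto simp: in_keys_iff)

lemma mdeg_add: "mdeg (m + k) = mdeg m + mdeg k" for m :: "'v::finite \<Rightarrow>\<^sub>0 nat"
  by (simp add: mdeg_eq lookup_add sum.distrib)

lemma homog_zero [simp]: "0 \<in> homog n"
  by (simp add: homog_def)

lemma homog_add: "f \<in> homog n \<Longrightarrow> g \<in> homog n \<Longrightarrow> f + g \<in> homog n"
  using Poly_Mapping.keys_add[of f g] by (auto simp: homog_def)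

lemma homog_uminus: "f \<in> homog n \<Longrightarrow> - f \<in> homog n"
  by (auto simp: homog_def in_keys_iff)

lemma homog_diff: "f \<in> homog n \<Longrightarrow> g \<in> homog n \<Longrightarrow> f - g \<in> homog n"
  using homog_add[of f n "- g"] homog_uminus[of g n] by simp

lemma homog_sum: "(\<And>i. i \<in> A \<Longrightarrow> f i \<in> homog n) \<Longrightarrow> sum f A \<in> homog n"
  by (induction A rule: infinite_finite_induct) (auto intro: homog_add)

lemma homog_mult: "f \<in> homog n \<Longrightarrow> g \<in> homog k \<Longrightarrow> f * g \<in> homog (n + k)"
  for f g :: "'v::finite mpoly"
  using keys_mult[of f g] by (auto simp: homog_def mdeg_add)

lemma homog_cst [simp]: "cst c \<in> homog 0"
  by (simp add: homog_def cst_def mdeg_def)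

lemma homog_one [simp]: "1 \<in> homog 0"
  using homog_cst[of 1] by (simp add: cst_def)

lemma homog_var [simp]: "var i \<in> homog 1"
  by (simp add: homog_def var_def mdeg_def)

lemma homog_power: "f \<in> homog n \<Longrightarrow> f ^ k \<in> homog (k * n)" for f :: "'v::finite mpoly"
  by (induction k) (auto dest: homog_mult)

lemma homog_prod: "(\<And>i. i \<in> A \<Longrightarrow> f i \<in> homog (g i)) \<Longrightarrow> prod f A \<in> homog (sum g A)"
  for f :: "'i \<Rightarrow> 'v::finite mpoly"
  by (induction A rule: infinite_finite_induct) (auto intro: homog_mult)

lemma homog_cst_mult: "f \<in> homog n \<Longrightarrow> cst c * f \<in> homog n" for f :: "'v::finite mpoly"
  using homog_mult[of "cst c" 0 f n] by simp

lemma subspace_homog: "cvs.subspace (homog n :: 'v::finite mpoly set)"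
  by (intro cvs.subspaceI) (auto simp: cscale_eq homog_add homog_cst_mult)

lemma homog_unique: "f \<in> homog n \<Longrightarrow> f \<in> homog k \<Longrightarrow> f \<noteq> 0 \<Longrightarrow> n = k"
  by (auto simp: homog_def)

lemma homog_0_cst: "f \<in> homog 0 \<Longrightarrow> \<exists>c. f = cst c" for f :: "'v::finite mpoly"
proof
  assume f: "f \<in> homog 0"
  have "m = 0" if "mdeg m = 0" for m :: "'v \<Rightarrow>\<^sub>0 nat"
    using that by (intro poly_mapping_eqI) (auto simp: mdeg_eq)
  with f have "Poly_Mapping.keys f \<subseteq> {0}"
    by (auto simp: homog_def)
  then show "f = cst (Poly_Mapping.lookup f 0)"
    by (intro poly_mapping_eqI) (auto simp: cst_def lookup_single when_def in_keys_iff)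
qed

definition hcomp :: "nat \<Rightarrow> 'v mpoly \<Rightarrow> 'v mpoly" where
  "hcomp n f = (\<Sum>m\<in>{m\<in>Poly_Mapping.keys f. mdeg m = n}. Poly_Mapping.single m (Poly_Mapping.lookup f m))"

lemma lookup_hcomp: "Poly_Mapping.lookup (hcomp n f) m = (if mdeg m = n then Poly_Mapping.lookup f m else 0)"
proof -
  have "Poly_Mapping.lookup (hcomp n f) m =
    (\<Sum>k\<in>{m\<in>Poly_Mapping.keys f. mdeg m = n}. if k = m then Poly_Mapping.lookup f k else 0)"
    unfolding hcomp_def lookup_sum by (intro sum.cong) (auto simp: lookup_single when_def)
  then show ?thesis
    by (auto simp: in_keys_iff)
qed

lemma hcomp_homog [simp]: "hcomp n f \<in> homog n"
  by (auto simp: homog_def in_keys_iff lookup_hcomp split: if_splits)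

lemma hcomp_add: "hcomp n (f + g) = hcomp n f + hcomp n g"
  by (rule poly_mapping_eqI) (simp add: lookup_hcomp lookup_add)

lemma hcomp_zero [simp]: "hcomp n 0 = 0"
  by (rule poly_mapping_eqI) (simp add: lookup_hcomp)

lemma hcomp_sum: "hcomp n (sum f A) = (\<Sum>i\<in>A. hcomp n (f i))"
  by (induction A rule: infinite_finite_induct) (auto simp: hcomp_add)

lemma hcomp_of_homog: "f \<in> homog k \<Longrightarrow> hcomp n f = (if n = k then f else 0)"
  by (rule poly_mapping_eqI) (auto simp: lookup_hcomp homog_def in_keys_iff)

lemma hcomp_eq_0: "\<exists>N. \<forall>n\<ge>N. hcomp n f = 0"
proof -
  let ?N = "Suc (Max (insert 0 (mdeg ` Poly_Mapping.keys f)))"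
  have "mdeg m < ?N" if "m \<in> Poly_Mapping.keys f" for m
    using that by (auto simp: less_Suc_eq_le intro!: Max_ge)
  then have "\<forall>n\<ge>?N. hcomp n f = 0"
    by (intro allI impI poly_mapping_eqI) (auto simp: lookup_hcomp in_keys_iff not_less[symmetric])
  then show ?thesis ..
qed

lemma sum_hcomp: 
  assumes "\<And>n. n \<ge> N \<Longrightarrow> hcomp n f = 0" shows "f = (\<Sum>n<N. hcomp n f)"
proof (rule poly_mapping_eqI)
  fix m
  have "Poly_Mapping.lookup f m = (if mdeg m < N then Poly_Mapping.lookup f m else 0)"
    using assms[of "mdeg m"] lookup_hcomp[of "mdeg m" f m] by (auto simp: not_less)
  then show "Poly_Mapping.lookup f m = Poly_Mapping.lookup (\<Sum>n<N. hcomp n f) m"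
    by (simp add: lookup_sum lookup_hcomp)
qed

lemma hcomp_mult_homog:
  fixes f h :: "'v::finite mpoly"
  assumes "h \<in> homog k" shows "hcomp (k + n) (h * f) = h * hcomp n f"
proof -
  obtain N where N: "\<And>n. n \<ge> N \<Longrightarrow> hcomp n f = 0"
    using hcomp_eq_0 by blast
  have "hcomp (k + n) (h * f) = (\<Sum>i<N. hcomp (k + n) (h * hcomp i f))"
    by (subst sum_hcomp[OF N]) (simp_all add: sum_distrib_left hcomp_sum)
  also have "\<dots> = (\<Sum>i<N. if i = n then h * hcomp i f else 0)"
    by (intro sum.cong refl) (simp add: hcomp_of_homog[OF homog_mult[OF assms hcomp_homog]] eq_commute)
  also have "\<dots> = h * hcomp n f"
    using N[of n] by (simp add: not_less)
  finally show ?thesis .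
qed

lemma hcomp_mult_homog_less:
  fixes f h :: "'v::finite mpoly"
  assumes "h \<in> homog k" "n < k" shows "hcomp n (h * f) = 0"
proof -
  obtain N where N: "\<And>n. n \<ge> N \<Longrightarrow> hcomp n f = 0"
    using hcomp_eq_0 by blast
  have "hcomp n (h * f) = (\<Sum>i<N. hcomp n (h * hcomp i f))"
    by (subst sum_hcomp[OF N]) (simp_all add: sum_distrib_left hcomp_sum)
  also have "\<dots> = 0"
    using assms(2) by (intro sum.neutral) (simp add: hcomp_of_homog[OF homog_mult[OF assms(1) hcomp_homog]])
  finally show ?thesis .
qed

lemma homogI_hcomp: "(\<And>k. k \<noteq> n \<Longrightarrow> hcomp k f = 0) \<Longrightarrow> f \<in> homog n"
proof -
  assume a: "\<And>k. k \<noteq> n \<Longrightarrow> hcomp k f = 0"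
  have "mdeg m = n" if "Poly_Mapping.lookup f m \<noteq> 0" for m
    using that a[of "mdeg m"] lookup_hcomp[of "mdeg m" f m] by force
  then show ?thesis
    by (auto simp: homog_def in_keys_iff)
qed

text \<open>In a domain the lowest components of the factors multiply to the lowest component of the
  product, and likewise the highest ones. The product has a single degree, so lowest and highest
  coincide in each factor.\<close>

lemma factor_homog:
  fixes f g :: coord_ring
  assumes "f * g \<in> homog n" "f * g \<noteq> 0"
  shows "\<exists>k\<le>n. f \<in> homog k"
proof -
  have nz: "f \<noteq> 0" "g \<noteq> 0" using assms by auto
  define S where "S = (\<lambda>f::coord_ring. {n. hcomp n f \<noteq> 0})"
  have fin: "finite (S f)" for f
  proof -
    obtain N where "\<forall>n\<ge>N. hcomp n f = 0" using hcomp_eq_0 by blast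
    then have "S f \<subseteq> {..<N}" by (auto simp: S_def not_le[symmetric])
    then show ?thesis by (rule finite_subset) simp
  qed
  have ne: "S f \<noteq> {}" if "f \<noteq> 0" for f
    using that hcomp_eq_0[of f] sum_hcomp[of 0 f] by (auto simp: S_def)
  have decomp: "f = (\<Sum>i\<in>S f. hcomp i f)" for f
  proof -
    obtain N where N: "\<And>n. n \<ge> N \<Longrightarrow> hcomp n f = 0" using hcomp_eq_0 by blast
    have "f = (\<Sum>n<N. hcomp n f)" by (rule sum_hcomp[OF N])
    also have "\<dots> = (\<Sum>i\<in>S f. hcomp i f)"
      using N by (intro sum.mono_neutral_right) (auto simp: S_def not_le[symmetric])
    finally show ?thesis .
  qed
  have prod: "hcomp m (f * g) = (\<Sum>i\<in>S f. \<Sum>j\<in>S g. if i + j = m then hcomp i f * hcomp j g else 0)" for m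
  proof -
    have "hcomp m (f * g) = hcomp m ((\<Sum>i\<in>S f. hcomp i f) * (\<Sum>j\<in>S g. hcomp j g))"
      using decomp[of f] decomp[of g] by simp
    also have "\<dots> = (\<Sum>i\<in>S f. \<Sum>j\<in>S g. hcomp m (hcomp i f * hcomp j g))"
      by (simp add: sum_product hcomp_sum)
    finally show ?thesis
      by (simp add: hcomp_of_homog[OF homog_mult[OF hcomp_homog hcomp_homog]] eq_commute cong: if_cong)
  qed
  \<comment> \<open>A pair of degrees whose sum no other pair attains contributes a product that
    cannot cancel. This applies to the two minima and to the two maxima.\<close>
  have ext: "i + j = n" if ij: "i \<in> S f" "j \<in> S g" and u: "\<And>i' j'. i' \<in> S f \<Longrightarrow> j' \<in> S g \<Longrightarrow> i' + j' = i + j \<Longrightarrow> i' = i \<and> j' = j" for i j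
  proof -
    have "hcomp (i + j) (f * g) = (\<Sum>i'\<in>S f. \<Sum>j'\<in>S g. if i' = i \<and> j' = j then hcomp i f * hcomp j g else 0)"
      unfolding prod using u by (intro sum.cong refl) auto
    also have "\<dots> = (\<Sum>i'\<in>S f. if i' = i then hcomp i f * hcomp j g else 0)"
      using ij fin by (intro sum.cong refl) auto
    also have "\<dots> = hcomp i f * hcomp j g"
      using ij fin by simp
    finally have "hcomp (i + j) (f * g) \<noteq> 0"
      using ij by (simp add: S_def)
    then show ?thesis
      using hcomp_of_homog[OF assms(1), of "i + j"] by (auto split: if_splits)
  qed
  have "Min (S f) + Min (S g) = n"
    using fin ne nz by (intro ext Min_in) (auto dest!: Min_le[OF fin] simp: order_antisym_conv)
  moreover have "Max (S f) + Max (S g) = n"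
    using fin ne nz by (intro ext Max_in) (auto dest!: Max_ge[OF fin] simp: order_antisym_conv)
  moreover have "Min (S f) \<le> Max (S f)" "Min (S g) \<le> Max (S g)"
    using fin ne nz by (auto intro!: Min_le)
  ultimately have mm: "Min (S f) = Max (S f)" "Min (S f) \<le> n" by linarith+
  have "k = Min (S f)" if "hcomp k f \<noteq> 0" for k
    using that mm Min_le[OF fin, of k f] Max_ge[OF fin, of k f] by (auto simp: S_def)
  then have "f \<in> homog (Min (S f))"
    by (intro homogI_hcomp) auto
  with mm show ?thesis by blast
qed

lemma homog_cancel:
  fixes g h :: coord_ring
  assumes "h \<in> homog k" "h \<noteq> 0" "h * g \<in> homog (k + n)" shows "g \<in> homog n"
proof (rule homogI_hcomp)
  fix i assume "i \<noteq> n"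
  then have "h * hcomp i g = 0"
    using hcomp_mult_homog[OF assms(1), of i g] hcomp_of_homog[OF assms(3), of "k + i"] by simp
  with assms(2) show "hcomp i g = 0" by simp
qed

lemma homog_cancel_less:
  fixes g h :: coord_ring
  assumes "h \<in> homog k" "h \<noteq> 0" "h * g \<in> homog n" "n < k" shows "g = 0"
proof -
  have "h * hcomp i g = 0" for i
    using hcomp_mult_homog[OF assms(1), of i g] hcomp_of_homog[OF assms(3), of "k + i"] assms(4) by simp
  then have "hcomp i g = 0" for i using assms(2) by simp
  then show ?thesis using sum_hcomp[of 0 g] by simp
qed

lemma hom_homog:
  fixes h :: "'v::finite mpoly \<Rightarrow> 'u::finite mpoly"
  assumes h: "ring_hom1 h" and "\<And>c. h (cst c) \<in> homog 0" "\<And>i. h (var i) \<in> homog 1" "f \<in> homog n"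
  shows "h f \<in> homog n"
proof -
  have "h f = (\<Sum>m\<in>Poly_Mapping.keys f. h (cst (Poly_Mapping.lookup f m)) * (\<Prod>i\<in>UNIV. h (var i) ^ Poly_Mapping.lookup m i))"
    by (subst mpoly_sum_monomials) (simp add: monomial_eq_prod hom_simps[OF h])
  also have "\<dots> \<in> homog n"
  proof (rule homog_sum)
    fix m assume m: "m \<in> Poly_Mapping.keys f"
    have "h (cst (Poly_Mapping.lookup f m)) * (\<Prod>i\<in>UNIV. h (var i) ^ Poly_Mapping.lookup m i) \<in>
      homog (0 + (\<Sum>i\<in>UNIV. Poly_Mapping.lookup m i * 1))"
      by (intro homog_mult homog_prod homog_power assms)
    with m assms(4) show "h (cst (Poly_Mapping.lookup f m)) * (\<Prod>i\<in>UNIV. h (var i) ^ Poly_Mapping.lookup m i) \<in> homog n"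
      by (auto simp: homog_def mdeg_eq)
  qed
  finally show ?thesis .
qed

lemma hom_cscale: "ring_hom1 h \<Longrightarrow> h (cscale c f) = h (cst c) * h f"
  by (simp add: cscale_eq hom_mult)

lemma homog_cscale: "f \<in> homog n \<Longrightarrow> cscale c f \<in> homog n" for f :: "'v::finite mpoly"
  by (simp add: cscale_eq homog_cst_mult)

section \<open>Coordinate systems\<close>

definition peval :: "('a::comm_ring_1 \<Rightarrow> 'b::comm_ring_1) \<Rightarrow> 'b \<Rightarrow> 'a poly \<Rightarrow> 'b" where
  "peval h a p = poly (map_poly h p) a"

lemma peval_pCons: "ring_hom1 h \<Longrightarrow> peval h a (pCons c p) = h c + a * peval h a p"
  by (simp add: peval_def map_poly_pCons hom_simps)

lemma peval_zero: "peval h a 0 = 0"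
  by (simp add: peval_def)

lemma ring_hom1_peval:
  assumes h: "ring_hom1 h" shows "ring_hom1 (peval h a)"
proof -
  have z: "h 0 = 0" "h 1 = 1" by (simp_all only: hom_simps[OF h])
  have mp: "map_poly h (p + q) = map_poly h p + map_poly h q" for p q
    by (rule poly_eqI) (simp add: coeff_map_poly z hom_add[OF h])
  have add: "peval h a (p + q) = peval h a p + peval h a q" for p q
    by (simp add: peval_def mp)
  have ms: "map_poly h (smult c p) = smult (h c) (map_poly h p)" for c p
    by (rule poly_eqI) (simp add: coeff_map_poly z hom_mult[OF h])
  have smult: "peval h a (smult c p) = h c * peval h a p" for c p
    by (simp add: peval_def ms)
  have "peval h a (p * q) = peval h a p * peval h a q" for p q
  proof (induction p)
    case 0
    then show ?case by (simp add: peval_zero)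
  next
    case (pCons c p)
    show ?case
      by (simp only: mult_pCons_left add smult peval_pCons[OF h] z pCons.IH distrib_right mult.assoc add_0)
  qed
  moreover have "peval h a [:1:] = 1"
    by (simp only: peval_pCons[OF h] peval_zero z) simp
  ultimately show ?thesis
    using add by (intro ring_hom1I) (simp_all flip: one_pCons)
qed

lemma poly_hom_eqI:
  assumes g: "ring_hom1 g" and h: "ring_hom1 h" and "\<And>c. g [:c:] = h [:c:]" "g [:0, 1:] = h [:0, 1:]"
  shows "g p = h p"
proof (induction p)
  case 0
  then show ?case by (simp add: hom_simps[OF g] hom_simps[OF h])
next
  case (pCons c p)
  have "pCons c p = [:c:] + [:0, 1:] * p" by simp
  with pCons assms show ?case by (simp only: hom_simps[OF g] hom_simps[OF h])
qed

lemma homog_1_eq_span: "homog 1 = cvs.span (range (var :: 4 \<Rightarrow> coord_ring))"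
proof
  show "cvs.span (range (var :: 4 \<Rightarrow> coord_ring)) \<subseteq> homog 1"
    by (intro cvs.span_minimal subspace_homog) (rule image_subsetI, rule homog_var)
  show "homog 1 \<subseteq> cvs.span (range (var :: 4 \<Rightarrow> coord_ring))"
  proof
    fix f :: coord_ring assume f: "f \<in> homog 1"
    have "Poly_Mapping.single m (Poly_Mapping.lookup f m) \<in> cvs.span (range var)" if "m \<in> Poly_Mapping.keys f" for m
    proof -
      have "mdeg m = 1" using that f by (auto simp: homog_def)
      then obtain i where i: "Poly_Mapping.lookup m i = 1" "\<And>j. j \<noteq> i \<Longrightarrow> Poly_Mapping.lookup m j = 0"
        unfolding mdeg_eq by (metis (mono_tags, lifting) UNIV_I finite sum_eq_1_iff)
      then have "(\<Prod>j\<in>UNIV. var j ^ Poly_Mapping.lookup m j :: coord_ring) = (\<Prod>j\<in>UNIV. if j = i then var i else 1)"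
        by (intro prod.cong) auto
      then have "Poly_Mapping.single m c = cscale c (var i)" for c
        by (simp add: monomial_eq_prod cscale_eq)
      then show ?thesis by (auto intro: cvs.span_scale cvs.span_base)
    qed
    then show "f \<in> cvs.span (range var)"
      by (subst mpoly_sum_monomials) (rule cvs.span_sum)
  qed
qed

text \<open>Four independent linear forms must span, since the variables span \<open>homog 1\<close>
  and are at most four. A homomorphism prescribed on \<open>B\<close> is the substitution that sends
  each variable to its expansion in \<open>B\<close> with the prescribed values inserted.\<close>

lemma linear_coords_hom_exists:
  fixes B :: "coord_ring set" and t :: "coord_ring \<Rightarrow> 'b::comm_ring_1"
  assumes B: "\<not> cvs.dependent B" "B \<subseteq> homog 1" "card B = 4" and \<iota>: "ring_hom1 \<iota>"
  shows "cvs.span B = homog 1"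
    and "\<exists>h. ring_hom1 h \<and> (\<forall>c. h (cst c) = \<iota> c) \<and> (\<forall>b\<in>B. h b = t b)"
proof -
  have fB: "finite B" using B(3) by (metis card.infinite zero_neq_numeral)
  have c4: "card (range (var :: 4 \<Rightarrow> coord_ring)) \<le> 4"
    using card_image_le[of UNIV "var :: 4 \<Rightarrow> coord_ring"] by simp
  have "f \<in> cvs.span B" if f: "f \<in> homog 1" for f
  proof (rule ccontr)
    assume n: "f \<notin> cvs.span B"
    then have "cvs.independent (insert f B)" using B(1) by (rule cvs.independent_insertI)
    moreover have "insert f B \<subseteq> cvs.span (range var)" using B(2) f homog_1_eq_span by blast
    ultimately have "card (insert f B) \<le> card (range (var :: 4 \<Rightarrow> coord_ring))"
      by (intro cvs.independent_span_bound[THEN conjunct2]) auto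
    moreover have "f \<notin> B" using n cvs.span_base[of f B] by blast
    ultimately show False using fB B(3) c4 by simp
  qed
  then have "homog 1 \<subseteq> cvs.span B" by blast
  moreover have "cvs.span B \<subseteq> homog 1"
    using B subspace_homog by (intro cvs.span_minimal)
  ultimately show sp: "cvs.span B = homog 1" by simp
  let ?r = "cvs.representation B"
  define \<phi> where "\<phi> i = (\<Sum>b\<in>B. \<iota> (?r (var i) b) * t b)" for i
  let ?h = "mpsubst \<iota> \<phi>"
  note h = ring_hom1_mpsubst[OF \<iota>, of \<phi>]
  have eq': "f \<in> cvs.span B \<and> ?h f = (\<Sum>b\<in>B. \<iota> (?r f b) * t b)" if "f \<in> cvs.span (range var)" for f
    using that
  proof (induction rule: cvs.span_induct_alt)
    case base
    then show ?case by (simp add: hom_simps[OF h] cvs.representation_zero hom_simps[OF \<iota>] cvs.span_zero)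
  next
    case (step c x y)
    then obtain i where x: "x = var i" by blast
    have e: "cvs.span (range var) = cvs.span B" using sp homog_1_eq_span by simp
    have xs: "x \<in> cvs.span B" unfolding e[symmetric] by (rule cvs.span_base[OF step(1)])
    then have cx: "cscale c x \<in> cvs.span B" by (rule cvs.span_scale)
    have ys: "y \<in> cvs.span B" using step by blast
    have "?h (cscale c x + y) = \<iota> c * \<phi> i + (\<Sum>b\<in>B. \<iota> (?r y b) * t b)"
      using step(2) by (simp add: hom_add[OF h] hom_cscale[OF h] mpsubst_cst[OF \<iota>] x mpsubst_var[OF \<iota>])
    also have "\<phi> i = (\<Sum>b\<in>B. \<iota> (?r x b) * t b)"
      by (simp add: \<phi>_def x)
    also have "\<iota> c * \<dots> + (\<Sum>b\<in>B. \<iota> (?r y b) * t b) = (\<Sum>b\<in>B. \<iota> (?r (cscale c x + y) b) * t b)"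
    proof -
      have "?r (cscale c x + y) = (\<lambda>b. c * ?r x b + ?r y b)"
        unfolding cvs.representation_add[OF B(1) ys cx] cvs.representation_scale[OF B(1) xs] ..
      then show ?thesis
        by (simp only: hom_add[OF \<iota>] hom_mult[OF \<iota>] distrib_right sum.distrib sum_distrib_left mult.assoc)
    qed
    finally have "?h (cscale c x + y) = (\<Sum>b\<in>B. \<iota> (?r (cscale c x + y) b) * t b)" .
    with cx ys cvs.span_add show ?case by blast
  qed
  note eq = eq'[THEN conjunct2]
  have "?h b = t b" if b: "b \<in> B" for b
  proof -
    have "b \<in> cvs.span (range var)" using b B(2) homog_1_eq_span by blast
    then have "?h b = (\<Sum>b'\<in>B. \<iota> (?r b b') * t b')" by (rule eq)
    also have "\<dots> = (\<Sum>b'\<in>B. if b' = b then t b else 0)"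
      using b by (intro sum.cong) (auto simp: cvs.representation_basis[OF B(1)] hom_simps[OF \<iota>])
    also have "\<dots> = t b" using fB b by simp
    finally show ?thesis .
  qed
  with h mpsubst_cst[OF \<iota>] show "\<exists>h. ring_hom1 h \<and> (\<forall>c. h (cst c) = \<iota> c) \<and> (\<forall>b\<in>B. h b = t b)"
    by blast
qed

text \<open>In the nested polynomial ring the variables \<open>y, w, x, z\<close> are adjoined in this order, so that setting
  \<open>z = 0\<close>, and then \<open>x = 0\<close>, amounts to taking constant coefficients.\<close>

type_synonym plane_ring = "complex poly poly poly"

text \<open>The cardinality excludes repetitions among the four forms, which independence of a set
  cannot detect.\<close>

locale coords =
  fixes x y z w :: coord_ring
  assumes linear: "x \<in> homog 1" "y \<in> homog 1" "z \<in> homog 1" "w \<in> homog 1"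
    and dist: "card {x, y, z, w} = 4"
    and indep: "\<not> cvs.dependent {x, y, z, w}"
begin

lemma subst_exists:
  fixes a b c e :: "'b::comm_ring_1"
  assumes "ring_hom1 \<iota>"
  obtains h where "ring_hom1 h" "\<And>k. h (cst k) = \<iota> k" "h x = a" "h y = b" "h z = c" "h w = e"
proof -
  have d: "x \<noteq> y" "x \<noteq> z" "x \<noteq> w" "y \<noteq> z" "y \<noteq> w" "z \<noteq> w"
    using dist by (auto simp: card_insert_if split: if_splits)
  let ?t = "(\<lambda>_. 0)(x := a, y := b, z := c, w := e)"
  have "{x, y, z, w} \<subseteq> homog 1" using linear by simp
  from linear_coords_hom_exists(2)[OF indep this dist assms, of ?t]
  obtain h where "ring_hom1 h" "\<And>k. h (cst k) = \<iota> k" "\<forall>b\<in>{x,y,z,w}. h b = ?t b"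
    by blast
  with d show ?thesis by (intro that[of h]) simp_all
qed

lemma var_in_span: "var i \<in> cvs.span {x, y, z, w}"
proof -
  have "{x, y, z, w} \<subseteq> homog 1" using linear by simp
  from linear_coords_hom_exists(1)[OF indep this dist ring_hom1_id] show ?thesis
    by (simp only: homog_var)
qed

lemma hom_eqI_coords:
  fixes g h :: "coord_ring \<Rightarrow> 'b::comm_ring_1"
  assumes g: "ring_hom1 g" and h: "ring_hom1 h" and "\<And>c. g (cst c) = h (cst c)"
    and "g x = h x" "g y = h y" "g z = h z" "g w = h w"
  shows "g f = h f"
proof (rule hom_eqI[OF g h assms(3)])
  fix i
  show "g (var i) = h (var i)"
    using var_in_span[of i]
  proof (induction rule: cvs.span_induct_alt)
    case base
    then show ?case by (simp add: hom_simps[OF g] hom_simps[OF h])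
  next
    case (step c a b)
    then show ?case
      using assms by (auto simp: hom_add[OF g] hom_add[OF h] hom_cscale[OF g] hom_cscale[OF h])
  qed
qed

lemma hom_homog_coords:
  fixes h :: "coord_ring \<Rightarrow> coord_ring"
  assumes h: "ring_hom1 h" and c: "\<And>c. h (cst c) = cst c"
    and "h x \<in> homog 1" "h y \<in> homog 1" "h z \<in> homog 1" "h w \<in> homog 1" and f: "f \<in> homog n"
  shows "h f \<in> homog n"
proof (rule hom_homog[OF h _ _ f])
  fix i
  show "h (var i) \<in> homog 1"
    using var_in_span[of i]
  proof (induction rule: cvs.span_induct_alt)
    case base
    then show ?case by (simp add: hom_simps[OF h])
  next
    case (step c a b)
    then show ?case
      using assms by (auto simp: hom_add[OF h] hom_cscale[OF h] intro!: homog_add homog_cst_mult)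
  qed
qed (simp add: c)

text \<open>An isomorphism with inverse \<open>i4\<close>. Through it factoriality and the
  Noetherian property, available for iterated univariate polynomial rings, reach
  \<open>coord_ring\<close>.\<close>

definition \<Theta> :: "coord_ring \<Rightarrow> plane_ring poly" where
  "\<Theta> = (SOME h. ring_hom1 h \<and> (\<forall>c. h (cst c) = [:[:[:[:c:]:]:]:]) \<and> h x = [:[:0, 1:]:] \<and>
     h y = [:[:[:[:0, 1:]:]:]:] \<and> h z = [:0, 1:] \<and> h w = [:[:[:0, 1:]:]:])"

lemma \<Theta>: "ring_hom1 \<Theta>" "\<And>c. \<Theta> (cst c) = [:[:[:[:c:]:]:]:]" "\<Theta> x = [:[:0, 1:]:]"
  "\<Theta> y = [:[:[:[:0, 1:]:]:]:]" "\<Theta> z = [:0, 1:]" "\<Theta> w = [:[:[:0, 1:]:]:]"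
proof -
  have "ring_hom1 (\<lambda>c::complex. [:[:[:[:c:]:]:]:])" by (simp add: ring_hom1_def flip: one_pCons)
  then obtain h where "ring_hom1 h" "\<And>k. h (cst k) = [:[:[:[:k:]:]:]:]" "h x = [:[:0, 1:]:]"
    "h y = [:[:[:[:0, 1:]:]:]:]" "h z = [:0, 1:]" "h w = [:[:[:0, 1:]:]:]"
    by (rule subst_exists[where a = "[:[:0, 1:]:]" and b = "[:[:[:[:0, 1:]:]:]:]" and c = "[:0, 1:]" and e = "[:[:[:0, 1:]:]:]"]) blast
  then have "\<exists>h. ring_hom1 h \<and> (\<forall>c. h (cst c) = [:[:[:[:c:]:]:]:]) \<and> h x = [:[:0, 1:]:] \<and>
     h y = [:[:[:[:0, 1:]:]:]:] \<and> h z = [:0, 1:] \<and> h w = [:[:[:0, 1:]:]:]" by blast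
  from someI_ex[OF this, folded \<Theta>_def] show "ring_hom1 \<Theta>" "\<And>c. \<Theta> (cst c) = [:[:[:[:c:]:]:]:]"
    "\<Theta> x = [:[:0, 1:]:]" "\<Theta> y = [:[:[:[:0, 1:]:]:]:]" "\<Theta> z = [:0, 1:]" "\<Theta> w = [:[:[:0, 1:]:]:]"
    by blast+
qed

definition i1 :: "complex poly \<Rightarrow> coord_ring" where "i1 = peval cst y"
definition i2 :: "complex poly poly \<Rightarrow> coord_ring" where "i2 = peval i1 w"
definition i3 :: "plane_ring \<Rightarrow> coord_ring" where "i3 = peval i2 x"
definition i4 :: "plane_ring poly \<Rightarrow> coord_ring" where "i4 = peval i3 z"

lemma i_hom: "ring_hom1 i1" "ring_hom1 i2" "ring_hom1 i3" "ring_hom1 i4"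
proof -
  show 1: "ring_hom1 i1" unfolding i1_def by (intro ring_hom1_peval ring_hom1_cst)
  show 2: "ring_hom1 i2" unfolding i2_def by (intro ring_hom1_peval 1)
  show 3: "ring_hom1 i3" unfolding i3_def by (intro ring_hom1_peval 2)
  show "ring_hom1 i4" unfolding i4_def by (intro ring_hom1_peval 3)
qed

lemma i_pCons: "i1 (pCons c p) = cst c + y * i1 p" "i2 (pCons d q) = i1 d + w * i2 q"
  "i3 (pCons e r) = i2 e + x * i3 r" "i4 (pCons r s) = i3 r + z * i4 s"
  by (simp_all add: i1_def i2_def i3_def i4_def peval_pCons ring_hom1_cst i_hom(1)[unfolded i1_def]
      i_hom(2)[unfolded i2_def i1_def] i_hom(3)[unfolded i3_def i2_def i1_def])

lemma i_zero [simp]: "i1 0 = 0" "i2 0 = 0" "i3 0 = 0" "i4 0 = 0"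
  by (simp_all add: i_hom[THEN hom_zero])

lemma cst_0_1 [simp]: "cst 0 = 0" "cst 1 = 1"
  by (simp_all add: hom_simps[OF ring_hom1_cst])

lemma i_one [simp]: "i1 1 = 1" "i2 1 = 1" "i3 1 = 1" "i4 1 = 1"
  by (simp_all add: i_hom[THEN hom_one])

lemma \<Theta>_i4: "\<Theta> (i4 p) = p"
proof -
  have 1: "\<Theta> (i1 p) = [:[:[:p:]:]:]" for p
  proof (rule poly_hom_eqI[OF ring_hom1_comp[OF \<Theta>(1) i_hom(1)]])
    show "ring_hom1 (\<lambda>p::complex poly. [:[:[:p:]:]:])" by (simp add: ring_hom1_def flip: one_pCons)
  qed (simp_all add: i_pCons \<Theta>)
  have 2: "\<Theta> (i2 p) = [:[:p:]:]" for p
  proof (rule poly_hom_eqI[OF ring_hom1_comp[OF \<Theta>(1) i_hom(2)]])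
    show "ring_hom1 (\<lambda>p::complex poly poly. [:[:p:]:])" by (simp add: ring_hom1_def flip: one_pCons)
  qed (simp_all add: i_pCons \<Theta> 1)
  have 3: "\<Theta> (i3 p) = [:p:]" for p
    by (rule poly_hom_eqI[OF ring_hom1_comp[OF \<Theta>(1) i_hom(3)] ring_hom1_pCons]) (simp_all add: i_pCons \<Theta> 2)
  show ?thesis
    by (rule poly_hom_eqI[OF ring_hom1_comp[OF \<Theta>(1) i_hom(4)] ring_hom1_id]) (simp_all add: i_pCons \<Theta> 3)
qed

lemma i4_\<Theta>: "i4 (\<Theta> f) = f"
  by (rule hom_eqI_coords[OF ring_hom1_comp[OF i_hom(4) \<Theta>(1)] ring_hom1_id]) (simp_all add: i_pCons \<Theta>)

text \<open>Restriction to the plane z = 0, with \<open>plane_ring\<close> as its coordinate ring;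
  \<open>i3\<close> is a section of it and z generates its kernel.\<close>

definition \<rho> :: "coord_ring \<Rightarrow> plane_ring" where
  "\<rho> f = coeff (\<Theta> f) 0"

lemma \<rho>_hom: "ring_hom1 \<rho>"
  unfolding \<rho>_def by (rule ring_hom1_comp[OF ring_hom1_coeff_0 \<Theta>(1)])

lemma \<rho>_i3 [simp]: "\<rho> (i3 p) = p"
  using \<Theta>_i4[of "[:p:]"] by (simp add: i_pCons \<rho>_def)

lemma \<rho>_simps [simp]: "\<rho> x = [:0, 1:]" "\<rho> y = [:[:[:0, 1:]:]:]" "\<rho> z = 0" "\<rho> w = [:[:0, 1:]:]"
  "\<rho> (cst c) = [:[:[:c:]:]:]"
  by (simp_all add: \<rho>_def \<Theta>)

lemma i3_coords: "i3 [:0, 1:] = x" "i3 [:[:[:0, 1:]:]:] = y" "i3 [:[:0, 1:]:] = w"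
  by (simp_all add: i_pCons)

lemma z_decomp: obtains g where "f = i3 (\<rho> f) + z * g"
proof -
  obtain c p where "\<Theta> f = pCons c p" by (rule pCons_cases)
  then have "f = i3 (\<rho> f) + z * i4 p"
    using i4_\<Theta>[of f] by (simp add: \<rho>_def i_pCons)
  then show ?thesis by (rule that)
qed

lemma \<rho>_eq_0_iff: "\<rho> f = 0 \<longleftrightarrow> (\<exists>g. f = z * g)"
  by (metis z_decomp[of f] add_0 hom_mult[OF \<rho>_hom] i_zero(3) mult_zero_left \<rho>_simps(3))

lemma i3_\<rho>_homog: "f \<in> homog n \<Longrightarrow> i3 (\<rho> f) \<in> homog n"
proof (erule hom_homog_coords[rotated -1])
  show "ring_hom1 (\<lambda>f. i3 (\<rho> f))" by (rule ring_hom1_comp[OF i_hom(3) \<rho>_hom])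
qed (use linear in \<open>simp_all add: i3_coords i_pCons\<close>)

text \<open>Restriction to the line x = z = 0, embedded again by \<open>i2\<close>, so that degrees
  keep their meaning in \<open>coord_ring\<close>.\<close>

definition \<kappa> :: "coord_ring \<Rightarrow> coord_ring" where
  "\<kappa> f = i2 (coeff (\<rho> f) 0)"

lemma \<kappa>_hom: "ring_hom1 \<kappa>"
  unfolding \<kappa>_def
  by (rule ring_hom1_comp[OF i_hom(2)], rule ring_hom1_comp[OF ring_hom1_coeff_0 \<rho>_hom])

lemma \<kappa>_simps [simp]: "\<kappa> x = 0" "\<kappa> y = y" "\<kappa> z = 0" "\<kappa> w = w" "\<kappa> (cst c) = cst c"
  by (simp_all add: \<kappa>_def i_pCons)

lemma xz_decomp: obtains a b where "f = \<kappa> f + x * a + z * b"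
proof -
  obtain g where g: "f = i3 (\<rho> f) + z * g" by (rule z_decomp)
  obtain c p where "\<rho> f = pCons c p" by (rule pCons_cases)
  then have "f = \<kappa> f + x * i3 p + z * g"
    by (subst g) (simp add: i_pCons \<kappa>_def)
  then show ?thesis by (rule that)
qed

lemma \<kappa>_eq_0_iff: "\<kappa> f = 0 \<longleftrightarrow> (\<exists>a b. f = x * a + z * b)"
proof
  show "\<kappa> f = 0 \<Longrightarrow> \<exists>a b. f = x * a + z * b" by (metis xz_decomp[of f] add_0)
qed (auto simp: hom_simps[OF \<kappa>_hom])

lemma \<rho>_\<kappa>: "\<rho> (\<kappa> f) = [:coeff (\<rho> f) 0:]"
  using \<rho>_i3[of "[:coeff (\<rho> f) 0:]"] by (simp add: \<kappa>_def i_pCons)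

text \<open>Restriction to the line x = z = 0 in the chart w = 1: a univariate polynomial in y,
  accessible to Bezout and to degree arguments.\<close>

definition \<delta> :: "coord_ring \<Rightarrow> complex poly" where
  "\<delta> f = poly (coeff (\<rho> f) 0) 1"

lemma \<delta>_hom: "ring_hom1 \<delta>"
  unfolding \<delta>_def
  by (rule ring_hom1_comp[OF ring_hom1_poly], rule ring_hom1_comp[OF ring_hom1_coeff_0 \<rho>_hom])

lemma \<delta>_simps [simp]: "\<delta> x = 0" "\<delta> y = [:0, 1:]" "\<delta> z = 0" "\<delta> w = 1" "\<delta> (cst c) = [:c:]"
  by (simp_all add: \<delta>_def flip: one_pCons)

lemma \<delta>_\<kappa> [simp]: "\<delta> (\<kappa> f) = \<delta> f"
  by (simp add: \<delta>_def \<rho>_\<kappa>)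

text \<open>Homogenization to degree n by means of w. Coefficients beyond degree n are lost, whence
  the degree bounds in \<open>H_mult\<close> and \<open>\<delta>_H\<close>.\<close>

definition H :: "nat \<Rightarrow> complex poly \<Rightarrow> coord_ring" where
  "H n p = (\<Sum>i\<le>n. cst (coeff p i) * y ^ i * w ^ (n - i))"

lemma H_add: "H n (p + q) = H n p + H n q"
  by (simp only: H_def coeff_add hom_add[OF ring_hom1_cst] distrib_right sum.distrib)

lemma H_zero [simp]: "H n 0 = 0"
  by (simp add: H_def)

lemma H_sum: "H n (sum p A) = (\<Sum>i\<in>A. H n (p i))"
  by (induction A rule: infinite_finite_induct) (simp_all add: H_add)

lemma H_smult: "H n (smult c p) = cst c * H n p"
  by (simp only: H_def coeff_smult hom_mult[OF ring_hom1_cst] sum_distrib_left mult.assoc)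

lemma H_monom: "i \<le> n \<Longrightarrow> H n (monom c i) = cst c * y ^ i * w ^ (n - i)"
proof -
  assume i: "i \<le> n"
  have "H n (monom c i) = (\<Sum>j\<le>n. if j = i then cst c * y ^ i * w ^ (n - i) else 0)"
    unfolding H_def by (intro sum.cong) auto
  also have "\<dots> = cst c * y ^ i * w ^ (n - i)" using i by simp
  finally show ?thesis .
qed

lemma H_homog: "H n p \<in> homog n"
  unfolding H_def
proof (rule homog_sum)
  fix i assume "i \<in> {..n}"
  have "cst (coeff p i) * y ^ i * w ^ (n - i) \<in> homog (0 + i * 1 + (n - i) * 1)"
    by (intro homog_mult homog_power linear homog_cst)
  with \<open>i \<in> {..n}\<close> show "cst (coeff p i) * y ^ i * w ^ (n - i) \<in> homog n" by simp
qed

lemma H_mult: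
  assumes "degree p \<le> n" "degree q \<le> k"
  shows "H (n + k) (p * q) = H n p * H k q"
proof -
  have "H (n + k) (p * q) = H (n + k) ((\<Sum>i\<le>n. monom (coeff p i) i) * (\<Sum>j\<le>k. monom (coeff q j) j))"
    using poly_as_sum_of_monoms'[OF assms(1)] poly_as_sum_of_monoms'[OF assms(2)] by simp
  also have "\<dots> = (\<Sum>i\<le>n. \<Sum>j\<le>k. H (n + k) (monom (coeff p i * coeff q j) (i + j)))"
    by (simp add: sum_product H_sum mult_monom)
  also have "\<dots> = (\<Sum>i\<le>n. \<Sum>j\<le>k. (cst (coeff p i) * y ^ i * w ^ (n - i)) * (cst (coeff q j) * y ^ j * w ^ (k - j)))"
  proof (intro sum.cong refl)
    fix i j assume "i \<in> {..n}" "j \<in> {..k}"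
    then have "n + k - (i + j) = (n - i) + (k - j)" "i + j \<le> n + k" by auto
    then show "H (n + k) (monom (coeff p i * coeff q j) (i + j)) =
      (cst (coeff p i) * y ^ i * w ^ (n - i)) * (cst (coeff q j) * y ^ j * w ^ (k - j))"
      by (simp only: H_monom hom_mult[OF ring_hom1_cst] power_add mult_ac)
  qed
  also have "\<dots> = H n p * H k q"
    by (simp add: H_def sum_product)
  finally show ?thesis .
qed

lemma H_pow_w: "H n 1 = w ^ n"
  using H_monom[of 0 n 1] by (simp add: monom_0 flip: one_pCons)

lemma \<delta>_H: "degree p \<le> n \<Longrightarrow> \<delta> (H n p) = p"
proof -
  assume "degree p \<le> n"
  have "\<delta> (H n p) = (\<Sum>i\<le>n. monom (coeff p i) i)"
    by (simp add: H_def hom_sum[OF \<delta>_hom] hom_mult[OF \<delta>_hom] hom_power[OF \<delta>_hom] monom_altdef)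
  with \<open>degree p \<le> n\<close> show ?thesis by (simp add: poly_as_sum_of_monoms')
qed

lemma \<kappa>_H [simp]: "\<kappa> (H n p) = H n p"
  by (simp add: H_def hom_sum[OF \<kappa>_hom] hom_mult[OF \<kappa>_hom] hom_power[OF \<kappa>_hom])

text \<open>\<open>H\<close> is multiplicative when degrees are tracked, so it suffices to treat
  linear forms and to pass on to monomials and sums. A form on the line is thus determined by its
  degree and its dehomogenization.\<close>

lemma \<kappa>_homog:
  assumes f: "f \<in> homog n"
  shows "\<kappa> f = H n (\<delta> f)" "degree (\<delta> f) \<le> n"
proof -
  have "\<exists>p. degree p \<le> n \<and> \<kappa> f = H n p"
  proof -
    have "\<exists>p. degree p \<le> 1 \<and> \<kappa> (var i) = H 1 p" for i
    proof -
      show ?thesis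
        using var_in_span[of i]
      proof (induction rule: cvs.span_induct_alt)
        case base
        then show ?case by (auto simp: hom_simps[OF \<kappa>_hom] intro!: exI[of _ 0])
      next
        case (step c a b)
        have "\<exists>p. degree p \<le> 1 \<and> \<kappa> a = H 1 p"
        proof -
          have "\<kappa> y = H 1 (monom 1 1)" "\<kappa> w = H 1 1"
            by (simp_all add: H_monom H_pow_w)
          moreover have "degree (monom (1::complex) 1) \<le> 1" by (rule degree_monom_le)
          ultimately have "\<exists>p. degree p \<le> 1 \<and> \<kappa> y = H 1 p" "\<exists>p. degree p \<le> 1 \<and> \<kappa> w = H 1 p"
            by (metis, metis degree_1 zero_le)
          moreover have "\<exists>p. degree p \<le> 1 \<and> 0 = H 1 p"
            by (rule exI[of _ 0]) simp
          ultimately show ?thesis using step(1) by auto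
        qed
        then obtain p p' where p: "degree p \<le> 1" "\<kappa> a = H 1 p" "degree p' \<le> 1" "\<kappa> b = H 1 p'"
          using step(2) by blast
        then have "degree (smult c p + p') \<le> 1" "\<kappa> (cscale c a + b) = H 1 (smult c p + p')"
          by (auto simp: hom_add[OF \<kappa>_hom] hom_cscale[OF \<kappa>_hom] H_add H_smult intro!: degree_add_le
              order_trans[OF degree_smult_le])
        then show ?case by blast
      qed
    qed
    then obtain p where p: "\<And>i. degree (p i) \<le> 1" "\<And>i. \<kappa> (var i) = H 1 (p i)" by metis
    have pow: "degree (p i ^ k) \<le> k \<and> \<kappa> (var i) ^ k = H k (p i ^ k)" for i k
    proof (induction k)
      case 0
      then show ?case by (simp add: H_pow_w)
    next
      case (Suc k)
      then show ?case
        using p[of i] H_mult[of "p i" 1 "p i ^ k" k] degree_mult_le[of "p i" "p i ^ k"] by auto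
    qed
    have prod: "degree (\<Prod>i\<in>A. p i ^ e i) \<le> sum e A \<and>
        (\<Prod>i\<in>A. \<kappa> (var i) ^ e i) = H (sum e A) (\<Prod>i\<in>A. p i ^ e i)" if "finite A" for A e
      using that
    proof (induction A rule: finite_induct)
      case empty
      then show ?case by (simp add: H_pow_w)
    next
      case (insert i A)
      then show ?case
        using pow[of i "e i"] H_mult[of "p i ^ e i" "e i" "\<Prod>i\<in>A. p i ^ e i" "sum e A"]
          degree_mult_le[of "p i ^ e i" "\<Prod>i\<in>A. p i ^ e i"] by auto
    qed
    let ?c = "Poly_Mapping.lookup f"
    let ?P = "\<lambda>m. \<Prod>i\<in>UNIV. p i ^ Poly_Mapping.lookup m i"
    have "\<kappa> f = (\<Sum>m\<in>Poly_Mapping.keys f. cst (?c m) * (\<Prod>i\<in>UNIV. \<kappa> (var i) ^ Poly_Mapping.lookup m i))"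
      by (subst mpoly_sum_monomials) (simp add: monomial_eq_prod hom_simps[OF \<kappa>_hom])
    also have "\<dots> = (\<Sum>m\<in>Poly_Mapping.keys f. H n (smult (?c m) (?P m)))"
      using f by (intro sum.cong refl) (auto simp: prod H_smult homog_def mdeg_eq)
    also have "\<dots> = H n (\<Sum>m\<in>Poly_Mapping.keys f. smult (?c m) (?P m))"
      by (simp add: H_sum)
    finally have 1: "\<kappa> f = H n (\<Sum>m\<in>Poly_Mapping.keys f. smult (?c m) (?P m))" .
    have "degree (smult (?c m) (?P m)) \<le> n" if "m \<in> Poly_Mapping.keys f" for m
      using that f prod[of UNIV "Poly_Mapping.lookup m"] order_trans[OF degree_smult_le]
      by (auto simp: homog_def mdeg_eq)
    then have "degree (\<Sum>m\<in>Poly_Mapping.keys f. smult (?c m) (?P m)) \<le> n"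
      by (intro degree_sum_le) auto
    with 1 show ?thesis by blast
  qed
  then obtain p where p: "degree p \<le> n" "\<kappa> f = H n p" by blast
  then have "\<delta> f = p" using \<delta>_\<kappa>[of f] \<delta>_H by simp
  with p show "\<kappa> f = H n (\<delta> f)" "degree (\<delta> f) \<le> n" by auto
qed

lemma homog_\<delta>_eq_0: "f \<in> homog n \<Longrightarrow> \<delta> f = 0 \<longleftrightarrow> \<kappa> f = 0"
  using \<kappa>_homog(1)[of f n] \<delta>_\<kappa>[of f] by (auto simp: hom_zero[OF \<delta>_hom])

lemma point_exists:
  obtains p :: "complex ^ 4" where "eval_mpoly (($) p) x = a" "eval_mpoly (($) p) y = b"
    "eval_mpoly (($) p) z = c" "eval_mpoly (($) p) w = e"
proof -
  obtain h where h: "ring_hom1 h" "\<And>k. h (cst k) = k" "h x = a" "h y = b" "h z = c" "h w = e"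
    by (rule subst_exists[OF ring_hom1_id, where a = a and b = b and c = c and e = e]) blast
  define p :: "complex ^ 4" where "p = vec_lambda (\<lambda>i. h (var i))"
  have "eval_mpoly (($) p) f = h f" for f
    by (rule hom_eqI) (auto simp: h ring_hom1_eval_mpoly eval_mpoly_cst eval_mpoly_var p_def)
  with h show ?thesis by (intro that[of p]) simp_all
qed

lemma eval_\<delta>:
  assumes "eval_mpoly (($) p) x = 0" "eval_mpoly (($) p) z = 0" "eval_mpoly (($) p) w = 1"
  shows "eval_mpoly (($) p) f = poly (\<delta> f) (eval_mpoly (($) p) y)"
  by (rule hom_eqI_coords[OF ring_hom1_eval_mpoly ring_hom1_comp[OF ring_hom1_poly \<delta>_hom]])
     (simp_all add: assms eval_mpoly_cst)

end

section \<open>Noetherian rings\<close>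

definition noetherian :: "'a::comm_ring_1 itself \<Rightarrow> bool" where
  "noetherian _ \<longleftrightarrow> (\<forall>I::'a set. ideal.subspace I \<longrightarrow> (\<exists>B. finite B \<and> ideal.span B = I))"

lemma noetherian_field: "noetherian TYPE('a::field)"
  unfolding noetherian_def
proof (intro allI impI)
  fix I :: "'a set" assume I: "ideal.subspace I"
  show "\<exists>B. finite B \<and> ideal.span B = I"
  proof (cases "I = {0}")
    case True
    then show ?thesis by (intro exI[of _ "{}"]) simp
  next
    case False
    then obtain a where a: "a \<in> I" "a \<noteq> 0" using ideal.subspace_0[OF I] by blast
    have 1: "b \<in> I" for b
      using ideal.subspace_scale[OF I a(1), of "b / a"] a(2) by simp
    have "b \<in> ideal.span {a}" for b
      using ideal.span_scale[OF ideal.span_base[of a "{a}"], of "b / a"] a(2) by simp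
    with 1 show ?thesis by (intro exI[of _ "{a}"]) auto
  qed
qed

text \<open>Hilbert's basis theorem. The ideals of leading coefficients in degree n increase with n
  and become stationary at some N; lifts of their generators in degrees up to N generate the
  ideal.\<close>

lemma noetherian_poly:
  assumes noeth: "noetherian TYPE('a::comm_ring_1)"
  shows "noetherian TYPE('a poly)"
  unfolding noetherian_def
proof (intro allI impI)
  fix I :: "'a poly set" assume I: "ideal.subspace I"
  \<comment> \<open>The inequality, instead of an exact degree, puts 0 into \<open>L n\<close> and
    makes it an ideal.\<close>
  define L where "L n = {coeff p n | p. p \<in> I \<and> degree p \<le> n}" for n
  have L: "ideal.subspace (L n)" for n
  proof (rule ideal.subspaceI)
    show "0 \<in> L n"
      using ideal.subspace_0[OF I] by (auto simp: L_def intro!: exI[of _ 0])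
  next
    fix a b assume "a \<in> L n" "b \<in> L n"
    then obtain p q where "p \<in> I" "degree p \<le> n" "a = coeff p n" "q \<in> I" "degree q \<le> n" "b = coeff q n"
      by (auto simp: L_def)
    then show "a + b \<in> L n"
      using ideal.subspace_add[OF I, of p q]
      by (auto simp: L_def degree_add_le intro!: exI[of _ "p + q"])
  next
    fix c a assume "a \<in> L n"
    then obtain p where "p \<in> I" "degree p \<le> n" "a = coeff p n"
      by (auto simp: L_def)
    then show "c * a \<in> L n"
      using ideal.subspace_scale[OF I, of p "[:c:]"] order_trans[OF degree_smult_le, of p n c]
      by (auto simp: L_def intro!: exI[of _ "smult c p"])
  qed
  have L_Suc: "L n \<subseteq> L (Suc n)" for n
  proof
    fix a assume "a \<in> L n"
    then obtain p where p: "p \<in> I" "degree p \<le> n" "a = coeff p n"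
      by (auto simp: L_def)
    have "pCons 0 p \<in> I"
      using ideal.subspace_scale[OF I p(1), of "[:0, 1:]"] by simp
    moreover have "degree (pCons 0 p) \<le> Suc n"
      using p(2) by (auto intro: order_trans[OF degree_pCons_le])
    ultimately show "a \<in> L (Suc n)"
      using p(3) by (auto simp: L_def intro!: exI[of _ "pCons 0 p"])
  qed
  have mono: "L m \<subseteq> L n" if "m \<le> n" for m n
    using lift_Suc_mono_le[of L, OF L_Suc that] .
  have LL: "ideal.subspace (\<Union>n. L n)"
  proof (rule ideal.subspaceI)
    show "0 \<in> (\<Union>n. L n)" using ideal.subspace_0[OF L] by blast
  next
    fix a b assume "a \<in> (\<Union>n. L n)" "b \<in> (\<Union>n. L n)"
    then obtain m n where "a \<in> L m" "b \<in> L n" by blast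
    then have "a \<in> L (max m n)" "b \<in> L (max m n)"
      using mono[of m "max m n"] mono[of n "max m n"] by auto
    then show "a + b \<in> (\<Union>n. L n)" using ideal.subspace_add[OF L] by blast
  next
    fix c a assume "a \<in> (\<Union>n. L n)"
    then show "c * a \<in> (\<Union>n. L n)" using ideal.subspace_scale[OF L] by blast
  qed
  then obtain C where C: "finite C" "ideal.span C = (\<Union>n. L n)"
    using noeth unfolding noetherian_def by blast
  have "\<exists>N. C \<subseteq> L N"
  proof -
    have "C \<subseteq> (\<Union>n. L n)" using C(2) ideal.span_superset by blast
    then have "\<forall>c\<in>C. \<exists>n. c \<in> L n" by blast
    then obtain \<nu> where \<nu>: "\<forall>c\<in>C. c \<in> L (\<nu> c)" by metis
    have "c \<in> L (Max (\<nu> ` C))" if "c \<in> C" for c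
      using mono[of "\<nu> c" "Max (\<nu> ` C)"] \<nu> that C(1) by auto
    then show ?thesis by blast
  qed
  then obtain N where "C \<subseteq> L N" ..
  then have LN: "L n \<subseteq> L N" for n
    using C(2) ideal.span_minimal[OF _ L] by blast
  have "\<forall>n. \<exists>B. finite B \<and> ideal.span B = L n"
    using noeth L unfolding noetherian_def by blast
  then obtain G where G: "\<And>n. finite (G n)" "\<And>n. ideal.span (G n) = L n" by metis
  have "\<forall>n. \<forall>c\<in>G n. \<exists>p. p \<in> I \<and> degree p \<le> n \<and> coeff p n = c"
  proof (intro allI ballI)
    fix n c assume "c \<in> G n"
    then have "c \<in> L n" using G(2) ideal.span_base by blast
    then show "\<exists>p. p \<in> I \<and> degree p \<le> n \<and> coeff p n = c" by (auto simp: L_def)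
  qed
  then obtain P where P: "\<And>n c. c \<in> G n \<Longrightarrow> P n c \<in> I" "\<And>n c. c \<in> G n \<Longrightarrow> degree (P n c) \<le> n"
    "\<And>n c. c \<in> G n \<Longrightarrow> coeff (P n c) n = c" by metis
  define B where "B = (\<Union>n\<le>N. P n ` G n)"
  have finB: "finite B" using G(1) by (auto simp: B_def)
  have BI: "ideal.span B \<subseteq> I"
    using P(1) by (intro ideal.span_minimal I) (auto simp: B_def)
  have "p \<in> ideal.span B" if "p \<in> I" for p
    using that
  proof (induction "degree p" arbitrary: p rule: less_induct)
    case less
    define n where "n = degree p"
    \<comment> \<open>Beyond degree N the leading coefficient is a combination of those of the
      generators of degree N, which are shifted up by a power of the variable.\<close>
    define k where "k = min n N"
    have "coeff p n \<in> L n" using less.prems by (auto simp: L_def n_def)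
    moreover have "L n \<subseteq> L k" using LN by (cases "n \<le> N") (auto simp: k_def min_def)
    ultimately have "coeff p n \<in> ideal.span (G k)" using G(2) by blast
    then obtain u where u: "coeff p n = (\<Sum>c\<in>G k. u c * c)"
      using G(1) by (auto simp: ideal.span_finite)
    define q where "q = (\<Sum>c\<in>G k. monom (u c) (n - k) * P k c)"
    have kn: "k \<le> n" "k \<le> N" by (auto simp: k_def)
    have qB: "q \<in> ideal.span B"
      unfolding q_def using kn
      by (intro ideal.span_sum ideal.span_scale ideal.span_base) (auto simp: B_def)
    have "degree (monom (u c) (n - k) * P k c) \<le> n" if "c \<in> G k" for c
      using degree_mult_le[of "monom (u c) (n - k)" "P k c"] degree_monom_le[of "u c" "n - k"] P(2)[OF that] kn
      by linarith
    then have dq: "degree q \<le> n" unfolding q_def using G(1) by (intro degree_sum_le)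
    have "coeff q n = (\<Sum>c\<in>G k. u c * coeff (P k c) k)"
      unfolding q_def coeff_sum using kn by (intro sum.cong) (auto simp: coeff_monom_mult)
    also have "\<dots> = coeff p n" using u P(3) by simp
    finally have cq: "coeff (p - q) n = 0" by simp
    have pqI: "p - q \<in> I" using less.prems qB BI by (intro ideal.subspace_diff[OF I]) auto
    have "p - q \<in> ideal.span B"
    proof (cases "p - q = 0")
      case True
      then show ?thesis using ideal.span_zero by simp
    next
      case False
      have "degree (p - q) \<le> n" using dq by (intro degree_diff_le) (simp_all add: n_def)
      moreover have "degree (p - q) \<noteq> n" using cq False leading_coeff_0_iff by metis
      ultimately show ?thesis using less.hyps pqI by (simp add: n_def)
    qed
    then show ?case using ideal.span_add[OF _ qB, of "p - q"] by simp
  qed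
  with finB BI show "\<exists>B. finite B \<and> ideal.span B = I" by blast
qed

text \<open>Otherwise repeated choice yields a strictly increasing sequence of ideals; its union is
  finitely generated and hence already equals one of its members.\<close>

lemma noetherian_maximal:
  assumes noeth: "noetherian TYPE('a::comm_ring_1)"
    and S: "S \<noteq> {}" "\<And>I :: 'a set. I \<in> S \<Longrightarrow> ideal.subspace I"
  obtains M where "M \<in> S" "\<And>J. J \<in> S \<Longrightarrow> M \<subseteq> J \<Longrightarrow> J = M"
proof (rule ccontr)
  note maxI = that
  assume "\<not> thesis"
  then have step: "\<exists>J. J \<in> S \<and> M \<subset> J" if "M \<in> S" for M
    using maxI[of M] \<open>M \<in> S\<close> by blast
  obtain M0 where "M0 \<in> S" using S(1) by blast
  define next_ideal where "next_ideal M = (SOME J. J \<in> S \<and> M \<subset> J)" for M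
  have nx: "next_ideal M \<in> S" "M \<subset> next_ideal M" if "M \<in> S" for M
    using someI_ex[OF step[OF that]] by (simp_all add: next_ideal_def)
  define f where "f n = (next_ideal ^^ n) M0" for n
  have f1: "f n \<in> S" for n by (induction n) (simp_all add: f_def \<open>M0 \<in> S\<close> nx)
  have f2: "f n \<subset> f (Suc n)" for n using nx(2)[OF f1[of n]] by (simp add: f_def)
  note f = f1 f2
  have mono: "f m \<subseteq> f n" if "m \<le> n" for m n
    using lift_Suc_mono_le[of f, OF _ that] f(2) by blast
  have U: "ideal.subspace (\<Union>n. f n)"
  proof (rule ideal.subspaceI)
    show "0 \<in> (\<Union>n. f n)" using ideal.subspace_0[OF S(2)[OF f(1)]] by blast
  next
    fix a b assume "a \<in> (\<Union>n. f n)" "b \<in> (\<Union>n. f n)"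
    then obtain m n where "a \<in> f m" "b \<in> f n" by blast
    then have "a \<in> f (max m n)" "b \<in> f (max m n)"
      using mono[of m "max m n"] mono[of n "max m n"] by auto
    then show "a + b \<in> (\<Union>n. f n)" using ideal.subspace_add[OF S(2)[OF f(1)]] by blast
  next
    fix c a assume "a \<in> (\<Union>n. f n)"
    then show "c * a \<in> (\<Union>n. f n)" using ideal.subspace_scale[OF S(2)[OF f(1)]] by blast
  qed
  then obtain B where B: "finite B" "ideal.span B = (\<Union>n. f n)"
    using noeth unfolding noetherian_def by blast
  then have "\<forall>b\<in>B. \<exists>n. b \<in> f n" using ideal.span_superset by blast
  then obtain \<nu> where \<nu>: "\<forall>b\<in>B. b \<in> f (\<nu> b)" by metis
  have "B \<subseteq> f (Max (\<nu> ` B))"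
  proof
    fix b assume "b \<in> B"
    then show "b \<in> f (Max (\<nu> ` B))" using mono[of "\<nu> b" "Max (\<nu> ` B)"] \<nu> B(1) by auto
  qed
  then have "(\<Union>n. f n) \<subseteq> f (Max (\<nu> ` B))"
    using B(2) ideal.span_minimal[OF _ S(2)[OF f(1)]] by blast
  with f(2)[of "Max (\<nu> ` B)"] show False by blast
qed

context coords
begin

lemma noetherian_coord_ring: "noetherian TYPE(coord_ring)"
proof -
  have N: "noetherian TYPE(plane_ring poly)"
    by (intro noetherian_poly noetherian_field)
  show ?thesis
    unfolding noetherian_def
  proof (intro allI impI)
    fix I :: "coord_ring set" assume I: "ideal.subspace I"
    have "ideal.subspace (\<Theta> ` I)"
    proof (rule ideal.subspaceI)
      show "0 \<in> \<Theta> ` I" using ideal.subspace_0[OF I] hom_zero[OF \<Theta>(1)] by force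
    next
      fix a b assume "a \<in> \<Theta> ` I" "b \<in> \<Theta> ` I"
      then show "a + b \<in> \<Theta> ` I"
        using ideal.subspace_add[OF I] hom_add[OF \<Theta>(1)] by (force simp flip: hom_add[OF \<Theta>(1)])
    next
      fix c a assume "a \<in> \<Theta> ` I"
      then obtain f where f: "f \<in> I" "a = \<Theta> f" by blast
      then have "c * a = \<Theta> (i4 c * f)" by (simp add: hom_mult[OF \<Theta>(1)] \<Theta>_i4)
      then show "c * a \<in> \<Theta> ` I" using ideal.subspace_scale[OF I f(1)] by blast
    qed
    then obtain B where B: "finite B" "ideal.span B = \<Theta> ` I"
      using N unfolding noetherian_def by blast
    have "i4 ` B \<subseteq> I"
    proof
      fix f assume "f \<in> i4 ` B"
      then obtain b where b: "b \<in> B" "f = i4 b" by blast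
      then have "b \<in> \<Theta> ` I" using B(2) ideal.span_base by blast
      with b show "f \<in> I" by (auto simp: i4_\<Theta>)
    qed
    then have 1: "ideal.span (i4 ` B) \<subseteq> I" by (intro ideal.span_minimal I)
    have "f \<in> ideal.span (i4 ` B)" if "f \<in> I" for f
    proof -
      have "i4 p \<in> ideal.span (i4 ` B)" if "p \<in> ideal.span B" for p
        using that
      proof (induction rule: ideal.span_induct_alt)
        case base
        then show ?case by (simp add: ideal.span_zero)
      next
        case (step c x y)
        have "i4 x \<in> ideal.span (i4 ` B)" using step(1) by (intro ideal.span_base) simp
        from ideal.span_add[OF ideal.span_scale[OF this] step(2)] show ?case
          by (simp add: hom_add[OF i_hom(4)] hom_mult[OF i_hom(4)])
      qed
      from this[of "\<Theta> f"] show ?thesis using that B(2) by (simp add: i4_\<Theta>)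
    qed
    with 1 B(1) show "\<exists>B. finite B \<and> ideal.span B = I" by blast
  qed
qed

end

section \<open>Chains of prime ideals\<close>

definition prime_ideal :: "'a::comm_ring_1 set \<Rightarrow> bool" where
  "prime_ideal p \<longleftrightarrow> ideal.subspace p \<and> p \<noteq> UNIV \<and> (\<forall>f g. f * g \<in> p \<longrightarrow> f \<in> p \<or> g \<in> p)"

lemma one_notin_proper_ideal: "ideal.subspace p \<Longrightarrow> p \<noteq> UNIV \<Longrightarrow> 1 \<notin> p"
  using ideal.subspace_scale[of p 1] by fastforce

lemma prime_ideal_power: "prime_ideal p \<Longrightarrow> f ^ n \<in> p \<Longrightarrow> f \<in> p"
  by (induction n) (auto simp: prime_ideal_def dest: one_notin_proper_ideal)

fun power_monom :: "coord_ring list \<Rightarrow> nat list \<Rightarrow> coord_ring" where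
  "power_monom (f # fs) (e # es) = f ^ e * power_monom fs es"
| "power_monom _ _ = 1"

text \<open>Dividing a relation by the highest possible power of the first element and reducing modulo it isolates the
  lexicographically smallest monomial.\<close>

lemma prime_chain_no_relation:
  assumes "\<And>i. i \<le> length fs \<Longrightarrow> prime_ideal (c i)" "\<And>i. i < length fs \<Longrightarrow> c i \<subseteq> c (Suc i)"
    "\<And>i. i < length fs \<Longrightarrow> fs ! i \<in> c (Suc i) - c i"
    and "finite T" "T \<noteq> {}" "\<And>e. e \<in> T \<Longrightarrow> length e = length fs" "\<And>e. e \<in> T \<Longrightarrow> u e \<noteq> (0::complex)"
  shows "(\<Sum>e\<in>T. cst (u e) * power_monom fs e) \<notin> c 0"
  using assms
proof (induction fs arbitrary: c T u)
  case Nil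
  then have T: "T = {[]}" by auto
  have "1 \<in> c 0" if "cst (u []) \<in> c 0"
  proof -
    have "cst (inverse (u [])) * cst (u []) \<in> c 0"
      using that Nil(1)[of 0] by (auto simp: prime_ideal_def intro: ideal.subspace_scale)
    moreover have "cst (inverse (u [])) * cst (u []) = (1 :: coord_ring)"
      using Nil(7)[of "[]"] T by (simp flip: hom_mult[OF ring_hom1_cst] add: hom_one[OF ring_hom1_cst])
    ultimately show ?thesis by simp
  qed
  then show ?case
    using T Nil(1)[of 0] by (auto simp: prime_ideal_def dest: one_notin_proper_ideal)
next
  case (Cons f fs)
  define m where "m = Min (hd ` T)"
  define T1 where "T1 = {e\<in>T. hd e = m}"
  define T2 where "T2 = T - T1"
  have ne: "e \<noteq> []" if "e \<in> T" for e using Cons.prems(6)[OF that] by auto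
  have m_le: "m \<le> hd e" if "e \<in> T" for e using that Cons.prems(4) by (simp add: m_def)
  have "m \<in> hd ` T" unfolding m_def using Cons.prems(4,5) by (intro Min_in) auto
  then have T1: "T1 \<noteq> {}" by (auto simp: T1_def)
  have p0: "prime_ideal (c 0)" and p1: "prime_ideal (c 1)" using Cons.prems(1)[of 0] Cons.prems(1)[of 1] by simp_all
  then have s0: "ideal.subspace (c 0)" and s1: "ideal.subspace (c 1)" by (simp_all add: prime_ideal_def)
  have f: "f \<in> c 1" "f \<notin> c 0" "c 0 \<subseteq> c 1" using Cons.prems(3)[of 0] Cons.prems(2)[of 0] by simp_all
  let ?A = "\<Sum>e\<in>T1. cst (u e) * power_monom fs (tl e)"
  let ?B = "\<Sum>e\<in>T2. cst (u e) * (f ^ (hd e - m - 1) * power_monom fs (tl e))"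
  have "(\<Sum>e\<in>T. cst (u e) * power_monom (f # fs) e) =
      (\<Sum>e\<in>T1. cst (u e) * power_monom (f # fs) e) + (\<Sum>e\<in>T2. cst (u e) * power_monom (f # fs) e)"
    unfolding T2_def using Cons.prems(4) by (subst add.commute, intro sum.subset_diff) (auto simp: T1_def)
  also have "(\<Sum>e\<in>T1. cst (u e) * power_monom (f # fs) e) = f ^ m * ?A"
    unfolding sum_distrib_left
  proof (intro sum.cong refl)
    fix e assume "e \<in> T1"
    then obtain es where "e = m # es" using ne by (cases e) (auto simp: T1_def)
    then show "cst (u e) * power_monom (f # fs) e = f ^ m * (cst (u e) * power_monom fs (tl e))"
      by simp
  qed
  also have "(\<Sum>e\<in>T2. cst (u e) * power_monom (f # fs) e) = f ^ m * (f * ?B)"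
    unfolding sum_distrib_left
  proof (intro sum.cong refl)
    fix e assume e: "e \<in> T2"
    then obtain k es where ke: "e = k # es" using ne by (cases e) (auto simp: T2_def)
    with e m_le[of e] have "m < k" by (auto simp: T2_def T1_def)
    then have "f ^ k = f ^ m * (f * f ^ (k - m - 1))"
      by (simp flip: power_add power_Suc)
    then show "cst (u e) * power_monom (f # fs) e =
        f ^ m * (f * (cst (u e) * (f ^ (hd e - m - 1) * power_monom fs (tl e))))"
      by (simp add: ke)
  qed
  finally have eq: "(\<Sum>e\<in>T. cst (u e) * power_monom (f # fs) e) = f ^ m * (?A + f * ?B)"
    by (simp only: distrib_left)
  show ?case
  proof
    assume "(\<Sum>e\<in>T. cst (u e) * power_monom (f # fs) e) \<in> c 0"
    then have "f ^ m * (?A + f * ?B) \<in> c 0" by (simp only: eq)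
    then have "f ^ m \<in> c 0 \<or> ?A + f * ?B \<in> c 0"
      using p0[unfolded prime_ideal_def, THEN conjunct2, THEN conjunct2] by blast
    then have "?A + f * ?B \<in> c 0" using f(2) prime_ideal_power[OF p0, of f m] by blast
    then have "?A + f * ?B \<in> c 1" using f by blast
    moreover have "?B * f \<in> c 1" by (rule ideal.subspace_scale[OF s1 f(1)])
    ultimately have "(?A + f * ?B) - ?B * f \<in> c 1" by (rule ideal.subspace_diff[OF s1])
    moreover have "a + f * b - b * f = a" for a b by simp
    ultimately have A: "?A \<in> c 1" by (simp only:)
    have inj: "inj_on tl T1" by (intro inj_onI) (metis (mono_tags, lifting) T1_def mem_Collect_eq list.expand ne)
    have "?A = (\<Sum>e\<in>tl ` T1. cst (u (m # e)) * power_monom fs e)"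
      unfolding sum.reindex[OF inj] using ne by (intro sum.cong refl) (auto simp: T1_def)
    moreover have "(\<Sum>e\<in>tl ` T1. cst (u (m # e)) * power_monom fs e) \<notin> (c \<circ> Suc) 0"
    proof (rule Cons.IH)
      show "e \<in> tl ` T1 \<Longrightarrow> u (m # e) \<noteq> 0" for e
        using Cons.prems(7) ne by (auto simp: T1_def)
      show "e \<in> tl ` T1 \<Longrightarrow> length e = length fs" for e
        using Cons.prems(6) by (auto simp: T1_def)
      show "i < length fs \<Longrightarrow> fs ! i \<in> (c \<circ> Suc) (Suc i) - (c \<circ> Suc) i" for i
        using Cons.prems(3)[of "Suc i"] by simp
      show "finite (tl ` T1)" using Cons.prems(4) by (simp add: T1_def)
    qed (use T1 Cons.prems(1)[of "Suc _"] Cons.prems(2)[of "Suc _"] in auto)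
    ultimately show False using A by simp
  qed
qed

text \<open>A count: the monomials in five polynomials with exponents below N number N^5, while they
  lie in a space spanned by at most (K + 1)^4 monomials, where K grows linearly in N. Bounding each
  exponent separately, rather than the degree, keeps both counts simple.\<close>

lemma algebraically_dependent:
  fixes fs :: "coord_ring list"
  assumes len: "length fs = 5"
  obtains T u where "finite T" "T \<noteq> {}" "\<And>e. e \<in> T \<Longrightarrow> length e = 5" "\<And>e. e \<in> T \<Longrightarrow> u e \<noteq> (0::complex)"
    "(\<Sum>e\<in>T. cst (u e) * power_monom fs e) = 0"
proof -
  define box :: "nat \<Rightarrow> coord_ring set" where
    "box K = {f. \<forall>m\<in>Poly_Mapping.keys f. \<forall>i. Poly_Mapping.lookup m i \<le> K}" for K
  have box_mono: "f \<in> box K \<Longrightarrow> K \<le> K' \<Longrightarrow> f \<in> box K'" for f K K'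
    unfolding box_def by (blast intro: le_trans)
  have box_mult: "f * g \<in> box (K + K')" if "f \<in> box K" "g \<in> box K'" for f g K K'
    using that keys_mult[of f g] by (fastforce simp: box_def lookup_add intro: add_mono)
  have box_1: "1 \<in> box 0" by (simp add: box_def)
  have box_pow: "f ^ n \<in> box (n * K)" if "f \<in> box K" for f n K
    by (induction n) (use box_1 box_mult[OF that] in auto)
  have "\<exists>D. f \<in> box D" for f
  proof -
    let ?S = "(\<lambda>(m, i). Poly_Mapping.lookup m i) ` (Poly_Mapping.keys f \<times> UNIV)"
    have "finite ?S" by simp
    then have "f \<in> box (Max ?S)" unfolding box_def by (auto intro!: Max_ge)
    then show ?thesis ..
  qed
  then obtain d where d: "\<And>f. f \<in> box (d f)" by metis
  define D where "D = sum_list (map d fs)"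
  have D: "f \<in> box D" if "f \<in> set fs" for f
    using d[of f] by (rule box_mono) (auto simp: D_def that member_le_sum_list)
  \<comment> \<open>With K = 5DN this gives (K + 1)^4 \<le> (5D + 1)^4 N^4 < N^5.\<close>
  define N where "N = (5 * D + 1) ^ 4 + 1"
  define K where "K = 5 * D * N"
  define E where "E = {e::nat list. set e \<subseteq> {..<N} \<and> length e = 5}"
  have E: "finite E" "card E = N ^ 5"
    unfolding E_def by (simp_all add: finite_lists_length_eq card_lists_length_eq)
  have mon: "power_monom gs e \<in> box (length gs * (D * N))"
    if "set gs \<subseteq> set fs" "set e \<subseteq> {..<N}" for gs e
    using that
  proof (induction gs e rule: power_monom.induct)
    case (1 f gs e es)
    have fs: "f \<in> set fs" "set gs \<subseteq> set fs" "set es \<subseteq> {..<N}" and "e < N" using 1(2,3) by simp_all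
    then have "e * D \<le> D * N" by (metis less_imp_le mult.commute mult_le_mono1)
    then have "f ^ e \<in> box (D * N)" using box_pow[OF D[OF fs(1)], of e] by (rule box_mono[rotated])
    from box_mult[OF this 1(1)[OF fs(2,3)]] show ?case by simp
  qed (auto intro: box_mono[OF box_1])
  define M where "M = {m :: 4 \<Rightarrow>\<^sub>0 nat. \<forall>i. Poly_Mapping.lookup m i \<le> K}"
  have M: "finite M" "card M \<le> (K + 1) ^ 4"
  proof -
    have inj: "inj_on Poly_Mapping.lookup M" by (auto intro!: inj_onI simp: lookup_inject)
    have sub: "Poly_Mapping.lookup ` M \<subseteq> (\<Pi>\<^sub>E i\<in>UNIV. {..K})" by (auto simp: M_def)
    have fin: "finite (\<Pi>\<^sub>E i\<in>(UNIV::4 set). {..K})" by (intro finite_PiE) auto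
    show "finite M" using inj_on_finite[OF inj sub fin] .
    have "card M \<le> card (\<Pi>\<^sub>E i\<in>(UNIV::4 set). {..K})" by (rule card_inj_on_le[OF inj sub fin])
    then show "card M \<le> (K + 1) ^ 4" by (simp add: card_PiE)
  qed
  let ?V = "(\<lambda>m. Poly_Mapping.single m (1::complex)) ` M"
  have box_span: "f \<in> cvs.span ?V" if "f \<in> box K" for f
  proof -
    have "Poly_Mapping.single m (Poly_Mapping.lookup f m) \<in> cvs.span ?V" if m: "m \<in> Poly_Mapping.keys f" for m
    proof -
      have "Poly_Mapping.single m (Poly_Mapping.lookup f m) = cscale (Poly_Mapping.lookup f m) (Poly_Mapping.single m 1)"
        by (simp add: cscale_def mult_single)
      moreover have "m \<in> M" using m \<open>f \<in> box K\<close> by (auto simp: box_def M_def)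
      ultimately show ?thesis by (auto intro: cvs.span_scale cvs.span_base)
    qed
    then show ?thesis by (subst mpoly_sum_monomials) (rule cvs.span_sum)
  qed
  have cardV: "card ?V \<le> (K + 1) ^ 4" using card_image_le[OF M(1)] M(2) by (rule order_trans)
  have "(K + 1) ^ 4 \<le> ((5 * D + 1) * N) ^ 4"
    by (intro power_mono) (auto simp: K_def N_def algebra_simps)
  also have "\<dots> = (5 * D + 1) ^ 4 * N ^ 4" by (rule power_mult_distrib)
  also have "\<dots> < N ^ 5"
  proof -
    have "N > 0" "(5 * D + 1) ^ 4 < N" by (simp_all add: N_def)
    then have "(5 * D + 1) ^ 4 * N ^ 4 < N * N ^ 4" by (intro mult_strict_right_mono) auto
    also have "N * N ^ 4 = N ^ 5" by (simp flip: power_Suc)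
    finally show ?thesis .
  qed
  finally have big: "card ?V < card E" using cardV E(2) by simp
  show ?thesis
  \<comment> \<open>Coinciding products would merge in the image set, so they are treated apart:
    their difference is already a relation.\<close>
  proof (cases "inj_on (power_monom fs) E")
    case False
    then obtain e e' where e: "e \<in> E" "e' \<in> E" "e \<noteq> e'" "power_monom fs e = power_monom fs e'"
      by (auto simp: inj_on_def)
    have m1: "cst (- 1) = (- 1 :: coord_ring)"
      by (simp add: hom_uminus[OF ring_hom1_cst] hom_one[OF ring_hom1_cst])
    show ?thesis
    proof (rule that[of "{e, e'}" "\<lambda>v. if v = e then 1 else - 1"])
      show "(\<Sum>v\<in>{e, e'}. cst (if v = e then 1 else - 1) * power_monom fs v) = 0"
        using e by (simp add: m1 hom_one[OF ring_hom1_cst])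
    qed (use e in \<open>auto simp: E_def\<close>)
  next
    case True
    have "cvs.dependent (power_monom fs ` E)"
    proof (rule ccontr)
      assume "cvs.independent (power_monom fs ` E)"
      moreover have "power_monom fs ` E \<subseteq> cvs.span ?V"
        using mon[of fs] len by (auto intro!: box_span simp: E_def K_def mult.assoc)
      ultimately have "card (power_monom fs ` E) \<le> card ?V"
        using M(1) by (intro cvs.independent_span_bound[THEN conjunct2]) auto
      with big True show False by (simp add: card_image)
    qed
    then obtain u where u: "\<exists>v\<in>power_monom fs ` E. u v \<noteq> 0" "(\<Sum>v\<in>power_monom fs ` E. cscale (u v) v) = 0"
      using cvs.dependent_finite[of "power_monom fs ` E"] E(1) by auto
    have "(\<Sum>e\<in>{e\<in>E. u (power_monom fs e) \<noteq> 0}. cst (u (power_monom fs e)) * power_monom fs e)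
       = (\<Sum>e\<in>E. cst (u (power_monom fs e)) * power_monom fs e)"
      using E(1) by (intro sum.mono_neutral_left) (auto simp: hom_zero[OF ring_hom1_cst])
    also have "\<dots> = 0"
      using u(2) unfolding sum.reindex[OF True] cscale_eq by simp
    finally have "(\<Sum>e\<in>{e\<in>E. u (power_monom fs e) \<noteq> 0}. cst (u (power_monom fs e)) * power_monom fs e) = 0" .
    moreover have "finite {e\<in>E. u (power_monom fs e) \<noteq> 0}" "{e\<in>E. u (power_monom fs e) \<noteq> 0} \<noteq> {}"
      using u(1) E(1) by auto
    moreover have "length e = 5" if "e \<in> {e\<in>E. u (power_monom fs e) \<noteq> 0}" for e
      using that by (simp add: E_def)
    ultimately show ?thesis
      by (intro that[of "{e\<in>E. u (power_monom fs e) \<noteq> 0}" "\<lambda>e. u (power_monom fs e)"]) auto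
  qed
qed

text \<open>The dimension of a polynomial ring in four variables is at most four: one element from
  each of five strict steps would give five algebraically independent polynomials.\<close>

lemma no_long_prime_chain:
  fixes c :: "nat \<Rightarrow> coord_ring set"
  assumes "\<And>i. i \<le> 5 \<Longrightarrow> prime_ideal (c i)" "\<And>i. i < 5 \<Longrightarrow> c i \<subset> c (Suc i)"
  shows False
proof -
  have "\<forall>i<5. \<exists>f. f \<in> c (Suc i) - c i" using assms(2) by blast
  then obtain f where f: "\<And>i. i < 5 \<Longrightarrow> f i \<in> c (Suc i) - c i" by metis
  let ?fs = "map f [0..<5]"
  obtain T u where T: "finite T" "T \<noteq> {}" "\<And>e. e \<in> T \<Longrightarrow> length e = 5" "\<And>e. e \<in> T \<Longrightarrow> u e \<noteq> (0::complex)"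
    "(\<Sum>e\<in>T. cst (u e) * power_monom ?fs e) = 0"
    using algebraically_dependent[of ?fs] by auto
  have "(\<Sum>e\<in>T. cst (u e) * power_monom ?fs e) \<notin> c 0"
    using assms f T by (intro prime_chain_no_relation) (auto simp: psubset_eq)
  moreover have "0 \<in> c 0" using assms(1)[of 0] by (auto simp: prime_ideal_def ideal.subspace_0)
  ultimately show False using T(5) by simp
qed

section \<open>Homogeneous ideals\<close>

lemma hcomp_mult: "hcomp n (f * g) = (\<Sum>i\<le>n. hcomp i f * hcomp (n - i) g)" for f g :: "'v::finite mpoly"
proof -
  obtain N0 where N0: "\<And>n. n \<ge> N0 \<Longrightarrow> hcomp n f = 0" using hcomp_eq_0 by blast
  define N where "N = max N0 (Suc n)"
  have N: "\<And>n. n \<ge> N \<Longrightarrow> hcomp n f = 0" using N0 by (simp add: N_def)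
  have "hcomp n (f * g) = hcomp n ((\<Sum>i<N. hcomp i f) * g)"
    using sum_hcomp[OF N] by simp
  also have "\<dots> = (\<Sum>i<N. hcomp n (hcomp i f * g))"
    by (simp add: sum_distrib_right hcomp_sum)
  also have "\<dots> = (\<Sum>i<N. if i \<le> n then hcomp i f * hcomp (n - i) g else 0)"
  proof (intro sum.cong refl)
    fix i
    show "hcomp n (hcomp i f * g) = (if i \<le> n then hcomp i f * hcomp (n - i) g else 0)"
      using hcomp_mult_homog[OF hcomp_homog[of i f], of "n - i" g] hcomp_mult_homog_less[OF hcomp_homog[of i f], of n g]
      by auto
  qed
  also have "\<dots> = (\<Sum>i\<le>n. hcomp i f * hcomp (n - i) g)"
    unfolding N_def by (intro sum.mono_neutral_cong_right) auto
  finally show ?thesis .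
qed

lemma homogeneous_ideal_subspace: "homogeneous_ideal I \<Longrightarrow> ideal.subspace I"
  unfolding homogeneous_ideal_def by (metis ideal.subspace_span)

lemma homogeneous_ideal_hcomp:
  assumes I: "homogeneous_ideal I" and f: "f \<in> I" shows "hcomp n f \<in> I"
proof -
  note sub = homogeneous_ideal_subspace[OF I]
  have "f \<in> ideal.span (I \<inter> (\<Union>n. homog n))" using assms by (simp add: homogeneous_ideal_def)
  then show ?thesis
  proof (induction rule: ideal.span_induct_alt)
    case base
    then show ?case using ideal.subspace_0[OF sub] by simp
  next
    case (step c x y)
    then obtain k where x: "x \<in> I" "x \<in> homog k" by blast
    have "hcomp n (x * c) \<in> I"
    proof (cases "k \<le> n")
      case True
      then have "hcomp n (x * c) = hcomp (n - k) c * x"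
        using hcomp_mult_homog[OF x(2), of "n - k" c] by (simp add: mult.commute)
      then show ?thesis using ideal.subspace_scale[OF sub x(1)] by simp
    next
      case False
      then show ?thesis using hcomp_mult_homog_less[OF x(2), of n c] ideal.subspace_0[OF sub] by simp
    qed
    then show ?case
      using step.IH ideal.subspace_add[OF sub] by (simp add: hcomp_add mult.commute)
  qed
qed

lemma homogeneous_idealI:
  assumes sub: "ideal.subspace I" and "\<And>f n. f \<in> I \<Longrightarrow> hcomp n f \<in> I"
  shows "homogeneous_ideal I"
  unfolding homogeneous_ideal_def
proof
  show "ideal.span (I \<inter> (\<Union>n. homog n)) \<subseteq> I"
    by (intro ideal.span_minimal sub) auto
  show "I \<subseteq> ideal.span (I \<inter> (\<Union>n. homog n))"
  proof
    fix f assume f: "f \<in> I"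
    obtain N where N: "\<And>n. n \<ge> N \<Longrightarrow> hcomp n f = 0" using hcomp_eq_0 by blast
    have "hcomp n f \<in> ideal.span (I \<inter> (\<Union>n. homog n))" for n
      using assms(2)[OF f, of n] by (intro ideal.span_base) (use hcomp_homog in blast)
    then have "(\<Sum>n<N. hcomp n f) \<in> ideal.span (I \<inter> (\<Union>n. homog n))" by (intro ideal.span_sum)
    then show "f \<in> ideal.span (I \<inter> (\<Union>n. homog n))" using sum_hcomp[OF N] by simp
  qed
qed

lemma homogeneous_ideal_iff:
  "homogeneous_ideal I \<longleftrightarrow> ideal.subspace I \<and> (\<forall>f\<in>I. \<forall>n. hcomp n f \<in> I)"
  using homogeneous_ideal_subspace homogeneous_ideal_hcomp homogeneous_idealI by blast

text \<open>Take the components of lowest degrees i and j outside \<open>p\<close> in the two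
  factors. In degree i + j of the product every other term has a factor in \<open>p\<close>, so the
  product of these two components lies in \<open>p\<close> as well.\<close>

lemma homogeneous_prime_idealI:
  assumes p: "homogeneous_ideal p" "p \<noteq> UNIV"
    and hp: "\<And>m n f g. f \<in> homog m \<Longrightarrow> g \<in> homog n \<Longrightarrow> f * g \<in> p \<Longrightarrow> f \<in> p \<or> g \<in> p"
  shows "prime_ideal p"
proof -
  note sub = homogeneous_ideal_subspace[OF p(1)]
  have "f \<in> p \<or> g \<in> p" if fg: "f * g \<in> p" for f g
  proof (rule ccontr)
    assume n: "\<not> (f \<in> p \<or> g \<in> p)"
    have ex: "\<exists>i. hcomp i h \<notin> p" if "h \<notin> p" for h
    proof (rule ccontr)
      assume a: "\<not> (\<exists>i. hcomp i h \<notin> p)"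
      obtain N where N: "\<And>n. n \<ge> N \<Longrightarrow> hcomp n h = 0" using hcomp_eq_0 by blast
      have "(\<Sum>i<N. hcomp i h) \<in> p" using a by (intro ideal.subspace_sum[OF sub]) blast
      with sum_hcomp[OF N] that show False by simp
    qed
    define i where "i = (LEAST i. hcomp i f \<notin> p)"
    define j where "j = (LEAST j. hcomp j g \<notin> p)"
    have i1: "hcomp i f \<notin> p"
      unfolding i_def by (rule LeastI_ex) (use n ex in blast)
    have i2: "hcomp k f \<in> p" if "k < i" for k
      using not_less_Least[OF that[unfolded i_def]] by blast
    note i = i1 i2
    have j1: "hcomp j g \<notin> p"
      unfolding j_def by (rule LeastI_ex) (use n ex in blast)
    have j2: "hcomp k g \<in> p" if "k < j" for k
      using not_less_Least[OF that[unfolded j_def]] by blast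
    note j = j1 j2
    have eq: "hcomp (i + j) (f * g) = hcomp i f * hcomp j g + (\<Sum>k\<in>{..i + j} - {i}. hcomp k f * hcomp (i + j - k) g)"
      unfolding hcomp_mult by (subst sum.remove[of _ i]) auto
    have "hcomp k f * hcomp (i + j - k) g \<in> p" if "k \<in> {..i + j} - {i}" for k
    proof (cases "k < i")
      case True
      then show ?thesis using ideal.subspace_scale[OF sub i(2)[OF True], of "hcomp (i + j - k) g"]
        by (simp add: mult.commute)
    next
      case False
      with that have "i + j - k < j" by auto
      from ideal.subspace_scale[OF sub j(2)[OF this]] show ?thesis by simp
    qed
    then have "(\<Sum>k\<in>{..i + j} - {i}. hcomp k f * hcomp (i + j - k) g) \<in> p"
      by (intro ideal.subspace_sum[OF sub])
    from ideal.subspace_diff[OF sub homogeneous_ideal_hcomp[OF p(1) fg, of "i + j"] this]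
    have "hcomp i f * hcomp j g \<in> p" unfolding eq by simp
    then show False using hp[OF hcomp_homog hcomp_homog] i(1) j(1) by blast
  qed
  with sub p(2) show ?thesis by (simp add: prime_ideal_def)
qed

text \<open>A prime that is not a point of projective space; it prolongs every chain of points by
  one more step.\<close>

definition irrelevant_ideal :: "coord_ring set" where
  "irrelevant_ideal = {f. hcomp 0 f = 0}"

lemma prime_irrelevant_ideal: "prime_ideal irrelevant_ideal"
proof -
  have "ideal.subspace irrelevant_ideal"
    by (rule ideal.subspaceI) (auto simp: irrelevant_ideal_def hcomp_add hcomp_mult)
  moreover have "1 \<notin> irrelevant_ideal"
    by (simp add: irrelevant_ideal_def hcomp_of_homog[OF homog_one])
  ultimately show ?thesis
    by (auto simp: prime_ideal_def irrelevant_ideal_def hcomp_mult)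
qed

lemma homogeneous_ideal_subset_irrelevant:
  assumes I: "homogeneous_ideal I" "I \<noteq> UNIV" shows "I \<subseteq> irrelevant_ideal"
proof
  fix f assume "f \<in> I"
  then have f: "hcomp 0 f \<in> I" by (rule homogeneous_ideal_hcomp[OF I(1)])
  obtain c where c: "hcomp 0 f = cst c" using homog_0_cst[OF hcomp_homog] by blast
  note sub = homogeneous_ideal_subspace[OF I(1)]
  have "c = 0"
  proof (rule ccontr)
    assume "c \<noteq> 0"
    then have "cst (inverse c) * hcomp 0 f = 1"
      by (simp add: c flip: hom_mult[OF ring_hom1_cst]) (simp add: hom_one[OF ring_hom1_cst])
    with ideal.subspace_scale[OF sub f, of "cst (inverse c)"] one_notin_proper_ideal[OF sub I(2)] show False
      by simp
  qed
  then show "f \<in> irrelevant_ideal" by (simp add: c irrelevant_ideal_def hom_zero[OF ring_hom1_cst])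
qed

lemma saturateD:
  assumes "saturate I = I" "\<And>g. g \<in> homog n \<Longrightarrow> g * f \<in> I" shows "f \<in> I"
proof -
  have "f \<in> saturate I" unfolding saturate_def using assms(2) by blast
  then show ?thesis unfolding assms(1) .
qed

lemma proj_pointsD:
  assumes "p \<in> proj_points" shows "homogeneous_ideal p" "prime_ideal p" "p \<noteq> UNIV" "\<exists>i. var i \<notin> p"
  using assms homogeneous_ideal_subspace by (auto simp: proj_points_def prime_ideal_def)

section \<open>Pure codimension one in a factorial ring\<close>

lemma prime_factor_in_ideal:
  fixes \<iota> :: "'r::factorial_semiring \<Rightarrow> coord_ring"
  assumes p: "prime_ideal p" and mult: "\<And>a b. \<iota> (a * b) = \<iota> a * \<iota> b" and one: "\<iota> 1 = 1"
    and "k \<noteq> 0" "\<iota> k \<in> p"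
  shows "\<exists>\<pi>. prime_elem \<pi> \<and> \<iota> \<pi> \<in> p"
  using assms(4,5)
proof (induction k rule: prime_divisors_induct)
  case (unit x)
  then obtain y where "1 = x * y" by (auto elim: dvdE)
  then have "1 = \<iota> x * \<iota> y" using mult[of x y] one by simp
  moreover have "\<iota> y * \<iota> x \<in> p" using p unit(3) by (auto simp: prime_ideal_def intro: ideal.subspace_scale)
  ultimately have "1 \<in> p" by (metis mult.commute)
  then show ?case using p by (auto simp: prime_ideal_def dest: one_notin_proper_ideal)
next
  case (factor q x)
  then have "\<iota> q \<in> p \<or> \<iota> x \<in> p" using p by (auto simp: prime_ideal_def mult)
  with factor show ?case by auto
qed simp

lemma subspace_colon:
  assumes "ideal.subspace (I :: 'a::comm_ring_1 set)" shows "ideal.subspace {u. u * f \<in> I}"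
  using assms unfolding ideal.subspace_def
  by (simp add: distrib_right mult.assoc)

context coords
begin

text \<open>If the gcd of the image of \<open>I\<close> did not come from \<open>I\<close>, then
  some associated point of \<open>I\<close> would have codimension at least two modulo the kernel.
  Its specializations, together with the chain \<open>c\<close> below, form a chain of primes that
  is too long. The lemma serves for surfaces (j = 0, k = 2, kernel 0) and for curves in the plane (j
  = 1, k = 1, kernel generated by z).\<close>

lemma pure_codim_one_principal:
  fixes \<rho>' :: "coord_ring \<Rightarrow> 'r::factorial_ring_gcd" and \<iota> :: "'r \<Rightarrow> coord_ring"
  assumes \<rho>': "ring_hom1 \<rho>'" and \<iota>: "ring_hom1 \<iota>" and inv: "\<And>r. \<rho>' (\<iota> r) = r"
    and gr: "\<And>f n. f \<in> homog n \<Longrightarrow> \<iota> (\<rho>' f) \<in> homog n"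
    and I: "closed_subscheme I" "I \<noteq> UNIV" and ker: "\<And>f. \<rho>' f = 0 \<Longrightarrow> f \<in> I"
    and pure: "\<And>p. p \<in> associated_points I \<Longrightarrow> point_dim p = enat k" and k: "k \<ge> 1" "j + k = 2"
    and chain: "\<And>i. i \<le> j \<Longrightarrow> prime_ideal (c i)" "\<And>i. i < j \<Longrightarrow> c i \<subset> c (Suc i)" "c j = {f. \<rho>' f = 0}"
  obtains F e where "F \<in> homog e" "\<iota> (\<rho>' F) = F" "I = {g. \<rho>' F dvd \<rho>' g}"
proof -
  have hI: "homogeneous_ideal I" and satI: "saturate I = I" using I by (auto simp: closed_subscheme_def)
  note sub = homogeneous_ideal_subspace[OF hI]
  \<comment> \<open>The candidate for a generator; what has to be shown is that its lift lies in
    \<open>I\<close>.\<close>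
  define F0 where "F0 = Gcd (\<rho>' ` I)"
  define F where "F = \<iota> F0"
  have F0: "\<rho>' F = F0" "\<iota> (\<rho>' F) = F" by (simp_all add: F_def inv)
  have dvd: "F0 dvd \<rho>' h" if "h \<in> I" for h unfolding F0_def using that by (intro Gcd_dvd imageI)
  have inI: "f \<in> I" if "\<rho>' f = \<rho>' g" "g \<in> I" for f g
  proof -
    have "f - g \<in> I" using that by (intro ker) (simp add: hom_diff[OF \<rho>'])
    then show ?thesis using ideal.subspace_add[OF sub _ that(2)] by force
  qed
  show ?thesis
  proof (cases "\<forall>h\<in>I. \<rho>' h = 0")
    case True
    then have "F0 = 0" by (auto simp: F0_def)
    then have "F = 0" by (simp add: F_def hom_zero[OF \<iota>])
    moreover have "I = {g. 0 dvd \<rho>' g}" using True ker by auto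
    ultimately show ?thesis using F0 \<open>F0 = 0\<close> by (intro that[of F 0]) auto
  next
    case False
    have "\<exists>h m. h \<in> I \<and> h \<in> homog m \<and> \<rho>' h \<noteq> 0"
    proof (rule ccontr)
      assume n: "\<not> (\<exists>h m. h \<in> I \<and> h \<in> homog m \<and> \<rho>' h \<noteq> 0)"
      have "\<rho>' h = 0" if "h \<in> I" for h
      proof -
        obtain N where N: "\<And>n. n \<ge> N \<Longrightarrow> hcomp n h = 0" using hcomp_eq_0 by blast
        have "\<rho>' (hcomp i h) = 0" for i
          using n homogeneous_ideal_hcomp[OF hI that] hcomp_homog by blast
        then have "\<rho>' (\<Sum>i<N. hcomp i h) = 0" by (simp add: hom_sum[OF \<rho>'])
        then show ?thesis using sum_hcomp[OF N] by simp
      qed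
      with False show False by blast
    qed
    then obtain h m where h: "h \<in> I" "h \<in> homog m" "\<rho>' h \<noteq> 0" by blast
    obtain k0 where k0: "\<rho>' h = F0 * k0" using dvd[OF h(1)] by (auto elim: dvdE)
    have "\<iota> (\<rho>' h) = F * \<iota> k0" by (simp add: k0 hom_mult[OF \<iota>] F_def)
    moreover have "\<iota> (\<rho>' h) \<noteq> 0" using h(3) inv[of "\<rho>' h"] by (auto simp: hom_zero[OF \<rho>'])
    ultimately obtain e where e: "F \<in> homog e" using factor_homog[of F "\<iota> k0" m] gr[OF h(2)] by auto
    have F0_nz: "F0 \<noteq> 0" using k0 h(3) by auto
    show ?thesis
    proof (cases "F \<in> I")
      case True
      have "g \<in> I" if dv: "F0 dvd \<rho>' g" for g
      proof -
        obtain c where "\<rho>' g = F0 * c" using dv by (auto elim: dvdE)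
        then have "\<rho>' g = \<rho>' (\<iota> c * F)" by (simp add: hom_mult[OF \<rho>'] inv F0 mult.commute)
        then show ?thesis by (rule inI) (rule ideal.subspace_scale[OF sub True])
      qed
      with dvd have "I = {g. \<rho>' F dvd \<rho>' g}" unfolding F0(1) by blast
      then show ?thesis by (rule that[OF e F0(2)])
    next
      case FI: False
      \<comment> \<open>Only annihilators of multiples of \<open>F\<close> modulo \<open>I\<close>
        compete. So each of them contains every u with u F in \<open>I\<close>, in particular the
        lifted cofactor of any element of \<open>I\<close>. Forms g make a maximal annihilator
        homogeneous, and maximality makes it prime.\<close>
      define S where "S = {{u. u * (F * g) \<in> I} | g. (\<exists>n. g \<in> homog n) \<and> F * g \<notin> I}"
      have subcol: "ideal.subspace {u. u * f \<in> I}" for f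
        by (rule subspace_colon[OF sub])
      have "(\<exists>n. (1 :: coord_ring) \<in> homog n) \<and> F * 1 \<notin> I" using FI by (auto intro: exI[of _ 0])
      then have "{u. u * (F * 1) \<in> I} \<in> S" unfolding S_def by blast
      then have "S \<noteq> {}" by blast
      moreover have "ideal.subspace J" if "J \<in> S" for J using that subcol by (auto simp: S_def)
      ultimately obtain p where p: "p \<in> S" "\<And>J. J \<in> S \<Longrightarrow> p \<subseteq> J \<Longrightarrow> J = p"
        using noetherian_maximal[OF noetherian_coord_ring] by metis
      then obtain g0 n0 where g0: "p = {u. u * (F * g0) \<in> I}" "g0 \<in> homog n0" "F * g0 \<notin> I"
        by (auto simp: S_def)
      define f0 where "f0 = F * g0"
      have p_def: "p = {u. u * f0 \<in> I}" and f0: "f0 \<in> homog (e + n0)" "f0 \<notin> I"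
        using g0 e homog_mult by (auto simp: f0_def)
      have subp: "ideal.subspace p" unfolding p_def by (rule subcol)
      have hp: "homogeneous_ideal p"
      proof (rule homogeneous_idealI[OF subp])
        fix f n assume "f \<in> p"
        then have "f0 * f \<in> I" by (simp add: p_def mult.commute)
        from homogeneous_ideal_hcomp[OF hI this, of "e + n0 + n"] show "hcomp n f \<in> p"
          by (simp add: hcomp_mult_homog[OF f0(1)] p_def mult.commute)
      qed
      have p_ne: "p \<noteq> UNIV" using f0(2) by (auto simp: p_def set_eq_iff intro!: exI[of _ 1])
      have pp: "prime_ideal p"
      proof (rule homogeneous_prime_idealI[OF hp p_ne])
        fix m n f g assume fg: "f \<in> homog m" "g \<in> homog n" "f * g \<in> p"
        show "f \<in> p \<or> g \<in> p"
        proof (cases "g \<in> p")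
          case False
          let ?J = "{u. u * (F * (g0 * g)) \<in> I}"
          have "?J \<in> S" using False homog_mult[OF g0(2) fg(2)] by (auto simp: S_def g0(1) mult_ac)
          moreover have "p \<subseteq> ?J"
          proof
            fix u assume "u \<in> p"
            then have "g * (u * f0) \<in> I" unfolding p_def using ideal.subspace_scale[OF sub] by blast
            then show "u \<in> ?J" by (simp add: f0_def mult_ac)
          qed
          ultimately have "?J = p" by (rule p(2))
          moreover have "f \<in> ?J" using fg(3) by (simp add: p_def f0_def mult_ac)
          ultimately show ?thesis by blast
        qed simp
      qed
      \<comment> \<open>If all variables annihilated \<open>f0\<close>, then all linear forms would,
        and saturation would put \<open>f0\<close> into \<open>I\<close>.\<close>
      have rel: "\<exists>i. var i \<notin> p"
      proof (rule ccontr)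
        assume "\<not> (\<exists>i. var i \<notin> p)"
        then have "range var \<subseteq> p" by blast
        moreover have "cvs.subspace p"
          using subp by (intro cvs.subspaceI) (auto simp: cscale_eq ideal.subspace_0 ideal.subspace_add ideal.subspace_scale)
        ultimately have "homog 1 \<subseteq> p" unfolding homog_1_eq_span by (intro cvs.span_minimal)
        then have "g * f0 \<in> I" if "g \<in> homog 1" for g using that unfolding p_def by blast
        then have "f0 \<in> I" by (rule saturateD[OF satI])
        with f0(2) show False by simp
      qed
      have "p \<in> proj_points" using hp p_ne pp rel by (auto simp: proj_points_def prime_ideal_def)
      then have "p \<in> associated_points I" by (auto simp: associated_points_def p_def)
      then have "point_dim p = enat k" by (rule pure)
      then have "enat (k - 1) < point_dim p" using k by simp
      then obtain n d where n: "k - 1 < n" and d: "d 0 = p" "\<And>i. i \<le> n \<Longrightarrow> d i \<in> proj_points"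
        "\<And>i. i < n \<Longrightarrow> d i \<subset> d (Suc i)"
        unfolding point_dim_def less_SUP_iff by auto
      have colon: "u \<in> p" if "u * F \<in> I" for u
        using ideal.subspace_scale[OF sub that, of g0] by (simp add: p_def f0_def mult_ac)
      have "\<iota> k0 * F \<in> I"
        by (rule inI[OF _ h(1)]) (simp add: hom_mult[OF \<rho>'] inv F0 k0 mult.commute)
      then have "\<iota> k0 \<in> p" by (rule colon)
      moreover have "k0 \<noteq> 0" using k0 h(3) by auto
      ultimately obtain \<pi> where \<pi>: "prime_elem \<pi>" "\<iota> \<pi> \<in> p"
        using prime_factor_in_ideal[OF pp hom_mult[OF \<iota>] hom_one[OF \<iota>]] by blast
      define P1 where "P1 = {f. \<pi> dvd \<rho>' f}"
      have P1: "prime_ideal P1"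
      proof -
        have "ideal.subspace P1"
          by (rule ideal.subspaceI) (auto simp: P1_def hom_zero[OF \<rho>'] hom_add[OF \<rho>'] hom_mult[OF \<rho>'])
        moreover have "1 \<notin> P1" using \<pi>(1) by (auto simp: P1_def hom_one[OF \<rho>'] prime_elem_def)
        moreover have "f \<in> P1 \<or> g \<in> P1" if "f * g \<in> P1" for f g
          using that \<pi>(1) by (simp add: P1_def hom_mult[OF \<rho>'] prime_elem_dvd_mult_iff)
        ultimately show ?thesis by (auto simp: prime_ideal_def)
      qed
      have Ip: "u \<in> p" if "u \<in> I" for u
        using ideal.subspace_scale[OF sub that, of f0] by (simp add: p_def mult.commute)
      have P1p: "P1 \<subset> p"
      proof
        show "P1 \<subseteq> p"
        proof
          fix f assume "f \<in> P1"
          then obtain c where "\<rho>' f = \<pi> * c" by (auto simp: P1_def elim: dvdE)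
          then have "\<rho>' (f - \<iota> c * \<iota> \<pi>) = 0" by (simp add: hom_diff[OF \<rho>'] hom_mult[OF \<rho>'] inv mult.commute)
          then have "f - \<iota> c * \<iota> \<pi> \<in> p" by (intro Ip ker)
          from ideal.subspace_add[OF subp this ideal.subspace_scale[OF subp \<pi>(2), of "\<iota> c"]] show "f \<in> p" by simp
        qed
        \<comment> \<open>If they were equal, the cofactor of every u in \<open>I\<close> would be
          divisible by \<pi>, so \<open>F0 * \<pi>\<close> would divide the gcd
          \<open>F0\<close>.\<close>
        show "P1 \<noteq> p"
        proof
          assume eq: "P1 = p"
          have "F0 * \<pi> dvd \<rho>' u" if uI: "u \<in> I" for u
          proof -
            obtain v where v: "\<rho>' u = F0 * v" using dvd[OF uI] by (auto elim: dvdE)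
            have "\<iota> v * F \<in> I"
              by (rule inI[OF _ uI]) (simp add: hom_mult[OF \<rho>'] inv F0 v mult.commute)
            then have "\<iota> v \<in> P1" unfolding eq by (rule colon)
            then show ?thesis by (simp add: P1_def inv v)
          qed
          then have "F0 * \<pi> dvd F0" unfolding F0_def by (intro Gcd_greatest) auto
          then have "\<pi> dvd 1" using F0_nz by (metis dvd_mult_cancel_left mult.right_neutral)
          with \<pi>(1) show False by (simp add: prime_elem_def)
        qed
      qed
      have kerP1: "c j \<subset> P1"
      proof
        show "c j \<subseteq> P1" by (auto simp: chain(3) P1_def)
        have "\<iota> \<pi> \<in> P1" "\<iota> \<pi> \<notin> c j" using \<pi>(1) by (auto simp: P1_def inv chain(3) prime_elem_def)
        then show "c j \<noteq> P1" by blast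
      qed
      \<comment> \<open>There are j + 1 primes from \<open>c\<close>, then \<open>P1\<close>, then k
        + 1 points starting with \<open>p\<close>, then the irrelevant ideal: j + k + 4 = 6 primes
        with five strict inclusions.\<close>
      define C where "C i = (if i \<le> j then c i else if i = j + 1 then P1 else if i \<le> j + 2 + k then d (i - j - 2)
        else irrelevant_ideal)" for i
      have dk: "d i \<in> proj_points" if "i \<le> k" for i using d(2)[of i] that n by simp
      have last: "d k \<subset> irrelevant_ideal"
      proof
        show "d k \<subseteq> irrelevant_ideal"
          using proj_pointsD[OF dk[of k]] by (intro homogeneous_ideal_subset_irrelevant) auto
        obtain i where "var i \<notin> d k" using proj_pointsD[OF dk[of k]] by auto
        moreover have "var i \<in> irrelevant_ideal"
          by (simp add: irrelevant_ideal_def hcomp_of_homog[OF homog_var])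
        ultimately show "d k \<noteq> irrelevant_ideal" by blast
      qed
      have "prime_ideal (C i)" for i
        using chain(1) P1 proj_pointsD(2)[OF dk] prime_irrelevant_ideal by (auto simp: C_def)
      moreover have "C i \<subset> C (Suc i)" if i5: "i < 5" for i
      proof -
        consider "i < j" | "i = j" | "i = j + 1" | "j + 2 \<le> i" "i < j + 2 + k" | "i = j + 2 + k"
          using i5 k by linarith
        then show ?thesis
        proof cases
          case 4
          then have "Suc i - j - 2 = Suc (i - j - 2)" "i - j - 2 < n" using n by auto
          with 4 d(3)[of "i - j - 2"] show ?thesis by (auto simp: C_def)
        qed (use chain(2) kerP1 P1p d(1) last in \<open>auto simp: C_def\<close>)
      qed
      ultimately show ?thesis using no_long_prime_chain[of C] by blast
    qed
  qed
qed

end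

section \<open>Dimensions of graded pieces\<close>

lemma homog_findim: "\<exists>B. finite B \<and> (homog n :: coord_ring set) \<subseteq> cvs.span B"
proof -
  let ?M = "{m :: 4 \<Rightarrow>\<^sub>0 nat. mdeg m = n}"
  have sub: "Poly_Mapping.lookup ` ?M \<subseteq> (\<Pi>\<^sub>E i\<in>UNIV. {..n})"
    by (auto simp: mdeg_eq intro: member_le_sum)
  have "finite (\<Pi>\<^sub>E i\<in>(UNIV::4 set). {..n})" by (intro finite_PiE) auto
  moreover have "inj_on Poly_Mapping.lookup ?M" by (rule inj_onI) (simp add: lookup_inject)
  ultimately have fin: "finite ?M" using inj_on_finite[OF _ sub] by blast
  have "f \<in> cvs.span ((\<lambda>m. Poly_Mapping.single m 1) ` ?M)" if f: "f \<in> homog n" for f :: coord_ring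
  proof -
    have "Poly_Mapping.single m (Poly_Mapping.lookup f m) \<in> cvs.span ((\<lambda>m. Poly_Mapping.single m 1) ` ?M)"
      if m: "m \<in> Poly_Mapping.keys f" for m
    proof -
      have "Poly_Mapping.single m (Poly_Mapping.lookup f m) = cscale (Poly_Mapping.lookup f m) (Poly_Mapping.single m 1)"
        by (simp add: cscale_def mult_single)
      moreover have "m \<in> ?M" using m f by (auto simp: homog_def)
      ultimately show ?thesis by (auto intro: cvs.span_scale cvs.span_base)
    qed
    then show ?thesis by (subst mpoly_sum_monomials) (rule cvs.span_sum)
  qed
  with fin show ?thesis by blast
qed

lemma findim_basis:
  fixes V :: "coord_ring set"
  assumes "V \<subseteq> homog n"
  obtains B where "finite B" "B \<subseteq> V" "\<not> cvs.dependent B" "V \<subseteq> cvs.span B" "card B = cvs.dim V"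
proof -
  obtain B where B: "B \<subseteq> V" "\<not> cvs.dependent B" "V \<subseteq> cvs.span B" "card B = cvs.dim V"
    by (rule cvs.basis_exists)
  obtain C :: "coord_ring set" where "finite C" "homog n \<subseteq> cvs.span C" using homog_findim by blast
  then have "finite B" using cvs.independent_span_bound[of C B] B assms by auto
  with B that show ?thesis by blast
qed

lemma dim_mono_homog:
  assumes "V \<subseteq> W" "W \<subseteq> homog n" shows "cvs.dim V \<le> cvs.dim (W :: coord_ring set)"
proof -
  obtain B where B: "finite B" "B \<subseteq> W" "\<not> cvs.dependent B" "W \<subseteq> cvs.span B" "card B = cvs.dim W"
    by (rule findim_basis[OF assms(2)])
  from cvs.dim_le_card[OF subset_trans[OF assms(1) B(4)] B(1)] B(5) show ?thesis by simp
qed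

text \<open>A basis of the kernel is extended to one of \<open>V\<close>; the added vectors map
  injectively onto a basis of the image. Containment in a graded piece supplies finiteness.\<close>

lemma rank_nullity:
  fixes T :: "coord_ring \<Rightarrow> coord_ring"
  assumes V: "cvs.subspace V" "V \<subseteq> homog n"
    and T: "\<And>f g. T (f + g) = T f + T g" "\<And>c f. T (cscale c f) = cscale c (T f)"
  shows "cvs.dim V = cvs.dim {f\<in>V. T f = 0} + cvs.dim (T ` V)"
proof -
  let ?K = "{f\<in>V. T f = 0}"
  have T0: "T 0 = 0" using T(1)[of 0 0] by simp
  have Tsum: "T (\<Sum>b\<in>B. cscale (u b) b) = (\<Sum>b\<in>B. cscale (u b) (T b))" for u B
    by (induction B rule: infinite_finite_induct) (simp_all add: T0 T)
  have K: "?K \<subseteq> homog n" using V(2) by blast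
  obtain C where C: "finite C" "C \<subseteq> ?K" "\<not> cvs.dependent C" "?K \<subseteq> cvs.span C" "card C = cvs.dim ?K"
    by (rule findim_basis[OF K])
  obtain E where E: "C \<subseteq> E" "E \<subseteq> V" "\<not> cvs.dependent E" "V \<subseteq> cvs.span E"
    using cvs.maximal_independent_subset_extend[of C V] C by auto
  obtain B :: "coord_ring set" where B: "finite B" "homog n \<subseteq> cvs.span B" using homog_findim by blast
  then have finE: "finite E" using cvs.independent_span_bound[of B E] E V(2) by auto
  define D where "D = E - C"
  have D: "finite D" "D \<inter> C = {}" "E = C \<union> D" using finE E(1) by (auto simp: D_def)
  have key: "\<forall>d\<in>D. u d = 0" if u: "(\<Sum>d\<in>D. cscale (u d) (T d)) = 0" for u
  proof -
    have "(\<Sum>d\<in>D. cscale (u d) d) \<in> V"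
      using E(2) D by (intro cvs.subspace_sum[OF V(1)] cvs.subspace_scale[OF V(1)]) auto
    then have "(\<Sum>d\<in>D. cscale (u d) d) \<in> cvs.span C" using u C(4) Tsum[of u D] by auto
    then obtain v where v: "(\<Sum>d\<in>D. cscale (u d) d) = (\<Sum>c\<in>C. cscale (v c) c)"
      using C(1) by (auto simp: cvs.span_finite)
    define t where "t b = (if b \<in> D then u b else - v b)" for b
    have "(\<Sum>b\<in>E. cscale (t b) b) = (\<Sum>c\<in>C. cscale (t c) c) + (\<Sum>d\<in>D. cscale (t d) d)"
      unfolding D(3) using C(1) D by (intro sum.union_disjoint) auto
    also have "(\<Sum>c\<in>C. cscale (t c) c) = (\<Sum>c\<in>C. - cscale (v c) c)"
      using D(2) by (intro sum.cong) (auto simp: t_def)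
    also have "(\<Sum>d\<in>D. cscale (t d) d) = (\<Sum>d\<in>D. cscale (u d) d)"
      by (intro sum.cong) (auto simp: t_def)
    finally have "(\<Sum>b\<in>E. cscale (t b) b) = 0" using v by (simp add: sum_negf)
    from cvs.independentD[OF E(3) finE order_refl this] have t: "t b = 0" if "b \<in> E" for b using that .
    show ?thesis
    proof
      fix d assume "d \<in> D"
      then show "u d = 0" using t[of d] D(3) by (simp add: t_def)
    qed
  qed
  have inj: "inj_on T D"
  proof (rule inj_onI, rule ccontr)
    fix a b assume ab: "a \<in> D" "b \<in> D" "T a = T b" "a \<noteq> b"
    define u where "u d = (if d = a then 1 else if d = b then - 1 else (0::complex))" for d
    have "(\<Sum>d\<in>D. cscale (u d) (T d)) = (\<Sum>d\<in>{a, b}. cscale (u d) (T d))"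
      using ab D(1) by (intro sum.mono_neutral_right) (auto simp: u_def)
    also have "\<dots> = 0" using ab by (simp add: u_def)
    finally have "u a = 0" using key ab by blast
    then show False by (simp add: u_def)
  qed
  have ind: "\<not> cvs.dependent (T ` D)"
  proof
    assume "cvs.dependent (T ` D)"
    then obtain u where u: "\<exists>v\<in>T ` D. u v \<noteq> 0" "(\<Sum>v\<in>T ` D. cscale (u v) v) = 0"
      using cvs.dependent_finite[of "T ` D"] D(1) by auto
    then have "(\<Sum>d\<in>D. cscale (u (T d)) (T d)) = 0" by (simp add: sum.reindex[OF inj])
    from key[OF this] u(1) show False by auto
  qed
  have "T ` V \<subseteq> cvs.span (T ` D)"
  proof
    fix h assume "h \<in> T ` V"
    then obtain f where f: "f \<in> V" "h = T f" by blast
    then obtain u where "f = (\<Sum>b\<in>E. cscale (u b) b)" using E(4) finE by (auto simp: cvs.span_finite)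
    then have "h = (\<Sum>b\<in>C \<union> D. cscale (u b) (T b))" using f Tsum D(3) by simp
    also have "\<dots> = (\<Sum>b\<in>D. cscale (u b) (T b))"
      using C(1,2) D(1) by (intro sum.mono_neutral_right) auto
    also have "\<dots> \<in> cvs.span (T ` D)"
      by (intro cvs.span_sum cvs.span_scale cvs.span_base) auto
    finally show "h \<in> cvs.span (T ` D)" .
  qed
  moreover have "T ` D \<subseteq> T ` V" using E D by auto
  ultimately have "card (T ` D) = cvs.dim (T ` V)" using ind by (intro cvs.basis_card_eq_dim)
  then have "card D = cvs.dim (T ` V)" using inj by (simp add: card_image)
  moreover have "card E = cvs.dim V" using E by (intro cvs.basis_card_eq_dim)
  moreover have "card E = card C + card D" unfolding D(3) using C(1) D by (intro card_Un_disjoint) auto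
  ultimately show ?thesis using C(5) by simp
qed

lemma dim_singleton_0: "cvs.dim {0 :: coord_ring} = 0"
  by (rule cvs.dim_unique[of "{}"]) (simp_all add: cvs.independent_empty)

lemma dim_times:
  fixes h :: coord_ring
  assumes V: "cvs.subspace V" "V \<subseteq> homog n" and h: "h \<noteq> 0"
  shows "cvs.dim ((*) h ` V) = cvs.dim V"
proof -
  have "{f\<in>V. h * f = 0} = {0}" using h cvs.subspace_0[OF V(1)] by auto
  moreover have "cvs.dim {0 :: coord_ring} = 0" by (rule dim_singleton_0)
  moreover have "cvs.dim V = cvs.dim {f\<in>V. h * f = 0} + cvs.dim ((*) h ` V)"
    by (rule rank_nullity[OF V]) (simp_all add: distrib_left cscale_eq mult_ac)
  ultimately show ?thesis by simp
qed

lemma poly_eq_of_eventually: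
  fixes P Q :: "rat poly"
  assumes "\<forall>\<^sub>F n in sequentially. poly P (of_nat n) = poly Q (of_nat n)"
  shows "P = Q"
proof (rule ccontr)
  assume "P \<noteq> Q"
  then have "finite {x. poly (P - Q) x = 0}" by (intro poly_roots_finite) simp
  moreover obtain N where N: "\<And>n. n \<ge> N \<Longrightarrow> poly P (of_nat n) = poly Q (of_nat n)"
    using assms by (auto simp: eventually_sequentially)
  have "of_nat ` {N..} \<subseteq> {x. poly (P - Q) x = 0}" using N by auto
  moreover have "infinite (of_nat ` {N..} :: rat set)"
    by (subst finite_image_iff) (auto simp: inj_on_def infinite_Ici)
  ultimately show False using finite_subset by blast
qed

section \<open>Graded pieces in adapted coordinates\<close>

context coords
begin

text \<open>Forms in x, y, w alone, which \<rho> and \<open>i3\<close> identify with the forms of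
  degree n on the plane z = 0.\<close>

definition plane_homog :: "nat \<Rightarrow> coord_ring set" where
  "plane_homog n = {f\<in>homog n. i3 (\<rho> f) = f}"

lemma i3_\<rho>_hom: "ring_hom1 (\<lambda>f. i3 (\<rho> f))"
  by (rule ring_hom1_comp[OF i_hom(3) \<rho>_hom])

lemma i3_\<rho>_cst: "i3 (\<rho> (cst c)) = cst c"
  by (simp add: i_pCons)

lemma i3_\<rho>_cscale: "i3 (\<rho> (cscale c f)) = cscale c (i3 (\<rho> f))"
  by (simp add: cscale_eq hom_mult[OF i3_\<rho>_hom] i3_\<rho>_cst del: \<rho>_simps)

lemma \<kappa>_cscale: "\<kappa> (cscale c f) = cscale c (\<kappa> f)"
  by (simp add: cscale_eq hom_mult[OF \<kappa>_hom])

lemma plane_homog_image: "(\<lambda>f. i3 (\<rho> f)) ` homog n = plane_homog n"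
  by (force simp: plane_homog_def i3_\<rho>_homog)

lemma subspace_plane_homog: "cvs.subspace (plane_homog n)"
  using subspace_homog[of n]
  by (intro cvs.subspaceI)
     (auto simp: plane_homog_def hom_zero[OF i3_\<rho>_hom] hom_add[OF i3_\<rho>_hom] i3_\<rho>_cscale
        homog_add homog_cscale)

lemma plane_homog_sub: "plane_homog n \<subseteq> homog n"
  by (auto simp: plane_homog_def)

lemma plane_homog_mult: "f \<in> plane_homog n \<Longrightarrow> g \<in> plane_homog k \<Longrightarrow> f * g \<in> plane_homog (n + k)"
  by (simp add: plane_homog_def homog_mult hom_mult[OF i3_\<rho>_hom])

lemma x_plane_homog: "x \<in> plane_homog 1" and w_plane_homog: "w \<in> plane_homog 1"
  using linear by (simp_all add: plane_homog_def i3_coords)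

lemma coords_nonzero: "x \<noteq> 0" "y \<noteq> 0" "z \<noteq> 0" "w \<noteq> 0"
  using \<Theta>(3-6) hom_zero[OF \<Theta>(1)] by (metis one_neq_zero pCons_eq_0_iff)+

lemma z_kernel: "{f\<in>homog (Suc n). i3 (\<rho> f) = 0} = (*) z ` homog n"
proof safe
  fix f assume f: "f \<in> homog (Suc n)" "i3 (\<rho> f) = 0"
  then have "\<rho> f = 0" using \<rho>_i3[of "\<rho> f"] by (simp add: hom_zero[OF \<rho>_hom])
  then obtain g where g: "f = z * g" by (auto simp: \<rho>_eq_0_iff)
  then have "g \<in> homog n" using homog_cancel[OF linear(3) coords_nonzero(3), of g n] f(1) by simp
  with g show "f \<in> (*) z ` homog n" by blast
next
  fix g :: coord_ring assume "g \<in> homog n"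
  then show "z * g \<in> homog (Suc n)" using homog_mult[OF linear(3), of g n] by simp
qed (simp add: hom_mult[OF \<rho>_hom])

lemma x_kernel: "{f\<in>plane_homog (Suc n). \<kappa> f = 0} = (*) x ` plane_homog n"
proof safe
  fix f assume f: "f \<in> plane_homog (Suc n)" "\<kappa> f = 0"
  then obtain a b where "f = x * a + z * b" by (auto simp: \<kappa>_eq_0_iff)
  then have "i3 (\<rho> f) = i3 (\<rho> (x * a + z * b))" by simp
  with f have g: "f = x * i3 (\<rho> a)"
    by (simp add: plane_homog_def hom_add[OF i3_\<rho>_hom] hom_mult[OF i3_\<rho>_hom] i3_coords)
  then have "i3 (\<rho> a) \<in> homog n"
    using homog_cancel[OF linear(1) coords_nonzero(1), of _ n] f(1) by (simp add: plane_homog_def)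
  with g show "f \<in> (*) x ` plane_homog n" by (auto simp: plane_homog_def)
next
  fix g assume "g \<in> plane_homog n"
  then show "x * g \<in> plane_homog (Suc n)" using plane_homog_mult[OF x_plane_homog, of g n] by simp
qed (simp add: hom_mult[OF \<kappa>_hom])

lemma i3_\<rho>_\<kappa>: "i3 (\<rho> (\<kappa> f)) = \<kappa> f"
  unfolding \<rho>_\<kappa> by (simp add: i_pCons \<kappa>_def)

lemma \<kappa>_H_image: "\<kappa> ` homog n = H n ` {p. degree p \<le> n}" "\<kappa> ` plane_homog n = H n ` {p. degree p \<le> n}"
proof -
  have 1: "\<kappa> ` homog n \<subseteq> H n ` {p. degree p \<le> n}" using \<kappa>_homog by blast
  have H: "H n p \<in> plane_homog n" for p
    using i3_\<rho>_\<kappa>[of "H n p"] by (simp add: plane_homog_def H_homog)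
  have 2: "H n ` {p. degree p \<le> n} \<subseteq> \<kappa> ` plane_homog n"
    using \<kappa>_H H by (metis (no_types, lifting) image_subset_iff image_eqI)
  have 3: "\<kappa> ` plane_homog n \<subseteq> \<kappa> ` homog n" using plane_homog_sub by blast
  show "\<kappa> ` homog n = H n ` {p. degree p \<le> n}" "\<kappa> ` plane_homog n = H n ` {p. degree p \<le> n}"
    using 1 2 3 by auto
qed

lemma H_plane_homog: "H n p \<in> plane_homog n"
  using i3_\<rho>_\<kappa>[of "H n p"] by (simp add: plane_homog_def H_homog)

lemma subspace_H: "cvs.subspace (H n ` {p. degree p \<le> n})"
proof (rule cvs.subspaceI)
  show "0 \<in> H n ` {p. degree p \<le> n}" by (rule image_eqI[of _ _ 0]) auto
next
  fix f g assume "f \<in> H n ` {p. degree p \<le> n}" "g \<in> H n ` {p. degree p \<le> n}"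
  then show "f + g \<in> H n ` {p. degree p \<le> n}"
    by (auto simp flip: H_add intro!: imageI degree_add_le)
next
  fix c f assume "f \<in> H n ` {p. degree p \<le> n}"
  then show "cscale c f \<in> H n ` {p. degree p \<le> n}"
    by (auto simp: cscale_eq simp flip: H_smult intro!: imageI order_trans[OF degree_smult_le])
qed

lemma dim_H: "cvs.dim (H n ` {p. degree p \<le> n}) = Suc n"
proof -
  define e where "e i = H n (monom 1 i)" for i
  have \<delta>e: "\<delta> (e i) = monom 1 i" if "i \<le> n" for i
    unfolding e_def using that by (intro \<delta>_H) (simp add: degree_monom_eq)
  have inj: "inj_on e {..n}"
    by (intro inj_onI) (metis \<delta>e atMost_iff monom_eq_iff' zero_neq_one)
  have ind: "\<not> cvs.dependent (e ` {..n})"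
  proof
    assume "cvs.dependent (e ` {..n})"
    then obtain u where u: "\<exists>v\<in>e ` {..n}. u v \<noteq> 0" "(\<Sum>v\<in>e ` {..n}. cscale (u v) v) = 0"
      using cvs.dependent_finite[of "e ` {..n}"] by auto
    have "0 = \<delta> (\<Sum>i\<le>n. cscale (u (e i)) (e i))"
      using u(2) by (simp add: sum.reindex[OF inj] hom_zero[OF \<delta>_hom])
    also have "\<dots> = (\<Sum>i\<le>n. monom (u (e i)) i)"
      by (simp add: hom_sum[OF \<delta>_hom] hom_cscale[OF \<delta>_hom] \<delta>e smult_monom)
    finally have c0: "coeff (\<Sum>i\<le>n. monom (u (e i)) i) j = 0" for j by simp
    have "coeff (\<Sum>i\<le>n. monom (u (e i)) i) j = u (e j)" if "j \<le> n" for j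
      using that by (simp add: coeff_sum)
    then have "u (e j) = 0" if "j \<le> n" for j using that c0[of j] by simp
    with u(1) show False by auto
  qed
  have "H n p \<in> cvs.span (e ` {..n})" if "degree p \<le> n" for p
  proof -
    have "H n p = H n (\<Sum>i\<le>n. smult (coeff p i) (monom 1 i))"
      using poly_as_sum_of_monoms'[OF that] by (simp add: smult_monom)
    also have "\<dots> = (\<Sum>i\<le>n. cscale (coeff p i) (e i))"
      by (simp only: H_sum H_smult e_def cscale_eq)
    also have "\<dots> \<in> cvs.span (e ` {..n})"
      by (intro cvs.span_sum cvs.span_scale cvs.span_base) auto
    finally show ?thesis .
  qed
  then have "H n ` {p. degree p \<le> n} \<subseteq> cvs.span (e ` {..n})" by auto
  moreover have "e ` {..n} \<subseteq> H n ` {p. degree p \<le> n}"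
    by (auto simp: e_def intro!: imageI simp: degree_monom_eq)
  ultimately have "card (e ` {..n}) = cvs.dim (H n ` {p. degree p \<le> n})"
    using ind by (intro cvs.basis_card_eq_dim)
  then show ?thesis by (simp add: card_image[OF inj])
qed

text \<open>Setting x = 0 gives a recursion: the kernel is x times the previous piece, and the image
  consists of the forms in y and w. The factor 2 avoids division in the natural numbers.\<close>

lemma dim_plane_homog: "2 * cvs.dim (plane_homog n) = (n + 1) * (n + 2)"
proof (induction n)
  case 0
  have "{f\<in>plane_homog 0. \<kappa> f = 0} = {0}"
  proof -
    have "f = 0" if "f \<in> homog 0" "\<kappa> f = 0" for f
      using homog_0_cst[OF that(1)] that(2) by auto
    then show ?thesis using cvs.subspace_0[OF subspace_plane_homog] by (auto simp: plane_homog_def hom_zero[OF \<kappa>_hom])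
  qed
  then have "cvs.dim (plane_homog 0) = 1"
    using rank_nullity[OF subspace_plane_homog plane_homog_sub, of \<kappa> 0] dim_H[of 0]
    by (simp add: \<kappa>_H_image hom_add[OF \<kappa>_hom] \<kappa>_cscale dim_singleton_0)
  then show ?case by simp
next
  case (Suc n)
  have "cvs.dim (plane_homog (Suc n)) = cvs.dim ((*) x ` plane_homog n) + Suc (Suc n)"
    using rank_nullity[OF subspace_plane_homog plane_homog_sub, of \<kappa> "Suc n"] dim_H[of "Suc n"]
    by (simp add: \<kappa>_H_image hom_add[OF \<kappa>_hom] \<kappa>_cscale x_kernel)
  with Suc show ?case
    by (simp add: dim_times[OF subspace_plane_homog plane_homog_sub coords_nonzero(1)])
qed

lemma dim_homog_Suc: "cvs.dim (homog (Suc n) :: coord_ring set) = cvs.dim (homog n :: coord_ring set) + cvs.dim (plane_homog (Suc n))"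
  using rank_nullity[OF subspace_homog order_refl, of "\<lambda>f. i3 (\<rho> f)" "Suc n"]
  by (simp add: plane_homog_image hom_add[OF i3_\<rho>_hom] i3_\<rho>_cscale z_kernel
      dim_times[OF subspace_homog order_refl coords_nonzero(3)])

lemma dim_homog: "6 * cvs.dim (homog n :: coord_ring set) = (n + 1) * (n + 2) * (n + 3)"
proof (induction n)
  case 0
  have "plane_homog 0 = homog 0"
    using homog_0_cst i3_\<rho>_cst by (fastforce simp: plane_homog_def)
  then show ?case using dim_plane_homog[of 0] by simp
next
  case (Suc n)
  have "6 * cvs.dim (homog (Suc n) :: coord_ring set) =
    6 * cvs.dim (homog n :: coord_ring set) + 3 * (2 * cvs.dim (plane_homog (Suc n)))"
    by (simp add: dim_homog_Suc)
  also have "\<dots> = (n + 1) * (n + 2) * (n + 3) + 3 * ((Suc n + 1) * (Suc n + 2))"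
    by (simp only: Suc.IH dim_plane_homog)
  also have "\<dots> = (Suc n + 1) * (Suc n + 2) * (Suc n + 3)" by (simp add: algebra_simps)
  finally show ?case .
qed

lemma of_nat_dim_plane_homog: "of_nat (cvs.dim (plane_homog n)) = (of_nat n + 1) * (of_nat n + 2) / (2 :: rat)"
proof -
  have "2 * of_nat (cvs.dim (plane_homog n)) = (of_nat ((n + 1) * (n + 2)) :: rat)"
    using arg_cong[OF dim_plane_homog[of n], of "of_nat :: nat \<Rightarrow> rat"] by simp
  then show ?thesis by (simp add: field_simps)
qed

lemma of_nat_dim_homog: "of_nat (cvs.dim (homog n :: coord_ring set)) = (of_nat n + 1) * (of_nat n + 2) * (of_nat n + 3) / (6 :: rat)"
proof -
  have "6 * of_nat (cvs.dim (homog n :: coord_ring set)) = (of_nat ((n + 1) * (n + 2) * (n + 3)) :: rat)"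
    using arg_cong[OF dim_homog[of n], of "of_nat :: nat \<Rightarrow> rat"] by simp
  then show ?thesis by (simp add: field_simps)
qed

lemma degree_hypersurface:
  assumes F: "F \<in> homog e" "F \<noteq> 0" and deg: "has_degree {f. F dvd f} k"
  shows "e = k"
proof -
  have eq: "{f. F dvd f} \<inter> homog n = (*) F ` homog (n - e)" if "n \<ge> e" for n
    using homog_cancel[OF F, of _ "n - e"] homog_mult[OF F(1), of _ "n - e"] that by (auto elim!: dvdE)
  obtain P where P: "has_hilbert_poly {f. F dvd f} P" "fact (degree P) * lead_coeff P = of_nat k"
    using deg by (auto simp: has_degree_def)
  \<comment> \<open>The difference of the values of (t + 1)(t + 2)(t + 3)/6 at t = n and t = n - e.
    For e > 0 its degree is two and its leading coefficient e/2; for e = 0 it vanishes.\<close>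
  define Q :: "rat poly" where "Q = [: (6 - (1 - of_nat e) * (2 - of_nat e) * (3 - of_nat e)) / 6,
    (11 - (11 - 12 * of_nat e + 3 * (of_nat e)^2)) / 6, of_nat e / 2:]"
  have "\<forall>\<^sub>F n in sequentially. poly P (of_nat n) = poly Q (of_nat n)"
    using P(1) eventually_ge_at_top[of e] unfolding has_hilbert_poly_def
  proof eventually_elim
    case (elim n)
    have "cvs.dim ({f. F dvd f} \<inter> homog n) = cvs.dim (homog (n - e) :: coord_ring set)"
      unfolding eq[OF elim(2)] by (rule dim_times[OF subspace_homog order_refl F(2)])
    with elim show ?case
      by (simp add: of_nat_dim_homog of_nat_diff Q_def) (simp add: field_simps power2_eq_square)
  qed
  then have "P = Q" by (rule poly_eq_of_eventually)
  with P(2) show ?thesis by (cases "e = 0") (simp_all add: Q_def fact_numeral)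
qed

text \<open>Restriction to z = 0 splits the degree n part of the ideal (z, q): the kernel is z times
  all forms of degree n - 1, the image q times the plane forms of degree n - e.\<close>

lemma dim_plane_ideal:
  assumes q: "q \<in> plane_homog e" "q \<noteq> 0" and n: "n \<ge> e" "n \<ge> 1"
  shows "cvs.dim ({f. \<rho> q dvd \<rho> f} \<inter> homog n) = cvs.dim (homog (n - 1) :: coord_ring set) + cvs.dim (plane_homog (n - e))"
proof -
  let ?V = "{f. \<rho> q dvd \<rho> f} \<inter> homog n"
  have qq: "i3 (\<rho> q) = q" "q \<in> homog e" using q by (simp_all add: plane_homog_def)
  have V: "cvs.subspace ?V"
    using subspace_homog[of n]
    by (intro cvs.subspaceI) (auto simp: cscale_eq homog_cst_mult homog_add hom_zero[OF \<rho>_hom] hom_add[OF \<rho>_hom] hom_mult[OF \<rho>_hom] intro: dvd_smult)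
  have ker: "{f\<in>?V. i3 (\<rho> f) = 0} = (*) z ` homog (n - 1)"
  proof -
    have "{f\<in>?V. i3 (\<rho> f) = 0} = {f\<in>homog (Suc (n - 1)). i3 (\<rho> f) = 0}"
      using n \<rho>_i3 hom_zero[OF \<rho>_hom] by (auto, metis dvd_0_right)
    then show ?thesis by (simp only: z_kernel)
  qed
  have im: "(\<lambda>f. i3 (\<rho> f)) ` ?V = (*) q ` plane_homog (n - e)"
  proof safe
    fix f assume f: "\<rho> q dvd \<rho> f" "f \<in> homog n"
    then obtain c where c: "\<rho> f = \<rho> q * c" by (auto elim: dvdE)
    then have eq: "i3 (\<rho> f) = q * i3 c" by (simp add: hom_mult[OF i_hom(3)] qq)
    then have "q * i3 c \<in> homog (e + (n - e))" using i3_\<rho>_homog[OF f(2)] n by simp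
    then have "i3 c \<in> homog (n - e)" by (rule homog_cancel[OF qq(2) q(2)])
    with eq show "i3 (\<rho> f) \<in> (*) q ` plane_homog (n - e)" by (auto simp: plane_homog_def)
  next
    fix f assume f: "f \<in> plane_homog (n - e)"
    have "q * f \<in> plane_homog n" using plane_homog_mult[OF q(1) f] n by simp
    then show "q * f \<in> (\<lambda>f. i3 (\<rho> f)) ` ?V"
      by (intro image_eqI[of _ _ "q * f"]) (auto simp: plane_homog_def hom_mult[OF \<rho>_hom])
  qed
  have "cvs.dim ?V = cvs.dim {f\<in>?V. i3 (\<rho> f) = 0} + cvs.dim ((\<lambda>f. i3 (\<rho> f)) ` ?V)"
    by (rule rank_nullity[OF V Int_lower2]) (rule hom_add[OF i3_\<rho>_hom] i3_\<rho>_cscale)+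
  then show ?thesis
    by (simp only: ker im dim_times[OF subspace_homog order_refl coords_nonzero(3)]
        dim_times[OF subspace_plane_homog plane_homog_sub q(2)])
qed

lemma degree_plane_curve:
  assumes q: "q \<in> plane_homog e" "q \<noteq> 0" and deg: "has_degree {f. \<rho> q dvd \<rho> f} k"
  shows "e = k"
proof -
  obtain P where P: "has_hilbert_poly {f. \<rho> q dvd \<rho> f} P" "fact (degree P) * lead_coeff P = of_nat k"
    using deg by (auto simp: has_degree_def)
  \<comment> \<open>The difference of the values of (t + 1)(t + 2)/2 at t = n and t = n - e; its
    linear coefficient is e.\<close>
  define Q :: "rat poly" where "Q = [: (3 * of_nat e - (of_nat e)^2) / 2, of_nat e:]"
  have "\<forall>\<^sub>F n in sequentially. poly P (of_nat n) = poly Q (of_nat n)"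
    using P(1) eventually_ge_at_top[of "Suc e"] unfolding has_hilbert_poly_def
  proof eventually_elim
    case (elim n)
    have n: "n = Suc (n - 1)" using elim(2) by simp
    have "of_nat (cvs.dim (homog n :: coord_ring set)) =
        (of_nat (cvs.dim (homog (n - 1) :: coord_ring set)) + of_nat (cvs.dim (plane_homog n)) :: rat)"
      using dim_homog_Suc[of "n - 1"] n by simp
    with elim have "poly P (of_nat n) = of_nat (cvs.dim (plane_homog n)) - of_nat (cvs.dim (plane_homog (n - e)))"
      using dim_plane_ideal[OF q, of n] by simp
    with elim show ?case
      by (simp add: of_nat_dim_plane_homog of_nat_diff Q_def) (simp add: field_simps power2_eq_square)
  qed
  then have "P = Q" by (rule poly_eq_of_eventually)
  with P(2) show ?thesis by (cases "e = 0") (simp_all add: Q_def)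
qed

end

section \<open>Divisors supported in a plane\<close>

text \<open>The multiplier of p may be reduced modulo q, which bounds its degree; the degree of the
  other multiplier is then forced because q has degree exactly n.\<close>

lemma bezout_degree:
  fixes p q f :: "complex poly"
  assumes pq: "coprime p q" "q \<noteq> 0" "degree p \<le> m" "degree q = n" and f: "degree f \<le> N" "m + n \<le> N"
  shows "\<exists>P Q. f = P * p + Q * q \<and> degree P \<le> N - m \<and> degree Q \<le> N - n"
proof -
  have "fst (bezout_coefficients p q) * p + snd (bezout_coefficients p q) * q = 1"
    using bezout_coefficients_fst_snd[of p q] pq(1) by simp
  then obtain u v where uv: "u * p + v * q = 1" by blast
  define P where "P = (f * u) mod q"
  have dP: "degree P \<le> N - m"
  proof (cases "degree q = 0")
    case True
    then have "P = 0" using pq(2) degree_mod_less[of q "f * u"] by (auto simp: P_def)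
    then show ?thesis by simp
  next
    case False
    then have "degree P < n" using pq(2,4) degree_mod_less[of q "f * u"] by (auto simp: P_def)
    with f show ?thesis by simp
  qed
  have "f = f * (u * p + v * q)" by (simp add: uv)
  also have "\<dots> = (f * u) * p + f * v * q" by (simp add: algebra_simps)
  also have "f * u = q * ((f * u) div q) + P" by (simp add: P_def)
  finally have "f = P * p + ((f * u) div q * p + f * v) * q" by (simp add: algebra_simps)
  then obtain Q where Q: "f = P * p + Q * q" by blast
  have "degree (Q * q) \<le> N"
  proof -
    have "Q * q = f - P * p" using Q by simp
    moreover have "degree (P * p) \<le> N" using degree_mult_le[of P p] dP pq(3) f(2) by linarith
    ultimately show ?thesis using f(1) degree_diff_le by metis
  qed
  then have "degree Q \<le> N - n"
    using pq(2,4) by (cases "Q = 0") (auto simp: degree_mult_eq)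
  with Q dP show ?thesis by blast
qed

lemma coeff_0_eq_0_E:
  fixes p :: "'a::comm_ring_1 poly"
  assumes "coeff p 0 = 0" obtains q where "p = [:0, 1:] * q"
proof -
  obtain a q where "p = pCons a q" by (rule pCons_cases)
  with assms have "p = [:0, 1:] * q" by simp
  then show ?thesis by (rule that)
qed

lemma X_power_dvd_cancel:
  fixes a b c :: "'a::idom poly"
  assumes "coeff b 0 \<noteq> 0" "[:0, 1:] ^ j * a = b * c"
  shows "\<exists>d. c = [:0, 1:] ^ j * d"
  using assms(2)
proof (induction j arbitrary: a c)
  case (Suc j)
  have "coeff (b * c) 0 = 0" unfolding Suc.prems[symmetric] by (simp add: coeff_mult_0)
  then have "coeff c 0 = 0" using assms(1) by (simp add: coeff_mult_0)
  then obtain c' where c': "c = [:0, 1:] * c'" by (rule coeff_0_eq_0_E)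
  then have "[:0, 1:] * ([:0, 1:] ^ j * a) = [:0, 1:] * (b * c')" using Suc.prems by (simp add: mult_ac)
  then have "[:0, 1:] ^ j * a = b * c'" by (metis mult_left_cancel pCons_eq_0_iff zero_neq_one)
  then obtain d where "c' = [:0, 1:] ^ j * d" using Suc.IH by blast
  with c' have "c = [:0, 1:] ^ Suc j * d" by (simp add: mult_ac)
  then show ?case by blast
qed simp

lemma hcomp_mult_homog_if:
  fixes h f :: "'v::finite mpoly"
  assumes "h \<in> homog k" shows "hcomp n (h * f) = (if k \<le> n then h * hcomp (n - k) f else 0)"
  using hcomp_mult_homog[OF assms, of "n - k" f] hcomp_mult_homog_less[OF assms, of n f] by auto

lemma saturate_mono: "I \<subseteq> J \<Longrightarrow> saturate I \<subseteq> saturate J"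
  by (auto simp: saturate_def)

lemma saturate_superset:
  assumes "ideal.subspace I" shows "I \<subseteq> saturate I"
  using ideal.subspace_scale[OF assms] by (auto simp: saturate_def)

context coords
begin

text \<open>Restriction to the point x = z = w = 0, kept as a polynomial in y. For a form of degree
  n it is the term in y^n, so its nonvanishing means that dehomogenization does not lower the
  degree.\<close>

definition \<omega> :: "coord_ring \<Rightarrow> complex poly" where
  "\<omega> f = coeff (coeff (\<rho> f) 0) 0"

lemma \<omega>_hom: "ring_hom1 \<omega>"
  unfolding \<omega>_def
  by (rule ring_hom1_comp[OF ring_hom1_coeff_0], rule ring_hom1_comp[OF ring_hom1_coeff_0 \<rho>_hom])

lemma \<omega>_simps [simp]: "\<omega> x = 0" "\<omega> y = [:0, 1:]" "\<omega> z = 0" "\<omega> w = 0" "\<omega> (cst c) = [:c:]"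
  by (simp_all add: \<omega>_def)

lemma \<omega>_homog: assumes "f \<in> homog n" shows "\<omega> f = monom (coeff (\<delta> f) n) n"
proof -
  have "\<omega> f = \<omega> (\<kappa> f)" by (simp add: \<omega>_def \<rho>_\<kappa>)
  also have "\<dots> = (\<Sum>i\<le>n. [:coeff (\<delta> f) i:] * [:0, 1:] ^ i * 0 ^ (n - i))"
    by (simp add: \<kappa>_homog(1)[OF assms] H_def hom_sum[OF \<omega>_hom] hom_mult[OF \<omega>_hom] hom_power[OF \<omega>_hom])
  also have "\<dots> = (\<Sum>i\<le>n. if i = n then [:coeff (\<delta> f) n:] * [:0, 1:] ^ n else 0)"
    by (intro sum.cong) auto
  also have "\<dots> = monom (coeff (\<delta> f) n) n" by (simp add: monom_altdef)
  finally show ?thesis .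
qed

lemma degree_\<delta>:
  assumes "f \<in> homog n" "\<omega> f \<noteq> 0" shows "degree (\<delta> f) = n" "\<delta> f \<noteq> 0"
proof -
  have "coeff (\<delta> f) n \<noteq> 0" using \<omega>_homog[OF assms(1)] assms(2) by auto
  then show "degree (\<delta> f) = n" "\<delta> f \<noteq> 0"
    using \<kappa>_homog(2)[OF assms(1)] le_degree[of "\<delta> f" n] by auto
qed

text \<open>The forms a and b have no common zero on the line x = z = 0: in the chart w = 1 by
  coprimality, at the remaining point because \<omega> b is nonzero. So a, b, x, z generate all
  forms of degree at least j + k. Bezout is applied in the chart, with degree bounds that allow
  rehomogenization.\<close>

lemma irrelevant_power:
  assumes a: "a \<in> homog j" and b: "b \<in> homog k" and cop: "coprime (\<delta> a) (\<delta> b)" "\<omega> b \<noteq> 0"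
    and f: "f \<in> homog N" "j + k \<le> N"
  obtains u1 u2 u3 u4 where "u1 \<in> homog (N - j)" "u2 \<in> homog (N - k)" "f = a * u1 + b * u2 + x * u3 + z * u4"
proof -
  obtain P Q where PQ: "\<delta> f = P * \<delta> a + Q * \<delta> b" "degree P \<le> N - j" "degree Q \<le> N - k"
    using bezout_degree[OF cop(1) degree_\<delta>(2)[OF b cop(2)] \<kappa>_homog(2)[OF a] degree_\<delta>(1)[OF b cop(2)] \<kappa>_homog(2)[OF f(1)] f(2)]
    by blast
  define u1 where "u1 = H (N - j) P"
  define u2 where "u2 = H (N - k) Q"
  have "H N (P * \<delta> a) = u1 * H j (\<delta> a)" "H N (Q * \<delta> b) = u2 * H k (\<delta> b)"
    using H_mult[OF PQ(2) \<kappa>_homog(2)[OF a]] H_mult[OF PQ(3) \<kappa>_homog(2)[OF b]] f(2)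
    by (simp_all add: u1_def u2_def)
  then have "\<kappa> f = u1 * \<kappa> a + u2 * \<kappa> b"
    using \<kappa>_homog(1)[OF f(1)] \<kappa>_homog(1)[OF a] \<kappa>_homog(1)[OF b] by (simp add: PQ(1) H_add)
  then have "\<kappa> (f - (a * u1 + b * u2)) = 0"
    by (simp add: hom_diff[OF \<kappa>_hom] hom_add[OF \<kappa>_hom] hom_mult[OF \<kappa>_hom] u1_def u2_def mult.commute)
  then obtain u3 u4 where "f - (a * u1 + b * u2) = x * u3 + z * u4" by (auto simp: \<kappa>_eq_0_iff)
  then have "f = a * u1 + b * u2 + x * u3 + z * u4" by (simp add: algebra_simps)
  then show ?thesis by (intro that[of u1 u2 u3 u4]) (simp_all add: u1_def u2_def H_homog)
qed

text \<open>In \<open>plane_ring\<close> the constant \<open>[:[:0, 1:]:]\<close> is the variable w,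
  while \<open>[:0, 1:]\<close> is the variable x.\<close>

lemma W_dvd_iff: "[:[:0, 1:]:] dvd (r :: plane_ring) \<longleftrightarrow> (\<forall>i. coeff (coeff r i) 0 = 0)"
proof -
  have "[:0, 1:] dvd p \<longleftrightarrow> coeff p 0 = 0" for p :: "complex poly poly"
    using poly_eq_0_iff_dvd[of p 0] by (simp add: poly_0_coeff_0)
  then show ?thesis by (simp add: const_poly_dvd_iff)
qed

lemma W_prime: "[:[:0, 1:]:] dvd a * b \<longleftrightarrow> [:[:0, 1:]:] dvd a \<or> [:[:0, 1:]:] dvd b" for a b :: plane_ring
proof -
  have "prime_elem ([:0, 1:] :: complex poly poly)"
  proof (rule prime_elemI)
    have d: "[:0, 1:] dvd p \<longleftrightarrow> coeff p 0 = 0" for p :: "complex poly poly"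
      using poly_eq_0_iff_dvd[of p 0] by (simp add: poly_0_coeff_0)
    show "\<not> [:0, 1:] dvd (1 :: complex poly poly)" by (simp add: d)
    show "[:0, 1:] dvd p \<or> [:0, 1:] dvd q" if "[:0, 1:] dvd p * q" for p q :: "complex poly poly"
      using that by (simp add: d coeff_mult_0)
  qed simp
  then have "prime_elem [:[:0, 1:] :: complex poly poly:]" by (simp add: prime_elem_const_poly_iff)
  then show ?thesis by (rule prime_elem_dvd_mult_iff)
qed

end

text \<open>Smoothness along the line enters through the last two assumptions: A and g have no
  common zero in the chart w = 1, and g does not vanish at the remaining point of the line. All
  multiples of z in F are collected in A, so g involves only x, y, w.\<close>

locale surface = coords +
  fixes A g F :: coord_ring and m :: nat
  assumes A: "A \<in> homog m" and g: "g \<in> plane_homog m" and F: "F = z * A + x * g"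
    and cop: "coprime (\<delta> A) (\<delta> g)" and \<omega>g: "\<omega> g \<noteq> 0"
begin

lemma F_homog: "F \<in> homog (Suc m)"
  using homog_mult[OF linear(3) A] homog_mult[OF linear(1), of g m] g
  by (auto simp: F plane_homog_def intro: homog_add)

lemma \<rho>_F: "\<rho> F = [:0, 1:] * \<rho> g"
  by (simp add: F hom_add[OF \<rho>_hom] hom_mult[OF \<rho>_hom])

text \<open>\<open>T j q\<close> is the saturated ideal of the divisor \<open>j l + C\<close> on the surface \<open>F = 0\<close>, where \<open>C\<close> is the curve
  \<open>z = q = 0\<close>; here \<open>z\<close> cuts out \<open>l + C\<close> and the residual plane curve \<open>z = B = 0\<close>, where \<open>g = q B\<close>.\<close>

primrec T :: "nat \<Rightarrow> coord_ring \<Rightarrow> coord_ring set" where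
  "T 0 = (\<lambda>q. UNIV)"
| "T (Suc j) = (\<lambda>q. {z * t + x ^ Suc j * q * a + F * b | t a b. t \<in> T j 1})"

definition splits :: "coord_ring \<Rightarrow> coord_ring \<Rightarrow> nat \<Rightarrow> bool" where
  "splits q B e \<longleftrightarrow> q \<in> plane_homog e \<and> B \<in> plane_homog (m - e) \<and> e \<le> m \<and> q * B = g"

lemma splits_1: "splits 1 g 0"
  using g by (simp add: splits_def plane_homog_def hom_one[OF \<rho>_hom])

lemma subspace_T: "ideal.subspace (T j q)"
proof (induction j arbitrary: q)
  case (Suc j)
  show ?case
  proof (rule ideal.subspaceI)
    have "0 = z * 0 + x ^ Suc j * q * 0 + F * 0" by simp
    then show "0 \<in> T (Suc j) q" unfolding T.simps using ideal.subspace_0[OF Suc] by blast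
  next
    fix f h assume "f \<in> T (Suc j) q" "h \<in> T (Suc j) q"
    then obtain t a b t' a' b' where e: "f = z * t + x ^ Suc j * q * a + F * b" "t \<in> T j 1"
      "h = z * t' + x ^ Suc j * q * a' + F * b'" "t' \<in> T j 1"
      unfolding T.simps by blast
    have "f + h = z * (t + t') + x ^ Suc j * q * (a + a') + F * (b + b')"
      unfolding e by (simp only: distrib_left add_ac)
    then show "f + h \<in> T (Suc j) q" unfolding T.simps using ideal.subspace_add[OF Suc e(2,4)] by blast
  next
    fix c f assume "f \<in> T (Suc j) q"
    then obtain t a b where e: "f = z * t + x ^ Suc j * q * a + F * b" "t \<in> T j 1" unfolding T.simps by blast
    have "c * f = z * (c * t) + x ^ Suc j * q * (c * a) + F * (c * b)"
      unfolding e by (simp only: distrib_left mult_ac)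
    then show "c * f \<in> T (Suc j) q" unfolding T.simps using ideal.subspace_scale[OF Suc e(2)] by blast
  qed
qed simp

lemma T_SucI: "t \<in> T j 1 \<Longrightarrow> f = z * t + x ^ Suc j * q * a + F * b \<Longrightarrow> f \<in> T (Suc j) q"
  unfolding T.simps by blast

lemma T_zero: "0 \<in> T j q"
  by (rule ideal.subspace_0[OF subspace_T])

lemma F_in_T: "F \<in> T j q"
  using T_SucI[OF T_zero, of F _ q 0 1] by (cases j) auto

lemma x_power_in_T: "x ^ j \<in> T j 1"
  using T_SucI[OF T_zero, of "x ^ j" _ 1 1 0] by (cases j) auto

lemma T_1: "T 1 1 = {f. \<kappa> f = 0}"
proof -
  have "f \<in> T 1 1 \<longleftrightarrow> (\<exists>a b. f = x * a + z * b)" for f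
  proof
    assume "f \<in> T 1 1"
    then obtain t a b where "f = z * t + x ^ Suc 0 * 1 * a + F * b" by (auto simp: numeral_eq_Suc)
    then have "f = x * (a + g * b) + z * (t + A * b)" by (simp add: F algebra_simps)
    then show "\<exists>a b. f = x * a + z * b" by blast
  next
    assume "\<exists>a b. f = x * a + z * b"
    then obtain a b where "f = x * a + z * b" by blast
    then show "f \<in> T 1 1" using T_SucI[of b 0 f 1 a 0] by (simp add: add.commute)
  qed
  then show ?thesis by (auto simp: \<kappa>_eq_0_iff)
qed

lemma T_homogeneous: "q \<in> homog e \<Longrightarrow> homogeneous_ideal (T j q)"
proof (induction j arbitrary: q e)
  case 0
  then show ?case by (simp add: homogeneous_ideal_iff)
next
  case (Suc j)
  have IH: "homogeneous_ideal (T j 1)" by (rule Suc.IH[OF homog_one])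
  show ?case
  proof (rule homogeneous_idealI[OF subspace_T])
    fix f n assume "f \<in> T (Suc j) q"
    then obtain t a b where e: "f = z * t + x ^ Suc j * q * a + F * b" "t \<in> T j 1" unfolding T.simps by blast
    have xq: "x ^ Suc j * q \<in> homog (Suc j * 1 + e)" by (intro homog_mult homog_power linear Suc.prems)
    have "z * hcomp (n - 1) t \<in> T (Suc j) q"
      by (rule T_SucI[OF homogeneous_ideal_hcomp[OF IH e(2), of "n - 1"], of _ _ 0 0]) simp
    then have "hcomp n (z * t) \<in> T (Suc j) q"
      using T_zero by (simp add: hcomp_mult_homog_if[OF linear(3)] del: T.simps)
    moreover have "hcomp n (x ^ Suc j * q * a) \<in> T (Suc j) q"
      unfolding hcomp_mult_homog_if[OF xq] using T_SucI[OF T_zero, of _ j q "hcomp (n - (Suc j * 1 + e)) a" 0] T_zero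
      by (simp del: T.simps power_Suc)
    moreover have "hcomp n (F * b) \<in> T (Suc j) q"
      unfolding hcomp_mult_homog_if[OF F_homog] using T_SucI[OF T_zero, of _ j q 0 "hcomp (n - Suc m) b"] T_zero
      by (simp del: T.simps power_Suc)
    ultimately show "hcomp n f \<in> T (Suc j) q"
      unfolding e(1) hcomp_add by (intro ideal.subspace_add[OF subspace_T])
  qed
qed

context
  fixes q B e assumes sp: "splits q B e"
begin

lemma spD: "q \<in> homog e" "B \<in> homog (m - e)" "i3 (\<rho> q) = q" "i3 (\<rho> B) = B" "e \<le> m" "q * B = g"
  using sp by (auto simp: splits_def plane_homog_def)

lemma \<omega>_sp: "\<omega> q \<noteq> 0" "\<omega> B \<noteq> 0"
  using \<omega>g spD(6) hom_mult[OF \<omega>_hom, of q B] by auto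

lemma \<rho>_sp: "\<rho> g = \<rho> q * \<rho> B" "coeff (\<rho> q) 0 \<noteq> 0" "coeff (\<rho> B) 0 \<noteq> 0" "\<rho> q \<noteq> 0" "q \<noteq> 0" "B \<noteq> 0"
  using \<omega>_sp hom_mult[OF \<rho>_hom, of q B] spD(6) hom_zero[OF \<omega>_hom] by (auto simp: \<omega>_def)

lemma \<rho>_T_iff: "(\<exists>h\<in>T (Suc j) q. \<rho> h = r) \<longleftrightarrow> (\<exists>a b. r = [:0, 1:] * \<rho> q * ([:0, 1:] ^ j * a + \<rho> B * b))"
proof
  assume "\<exists>h\<in>T (Suc j) q. \<rho> h = r"
  then obtain t a b where "r = \<rho> (z * t + x ^ Suc j * q * a + F * b)" unfolding T.simps by blast
  then have "r = [:0, 1:] * \<rho> q * ([:0, 1:] ^ j * \<rho> a + \<rho> B * \<rho> b)"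
    by (simp only: hom_add[OF \<rho>_hom] hom_mult[OF \<rho>_hom] hom_power[OF \<rho>_hom] \<rho>_simps \<rho>_F \<rho>_sp(1) power_Suc)
      (simp add: algebra_simps)
  then show "\<exists>a b. r = [:0, 1:] * \<rho> q * ([:0, 1:] ^ j * a + \<rho> B * b)" by blast
next
  assume "\<exists>a b. r = [:0, 1:] * \<rho> q * ([:0, 1:] ^ j * a + \<rho> B * b)"
  then obtain a b where r: "r = [:0, 1:] * \<rho> q * ([:0, 1:] ^ j * a + \<rho> B * b)" by blast
  let ?h = "z * 0 + x ^ Suc j * q * i3 a + F * i3 b"
  have "?h \<in> T (Suc j) q" by (rule T_SucI[OF T_zero refl])
  moreover have "\<rho> ?h = r"
    unfolding r by (simp only: hom_add[OF \<rho>_hom] hom_mult[OF \<rho>_hom] hom_power[OF \<rho>_hom] \<rho>_simps \<rho>_i3 \<rho>_F \<rho>_sp(1) power_Suc)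
      (simp add: algebra_simps)
  ultimately show "\<exists>h\<in>T (Suc j) q. \<rho> h = r" by blast
qed

text \<open>As divisors, (j + 1) l + C minus the part l + C that z cuts out leaves j l.
  Algebraically, a combination of x^j and B that vanishes on the plane z = 0 is a multiple of the
  obvious one, because x does not divide B there.\<close>

lemma z_times_T_iff: "z * G \<in> T (Suc j) q \<longleftrightarrow> G \<in> T j 1"
proof
  assume "G \<in> T j 1"
  then show "z * G \<in> T (Suc j) q" by (rule T_SucI[of _ _ _ _ 0 0]) simp
next
  assume "z * G \<in> T (Suc j) q"
  then obtain t a b where eq: "z * G = z * t + x ^ Suc j * q * a + F * b" and t: "t \<in> T j 1"
    unfolding T.simps by blast
  have "0 = \<rho> (z * G)" by (simp add: hom_mult[OF \<rho>_hom])
  also have "\<dots> = ([:0, 1:] * \<rho> q) * ([:0, 1:] ^ j * \<rho> a + \<rho> B * \<rho> b)"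
    unfolding eq by (simp only: hom_add[OF \<rho>_hom] hom_mult[OF \<rho>_hom] hom_power[OF \<rho>_hom] \<rho>_simps \<rho>_F \<rho>_sp(1) power_Suc)
      (simp add: algebra_simps)
  finally have p0: "([:0, 1:] * \<rho> q) * ([:0, 1:] ^ j * \<rho> a + \<rho> B * \<rho> b) = 0" by (rule sym)
  have "[:0, 1:] * \<rho> q \<noteq> 0" using \<rho>_sp(4) by simp
  with iffD1[OF mult_eq_0_iff p0] have "[:0, 1:] ^ j * \<rho> a + \<rho> B * \<rho> b = 0" by blast
  then have ab: "[:0, 1:] ^ j * (- \<rho> a) = \<rho> B * \<rho> b" by (simp add: add_eq_0_iff)
  then obtain k where k: "\<rho> b = [:0, 1:] ^ j * k" using X_power_dvd_cancel[OF \<rho>_sp(3)] by blast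
  then have "[:0, 1:] ^ j * (- \<rho> a) = [:0, 1:] ^ j * (\<rho> B * k)" using ab by (simp add: mult_ac)
  moreover have "([:0, 1:] :: plane_ring) ^ j \<noteq> 0" by simp
  ultimately have "- \<rho> a = \<rho> B * k" using mult_left_cancel by blast
  then have k': "\<rho> a = - (\<rho> B * k)" by (rule minus_equation_iff[THEN iffD1, symmetric])
  obtain a' where a': "a = i3 (\<rho> a) + z * a'" by (rule z_decomp)
  obtain b' where b': "b = i3 (\<rho> b) + z * b'" by (rule z_decomp)
  define K where "K = i3 k"
  \<comment> \<open>The plane syzygy (-Bk, x^j k), lifted to the coordinate ring. In
    \<open>z * G\<close> the terms x^(j+1) q B K then cancel, and every remaining term has the
    factor z.\<close>
  have a'': "a = - (B * K) + z * a'"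
    by (subst a') (simp add: k' K_def hom_uminus[OF i_hom(3)] hom_mult[OF i_hom(3)] spD)
  have b'': "b = x ^ j * K + z * b'"
    by (subst b') (simp add: k K_def hom_mult[OF i_hom(3)] hom_power[OF i_hom(3)] i3_coords)
  have "z * G = z * (t + x ^ j * (x * q * a') + (A * K) * x ^ j + b' * F)"
    unfolding eq a'' b'' F by (subst spD(6)[symmetric])+ (simp add: algebra_simps)
  then have G: "G = t + (x * q * a') * x ^ j + (A * K) * x ^ j + b' * F"
    using coords_nonzero(3) by (simp add: mult_ac)
  show "G \<in> T j 1"
    unfolding G by (intro ideal.subspace_add[OF subspace_T] ideal.subspace_scale[OF subspace_T] t x_power_in_T F_in_T)
qed

text \<open>The variable w divides neither x nor q, so it can only divide the last factor. That it
  is a nonzerodivisor modulo (x^j, B) rests on B not vanishing at x = w = 0, by induction on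
  j.\<close>

lemma W_regular:
  assumes "[:[:0, 1:]:] * r = [:0, 1:] * \<rho> q * ([:0, 1:] ^ j * a + \<rho> B * b)"
  shows "\<exists>a b. r = [:0, 1:] * \<rho> q * ([:0, 1:] ^ j * a + \<rho> B * b)"
proof -
  let ?W = "[:[:0, 1:]:] :: plane_ring" and ?X = "[:0, 1:] :: plane_ring"
  have B0: "coeff (coeff (\<rho> B) 0) 0 \<noteq> 0" "coeff (coeff (\<rho> q) 0) 0 \<noteq> 0" using \<omega>_sp by (simp_all add: \<omega>_def)
  have Xnz: "?X \<noteq> 0" and Wnz: "?W \<noteq> 0" by simp_all
  have "\<not> ?W dvd ?X" by (auto simp: W_dvd_iff intro!: exI[of _ 1])
  moreover have "\<not> ?W dvd \<rho> q" using B0 by (auto simp: W_dvd_iff)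
  ultimately have "\<not> ?W dvd ?X * \<rho> q" by (simp only: W_prime) blast
  moreover have "?W dvd (?X * \<rho> q) * (?X ^ j * a + \<rho> B * b)" using assms by (rule dvdI[OF sym])
  ultimately have "?W dvd ?X ^ j * a + \<rho> B * b" by (simp only: W_prime) blast
  then obtain r' where r': "?X ^ j * a + \<rho> B * b = ?W * r'" by (auto elim: dvdE)
  have "\<exists>a b. r = ?X ^ j * a + \<rho> B * b" if "?W * r = ?X ^ j * a + \<rho> B * b" for r a b
    using that
  proof (induction j arbitrary: r a b)
    case 0
    then show ?case by (intro exI[of _ r] exI[of _ 0]) simp
  next
    case (Suc j)
    have "coeff (?W * r) 0 = coeff (\<rho> B) 0 * coeff b 0" unfolding Suc.prems by (simp add: coeff_mult_0)
    moreover have "coeff (coeff (?W * r) 0) 0 = 0" by (simp add: coeff_mult_0)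
    ultimately have "coeff (coeff (\<rho> B) 0 * coeff b 0) 0 = 0" by simp
    \<comment> \<open>Since B is nonzero modulo x and w, b must be a combination of w and x. The w
      part is moved to the other side, after which one factor x cancels.\<close>
    then have "coeff (coeff b 0) 0 = 0" using B0 by (simp add: coeff_mult_0)
    then obtain c where c: "coeff b 0 = [:0, 1:] * c" by (rule coeff_0_eq_0_E)
    have "coeff (b - [:coeff b 0:]) 0 = 0" by simp
    then obtain b1 where "b - [:coeff b 0:] = ?X * b1" by (rule coeff_0_eq_0_E)
    then have "b = [:coeff b 0:] + ?X * b1" by (simp only: diff_eq_eq add.commute)
    then have b: "b = ?W * [:c:] + ?X * b1" unfolding c by simp
    have eq: "?W * (r - \<rho> B * [:c:]) = ?X * (?X ^ j * a + \<rho> B * b1)"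
      using Suc.prems unfolding b by (simp only: power_Suc ring_distribs mult_ac) (simp add: algebra_simps)
    have "coeff (?W * (r - \<rho> B * [:c:])) 0 = 0" unfolding eq by (simp add: coeff_mult_0)
    then have "coeff (r - \<rho> B * [:c:]) 0 = 0" by (simp add: coeff_mult_0)
    then obtain r2 where r2: "r - \<rho> B * [:c:] = ?X * r2" by (rule coeff_0_eq_0_E)
    then have "?X * (?W * r2) = ?X * (?X ^ j * a + \<rho> B * b1)" using eq by (simp only: mult.left_commute)
    then have "?W * r2 = ?X ^ j * a + \<rho> B * b1" using mult_left_cancel[OF Xnz] by blast
    then obtain a2 b2 where "r2 = ?X ^ j * a2 + \<rho> B * b2" using Suc.IH by blast
    then have "r = ?X ^ Suc j * a2 + \<rho> B * ([:c:] + ?X * b2)"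
      using r2 by (simp only: eq_diff_eq diff_eq_eq power_Suc ring_distribs mult_ac) (simp add: algebra_simps)
    then show ?case by blast
  qed
  from this[OF r'[symmetric]] obtain a' b' where "r' = ?X ^ j * a' + \<rho> B * b'" by blast
  moreover have "?W * r = ?W * (?X * \<rho> q * r')" using assms r' by (simp only: mult.left_commute)
  then have "r = ?X * \<rho> q * r'" using mult_left_cancel[OF Wnz] by blast
  ultimately show ?thesis by blast
qed

end

text \<open>On the plane z = 0 the claim is \<open>W_regular\<close>; the difference from a member
  of the ideal is a multiple of z, to which \<open>z_times_T_iff\<close> and the induction
  hypothesis for j apply. Saturatedness follows, since powers of w occur among the forms of each
  degree.\<close>

lemma w_regular: "splits q B e \<Longrightarrow> w * f \<in> T j q \<Longrightarrow> f \<in> T j q"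
proof (induction j arbitrary: q B e f)
  case (Suc j)
  note sp = Suc.prems(1)
  have "\<exists>h\<in>T (Suc j) q. \<rho> h = \<rho> (w * f)" using Suc.prems(2) by blast
  then obtain a b where "[:[:0, 1:]:] * \<rho> f = [:0, 1:] * \<rho> q * ([:0, 1:] ^ j * a + \<rho> B * b)"
    unfolding \<rho>_T_iff[OF sp] hom_mult[OF \<rho>_hom] \<rho>_simps by blast
  from W_regular[OF sp this] obtain h where h: "h \<in> T (Suc j) q" "\<rho> h = \<rho> f"
    unfolding \<rho>_T_iff[OF sp, symmetric] by blast
  then have "\<rho> (f - h) = 0" by (simp add: hom_diff[OF \<rho>_hom])
  then obtain G where G: "f - h = z * G" by (auto simp: \<rho>_eq_0_iff)
  have "w * f - w * h \<in> T (Suc j) q"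
    by (rule ideal.subspace_diff[OF subspace_T Suc.prems(2) ideal.subspace_scale[OF subspace_T h(1)]])
  moreover have "w * f - w * h = z * (w * G)" unfolding right_diff_distrib[symmetric] G by (rule mult.left_commute)
  ultimately have "z * (w * G) \<in> T (Suc j) q" by (simp only:)
  then have "w * G \<in> T j 1" unfolding z_times_T_iff[OF sp] .
  then have "G \<in> T j 1" by (rule Suc.IH[OF splits_1])
  then have "z * G \<in> T (Suc j) q" unfolding z_times_T_iff[OF sp] .
  then have "z * G + h \<in> T (Suc j) q" using h(1) by (rule ideal.subspace_add[OF subspace_T])
  then show ?case unfolding G[symmetric] by simp
qed simp

lemma w_power_regular: "splits q B e \<Longrightarrow> w ^ n * f \<in> T j q \<Longrightarrow> f \<in> T j q"
proof (induction n)
  case (Suc n)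
  then have "w * (w ^ n * f) \<in> T j q" by (simp add: mult.assoc)
  then show ?case using Suc w_regular by blast
qed simp

lemma saturate_T: assumes "splits q B e" shows "saturate (T j q) = T j q"
proof
  show "T j q \<subseteq> saturate (T j q)" by (rule saturate_superset[OF subspace_T])
  show "saturate (T j q) \<subseteq> T j q"
  proof
    fix f assume "f \<in> saturate (T j q)"
    then obtain n where n: "\<forall>h\<in>homog n. h * f \<in> T j q" by (auto simp: saturate_def)
    have "w ^ n \<in> homog n" using homog_power[OF linear(4), of n] by simp
    then show "f \<in> T j q" using n w_power_regular[OF assms] by blast
  qed
qed

lemma divisor_2l_subset:
  "divisor_add {f. F dvd f} {f. \<kappa> f = 0} {f. \<kappa> f = 0} \<subseteq> T 2 1"
proof -
  have "f * h \<in> T 2 1" if "\<kappa> f = 0" "\<kappa> h = 0" for f h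
  proof -
    obtain a b c d where e: "f = x * a + z * b" "h = x * c + z * d" using \<open>\<kappa> f = 0\<close> \<open>\<kappa> h = 0\<close> by (auto simp: \<kappa>_eq_0_iff)
    have "x * (a * d + b * c) + z * (b * d) \<in> T 1 1" unfolding T_1 \<kappa>_eq_0_iff mem_Collect_eq by blast
    moreover have "f * h = z * (x * (a * d + b * c) + z * (b * d)) + x ^ Suc 1 * 1 * (a * c) + F * 0"
      unfolding e by (simp add: algebra_simps)
    ultimately show ?thesis using T_SucI[of _ 1] by (metis Suc_1)
  qed
  moreover have "f \<in> T 2 1" if dv: "F dvd f" for f
  proof -
    obtain k where "f = F * k" using dv by (auto elim: dvdE)
    then show ?thesis using ideal.subspace_scale[OF subspace_T F_in_T, of k 2 1] by (simp only: mult.commute)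
  qed
  ultimately have "ideal.span ({f * g |f g. f \<in> {f. \<kappa> f = 0} \<and> g \<in> {f. \<kappa> f = 0}} \<union> {f. F dvd f}) \<subseteq> T 2 1"
    by (intro ideal.span_minimal subspace_T) blast
  from saturate_mono[OF this] show ?thesis unfolding divisor_add_def saturate_T[OF splits_1] .
qed

lemma dvd_\<rho>E:
  assumes "i3 (\<rho> q) = q" "\<rho> q dvd \<rho> f" obtains a b where "f = q * a + z * b"
proof -
  obtain c where c: "\<rho> f = \<rho> q * c" using assms(2) by (auto elim: dvdE)
  have "\<rho> (f - q * i3 c) = 0" by (simp add: hom_diff[OF \<rho>_hom] hom_mult[OF \<rho>_hom] c)
  then obtain b where "f - q * i3 c = z * b" by (auto simp: \<rho>_eq_0_iff)
  then have "f = q * i3 c + z * b" by (simp add: algebra_simps)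
  then show ?thesis by (rule that)
qed

lemma T_2_1_E:
  assumes "k \<in> T 2 1" obtains t u v where "k = z * t + x ^ 2 * u + F * v" "t \<in> T 1 1"
proof -
  have "k \<in> T (Suc (Suc 0)) 1" using assms by (simp only: numeral_2_eq_2)
  then obtain t u v where "k = z * t + x ^ Suc (Suc 0) * 1 * u + F * v" "t \<in> T (Suc 0) 1"
    by (subst (asm) T.simps(2)) blast
  then show ?thesis by (intro that[of t u v]) (simp_all only: numeral_2_eq_2 mult_1_right One_nat_def)
qed

lemma T_2_subset_T_1: "T 2 1 \<subseteq> T 1 1"
proof
  fix k assume "k \<in> T 2 1"
  then obtain t u v where "k = z * t + x ^ 2 * u + F * v" by (rule T_2_1_E)
  then have "k = x * (x * u + g * v) + z * (t + A * v)" by (simp add: F algebra_simps power2_eq_square)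
  then show "k \<in> T 1 1" unfolding T_1 \<kappa>_eq_0_iff mem_Collect_eq by blast
qed

lemma T_2_times_subset:
  assumes k: "k \<in> T 2 1" and c: "i3 (\<rho> q) = q" "\<rho> q dvd \<rho> c"
  shows "k * c \<in> T 2 q"
proof -
  obtain a b where c': "c = q * a + z * b" by (rule dvd_\<rho>E[OF c])
  obtain t u v where k': "k = z * t + x ^ 2 * u + F * v" "t \<in> T 1 1" by (rule T_2_1_E[OF k])
  have "b * k + (q * a) * t \<in> T 1 1"
    using T_2_subset_T_1 k k'(2) by (intro ideal.subspace_add[OF subspace_T] ideal.subspace_scale[OF subspace_T]) auto
  moreover have "k * c = k * (z * b) + k * (q * a)" unfolding c' by (simp only: distrib_left add.commute)
  then have "k * c = k * (z * b) + (z * t + x ^ 2 * u + F * v) * (q * a)" using k'(1) by (simp only:)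
  then have "k * c = z * (b * k + (q * a) * t) + x ^ Suc 1 * q * (u * a) + F * (v * q * a)"
    by (simp add: algebra_simps numeral_2_eq_2)
  ultimately have "k * c \<in> T (Suc 1) q" by (rule T_SucI)
  then show ?thesis by (simp only: Suc_1)
qed

text \<open>The additional factor x raises the multiplicity of the line: for t vanishing on l, the
  product \<open>x * t\<close> already lies in the ideal of 2l.\<close>

lemma T_2_times_x_subset:
  assumes k: "k \<in> T 2 1" and c: "i3 (\<rho> p) = p" "\<rho> (x * p) dvd \<rho> c"
  shows "k * c \<in> T 3 p"
proof -
  have "i3 (\<rho> (x * p)) = x * p" by (simp add: hom_mult[OF i3_\<rho>_hom] i3_coords c(1))
  from dvd_\<rho>E[OF this c(2)] obtain a b where c': "c = x * p * a + z * b" .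
  obtain t u v where k': "k = z * t + x ^ 2 * u + F * v" "t \<in> T 1 1" by (rule T_2_1_E[OF k])
  obtain t1 t2 where t: "t = x * t1 + z * t2" using k'(2) unfolding T_1 \<kappa>_eq_0_iff by blast
  have "x * t2 \<in> T 1 1" unfolding T_1 by (simp add: hom_mult[OF \<kappa>_hom])
  then have "x * t \<in> T (Suc 1) 1"
    by (rule T_SucI[of _ _ _ _ t1 0]) (simp add: t algebra_simps)
  then have "(p * a) * (x * t) \<in> T 2 1" unfolding Suc_1 by (rule ideal.subspace_scale[OF subspace_T])
  then have "b * k + (p * a) * (x * t) \<in> T 2 1"
    by (rule ideal.subspace_add[OF subspace_T ideal.subspace_scale[OF subspace_T k]])
  moreover have "k * c = k * (z * b) + k * (x * p * a)" unfolding c' by (simp only: distrib_left add.commute)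
  then have "k * c = k * (z * b) + (z * t + x ^ 2 * u + F * v) * (x * p * a)" using k'(1) by (simp only:)
  then have "k * c = z * (b * k + (p * a) * (x * t)) + x ^ Suc 2 * p * (u * a) + F * (v * x * p * a)"
    by (simp add: algebra_simps numeral_2_eq_2)
  ultimately have "k * c \<in> T (Suc 2) p" by (rule T_SucI)
  then show ?thesis by (simp only: numeral_3_eq_3 numeral_2_eq_2)
qed

lemma divisor_subset:
  assumes D: "D \<subseteq> {f. \<rho> q dvd \<rho> f}"
    and prod: "\<And>k c. k \<in> T 2 1 \<Longrightarrow> \<rho> q dvd \<rho> c \<Longrightarrow> k * c \<in> T j p" and p: "splits p B e"
  shows "divisor_add {f. F dvd f} (divisor_add {f. F dvd f} {f. \<kappa> f = 0} {f. \<kappa> f = 0}) D \<subseteq> T j p"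
proof -
  let ?K = "divisor_add {f. F dvd f} {f. \<kappa> f = 0} {f. \<kappa> f = 0}"
  have "f \<in> T j p" if dv: "F dvd f" for f
  proof -
    obtain k where "f = F * k" using dv by (auto elim: dvdE)
    then show ?thesis using ideal.subspace_scale[OF subspace_T F_in_T, of k j p] by (simp only: mult.commute)
  qed
  note Y = this
  have "{f * g |f g. f \<in> ?K \<and> g \<in> D} \<subseteq> T j p"
  proof
    fix h assume "h \<in> {f * g |f g. f \<in> ?K \<and> g \<in> D}"
    then obtain f c where h: "h = f * c" "f \<in> ?K" "c \<in> D" by blast
    have "f \<in> T 2 1" using h(2) divisor_2l_subset by (rule rev_subsetD)
    moreover have "\<rho> q dvd \<rho> c" using h(3) D by blast
    ultimately show "h \<in> T j p" unfolding h(1) by (rule prod)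
  qed
  moreover have "{f. F dvd f} \<subseteq> T j p" using Y by blast
  ultimately have "ideal.span ({f * g |f g. f \<in> ?K \<and> g \<in> D} \<union> {f. F dvd f}) \<subseteq> T j p"
    by (intro ideal.span_minimal subspace_T Un_least)
  from saturate_mono[OF this] show ?thesis
    unfolding divisor_add_def saturate_T[OF p] .
qed

text \<open>The products of the ideals contain x^2 q and F but, a priori, not xz and z^2. These two
  are multiplied into the span by x, z, q and A, hence by all forms of degree m + e, and so they lie
  in its saturation.\<close>

lemma divisor_eq_T:
  assumes sp: "splits q B e"
  shows "divisor_add {f. F dvd f} (divisor_add {f. F dvd f} {f. \<kappa> f = 0} {f. \<kappa> f = 0}) {f. \<rho> q dvd \<rho> f} = T 2 q"
    (is "divisor_add ?Y ?K ?D = _")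
proof
  note q = spD[OF sp]
  show "divisor_add ?Y ?K ?D \<subseteq> T 2 q"
    using T_2_times_subset[OF _ q(3)] by (intro divisor_subset[OF order_refl _ sp])
  let ?J = "ideal.span ({f * g |f g. f \<in> ?K \<and> g \<in> ?D} \<union> ?Y)"
  have J: "ideal.subspace ?J" by (rule ideal.subspace_span)
  have K: "f * h \<in> ?K" if "\<kappa> f = 0" "\<kappa> h = 0" for f h
  proof -
    have "f * h \<in> ideal.span ({f * g |f g. f \<in> {f. \<kappa> f = 0} \<and> g \<in> {f. \<kappa> f = 0}} \<union> ?Y)"
      using that by (intro ideal.span_base) blast
    then show ?thesis unfolding divisor_add_def using saturate_superset[OF ideal.subspace_span] by blast
  qed
  have prod: "f * h * c \<in> ?J" if "\<kappa> f = 0" "\<kappa> h = 0" "\<rho> q dvd \<rho> c" for f h c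
    using K[OF that(1,2)] that(3) by (intro ideal.span_base) blast
  have FJ: "F \<in> ?J" by (intro ideal.span_base) simp
  have xz: "\<kappa> x = 0" "\<kappa> z = 0" "\<rho> q dvd \<rho> z" "\<rho> q dvd \<rho> q" by simp_all
  \<comment> \<open>m + e is the bound of \<open>irrelevant_power\<close> for A of degree m and q of
    degree e, which have no common zero on l.\<close>
  have sat: "u * (h * z) \<in> ?J" if h: "h = x \<or> h = z" and u: "u \<in> homog (m + e)" for h u
  proof -
    have h0: "\<kappa> h = 0" using h xz by auto
    have 1: "x * (h * z) \<in> ?J" using prod[OF xz(1) h0 xz(3)] by (simp only: mult.assoc)
    have 2: "z * (h * z) \<in> ?J" using prod[OF xz(2) h0 xz(3)] by (simp only: mult.assoc)
    have 3: "q * (h * z) \<in> ?J" using prod[OF h0 xz(2,4)] by (simp only: mult_ac)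
    \<comment> \<open>The equation of the surface trades the multiplier A on z for F and the product
      x h q, both of which are available.\<close>
    have "A * (h * z) = h * F - B * (x * h * q)" unfolding F spD(6)[OF sp, symmetric] by (simp add: algebra_simps)
    moreover have "h * F - B * (x * h * q) \<in> ?J"
      by (intro ideal.subspace_diff[OF J] ideal.subspace_scale[OF J] FJ prod xz h0)
    ultimately have 4: "A * (h * z) \<in> ?J" by (simp only:)
    have cop': "coprime (\<delta> A) (\<delta> q)" using cop by (simp add: spD(6)[OF sp, symmetric] hom_mult[OF \<delta>_hom] coprime_mult_right_iff)
      obtain u1 u2 u3 u4 where u: "u = A * u1 + q * u2 + x * u3 + z * u4"
        using irrelevant_power[OF A q(1) cop' \<omega>_sp(1)[OF sp] u order_refl] by metis
      have "u * (h * z) = u1 * (A * (h * z)) + u2 * (q * (h * z)) + u3 * (x * (h * z)) + u4 * (z * (h * z))"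
        unfolding u by (simp add: algebra_simps)
      also have "\<dots> \<in> ?J" by (intro ideal.subspace_add[OF J] ideal.subspace_scale[OF J] 1 2 3 4)
      finally show ?thesis .
  qed
  show "T 2 q \<subseteq> divisor_add ?Y ?K ?D"
  proof
    fix f assume "f \<in> T 2 q"
    then have "f \<in> T (Suc (Suc 0)) q" by (simp only: numeral_2_eq_2)
    then obtain t u v where f: "f = z * t + x ^ Suc (Suc 0) * q * u + F * v" and t: "t \<in> T (Suc 0) 1"
      by (subst (asm) T.simps(2)) blast
    obtain a b where ab: "t = x * a + z * b" using t T_1 unfolding One_nat_def \<kappa>_eq_0_iff by blast
    have "h * f \<in> ?J" if h: "h \<in> homog (m + e)" for h
    proof -
      have "h * f = a * (h * (x * z)) + b * (h * (z * z)) + ((h * u) * (x * x * q) + (h * v) * F)"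
        unfolding f ab by (simp add: algebra_simps)
      also have "\<dots> \<in> ?J"
        by (rule ideal.subspace_add[OF J ideal.subspace_add[OF J
              ideal.subspace_scale[OF J sat[OF disjI1[OF refl] h]]
              ideal.subspace_scale[OF J sat[OF disjI2[OF refl] h]]]
            ideal.subspace_add[OF J ideal.subspace_scale[OF J prod[OF xz(1,1,4)]] ideal.subspace_scale[OF J FJ]]])
      finally show ?thesis .
    qed
    then show "f \<in> divisor_add ?Y ?K ?D" unfolding divisor_add_def saturate_def by blast
  qed
qed

end

section \<open>Hilbert functions of divisors supported in the plane\<close>

lemma subspace_ideal_Int_homog:
  assumes "ideal.subspace I" shows "cvs.subspace (I \<inter> homog n :: coord_ring set)"
  using ideal.subspace_0[OF assms] ideal.subspace_add[OF assms] ideal.subspace_scale[OF assms]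
  by (intro cvs.subspaceI) (auto simp: cscale_eq homog_add homog_cst_mult)

context coords
begin

text \<open>The degree k part of the ideal (x, B) of the plane. Up to the factor x q it is the
  restriction of \<open>T 2 q\<close> to z = 0.\<close>

definition plane_pencil :: "coord_ring \<Rightarrow> nat \<Rightarrow> coord_ring set" where
  "plane_pencil B k = {f\<in>plane_homog k. \<exists>a b. \<rho> f = [:0, 1:] * a + \<rho> B * b}"

lemma subspace_plane_pencil: "cvs.subspace (plane_pencil B k)"
proof (rule cvs.subspaceI)
  have "\<rho> 0 = [:0, 1:] * 0 + \<rho> B * 0" by (simp add: hom_zero[OF \<rho>_hom])
  then show "0 \<in> plane_pencil B k"
    unfolding plane_pencil_def using cvs.subspace_0[OF subspace_plane_homog] by blast
next
  fix f h assume "f \<in> plane_pencil B k" "h \<in> plane_pencil B k"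
  then obtain a b c d where e: "f \<in> plane_homog k" "\<rho> f = [:0, 1:] * a + \<rho> B * b"
    "h \<in> plane_homog k" "\<rho> h = [:0, 1:] * c + \<rho> B * d" unfolding plane_pencil_def by blast
  have "\<rho> (f + h) = [:0, 1:] * (a + c) + \<rho> B * (b + d)"
    unfolding hom_add[OF \<rho>_hom] e(2,4) by (simp only: distrib_left add_ac)
  then show "f + h \<in> plane_pencil B k"
    unfolding plane_pencil_def using cvs.subspace_add[OF subspace_plane_homog e(1,3)] by blast
next
  fix c f assume "f \<in> plane_pencil B k"
  then obtain a b where e: "f \<in> plane_homog k" "\<rho> f = [:0, 1:] * a + \<rho> B * b" unfolding plane_pencil_def by blast
  have "\<rho> (cscale c f) = [:0, 1:] * (\<rho> (cst c) * a) + \<rho> B * (\<rho> (cst c) * b)"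
    unfolding hom_cscale[OF \<rho>_hom] e(2) by (simp only: distrib_left mult.left_commute)
  then show "cscale c f \<in> plane_pencil B k"
    unfolding plane_pencil_def using cvs.subspace_scale[OF subspace_plane_homog e(1)] by blast
qed

lemma plane_pencil_sub: "plane_pencil B k \<subseteq> homog k"
  using plane_homog_sub by (auto simp: plane_pencil_def)

text \<open>Setting x = 0 leaves the multiples of B restricted to the line, a space of dimension k -
  b + 1; the kernel is x times all plane forms of degree k - 1.\<close>

lemma dim_plane_pencil:
  assumes B: "B \<in> plane_homog b" "\<omega> B \<noteq> 0" and k: "k \<ge> 1" "k \<ge> b"
  shows "cvs.dim (plane_pencil B k) = cvs.dim (plane_homog (k - 1)) + (k - b + 1)"
proof -
  have BB: "B \<in> homog b" "i3 (\<rho> B) = B" using B(1) by (simp_all add: plane_homog_def)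
  have \<kappa>B: "\<kappa> B \<noteq> 0"
  proof
    assume "\<kappa> B = 0"
    moreover have "\<omega> (\<kappa> B) = \<omega> B" by (simp add: \<omega>_def \<rho>_\<kappa>)
    ultimately show False using B(2) by (simp add: hom_zero[OF \<omega>_hom])
  qed
  have ker: "{f\<in>plane_pencil B k. \<kappa> f = 0} = (*) x ` plane_homog (k - 1)"
  proof -
    have "{f\<in>plane_pencil B k. \<kappa> f = 0} = {f\<in>plane_homog (Suc (k - 1)). \<kappa> f = 0}"
    proof (rule Collect_cong)
      fix f
      have "f \<in> plane_pencil B k \<longleftrightarrow> f \<in> plane_homog (Suc (k - 1))" if k0: "\<kappa> f = 0"
      proof -
        obtain c d where "f = x * c + z * d" using k0 by (auto simp: \<kappa>_eq_0_iff)
        then have "\<rho> f = [:0, 1:] * \<rho> c + \<rho> B * 0" by (simp add: hom_add[OF \<rho>_hom] hom_mult[OF \<rho>_hom])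
        then have "\<exists>a b. \<rho> f = [:0, 1:] * a + \<rho> B * b" by blast
        then show ?thesis using k(1) by (simp add: plane_pencil_def)
      qed
      then show "(f \<in> plane_pencil B k \<and> \<kappa> f = 0) = (f \<in> plane_homog (Suc (k - 1)) \<and> \<kappa> f = 0)" by blast
    qed
    then show ?thesis by (simp only: x_kernel)
  qed
  have im: "\<kappa> ` plane_pencil B k = (*) (\<kappa> B) ` H (k - b) ` {p. degree p \<le> k - b}"
  proof (intro subset_antisym subsetI)
    fix h assume "h \<in> \<kappa> ` plane_pencil B k"
    then obtain f c d where f: "f \<in> plane_homog k" "h = \<kappa> f" "\<rho> f = [:0, 1:] * c + \<rho> B * d"
      unfolding plane_pencil_def by blast
    have heq: "h = \<kappa> B * i2 (coeff d 0)"
      unfolding f(2) \<kappa>_def f(3) by (simp add: coeff_mult_0 hom_mult[OF i_hom(2)])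
    have i2\<kappa>: "\<kappa> (i2 p) = i2 p" for p
      using \<rho>_i3[of "[:p:]"] by (simp add: \<kappa>_def i_pCons)
    have "h \<in> homog k" unfolding f(2) using f(1) \<kappa>_homog(1)[of f k] by (simp add: plane_homog_def H_homog)
    moreover have "\<kappa> B \<in> homog b" using \<kappa>_homog(1)[OF BB(1)] by (simp add: H_homog)
    ultimately have "i2 (coeff d 0) \<in> homog (k - b)"
      using homog_cancel[OF _ \<kappa>B, of b "i2 (coeff d 0)" "k - b"] k(2) heq by simp
    from \<kappa>_homog[OF this] heq show "h \<in> (*) (\<kappa> B) ` H (k - b) ` {p. degree p \<le> k - b}"
      unfolding i2\<kappa> by blast
  next
    fix h assume "h \<in> (*) (\<kappa> B) ` H (k - b) ` {p. degree p \<le> k - b}"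
    then obtain p where h: "h = \<kappa> B * H (k - b) p" by blast
    have "B * H (k - b) p \<in> plane_homog k" using plane_homog_mult[OF B(1) H_plane_homog, of "k - b" p] k(2) by simp
    moreover have "\<rho> (B * H (k - b) p) = [:0, 1:] * 0 + \<rho> B * \<rho> (H (k - b) p)" by (simp add: hom_mult[OF \<rho>_hom])
    ultimately have "B * H (k - b) p \<in> plane_pencil B k" unfolding plane_pencil_def by blast
    moreover have "h = \<kappa> (B * H (k - b) p)" by (simp add: h hom_mult[OF \<kappa>_hom])
    ultimately show "h \<in> \<kappa> ` plane_pencil B k" by blast
  qed
  have "cvs.dim (plane_pencil B k) = cvs.dim {f\<in>plane_pencil B k. \<kappa> f = 0} + cvs.dim (\<kappa> ` plane_pencil B k)"
    by (rule rank_nullity[OF subspace_plane_pencil plane_pencil_sub hom_add[OF \<kappa>_hom] \<kappa>_cscale])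
  moreover have "H (k - b) ` {p. degree p \<le> k - b} \<subseteq> homog (k - b)" using H_homog by blast
  ultimately show ?thesis
    by (simp only: ker im dim_times[OF subspace_plane_homog plane_homog_sub coords_nonzero(1)]
        dim_times[OF subspace_H _ \<kappa>B] dim_H Suc_eq_plus1)
qed

end

context surface
begin

lemma dim_T_1: "cvs.dim (T 1 1 \<inter> homog n) + Suc n = cvs.dim (homog n :: coord_ring set)"
proof -
  have "cvs.dim (homog n :: coord_ring set) = cvs.dim {f\<in>homog n. \<kappa> f = 0} + cvs.dim (\<kappa> ` homog n)"
    by (rule rank_nullity[OF subspace_homog order_refl hom_add[OF \<kappa>_hom] \<kappa>_cscale])
  moreover have "{f\<in>homog n. \<kappa> f = 0} = T 1 1 \<inter> homog n" unfolding T_1 by blast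
  ultimately show ?thesis by (simp only: \<kappa>_H_image dim_H)
qed

lemma i3_\<rho>_hcomp: "i3 (\<rho> (hcomp n f)) = hcomp n (i3 (\<rho> f))"
proof -
  obtain N where N: "\<And>n. n \<ge> N \<Longrightarrow> hcomp n f = 0" using hcomp_eq_0 by blast
  have "hcomp n (i3 (\<rho> f)) = hcomp n (i3 (\<rho> (\<Sum>i<N. hcomp i f)))" using sum_hcomp[OF N] by simp
  also have "\<dots> = (\<Sum>i<N. hcomp n (i3 (\<rho> (hcomp i f))))" by (simp add: hom_sum[OF i3_\<rho>_hom] hcomp_sum)
  also have "\<dots> = (\<Sum>i<N. if n = i then i3 (\<rho> (hcomp i f)) else 0)"
    by (intro sum.cong refl) (simp add: hcomp_of_homog[OF i3_\<rho>_homog[OF hcomp_homog]])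
  also have "\<dots> = i3 (\<rho> (hcomp n f))"
    using N[of n] by (auto simp: not_less hom_zero[OF i3_\<rho>_hom])
  finally show ?thesis by simp
qed

context
  fixes q B e assumes sp: "splits q B e"
begin

text \<open>Rank-nullity for restriction to the plane z = 0; by \<open>z_times_T_iff\<close> the
  kernel is z times the ideal of j l.\<close>

lemma dim_T_Suc:
  assumes "n \<ge> 1"
  shows "cvs.dim (T (Suc j) q \<inter> homog n) =
    cvs.dim (T j 1 \<inter> homog (n - 1)) + cvs.dim ((\<lambda>f. i3 (\<rho> f)) ` (T (Suc j) q \<inter> homog n))"
proof -
  have ker: "{f\<in>T (Suc j) q \<inter> homog n. i3 (\<rho> f) = 0} = (*) z ` (T j 1 \<inter> homog (n - 1))"
  proof -
    have "{f\<in>T (Suc j) q \<inter> homog n. i3 (\<rho> f) = 0} = T (Suc j) q \<inter> {f\<in>homog (Suc (n - 1)). i3 (\<rho> f) = 0}"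
      using assms by auto
    also have "\<dots> = (*) z ` (T j 1 \<inter> homog (n - 1))"
      unfolding z_kernel using z_times_T_iff[OF sp, of _ j] by blast
    finally show ?thesis .
  qed
  have "cvs.dim (T (Suc j) q \<inter> homog n) = cvs.dim {f\<in>T (Suc j) q \<inter> homog n. i3 (\<rho> f) = 0} +
      cvs.dim ((\<lambda>f. i3 (\<rho> f)) ` (T (Suc j) q \<inter> homog n))"
    by (rule rank_nullity[OF subspace_ideal_Int_homog[OF subspace_T] Int_lower2]) (rule hom_add[OF i3_\<rho>_hom] i3_\<rho>_cscale)+
  then show ?thesis
    by (simp only: ker dim_times[OF subspace_ideal_Int_homog[OF subspace_T] Int_lower2 coords_nonzero(3)])
qed

lemma xq: "x * q \<in> plane_homog (Suc e)" "x * q \<noteq> 0"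
  using plane_homog_mult[OF x_plane_homog, of q e] sp coords_nonzero(1) \<rho>_sp(5)[OF sp] by (simp_all add: splits_def)

text \<open>On the plane a member becomes x q (x^(j+1) a + B b), and x^(j+1) a is in particular a
  multiple of x. For j = 0 this is an equality (\<open>T_2_image\<close>); for the triple line, j =
  1, it gives an upper bound.\<close>

lemma T_image_subset:
  assumes n: "n \<ge> Suc e"
  shows "(\<lambda>f. i3 (\<rho> f)) ` (T (Suc (Suc j)) q \<inter> homog n) \<subseteq> (*) (x * q) ` plane_pencil B (n - Suc e)"
proof
  fix h assume "h \<in> (\<lambda>f. i3 (\<rho> f)) ` (T (Suc (Suc j)) q \<inter> homog n)"
  then obtain f where f: "h = i3 (\<rho> f)" "f \<in> T (Suc (Suc j)) q" "f \<in> homog n" by blast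
  then have "\<exists>h\<in>T (Suc (Suc j)) q. \<rho> h = \<rho> f" by blast
  then obtain a b where r: "\<rho> f = [:0, 1:] * \<rho> q * ([:0, 1:] ^ Suc j * a + \<rho> B * b)"
    unfolding \<rho>_T_iff[OF sp] by blast
  define c where "c = [:0, 1:] * ([:0, 1:] ^ j * a) + \<rho> B * b"
  have r: "\<rho> f = [:0, 1:] * \<rho> q * c" unfolding r c_def by (simp only: power_Suc mult.assoc)
  have h: "h = (x * q) * i3 c" unfolding f(1) r by (simp only: hom_mult[OF i_hom(3)] i3_coords spD(3)[OF sp])
  have "(x * q) * i3 c \<in> homog (Suc e + (n - Suc e))" using i3_\<rho>_homog[OF f(3)] n by (simp flip: h f(1))
  moreover have "x * q \<in> homog (Suc e)" using xq(1) plane_homog_sub by blast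
  ultimately have "i3 c \<in> homog (n - Suc e)" using xq(2) homog_cancel by blast
  then have "i3 c \<in> plane_pencil B (n - Suc e)" unfolding plane_pencil_def plane_homog_def c_def by auto
  with h show "h \<in> (*) (x * q) ` plane_pencil B (n - Suc e)" by blast
qed

lemma T_2_image:
  assumes n: "n \<ge> Suc e"
  shows "(\<lambda>f. i3 (\<rho> f)) ` (T 2 q \<inter> homog n) = (*) (x * q) ` plane_pencil B (n - Suc e)"
proof
  show "(\<lambda>f. i3 (\<rho> f)) ` (T 2 q \<inter> homog n) \<subseteq> (*) (x * q) ` plane_pencil B (n - Suc e)"
    using T_image_subset[OF n, of 0] by (simp only: numeral_2_eq_2)
  show "(*) (x * q) ` plane_pencil B (n - Suc e) \<subseteq> (\<lambda>f. i3 (\<rho> f)) ` (T 2 q \<inter> homog n)"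
  proof
    fix h assume "h \<in> (*) (x * q) ` plane_pencil B (n - Suc e)"
    then obtain f a b where f: "h = (x * q) * f" "f \<in> plane_homog (n - Suc e)" "\<rho> f = [:0, 1:] * a + \<rho> B * b"
      unfolding plane_pencil_def by blast
    have "\<rho> h = [:0, 1:] * \<rho> q * ([:0, 1:] ^ 1 * a + \<rho> B * b)"
      unfolding f(1) hom_mult[OF \<rho>_hom] f(3) by simp
    then obtain t where t: "t \<in> T (Suc 1) q" "\<rho> t = \<rho> h" using \<rho>_T_iff[OF sp, of 1 "\<rho> h"] by blast
    have hp: "h \<in> plane_homog n" using plane_homog_mult[OF xq(1) f(2)] n by (simp add: f(1))
    have "hcomp n t \<in> T (Suc 1) q" by (rule homogeneous_ideal_hcomp[OF T_homogeneous[OF spD(1)[OF sp]] t(1)])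
    moreover have "i3 (\<rho> (hcomp n t)) = h"
      unfolding i3_\<rho>_hcomp t(2) using hp hcomp_of_homog[of h n n] by (simp add: plane_homog_def)
    ultimately show "h \<in> (\<lambda>f. i3 (\<rho> f)) ` (T 2 q \<inter> homog n)"
      unfolding Suc_1 by (intro image_eqI[of _ _ "hcomp n t"]) simp_all
  qed
qed

lemma dim_T_2:
  assumes n: "n \<ge> m + 2"
  shows "cvs.dim (T 2 q \<inter> homog n) = cvs.dim (plane_homog (n - 2 - e)) + (n - m) + cvs.dim (T 1 1 \<inter> homog (n - 1))"
proof -
  have e: "e \<le> m" by (rule spD(5)[OF sp])
  have a1: "cvs.dim (T (Suc 1) q \<inter> homog n) = cvs.dim (T 1 1 \<inter> homog (n - 1)) + cvs.dim ((\<lambda>f. i3 (\<rho> f)) ` (T (Suc 1) q \<inter> homog n))"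
    using n by (intro dim_T_Suc) simp
  have "Suc e \<le> n" using n e by simp
  then have a2: "cvs.dim ((\<lambda>f. i3 (\<rho> f)) ` (T 2 q \<inter> homog n)) = cvs.dim (plane_pencil B (n - Suc e))"
    by (simp only: T_2_image dim_times[OF subspace_plane_pencil plane_pencil_sub xq(2)])
  have a3: "cvs.dim (plane_pencil B (n - Suc e)) = cvs.dim (plane_homog (n - Suc e - 1)) + (n - Suc e - (m - e) + 1)"
    using sp n e \<omega>_sp(2)[OF sp] by (intro dim_plane_pencil) (auto simp: splits_def)
  have a4: "n - Suc e - 1 = n - 2 - e" "n - Suc e - (m - e) + 1 = n - m" using n e by linarith+
  show ?thesis using a1 unfolding Suc_1 a2 a3 a4 by (simp only: add.commute)
qed

lemma dim_T_3_le:
  assumes n: "n \<ge> m + 2"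
  shows "cvs.dim (T 3 q \<inter> homog n) \<le> cvs.dim (plane_homog (n - 2 - e)) + (n - m) + cvs.dim (T 2 1 \<inter> homog (n - 1))"
proof -
  have e: "e \<le> m" by (rule spD(5)[OF sp])
  have a1: "cvs.dim (T (Suc 2) q \<inter> homog n) = cvs.dim (T 2 1 \<inter> homog (n - 1)) + cvs.dim ((\<lambda>f. i3 (\<rho> f)) ` (T (Suc 2) q \<inter> homog n))"
    using n by (intro dim_T_Suc) simp
  have "Suc e \<le> n" using n e by simp
  have "cvs.dim ((\<lambda>f. i3 (\<rho> f)) ` (T (Suc 2) q \<inter> homog n)) \<le> cvs.dim ((*) (x * q) ` plane_pencil B (n - Suc e))"
  proof (rule dim_mono_homog)
    show "(\<lambda>f. i3 (\<rho> f)) ` (T (Suc 2) q \<inter> homog n) \<subseteq> (*) (x * q) ` plane_pencil B (n - Suc e)"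
      using T_image_subset[OF \<open>Suc e \<le> n\<close>, of 1] by (simp only: Suc_1)
    show "(*) (x * q) ` plane_pencil B (n - Suc e) \<subseteq> homog n"
    proof
      fix h assume "h \<in> (*) (x * q) ` plane_pencil B (n - Suc e)"
      then obtain f where f: "h = (x * q) * f" "f \<in> plane_homog (n - Suc e)" unfolding plane_pencil_def by blast
      have "(x * q) * f \<in> plane_homog (Suc e + (n - Suc e))" by (intro plane_homog_mult xq(1) f(2))
      moreover have "Suc e + (n - Suc e) = n" using \<open>Suc e \<le> n\<close> by simp
      ultimately have "h \<in> plane_homog n" unfolding f(1) by (simp only:)
      then show "h \<in> homog n" using plane_homog_sub by blast
    qed
  qed
  also have "\<dots> = cvs.dim (plane_pencil B (n - Suc e))"
    by (rule dim_times[OF subspace_plane_pencil plane_pencil_sub xq(2)])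
  also have "\<dots> = cvs.dim (plane_homog (n - Suc e - 1)) + (n - Suc e - (m - e) + 1)"
    using sp n e \<omega>_sp(2)[OF sp] by (intro dim_plane_pencil) (auto simp: splits_def)
  also have "n - Suc e - 1 = n - 2 - e" using n e by linarith
  also have "n - Suc e - (m - e) + 1 = n - m" using n e by linarith
  finally have le: "cvs.dim ((\<lambda>f. i3 (\<rho> f)) ` (T (Suc 2) q \<inter> homog n)) \<le> cvs.dim (plane_homog (n - 2 - e)) + (n - m)" .
  have "Suc 2 = (3::nat)" by simp
  with a1 add_left_mono[OF le, of "cvs.dim (T 2 1 \<inter> homog (n - 1))"] show ?thesis by (simp only: add.commute)
qed

text \<open>The constant terms of the Hilbert polynomials of \<open>2l + C\<close>, with \<open>C\<close> of degree \<open>e\<close>, and of a scheme containing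
  \<open>3l + C'\<close>, with \<open>C'\<close> of degree \<open>e - 1\<close>, differ by at least \<open>e + m - 1\<close>.\<close>

lemma dim_T_2_formula:
  assumes n: "n \<ge> m + 2"
  shows "2 * real (cvs.dim (T 2 q \<inter> homog n)) = (real n - 1 - real e) * (real n - real e) + 2 * (real n - real m)
    + 2 * real (cvs.dim (homog (n - 1) :: coord_ring set)) - 2 * real n"
proof -
  have e: "e \<le> m" by (rule spD(5)[OF sp])
  have "n - 2 - e + 1 = n - 1 - e" "n - 2 - e + 2 = n - e" using n e by auto
  then have "2 * cvs.dim (plane_homog (n - 2 - e)) = (n - 1 - e) * (n - e)"
    using dim_plane_homog[of "n - 2 - e"] by (simp only:)
  from arg_cong[OF this, of real] have "2 * real (cvs.dim (plane_homog (n - 2 - e))) = real (n - 1 - e) * real (n - e)" by (simp only: of_nat_mult of_nat_numeral)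
  note p = this
  have t: "real (cvs.dim (T 1 1 \<inter> homog (n - 1))) + real n = real (cvs.dim (homog (n - 1) :: coord_ring set))"
    using dim_T_1[of "n - 1"] n by simp
  have i: "real (n - 1 - e) = real n - 1 - real e" "real (n - e) = real n - real e" "real (n - m) = real n - real m" using n e by auto
  have "real (cvs.dim (T 2 q \<inter> homog n)) = real (cvs.dim (plane_homog (n - 2 - e))) + real (n - m) + real (cvs.dim (T 1 1 \<inter> homog (n - 1)))"
    using arg_cong[OF dim_T_2[OF n], of real] by (simp only: of_nat_add)
  \<comment> \<open>Products and dimensions are abstracted to variables, which leaves linear
    arithmetic.\<close>
  moreover have "2 * D = P + 2 * (a - b) + 2 * s - 2 * a"
    if "2 * p = P" "t + a = s" "D = p + (a - b) + t" for D P a b s p t :: real using that by argo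
  ultimately show ?thesis using p[unfolded i] t unfolding i by blast
qed

lemma dim_T_3_bound:
  assumes n: "n \<ge> m + 3"
  shows "2 * real (cvs.dim (T 3 q \<inter> homog n)) \<le> (real n - 1 - real e) * (real n - real e) + 2 * (real n - real m)
    + ((real n - 2) * (real n - 1) + 2 * (real n - 1 - real m)
    + 2 * real (cvs.dim (homog (n - 2) :: coord_ring set)) - 2 * (real n - 1))"
proof -
  have e: "e \<le> m" by (rule spD(5)[OF sp])
  have "n - 2 - e + 1 = n - 1 - e" "n - 2 - e + 2 = n - e" using n e by auto
  then have "2 * cvs.dim (plane_homog (n - 2 - e)) = (n - 1 - e) * (n - e)"
    using dim_plane_homog[of "n - 2 - e"] by (simp only:)
  from arg_cong[OF this, of real] have 1: "2 * real (cvs.dim (plane_homog (n - 2 - e))) = real (n - 1 - e) * real (n - e)" by (simp only: of_nat_mult of_nat_numeral)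
  have "n - 1 - 2 - 0 + 1 = n - 2" "n - 1 - 2 - 0 + 2 = n - 1" using n by auto
  then have "2 * cvs.dim (plane_homog (n - 1 - 2 - 0)) = (n - 2) * (n - 1)"
    using dim_plane_homog[of "n - 1 - 2 - 0"] by (simp only:)
  from arg_cong[OF this, of real] have 2: "2 * real (cvs.dim (plane_homog (n - 1 - 2 - 0))) = real (n - 2) * real (n - 1)" by (simp only: of_nat_mult of_nat_numeral)
  have i: "real (n - 1 - e) = real n - 1 - real e" "real (n - e) = real n - real e" "real (n - m) = real n - real m"
    "real (n - 2) = real n - 2" "real (n - 1) = real n - 1" "real (n - 1 - m) = real n - 1 - real m" "n - 1 - 1 = n - 2" using n e by auto
  have 3: "real (cvs.dim (T 1 1 \<inter> homog (n - 2))) + (real n - 1) = real (cvs.dim (homog (n - 2) :: coord_ring set))"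
    using dim_T_1[of "n - 2"] n i by simp
  have le: "m + 2 \<le> n" "m + 2 \<le> n - 1" using n by auto
  have "cvs.dim (T 2 1 \<inter> homog (n - 1)) = cvs.dim (plane_homog (n - 1 - 2 - 0)) + (n - 1 - m) + cvs.dim (T 1 1 \<inter> homog (n - 2))"
    using surface.dim_T_2[OF surface_axioms splits_1 le(2)] unfolding i(7) .
  from arg_cong[OF this, of real]
  have "real (cvs.dim (T 2 1 \<inter> homog (n - 1))) = real (cvs.dim (plane_homog (n - 1 - 2 - 0))) + (real n - 1 - real m)
    + real (cvs.dim (T 1 1 \<inter> homog (n - 2)))" unfolding i(6)[symmetric] by (simp only: of_nat_add)
  moreover have "real (cvs.dim (T 3 q \<inter> homog n)) \<le> real (cvs.dim (plane_homog (n - 2 - e))) + (real n - real m) + real (cvs.dim (T 2 1 \<inter> homog (n - 1)))"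
    unfolding i(3)[symmetric] of_nat_add[symmetric] by (rule of_nat_mono[OF dim_T_3_le[OF le(1)]])
  moreover have "2 * D \<le> P + 2 * (a - b) + (Q + 2 * c + 2 * s - 2 * k)"
    if "2 * p = P" "2 * r = Q" "t + k = s" "u = r + c + t" "D \<le> p + (a - b) + u"
    for D P a b s p t Q c k r u :: real using that by argo
  ultimately show ?thesis using 1[unfolded i] 2[unfolded i] 3 by blast
qed

end

end

section \<open>Homomorphisms of ideal sheaves\<close>

lemma basis_indexE: assumes "g \<in> basis_index" obtains e where "g \<noteq> 0" "e > 0" "g \<in> homog e"
  using assms by (auto simp: basis_index_def)

lemma Fract_in_sections:
  assumes "g \<in> homog e" "f \<in> I" "f \<in> homog (n * e)" shows "Fract f (g ^ n) \<in> sections g I"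
  using assms unfolding sections_def by blast

lemma sectionsE:
  assumes "s \<in> sections g I" "g \<in> homog e" "g \<noteq> 0"
  obtains f n where "s = Fract f (g ^ n)" "f \<in> I" "f \<in> homog (n * e)"
proof -
  from assms(1) obtain f n e' where "s = Fract f (g ^ n)" "g \<in> homog e'" "f \<in> I \<inter> homog (n * e')"
    unfolding sections_def by blast
  moreover have "e' = e" using calculation(2) assms(2,3) by (rule homog_unique)
  ultimately show ?thesis using that by blast
qed

lemma Fract_mult_cancel_power: "g \<noteq> 0 \<Longrightarrow> Fract (g ^ k * f) (g ^ k * h) = Fract f h" for g :: "'a::idom"
  by (simp add: mult_fract_cancel)

lemma Fract_diff: "g \<noteq> 0 \<Longrightarrow> Fract f (g ^ i) - Fract f' (g ^ j) = Fract (g ^ j * f - g ^ i * f') (g ^ (i + j))"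
  for g :: "'a::idom"
  by (simp add: diff_fract power_add mult.commute)

lemma Fract_sum: "g \<noteq> 0 \<Longrightarrow> Fract f (g ^ i) + Fract f' (g ^ j) = Fract (g ^ j * f + g ^ i * f') (g ^ (i + j))"
  for g :: "'a::idom"
  by (simp add: add_fract power_add mult.commute)

lemma Fract_diff_in_sections:
  assumes g: "g \<in> homog e" "g \<noteq> 0" and I: "ideal.subspace I" and f: "f \<in> homog (i * e)" "f' \<in> homog (j * e)"
    and "g ^ j * f - g ^ i * f' \<in> I"
  shows "Fract f (g ^ i) - Fract f' (g ^ j) \<in> sections g I"
proof -
  have "g ^ j * f \<in> homog (j * e + i * e)" "g ^ i * f' \<in> homog (i * e + j * e)" by (intro homog_mult homog_power g f)+
  then have "g ^ j * f - g ^ i * f' \<in> homog ((i + j) * e)" by (intro homog_diff) (simp_all add: add_mult_distrib add.commute)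
  then show ?thesis unfolding Fract_diff[OF g(2)] using assms(6) by (intro Fract_in_sections[OF g(1)])
qed

lemma sections_zero: "g \<in> homog e \<Longrightarrow> ideal.subspace I \<Longrightarrow> 0 \<in> sections g I"
  using Fract_in_sections[of g e 0 I 0] ideal.subspace_0[of I] by (simp add: Zero_fract_def)

lemma sections_diff:
  assumes g: "g \<in> homog e" "g \<noteq> 0" and I: "ideal.subspace I" and s: "s \<in> sections g I" "t \<in> sections g I"
  shows "s - t \<in> sections g I"
proof -
  obtain f i where f: "s = Fract f (g ^ i)" "f \<in> I" "f \<in> homog (i * e)" using s(1) g by (rule sectionsE)
  obtain f' j where f': "t = Fract f' (g ^ j)" "f' \<in> I" "f' \<in> homog (j * e)" using s(2) g by (rule sectionsE)
  show ?thesis unfolding f(1) f'(1)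
    by (intro Fract_diff_in_sections[OF g I f(3) f'(3)] ideal.subspace_diff[OF I] ideal.subspace_scale[OF I] f f')
qed

lemma sections_add:
  assumes g: "g \<in> homog e" "g \<noteq> 0" and I: "ideal.subspace I" and s: "s \<in> sections g I" "t \<in> sections g I"
  shows "s + t \<in> sections g I"
  using sections_diff[OF g I s(1) sections_diff[OF g I sections_zero[OF g(1) I] s(2)]] by simp

lemma sections_scale:
  assumes g: "g \<in> homog e" "g \<noteq> 0" and I: "ideal.subspace I" and r: "r \<in> regular g" and s: "s \<in> sections g I"
  shows "r * s \<in> sections g I"
proof -
  obtain p k where p: "r = Fract p (g ^ k)" "p \<in> homog (k * e)" using r g by (elim sectionsE)
  obtain f i where f: "s = Fract f (g ^ i)" "f \<in> I" "f \<in> homog (i * e)" using s g by (rule sectionsE)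
  have "r * s = Fract (p * f) (g ^ (k + i))" by (simp add: p f power_add)
  moreover have "p * f \<in> homog (k * e + i * e)" by (rule homog_mult[OF p(2) f(3)])
  then have "Fract (p * f) (g ^ (k + i)) \<in> sections g I"
    by (intro Fract_in_sections[OF g(1)] ideal.subspace_scale[OF I f(2)]) (simp add: add_mult_distrib)
  ultimately show ?thesis by simp
qed

section \<open>Cosets of sections of an ideal sheaf\<close>

lemma mem_coset_iff: "(y :: coord_field) \<in> a +o S \<longleftrightarrow> y - a \<in> S"
  unfolding elt_set_plus_def by (auto intro: bexI[of _ "y - a"])

lemma coset_eqI:
  assumes g: "g \<in> homog e" "g \<noteq> 0" and I: "ideal.subspace I" and ab: "a - b \<in> sections g I"
  shows "a +o sections g I = b +o sections g I"
proof -
  have "y - a \<in> sections g I \<longleftrightarrow> y - b \<in> sections g I" for y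
    using sections_add[OF g I _ ab, of "y - a"] sections_diff[OF g I _ ab, of "y - b"] by auto
  then show ?thesis by (auto simp: mem_coset_iff)
qed

lemma coset_add:
  assumes g: "g \<in> homog e" "g \<noteq> 0" and I: "ideal.subspace I"
  shows "(a +o sections g I) + (b +o sections g I) = (a + b) +o sections g I"
proof -
  have "y \<in> (a +o sections g I) + (b +o sections g I) \<longleftrightarrow> y - (a + b) \<in> sections g I" for y
  proof
    assume "y \<in> (a +o sections g I) + (b +o sections g I)"
    then obtain u v where "y = u + v" "u - a \<in> sections g I" "v - b \<in> sections g I"
      unfolding set_plus_def by (auto simp: mem_coset_iff)
    then show "y - (a + b) \<in> sections g I" using sections_add[OF g I, of "u - a" "v - b"] by (simp add: algebra_simps)
  next
    assume "y - (a + b) \<in> sections g I"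
    then have "(y - b) - a \<in> sections g I" "b - b \<in> sections g I"
      using sections_zero[OF g(1) I] by (simp_all add: algebra_simps)
    then show "y \<in> (a +o sections g I) + (b +o sections g I)"
      unfolding set_plus_def mem_coset_iff by (intro CollectI bexI[of _ "y - b"] bexI[of _ b]) (auto simp: mem_coset_iff)
  qed
  then show ?thesis by (intro set_eqI) (simp only: mem_coset_iff)
qed

lemma coset_scale:
  assumes g: "g \<in> homog e" "g \<noteq> 0" and I: "ideal.subspace I" and r: "r \<in> regular g"
  shows "(r *o (a +o sections g I)) + sections g I = (r * a) +o sections g I"
proof -
  have "y \<in> (r *o (a +o sections g I)) + sections g I \<longleftrightarrow> y - r * a \<in> sections g I" for y
  proof
    assume "y \<in> (r *o (a +o sections g I)) + sections g I"
    then obtain u v where y: "y = r * u + v" "u - a \<in> sections g I" "v \<in> sections g I"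
      unfolding set_plus_def elt_set_times_def mem_coset_iff by (auto simp: mem_coset_iff)
    have "y - r * a = r * (u - a) + v" unfolding y(1) by (simp add: algebra_simps)
    then show "y - r * a \<in> sections g I"
      using sections_add[OF g I sections_scale[OF g I r y(2)] y(3)] by simp
  next
    assume y: "y - r * a \<in> sections g I"
    have "a \<in> a +o sections g I" using sections_zero[OF g(1) I] by (simp add: mem_coset_iff)
    then have "r * a \<in> r *o (a +o sections g I)" unfolding elt_set_times_def by blast
    then have "r * a + (y - r * a) \<in> (r *o (a +o sections g I)) + sections g I" using y by (rule set_plus_intro)
    then show "y \<in> (r *o (a +o sections g I)) + sections g I" by simp
  qed
  then show ?thesis by (intro set_eqI) (simp only: mem_coset_iff)
qed

lemma coset_plus_sections:
  assumes g: "g \<in> homog e" "g \<noteq> 0" and I: "ideal.subspace I" and J: "ideal.subspace J" "I \<subseteq> J"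
  shows "(a +o sections g I) + sections g J = a +o sections g J"
proof -
  have IJ: "s \<in> sections g J" if "s \<in> sections g I" for s using that J(2) unfolding sections_def by blast
  have "y \<in> (a +o sections g I) + sections g J \<longleftrightarrow> y - a \<in> sections g J" for y
  proof
    assume "y \<in> (a +o sections g I) + sections g J"
    then obtain u v where "y = u + v" "u - a \<in> sections g I" "v \<in> sections g J"
      unfolding set_plus_def by (auto simp: mem_coset_iff)
    then show "y - a \<in> sections g J" using sections_add[OF g J(1) IJ, of "u - a" v] by (simp add: algebra_simps)
  next
    assume y: "y - a \<in> sections g J"
    have "a \<in> a +o sections g I" using sections_zero[OF g(1) I] by (simp add: mem_coset_iff)
    then have "a + (y - a) \<in> (a +o sections g I) + sections g J" using y by (rule set_plus_intro)
    then show "y \<in> (a +o sections g I) + sections g J" by simp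
  qed
  then show ?thesis by (intro set_eqI) (simp only: mem_coset_iff)
qed

context coords
begin

text \<open>A factor of a form is again a form, so the principal prime ideal is homogeneous. It is
  relevant because no prime divides both x and z.\<close>

lemma prime_factor_relevant:
  assumes \<pi>: "prime_elem \<pi>" "\<pi> dvd \<Theta> g" and g: "g \<in> homog e" "g \<noteq> 0"
  shows "{f. \<pi> dvd \<Theta> f} \<in> proj_points"
proof -
  let ?p = "{f. \<pi> dvd \<Theta> f}"
  have iff: "\<pi> dvd \<Theta> f \<longleftrightarrow> (\<exists>k. f = i4 \<pi> * k)" for f
  proof
    assume "\<pi> dvd \<Theta> f"
    then obtain k where "\<Theta> f = \<pi> * k" by (auto elim: dvdE)
    then have "f = i4 \<pi> * i4 k" using i4_\<Theta>[of f] by (simp add: hom_mult[OF i_hom(4)])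
    then show "\<exists>k. f = i4 \<pi> * k" by blast
  qed (auto simp: hom_mult[OF \<Theta>(1)] \<Theta>_i4)
  obtain k where k: "g = i4 \<pi> * k" using \<pi>(2) iff by blast
  then obtain n where n: "i4 \<pi> \<in> homog n" using factor_homog[of "i4 \<pi>" k e] g by auto
  have sub: "ideal.subspace ?p"
    by (rule ideal.subspaceI) (simp_all add: hom_zero[OF \<Theta>(1)] hom_add[OF \<Theta>(1)] hom_mult[OF \<Theta>(1)])
  have "homogeneous_ideal ?p"
  proof (rule homogeneous_idealI[OF sub])
    fix f i assume "f \<in> ?p"
    then obtain c where "f = i4 \<pi> * c" using iff by blast
    then have "hcomp i f = (if n \<le> i then i4 \<pi> * hcomp (i - n) c else 0)" by (simp add: hcomp_mult_homog_if[OF n])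
    then show "hcomp i f \<in> ?p" by (auto simp: hom_zero[OF \<Theta>(1)] hom_mult[OF \<Theta>(1)] \<Theta>_i4)
  qed
  moreover have "?p \<noteq> UNIV"
  proof
    assume "?p = UNIV"
    then have "\<pi> dvd \<Theta> 1" by blast
    with \<pi>(1) show False by (simp add: hom_one[OF \<Theta>(1)] prime_elem_def)
  qed
  moreover have "f \<in> ?p \<or> h \<in> ?p" if "f * h \<in> ?p" for f h
    using that \<pi>(1) by (simp add: hom_mult[OF \<Theta>(1)] prime_elem_dvd_mult_iff)
  moreover have "\<exists>i. var i \<notin> ?p"
  proof (rule ccontr)
    assume "\<not> (\<exists>i. var i \<notin> ?p)"
    then have "range var \<subseteq> ?p" by blast
    moreover have "cvs.subspace ?p"
      using sub by (intro cvs.subspaceI) (auto simp: cscale_eq ideal.subspace_0 ideal.subspace_add ideal.subspace_scale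
          hom_zero[OF \<Theta>(1)] hom_add[OF \<Theta>(1)] hom_mult[OF \<Theta>(1)])
    ultimately have "homog 1 \<subseteq> ?p" unfolding homog_1_eq_span by (intro cvs.span_minimal)
    then have xz: "\<pi> dvd [:[:0, 1:]:]" "\<pi> dvd [:0, 1:]" using linear \<Theta> by auto
    have "degree \<pi> \<le> degree ([:[:0, 1:]:] :: plane_ring poly)" using xz(1) by (rule dvd_imp_degree_le) simp
    then obtain c where c: "\<pi> = [:c:]" by (auto elim: degree_eq_zeroE)
    have "c dvd coeff ([:0, 1:] :: plane_ring poly) 1" using xz(2) unfolding c const_poly_dvd_iff by blast
    then have "c dvd 1" by simp
    then have "\<pi> dvd 1" unfolding c by (simp add: is_unit_const_poly_iff)
    with \<pi>(1) show False by (simp add: prime_elem_def)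
  qed
  ultimately show ?thesis by (auto simp: proj_points_def)
qed

text \<open>A prime factor of g that did not divide h would generate a point of
  \<open>D_plus h\<close> outside \<open>D_plus g\<close>. So every prime factor of g divides h, and
  unique factorization yields the power.\<close>

lemma D_plus_subset_imp_dvd_power:
  assumes sub: "D_plus h \<subseteq> D_plus g" and g: "g \<in> homog e" "g \<noteq> 0"
  obtains N c where "h ^ N = g * c"
proof -
  have prime: "\<pi> dvd \<Theta> h" if "prime_elem \<pi>" "\<pi> dvd \<Theta> g" for \<pi>
  proof (rule ccontr)
    assume "\<not> \<pi> dvd \<Theta> h"
    then have "{f. \<pi> dvd \<Theta> f} \<in> D_plus h" using prime_factor_relevant[OF that g] by (simp add: D_plus_def)
    with sub that(2) show False by (auto simp: D_plus_def)
  qed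
  have "\<exists>N. k dvd \<Theta> h ^ N" if "k \<noteq> 0" "k dvd \<Theta> g" for k
    using that
  proof (induction k rule: prime_divisors_induct)
    case (unit x)
    then show ?case by (intro exI[of _ 0]) simp
  next
    case (factor \<pi> x)
    then obtain N where "x dvd \<Theta> h ^ N" by (auto dest: dvd_mult_right)
    moreover have "\<pi> dvd \<Theta> h" using factor by (intro prime) (auto dest: dvd_mult_left)
    ultimately have "\<pi> * x dvd \<Theta> h ^ Suc N" by (simp add: mult_dvd_mono)
    then show ?case ..
  qed simp
  moreover have "\<Theta> g \<noteq> 0" using i4_\<Theta>[of g] g(2) by auto
  ultimately obtain N c where "\<Theta> h ^ N = \<Theta> g * c" by (metis dvd_refl dvdE)
  then have "i4 (\<Theta> (h ^ N)) = i4 (\<Theta> g * c)" by (simp add: hom_power[OF \<Theta>(1)])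
  then have "h ^ N = g * i4 c" by (simp add: i4_\<Theta> hom_mult[OF i_hom(4)])
  then show ?thesis by (rule that)
qed

text \<open>A homomorphism of sheaves is obtained from maps \<open>\<psi> g\<close> on the ideal which represent it up to the factor \<open>g ^ K g\<close>.\<close>

lemma sheaf_hom_construct:
  fixes \<psi> :: "coord_ring \<Rightarrow> coord_ring \<Rightarrow> coord_ring" and K :: "coord_ring \<Rightarrow> nat"
  assumes I: "homogeneous_ideal I" and J: "homogeneous_ideal J"
    and deg: "\<And>g e h n. g \<in> basis_index \<Longrightarrow> g \<in> homog e \<Longrightarrow> h \<in> I \<Longrightarrow> h \<in> homog n \<Longrightarrow> \<psi> g h \<in> homog (n + K g * e)"
    and add: "\<And>g h h'. g \<in> basis_index \<Longrightarrow> h \<in> I \<Longrightarrow> h' \<in> I \<Longrightarrow> \<psi> g (h + h') - (\<psi> g h + \<psi> g h') \<in> J"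
    and mult: "\<And>g p h. g \<in> basis_index \<Longrightarrow> h \<in> I \<Longrightarrow> \<psi> g (p * h) - p * \<psi> g h \<in> J"
    and compat: "\<And>g g' h. g \<in> basis_index \<Longrightarrow> g' \<in> basis_index \<Longrightarrow> h \<in> I \<Longrightarrow>
      g' ^ K g' * \<psi> g h - g ^ K g * \<psi> g' h \<in> J"
  obtains \<xi> where "\<xi> \<in> sheaf_hom I J"
    "\<And>g e h n. g \<in> basis_index \<Longrightarrow> g \<in> homog e \<Longrightarrow> h \<in> I \<Longrightarrow> h \<in> homog (n * e) \<Longrightarrow>
      \<xi> g (Fract h (g ^ n)) = Fract (\<psi> g h) (g ^ (n + K g)) +o sections g J"
proof -
  note sI = homogeneous_ideal_subspace[OF I] and sJ = homogeneous_ideal_subspace[OF J]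
  define val where "val g h n = Fract (\<psi> g h) (g ^ (n + K g)) +o sections g J" for g h n
  \<comment> \<open>A section has many representations h / g^n and the value is read off from a
    chosen one; \<open>wd\<close> shows that the coset does not depend on the choice.\<close>
  define \<xi> where "\<xi> = (\<lambda>g\<in>basis_index. \<lambda>s\<in>sections g I. (SOME V. \<exists>h n e. s = Fract h (g ^ n) \<and> g \<in> homog e \<and> h \<in> I \<and>
    h \<in> homog (n * e) \<and> V = val g h n))"
  have deg': "\<psi> g h \<in> homog ((n + K g) * e)" if "g \<in> basis_index" "g \<in> homog e" "h \<in> I" "h \<in> homog (n * e)" for g e h n
    using deg[OF that] by (simp add: add_mult_distrib)
  have wd: "val g h n = val g h' n'" if gb: "g \<in> basis_index" and ge: "g \<in> homog e" and h: "h \<in> I" "h \<in> homog (n * e)"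
    and h': "h' \<in> I" "h' \<in> homog (n' * e)" and eq: "Fract h (g ^ n) = Fract h' (g ^ n')" for g e h n h' n'
  proof -
    have g0: "g \<noteq> 0" using gb by (auto simp: basis_index_def)
    have e: "g ^ n' * h = g ^ n * h'" using eq g0 by (simp add: eq_fract mult.commute)
    have "\<psi> g (g ^ n' * h) - g ^ n' * \<psi> g h \<in> J" "\<psi> g (g ^ n * h') - g ^ n * \<psi> g h' \<in> J" by (intro mult gb h h')+
    from ideal.subspace_diff[OF sJ this(2,1)] have "g ^ n' * \<psi> g h - g ^ n * \<psi> g h' \<in> J" unfolding e by simp
    from ideal.subspace_scale[OF sJ this, of "g ^ K g"]
    have "g ^ (n' + K g) * \<psi> g h - g ^ (n + K g) * \<psi> g h' \<in> J" by (simp add: power_add algebra_simps)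
    then show ?thesis unfolding val_def
      by (intro coset_eqI[OF ge g0 sJ] Fract_diff_in_sections[OF ge g0 sJ] deg' gb ge h h')
  qed
  have val: "\<xi> g (Fract h (g ^ n)) = val g h n"
    if gb: "g \<in> basis_index" and ge: "g \<in> homog e" and h: "h \<in> I" "h \<in> homog (n * e)" for g e h n
  proof -
    have s: "Fract h (g ^ n) \<in> sections g I" by (rule Fract_in_sections[OF ge h])
    let ?P = "\<lambda>V. \<exists>h' n' e'. Fract h (g ^ n) = Fract h' (g ^ n') \<and> g \<in> homog e' \<and> h' \<in> I \<and> h' \<in> homog (n' * e') \<and> V = val g h' n'"
    have "?P (val g h n)" using ge h by blast
    then have "?P (SOME V. ?P V)" by (rule someI)
    then obtain h' n' e' where h': "Fract h (g ^ n) = Fract h' (g ^ n')" "g \<in> homog e'" "h' \<in> I" "h' \<in> homog (n' * e')"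
      "(SOME V. ?P V) = val g h' n'" by blast
    have "e' = e" using gb homog_unique[OF h'(2) ge] by (auto simp: basis_index_def)
    then have "(SOME V. ?P V) = val g h n" unfolding h'(5) using wd[OF gb ge h h'(3) _ h'(1)] h'(4) by simp
    then show ?thesis using gb s by (simp add: \<xi>_def)
  qed
  have "\<xi> \<in> sheaf_hom I J"
    unfolding sheaf_hom_def
  proof (intro CollectI conjI ballI impI)
    show "\<xi> \<in> (\<Pi>\<^sub>E g\<in>basis_index. \<Pi>\<^sub>E s\<in>sections g I. subscheme_sections g J)"
    proof (intro PiE_I)
      fix g s assume gb: "g \<in> basis_index" and s: "s \<in> sections g I"
      obtain e where e: "g \<noteq> 0" "e > 0" "g \<in> homog e" using gb by (rule basis_indexE)
      obtain h n where h: "s = Fract h (g ^ n)" "h \<in> I" "h \<in> homog (n * e)" using s e(3,1) by (rule sectionsE)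
      have "Fract (\<psi> g h) (g ^ (n + K g)) \<in> regular g" by (rule Fract_in_sections[OF e(3) UNIV_I deg'[OF gb e(3) h(2,3)]])
      then show "\<xi> g s \<in> subscheme_sections g J"
        unfolding h(1) val[OF gb e(3) h(2,3)] val_def subscheme_sections_def by blast
    qed (simp_all add: \<xi>_def)
  next
    fix g s t assume gb: "g \<in> basis_index" and s: "s \<in> sections g I" and t: "t \<in> sections g I"
    obtain e where e: "g \<noteq> 0" "e > 0" "g \<in> homog e" using gb by (rule basis_indexE)
    obtain h n where h: "s = Fract h (g ^ n)" "h \<in> I" "h \<in> homog (n * e)" using s e(3,1) by (rule sectionsE)
    obtain h' n' where h': "t = Fract h' (g ^ n')" "h' \<in> I" "h' \<in> homog (n' * e)" using t e(3,1) by (rule sectionsE)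
    have st: "s + t = Fract (g ^ n' * h + g ^ n * h') (g ^ (n + n'))" unfolding h(1) h'(1) by (rule Fract_sum[OF e(1)])
    have hh: "g ^ n' * h \<in> I" "g ^ n * h' \<in> I" by (intro ideal.subspace_scale[OF sI] h h')+
    have hd: "g ^ n' * h \<in> homog ((n + n') * e)" "g ^ n * h' \<in> homog ((n + n') * e)"
      using homog_mult[OF homog_power[OF e(3), of n'] h(3)] homog_mult[OF homog_power[OF e(3), of n] h'(3)]
      by (simp_all add: add_mult_distrib add.commute)
    have 1: "s = Fract (g ^ n' * h) (g ^ (n + n'))" "t = Fract (g ^ n * h') (g ^ (n + n'))"
      using Fract_mult_cancel_power[OF e(1), of n' h "g ^ n"] Fract_mult_cancel_power[OF e(1), of n h' "g ^ n'"]
      by (simp_all add: h(1) h'(1) power_add mult.commute)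
    have "\<xi> g (s + t) = val g (g ^ n' * h + g ^ n * h') (n + n')"
      unfolding st by (intro val[OF gb e(3)] ideal.subspace_add[OF sI] homog_add hh hd)
    also have "\<dots> = (Fract (\<psi> g (g ^ n' * h)) (g ^ (n + n' + K g)) + Fract (\<psi> g (g ^ n * h')) (g ^ (n + n' + K g))) +o sections g J"
      unfolding val_def
    proof (rule coset_eqI[OF e(3,1) sJ])
      let ?N = "n + n' + K g"
      have "Fract (\<psi> g (g ^ n' * h)) (g ^ ?N) + Fract (\<psi> g (g ^ n * h')) (g ^ ?N) = Fract (\<psi> g (g ^ n' * h) + \<psi> g (g ^ n * h')) (g ^ ?N)"
        unfolding Fract_sum[OF e(1)] power_add[of g ?N ?N] distrib_left[symmetric] using Fract_mult_cancel_power[OF e(1)] by blast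
      moreover have "Fract (\<psi> g (g ^ n' * h + g ^ n * h')) (g ^ ?N) - Fract (\<psi> g (g ^ n' * h) + \<psi> g (g ^ n * h')) (g ^ ?N) \<in> sections g J"
        unfolding right_diff_distrib[symmetric]
        by (intro Fract_diff_in_sections[OF e(3,1) sJ] deg'[OF gb e(3)] homog_add hh hd ideal.subspace_add[OF sI])
           (simp only: right_diff_distrib[symmetric], rule ideal.subspace_scale[OF sJ add[OF gb hh]])
      ultimately show "Fract (\<psi> g (g ^ n' * h + g ^ n * h')) (g ^ ?N) -
          (Fract (\<psi> g (g ^ n' * h)) (g ^ ?N) + Fract (\<psi> g (g ^ n * h')) (g ^ ?N)) \<in> sections g J" by simp
    qed
    also have "\<dots> = \<xi> g s + \<xi> g t"
      unfolding 1 val[OF gb e(3) hh(1) hd(1)] val[OF gb e(3) hh(2) hd(2)] unfolding val_def coset_add[OF e(3,1) sJ] ..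
    finally show "\<xi> g (s + t) = \<xi> g s + \<xi> g t" .
  next
    fix g r s assume gb: "g \<in> basis_index" and r: "r \<in> regular g" and s: "s \<in> sections g I"
    obtain e where e: "g \<noteq> 0" "e > 0" "g \<in> homog e" using gb by (rule basis_indexE)
    obtain h n where h: "s = Fract h (g ^ n)" "h \<in> I" "h \<in> homog (n * e)" using s e(3,1) by (rule sectionsE)
    obtain p k where p: "r = Fract p (g ^ k)" "p \<in> homog (k * e)" using r e(3,1) by (elim sectionsE)
    have rs: "r * s = Fract (p * h) (g ^ (k + n))" by (simp add: p h power_add)
    have ph: "p * h \<in> I" "p * h \<in> homog ((k + n) * e)"
      using ideal.subspace_scale[OF sI h(2)] homog_mult[OF p(2) h(3)] by (simp_all add: add_mult_distrib)
    have "\<xi> g (r * s) = val g (p * h) (k + n)" unfolding rs by (rule val[OF gb e(3) ph])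
    also have "\<dots> = (r * Fract (\<psi> g h) (g ^ (n + K g))) +o sections g J"
      unfolding val_def
    proof (rule coset_eqI[OF e(3,1) sJ])
      have eq: "r * Fract (\<psi> g h) (g ^ (n + K g)) = Fract (p * \<psi> g h) (g ^ (k + n + K g))"
        by (simp add: p power_add mult.assoc)
      have "p * \<psi> g h \<in> homog (k * e + (n + K g) * e)" by (intro homog_mult p deg'[OF gb e(3)] h)
      then have d: "p * \<psi> g h \<in> homog ((k + n + K g) * e)" by (simp add: add_mult_distrib add.assoc)
      show "Fract (\<psi> g (p * h)) (g ^ (k + n + K g)) - r * Fract (\<psi> g h) (g ^ (n + K g)) \<in> sections g J"
        unfolding eq
        by (intro Fract_diff_in_sections[OF e(3,1) sJ] deg'[OF gb e(3)] ph d)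
           (simp only: right_diff_distrib[symmetric], rule ideal.subspace_scale[OF sJ mult[OF gb h(2)]])
    qed
    also have "\<dots> = (r *o \<xi> g s) + sections g J"
      unfolding h(1) val[OF gb e(3) h(2,3)] unfolding val_def coset_scale[OF e(3,1) sJ r] ..
    finally show "\<xi> g (r * s) = (r *o \<xi> g s) + sections g J" .
  next
    fix g h s assume gb: "g \<in> basis_index" and hb: "h \<in> basis_index" and sub: "D_plus h \<subseteq> D_plus g" and s: "s \<in> sections g I"
    obtain e where e: "g \<noteq> 0" "e > 0" "g \<in> homog e" using gb by (rule basis_indexE)
    obtain e' where e': "h \<noteq> 0" "e' > 0" "h \<in> homog e'" using hb by (rule basis_indexE)
    obtain b n where b: "s = Fract b (g ^ n)" "b \<in> I" "b \<in> homog (n * e)" using s e(3,1) by (rule sectionsE)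
    \<comment> \<open>The inclusion of the open sets lets fractions with powers of g be rewritten
      with powers of h. Here c is a form of degree \<open>N * e' - e\<close>, so the degrees remain
      correct.\<close>
    obtain N c where c: "h ^ N = g * c" using D_plus_subset_imp_dvd_power[OF sub e(3,1)] .
    have hN: "h ^ N \<in> homog (N * e')" by (rule homog_power[OF e'(3)])
    have c0: "c \<noteq> 0" using c e'(1) by auto
    have Ne: "e \<le> N * e'" using homog_cancel_less[OF e(3,1), of c "N * e'"] hN c c0 by force
    then have cd: "c \<in> homog (N * e' - e)" using homog_cancel[OF e(3,1), of c "N * e' - e"] hN c by simp
    have frac: "Fract f (g ^ i) = Fract (f * c ^ i) (h ^ (N * i))" for f i
      using c0 e by (simp add: power_mult c power_mult_distrib eq_fract)
    have fd: "f * c ^ i \<in> homog ((N * i) * e')" if "f \<in> homog (i * e)" for f i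
    proof -
      have "f * c ^ i \<in> homog (i * e + i * (N * e' - e))" by (intro homog_mult homog_power that cd)
      moreover have "i * e + i * (N * e' - e) = i * (e + (N * e' - e))" by (simp only: distrib_left)
      moreover have "e + (N * e' - e) = N * e'" using Ne by simp
      moreover have "i * (N * e') = (N * i) * e'" by (simp only: mult_ac)
      ultimately show ?thesis by simp
    qed
    have sJJ: "t \<in> sections h J" if tJ: "t \<in> sections g J" for t
    proof -
      obtain f i where f: "t = Fract f (g ^ i)" "f \<in> J" "f \<in> homog (i * e)" using tJ e(3,1) by (rule sectionsE)
      show ?thesis unfolding f(1) frac
        using ideal.subspace_scale[OF sJ f(2), of "c ^ i"] by (intro Fract_in_sections[OF e'(3)] fd f) (simp add: mult.commute)
    qed
    let ?b = "b * c ^ n"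
    have bI: "?b \<in> I" using ideal.subspace_scale[OF sI b(2), of "c ^ n"] by (simp add: mult.commute)
    have hv: "\<xi> h s = val h ?b (N * n)" unfolding b(1) frac by (rule val[OF hb e'(3) bI fd[OF b(3)]])
    have gv: "\<xi> g s = val g b n" unfolding b(1) by (rule val[OF gb e(3) b(2,3)])
    have key: "Fract (\<psi> g b) (g ^ (n + K g)) - Fract (\<psi> h ?b) (h ^ (N * n + K h)) \<in> sections h J"
      unfolding frac
    proof (intro Fract_diff_in_sections[OF e'(3,1) sJ] fd deg'[OF gb e(3) b(2,3)] deg'[OF hb e'(3) bI] b(3))
      let ?G = "g ^ K g" and ?H = "h ^ K h"
      \<comment> \<open>With h^N = g c the difference splits into an instance of
        \<open>compat\<close> and an instance of \<open>mult\<close>.\<close>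
      have "h ^ (N * n + K h) * (\<psi> g b * c ^ (n + K g)) - h ^ (N * (n + K g)) * \<psi> h ?b
        = (h ^ (N * n) * c ^ (n + K g)) * (?H * \<psi> g b - ?G * \<psi> h b)
          - (h ^ (N * (n + K g))) * (\<psi> h (c ^ n * b) - c ^ n * \<psi> h b)"
        unfolding power_add distrib_left power_mult c power_mult_distrib by (simp add: algebra_simps)
      also have "\<dots> \<in> J"
        by (intro ideal.subspace_diff[OF sJ] ideal.subspace_scale[OF sJ] compat mult gb hb b(2))
      finally show "h ^ (N * n + K h) * (\<psi> g b * c ^ (n + K g)) - h ^ (N * (n + K g)) * \<psi> h ?b \<in> J" .
    qed
    show "\<xi> g s \<subseteq> \<xi> h s"
    proof
      fix t assume "t \<in> \<xi> g s"
      then have "t - Fract (\<psi> g b) (g ^ (n + K g)) \<in> sections h J" unfolding gv val_def mem_coset_iff by (rule sJJ)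
      note sections_add[OF e'(3,1) sJ this key]
      moreover have "t - a + (a - b) = t - b" for a b :: coord_field by simp
      ultimately show "t \<in> \<xi> h s" unfolding hv val_def mem_coset_iff by (simp only:)
    qed
  qed
  then show ?thesis by (rule that) (rule val[unfolded val_def])
qed

end

section \<open>First order deformations of a double line with a plane curve\<close>

text \<open>If q and B are coprime, Bezout gives A = P q + Q B, and s = 1, \<nu> = Q, \<tau> = -P/2
  solve the relation. If they have the gcd h, with q = h q1 and B = h B1, then s = 0, \<nu> = q1,
  \<tau> = B1/2 do. In either case the excluded shape of \<tau> leads to a divisibility by B or B1
  that fails because deg B \<ge> 2.\<close>

lemma nonliftable_exists:
  fixes A q B :: "complex poly"
  assumes q: "degree q = e" "e \<ge> 1" and B: "degree B = b" "b \<ge> 2" and A: "degree A \<le> e + b"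
    and cop: "coprime A (q * B)"
  obtains s \<tau> \<nu> where "degree s \<le> 1" "degree \<tau> \<le> b + 1" "degree \<nu> \<le> e + 1" "A * s = B * \<nu> - 2 * q * \<tau>"
    "\<And>c1 c2. c1 = 0 \<or> degree c1 + e \<le> 1 \<Longrightarrow> degree c2 \<le> 1 \<Longrightarrow> \<tau> \<noteq> B * c2 - A * c1"
proof -
  have nz: "q \<noteq> 0" "B \<noteq> 0" using q B by auto
  have copB: "coprime B A" using cop by (simp add: coprime_mult_right_iff coprime_commute)
  show ?thesis
  proof (cases "coprime q B")
    case True
    \<comment> \<open>All terms of the relation are forms of degree e + b + 1 on l, so P gets the
      degree bound b + 1 and Q the bound e + 1.\<close>
    obtain P Q where PQ: "A = P * q + Q * B" "degree P \<le> e + b + 1 - e" "degree Q \<le> e + b + 1 - b"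
      using bezout_degree[OF True nz(2) _ B(1), of e A "e + b + 1"] q A by auto
    define \<tau> where "\<tau> = smult (- 1 / 2) P"
    have P: "2 * q * \<tau> = - (P * q)" by (simp add: \<tau>_def mult.commute numeral_poly)
    show ?thesis
    proof (rule that[of 1 \<tau> Q])
      show "A * 1 = B * Q - 2 * q * \<tau>" unfolding P using PQ(1) by (simp add: algebra_simps)
      show "degree \<tau> \<le> b + 1" "degree Q \<le> e + 1" using PQ by (simp_all add: \<tau>_def)
      fix c1 c2 :: "complex poly" assume c: "c1 = 0 \<or> degree c1 + e \<le> 1" "degree c2 \<le> 1"
      show "\<tau> \<noteq> B * c2 - A * c1"
      proof
        assume \<tau>: "\<tau> = B * c2 - A * c1"
        have "A = Q * B - 2 * q * \<tau>" unfolding P using PQ(1) by simp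
        then have "A * (1 - 2 * q * c1) = B * (Q - 2 * q * c2)" unfolding \<tau> by (simp add: algebra_simps)
        then have "B dvd A * (1 - 2 * q * c1)" by simp
        then have dv: "B dvd 1 - 2 * q * c1" using copB by (simp add: coprime_dvd_mult_right_iff)
        have "degree (2 * q * c1) \<le> 1"
        proof (cases "c1 = 0")
          case False
          have "degree (2 * q * c1) \<le> degree q + degree c1"
            using degree_mult_le[of "smult 2 q" c1] by (simp add: numeral_poly)
          with False c(1) q show ?thesis by auto
        qed simp
        \<comment> \<open>A multiple of B of degree at most 1 vanishes; then q would be a
          unit.\<close>
        then have "degree (1 - 2 * q * c1) \<le> 1" by (intro degree_diff_le) auto
        then have "1 - 2 * q * c1 = 0" using dv dvd_imp_degree_le[OF dv] B by auto
        then have "q * (2 * c1) = 1" by (simp add: algebra_simps)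
        then have "q dvd 1" by (metis dvd_triv_left)
        then have "degree q = 0" using nz by (simp add: is_unit_iff_degree)
        with q show False by simp
      qed
    qed simp
  next
    case False
    define h where "h = gcd q B"
    have hu: "\<not> h dvd 1" using False by (simp add: h_def coprime_iff_gcd_eq_1 is_unit_gcd)
    obtain q1 where q1: "q = h * q1" unfolding h_def by (metis dvd_def gcd_dvd1)
    obtain B1 where B1: "B = h * B1" unfolding h_def by (metis dvd_def gcd_dvd2)
    have nz1: "h \<noteq> 0" "q1 \<noteq> 0" "B1 \<noteq> 0" using nz q1 B1 by auto
    have d: "degree q = degree h + degree q1" "degree B = degree h + degree B1"
      using nz1 by (simp_all add: q1 B1 degree_mult_eq)
    define \<tau> where "\<tau> = smult (1 / 2) B1"
    have half: "2 * \<tau> = B1" by (simp add: \<tau>_def numeral_poly)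
    show ?thesis
    proof (rule that[of 0 \<tau> q1])
      have "2 * q * \<tau> = q * (2 * \<tau>)" by (simp add: mult_ac)
      then show "A * 0 = B * q1 - 2 * q * \<tau>" unfolding half q1 B1 by (simp add: algebra_simps)
      show "degree \<tau> \<le> b + 1" "degree q1 \<le> e + 1" using d B q by (simp_all add: \<tau>_def)
      fix c1 c2 :: "complex poly" assume c: "c1 = 0 \<or> degree c1 + e \<le> 1" "degree c2 \<le> 1"
      show "\<tau> \<noteq> B * c2 - A * c1"
      proof
        assume "\<tau> = B * c2 - A * c1"
        then have eq: "B1 = 2 * (B * c2 - A * c1)" using half by simp
        then have "A * (2 * c1) = B1 * (2 * h * c2 - 1)" unfolding B1 by (simp add: algebra_simps)
        then have "B1 dvd A * (2 * c1)" by simp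
        moreover have "coprime B1 A" using copB unfolding B1 by simp
        ultimately have "B1 dvd 2 * c1" by (simp add: coprime_dvd_mult_right_iff)
        then have dv: "B1 dvd c1" by (simp add: numeral_poly dvd_smult_iff)
        \<comment> \<open>A nonzero c1 is constant and e = 1, so B1 is constant as well, and deg B =
          deg h \<le> deg q = 1.\<close>
        have "c1 = 0"
        proof (rule ccontr)
          assume "c1 \<noteq> 0"
          then have "degree c1 = 0" "e \<le> 1" "degree B1 \<le> degree c1" using c(1) q dvd_imp_degree_le[OF dv] by auto
          then have "degree B \<le> degree q" using d by simp
          then show False using B q \<open>e \<le> 1\<close> by simp
        qed
        then have "B1 * (h * (2 * c2)) = B1 * 1" using eq unfolding B1 by (simp add: algebra_simps)
        then have "h * (2 * c2) = 1" using nz1(3) by (simp only: mult_cancel_left) simp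
        then have "h dvd 1" by (metis dvd_triv_left)
        with hu show False ..
      qed
    qed simp
  qed
qed

lemma subspace_reduction:
  assumes I: "ideal.subspace I" shows "ideal.subspace (reduction I)"
proof (rule ideal.subspaceI)
  show "0 \<in> reduction I" using ideal.subspace_0[OF I] by (auto simp: reduction_def intro!: exI[of _ 1])
next
  fix f g assume "f \<in> reduction I" "g \<in> reduction I"
  then obtain n k where nk: "f ^ n \<in> I" "g ^ k \<in> I" by (auto simp: reduction_def)
  have "(f + g) ^ (n + k) = (\<Sum>i\<le>n + k. of_nat ((n + k) choose i) * f ^ i * g ^ (n + k - i))"
    by (rule binomial_ring)
  also have "\<dots> \<in> I"
  proof (rule ideal.subspace_sum[OF I])
    fix i assume "i \<in> {..n + k}"
    show "of_nat ((n + k) choose i) * f ^ i * g ^ (n + k - i) \<in> I"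
    proof (cases "n \<le> i")
      case True
      then have "f ^ i = f ^ (i - n) * f ^ n" by (simp flip: power_add)
      then have "of_nat ((n + k) choose i) * f ^ i * g ^ (n + k - i) =
          (of_nat ((n + k) choose i) * f ^ (i - n) * g ^ (n + k - i)) * f ^ n" by (simp only: mult_ac)
      then show ?thesis using ideal.subspace_scale[OF I nk(1)] by (simp only:)
    next
      case False
      then have "n + k - i = (n - i) + k" by simp
      then have "g ^ (n + k - i) = g ^ (n - i) * g ^ k" by (simp add: power_add)
      then have "of_nat ((n + k) choose i) * f ^ i * g ^ (n + k - i) =
          (of_nat ((n + k) choose i) * f ^ i * g ^ (n - i)) * g ^ k" by (simp only: mult_ac)
      then show ?thesis using ideal.subspace_scale[OF I nk(2)] by (simp only:)
    qed
  qed
  finally show "f + g \<in> reduction I" by (auto simp: reduction_def)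
next
  fix c f assume "f \<in> reduction I"
  then obtain n where "f ^ n \<in> I" by (auto simp: reduction_def)
  then have "(c * f) ^ n \<in> I" using ideal.subspace_scale[OF I] by (simp add: power_mult_distrib)
  then show "c * f \<in> reduction I" by (auto simp: reduction_def)
qed

lemma reduction_superset: "I \<subseteq> reduction I"
  unfolding reduction_def using power_one_right by (metis (mono_tags, lifting) mem_Collect_eq subsetI)

text \<open>For d > n the truncated difference would admit constants; there the coefficient is
  forced to be zero.\<close>

definition vanishes_or_homog :: "nat \<Rightarrow> nat \<Rightarrow> coord_ring \<Rightarrow> bool" where
  "vanishes_or_homog n d h \<longleftrightarrow> h = 0 \<or> d \<le> n \<and> h \<in> homog (n - d)"

lemma vanishes_or_homog_mult:
  assumes "vanishes_or_homog n d h" "f \<in> homog (d + k)" shows "f * h \<in> homog (n + k)"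
proof (cases "h = 0")
  case False
  then have h: "h \<in> homog (n - d)" "d \<le> n" using assms(1) by (auto simp: vanishes_or_homog_def)
  have "(d + k) + (n - d) = n + k" using h(2) by simp
  with homog_mult[OF assms(2) h(1)] show ?thesis by (simp only:)
qed simp

section \<open>The deformation attached to s, \<tau>, \<nu>\<close>

context surface
begin

context
  fixes q B e assumes sp: "splits q B e"
begin

lemma T_2_I: "f = z * z * h1 + x * z * h2 + x * x * q * h3 + F * h4 \<Longrightarrow> f \<in> T 2 q"
proof -
  assume f: "f = z * z * h1 + x * z * h2 + x * x * q * h3 + F * h4"
  have "x * h2 + z * h1 \<in> T 1 1" unfolding T_1 \<kappa>_eq_0_iff by blast
  moreover have "f = z * (x * h2 + z * h1) + x ^ Suc 1 * q * h3 + F * h4"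
    unfolding f by (simp add: algebra_simps)
  ultimately have "f \<in> T (Suc 1) q" by (rule T_SucI)
  then show ?thesis by (simp only: Suc_1)
qed

lemma T_2_E:
  assumes "f \<in> T 2 q" obtains h1 h2 h3 h4 where "f = z * z * h1 + x * z * h2 + x * x * q * h3 + F * h4"
proof -
  have "f \<in> T (Suc (Suc 0)) q" using assms by (simp only: numeral_2_eq_2)
  then obtain t u v where f: "f = z * t + x ^ Suc (Suc 0) * q * u + F * v" "t \<in> T (Suc 0) 1"
    by (subst (asm) T.simps(2)) blast
  obtain a b where "t = x * a + z * b" using f(2) T_1 unfolding One_nat_def \<kappa>_eq_0_iff by blast
  then have "f = z * z * b + x * z * a + x * x * q * u + F * v" unfolding f(1) by (simp add: algebra_simps)
  then show ?thesis by (rule that)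
qed

text \<open>Coefficients in the four generators are needed for every element of the ideal, but for a
  form they must be forms of matching degrees, so that the map built from them respects the
  grading.\<close>

definition dec_ok :: "coord_ring \<Rightarrow> coord_ring \<times> coord_ring \<times> coord_ring \<times> coord_ring \<Rightarrow> bool" where
  "dec_ok h = (\<lambda>(h1, h2, h3, h4). h = z * z * h1 + x * z * h2 + x * x * q * h3 + F * h4 \<and>
     (\<forall>n. h \<in> homog n \<longrightarrow> vanishes_or_homog n 2 h1 \<and> vanishes_or_homog n 2 h2 \<and>
        vanishes_or_homog n (2 + e) h3 \<and> vanishes_or_homog n (Suc m) h4))"

lemma dec_exists:
  assumes "h \<in> T 2 q" shows "\<exists>d. dec_ok h d"
proof -
  obtain h1 h2 h3 h4 where h: "h = z * z * h1 + x * z * h2 + x * x * q * h3 + F * h4"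
    using assms by (rule T_2_E)
  consider "h = 0" | "h \<noteq> 0" "\<exists>n. h \<in> homog n" | "\<not> (\<exists>n. h \<in> homog n)" by blast
  then show ?thesis
  proof cases
    \<comment> \<open>Zero is a form of every degree, including 0 and 1, so only zero coefficients
      satisfy all the conditions at once.\<close>
    case 1
    then show ?thesis by (intro exI[of _ "(0, 0, 0, 0)"]) (simp add: dec_ok_def vanishes_or_homog_def)
  next
    case 2
    then obtain n where n: "h \<in> homog n" by blast
    define c where "c d f = (if d \<le> n then hcomp (n - d) f else 0)" for d and f :: coord_ring
    have hc: "hcomp n (g * f) = g * c d f" if "g \<in> homog d" for g f :: coord_ring and d
      by (simp add: hcomp_mult_homog_if[OF that] c_def)
    have hd: "z * z \<in> homog 2" "x * z \<in> homog 2" "x * x * q \<in> homog (2 + e)"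
      using homog_mult[OF linear(3,3)] homog_mult[OF linear(1,3)] homog_mult[OF homog_mult[OF linear(1,1)] spD(1)[OF sp]]
      by (simp_all add: numeral_2_eq_2)
    have "h = hcomp n h" using hcomp_of_homog[OF n] by simp
    also have "\<dots> = z * z * c 2 h1 + x * z * c 2 h2 + x * x * q * c (2 + e) h3 + F * c (Suc m) h4"
      by (subst h) (simp only: hcomp_add hc[OF hd(1)] hc[OF hd(2)] hc[OF hd(3)] hc[OF F_homog])
    finally have "h = z * z * c 2 h1 + x * z * c 2 h2 + x * x * q * c (2 + e) h3 + F * c (Suc m) h4" .
    moreover have "vanishes_or_homog n d (c d f)" for d f by (simp add: vanishes_or_homog_def c_def)
    moreover have "k = n" if "h \<in> homog k" for k using homog_unique[OF that n 2(1)] .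
    ultimately show ?thesis
      by (intro exI[of _ "(c 2 h1, c 2 h2, c (2 + e) h3, c (Suc m) h4)"]) (auto simp: dec_ok_def)
  next
    case 3
    with h show ?thesis by (intro exI[of _ "(h1, h2, h3, h4)"]) (auto simp: dec_ok_def)
  qed
qed

text \<open>Multiplication by \<open>\<theta> / u\<close> represents the generator \<open>t\<close> of the kernel of \<open>\<O>\<^sub>C \<rightarrow> \<O>\<^sub>E\<close>, for which
  \<open>z = B t\<close> and \<open>x q = - A t\<close>; it is a regular section only away from the common zeros of \<open>A\<close> and \<open>B\<close> on \<open>l\<close>,
  of which there are none.\<close>

definition rep :: "coord_ring \<Rightarrow> coord_ring \<Rightarrow> bool" where
  "rep u \<theta> \<longleftrightarrow> B * \<theta> - z * u \<in> T 2 q \<and> A * \<theta> + x * q * u \<in> T 2 q \<and> x * \<theta> \<in> T 2 q \<and> z * \<theta> \<in> T 2 q \<and> [:0, 1:] * \<rho> q dvd \<rho> \<theta>"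

lemma F_eq: "F = z * A + x * q * B"
  unfolding F spD(6)[OF sp, symmetric] by (simp add: mult.assoc)

lemma repI:
  assumes u: "u = A * u1 + B * u2 + x * u3 + z * u4" and \<theta>: "\<theta> = z * u2 - x * q * u1"
  shows "rep u \<theta>"
proof -
  have 1: "B * \<theta> - z * u = z * z * (- u4) + x * z * (- u3) + x * x * q * 0 + F * (- u1)"
    unfolding u \<theta> F_eq by (simp add: algebra_simps)
  have 2: "A * \<theta> + x * q * u = z * z * 0 + x * z * (q * u4) + x * x * q * u3 + F * u2"
    unfolding u \<theta> F_eq by (simp add: algebra_simps)
  have 3: "x * \<theta> = z * z * 0 + x * z * u2 + x * x * q * (- u1) + F * 0" unfolding \<theta> by (simp add: algebra_simps)
  have 4: "z * \<theta> = z * z * u2 + x * z * (- q * u1) + x * x * q * 0 + F * 0" unfolding \<theta> by (simp add: algebra_simps)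
  have r: "\<rho> \<theta> = [:0, 1:] * \<rho> q * - \<rho> u1"
    unfolding \<theta> by (simp add: hom_diff[OF \<rho>_hom] hom_mult[OF \<rho>_hom])
  show ?thesis
    unfolding rep_def
    by (intro conjI dvdI[OF r] T_2_I[OF 1] T_2_I[OF 2] T_2_I[OF 3] T_2_I[OF 4])
qed

text \<open>The exponent 2m brings the degree of the power to at least m + (m - e), as
  \<open>irrelevant_power\<close> for A and B requires. The generator t has degree 1 + e - m, which
  gives the degree of \<theta>.\<close>

lemma rep_exists:
  assumes c: "c \<in> basis_index" shows "\<exists>\<theta>. rep (c ^ (2 * m)) \<theta> \<and> (\<forall>d. c \<in> homog d \<longrightarrow> \<theta> \<in> homog (2 * m * d + 1 + e - m))"
proof -
  obtain d where d: "c \<noteq> 0" "d > 0" "c \<in> homog d" using c by (rule basis_indexE)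
  have e: "e \<le> m" by (rule spD(5)[OF sp])
  have cop': "coprime (\<delta> A) (\<delta> B)" using cop unfolding spD(6)[OF sp, symmetric] by (simp add: hom_mult[OF \<delta>_hom] coprime_mult_right_iff)
  have "m + (m - e) \<le> 2 * m * d" using d(2) by (cases d) (auto simp: algebra_simps)
  from irrelevant_power[OF A spD(2)[OF sp] cop' \<omega>_sp(2)[OF sp] homog_power[OF d(3)] this]
  obtain u1 u2 u3 u4 where u: "u1 \<in> homog (2 * m * d - m)" "u2 \<in> homog (2 * m * d - (m - e))"
    "c ^ (2 * m) = A * u1 + B * u2 + x * u3 + z * u4" .
  have le: "m \<le> 2 * m * d" using d(2) by (cases d) (auto simp: algebra_simps)
  have "z * u2 \<in> homog (1 + (2 * m * d - (m - e)))" by (rule homog_mult[OF linear(3) u(2)])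
  moreover have "1 + (N - (m - e)) = N + 1 + e - m" if "m \<le> N" for N using that e by simp
  note this[OF le]
  moreover have "x * q * u1 \<in> homog (1 + e + (2 * m * d - m))" by (intro homog_mult linear spD(1)[OF sp] u)
  moreover have "1 + e + (N - m) = N + 1 + e - m" if "m \<le> N" for N using that by simp
  note this[OF le]
  ultimately have "z * u2 - x * q * u1 \<in> homog (2 * m * d + 1 + e - m)" by (metis homog_diff)
  moreover have "d' = d" if "c \<in> homog d'" for d' using homog_unique[OF that d(3,1)] .
  ultimately show ?thesis using repI[OF u(3) refl] by blast
qed

text \<open>The prescribed values of the generators, multiplied by u, satisfy every relation between
  the generators; this makes the deformation well defined.\<close>

lemma syzygy:
  assumes rep: "rep u \<theta>" and rel: "\<kappa> (B * \<nu> - 2 * q * \<tau> - A * s) = 0"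
    and h: "z * z * h1 + x * z * h2 + x * x * q * h3 + F * h4 = 0"
  shows "u * z * s * h1 + \<theta> * \<tau> * h2 + u * x * \<nu> * h3 + u * (B * \<nu> - q * \<tau>) * h4 \<in> T 2 q"
proof -
  \<comment> \<open>Restriction to z = 0 kills the first two generators and leaves a relation
    between x and B, which comes from the obvious one because x does not divide B.\<close>
  have "([:0, 1:] * \<rho> q) * ([:0, 1:] * \<rho> h3 + \<rho> B * \<rho> h4) = \<rho> (z * z * h1 + x * z * h2 + x * x * q * h3 + F * h4)"
    by (simp only: hom_add[OF \<rho>_hom] hom_mult[OF \<rho>_hom] \<rho>_simps \<rho>_F \<rho>_sp(1)[OF sp]) (simp add: algebra_simps)
  then have p0: "([:0, 1:] * \<rho> q) * ([:0, 1:] * \<rho> h3 + \<rho> B * \<rho> h4) = 0" unfolding h by (simp only: hom_zero[OF \<rho>_hom])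
  have "[:0, 1:] * \<rho> q \<noteq> 0" using \<rho>_sp(4)[OF sp] by simp
  with iffD1[OF mult_eq_0_iff p0] have "[:0, 1:] * \<rho> h3 + \<rho> B * \<rho> h4 = 0" by blast
  then have ab: "[:0, 1:] ^ 1 * (- \<rho> h3) = \<rho> B * \<rho> h4" by (simp add: add_eq_0_iff)
  then obtain k where k: "\<rho> h4 = [:0, 1:] ^ 1 * k" using X_power_dvd_cancel[OF \<rho>_sp(3)[OF sp]] by blast
  then have "[:0, 1:] * (- \<rho> h3) = [:0, 1:] * (\<rho> B * k)" using ab by (simp only: power_one_right mult.left_commute)
  moreover have "([:0, 1:] :: plane_ring) \<noteq> 0" by simp
  ultimately have "- \<rho> h3 = \<rho> B * k" using mult_left_cancel by blast
  then have k': "\<rho> h3 = - (\<rho> B * k)" by (rule minus_equation_iff[THEN iffD1, symmetric])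
  obtain k3 where k3: "h3 = i3 (\<rho> h3) + z * k3" by (rule z_decomp)
  obtain k4 where k4: "h4 = i3 (\<rho> h4) + z * k4" by (rule z_decomp)
  define K where "K = i3 k"
  have h3: "h3 = - (B * K) + z * k3"
    by (subst k3) (simp add: k' K_def hom_uminus[OF i_hom(3)] hom_mult[OF i_hom(3)] spD[OF sp])
  have h4: "h4 = x * K + z * k4"
    by (subst k4) (simp only: k K_def hom_mult[OF i_hom(3)] power_one_right i3_coords)
  have "z * (z * (h1 + A * k4) + x * (h2 + x * q * k3 + A * K + q * B * k4)) = 0"
    using h unfolding h3 h4 F_eq by (simp add: algebra_simps)
  then have 1: "z * (h1 + A * k4) + x * (h2 + x * q * k3 + A * K + q * B * k4) = 0"
    using coords_nonzero(3) by simp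
  have "\<rho> (z * (h1 + A * k4) + x * (h2 + x * q * k3 + A * K + q * B * k4)) = [:0, 1:] * \<rho> (h2 + x * q * k3 + A * K + q * B * k4)"
    by (simp only: hom_add[OF \<rho>_hom, of "z * _"] hom_mult[OF \<rho>_hom, of z] hom_mult[OF \<rho>_hom, of x] \<rho>_simps) simp
  then have "[:0, 1:] * \<rho> (h2 + x * q * k3 + A * K + q * B * k4) = 0" unfolding 1 hom_zero[OF \<rho>_hom] by (rule sym)
  then have "\<rho> (h2 + x * q * k3 + A * K + q * B * k4) = 0" by simp
  then obtain j where j: "h2 + x * q * k3 + A * K + q * B * k4 = z * j" unfolding \<rho>_eq_0_iff by blast
  have "z * (h1 + A * k4 + x * j) = 0" using 1 unfolding j by (simp add: algebra_simps)
  then have s0: "h1 + A * k4 + x * j = 0" using coords_nonzero(3) by (simp only: mult_eq_0_iff) simp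
  have "h1 = (h1 + A * k4 + x * j) - x * j - A * k4" by simp
  then have h1: "h1 = - (x * j) - A * k4" unfolding s0 by simp
  have h2: "h2 = z * j - (x * q * k3 + A * K + q * B * k4)" using j by (simp add: algebra_simps)
  obtain c d where cd: "B * \<nu> - 2 * q * \<tau> - A * s = x * c + z * d" using rel unfolding \<kappa>_eq_0_iff by blast
  have R: "B * \<theta> - z * u \<in> T 2 q" "A * \<theta> + x * q * u \<in> T 2 q" "x * \<theta> \<in> T 2 q" "z * \<theta> \<in> T 2 q"
    using rep by (auto simp: rep_def)
  have xz: "x * z \<in> T 2 q" "z * z \<in> T 2 q" by (rule T_2_I[of _ 0 1 0 0], simp, rule T_2_I[of _ 1 0 0 0], simp)
  \<comment> \<open>\<open>j\<close>, \<open>k3\<close>, \<open>K\<close>, \<open>k4\<close> are the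
    coefficients of the basic syzygies x z^2 = z xz, z x^2q = xq xz, xF = A xz + B x^2q and zF = A
    z^2 + qB xz. Only the last one needs \<open>rel\<close>: z times an element of the ideal of l
    lies in the ideal of C.\<close>
  have "u * z * s * h1 + \<theta> * \<tau> * h2 + u * x * \<nu> * h3 + u * (B * \<nu> - q * \<tau>) * h4
    = (j * \<tau>) * (z * \<theta>) + (- (j * u * s)) * (x * z) + ((k3 * u * \<nu>) * (x * z) + (- (k3 * q * \<tau>)) * (x * \<theta>))
      + ((- (K * \<tau>)) * (A * \<theta> + x * q * u)) + ((- (k4 * q * \<tau>)) * (B * \<theta> - z * u) + (k4 * u) * (z * (B * \<nu> - 2 * q * \<tau> - A * s)))"
    unfolding h1 h2 h3 h4 by (simp add: algebra_simps)
  also have "z * (B * \<nu> - 2 * q * \<tau> - A * s) = c * (x * z) + d * (z * z)" unfolding cd by (simp add: algebra_simps)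
  also have "(j * \<tau>) * (z * \<theta>) + (- (j * u * s)) * (x * z) + ((k3 * u * \<nu>) * (x * z) + (- (k3 * q * \<tau>)) * (x * \<theta>))
      + ((- (K * \<tau>)) * (A * \<theta> + x * q * u)) + ((- (k4 * q * \<tau>)) * (B * \<theta> - z * u) + (k4 * u) * (c * (x * z) + d * (z * z))) \<in> T 2 q"
    by (rule ideal.subspace_add[OF subspace_T] ideal.subspace_scale[OF subspace_T] R xz)+
  finally show ?thesis .
qed

text \<open>The difference is multiplied into the ideal by A, B, x and z, hence by all forms of
  degree m + (m - e), so it lies in this saturated ideal.\<close>

lemma rep_unique:
  assumes r: "rep u \<theta>" "rep u' \<theta>'" shows "u' * \<theta> - u * \<theta>' \<in> T 2 q"
proof -
  have R: "B * \<theta> - z * u \<in> T 2 q" "A * \<theta> + x * q * u \<in> T 2 q" "x * \<theta> \<in> T 2 q" "z * \<theta> \<in> T 2 q"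
    "B * \<theta>' - z * u' \<in> T 2 q" "A * \<theta>' + x * q * u' \<in> T 2 q" "x * \<theta>' \<in> T 2 q" "z * \<theta>' \<in> T 2 q"
    using r by (auto simp: rep_def)
  define D where "D = u' * \<theta> - u * \<theta>'"
  note diff = ideal.subspace_diff[OF subspace_T] and scale = ideal.subspace_scale[OF subspace_T]
  have "B * D = u' * (B * \<theta> - z * u) - u * (B * \<theta>' - z * u')" "A * D = u' * (A * \<theta> + x * q * u) - u * (A * \<theta>' + x * q * u')"
    "x * D = u' * (x * \<theta>) - u * (x * \<theta>')" "z * D = u' * (z * \<theta>) - u * (z * \<theta>')"
    unfolding D_def by (simp_all add: algebra_simps)
  then have D: "B * D \<in> T 2 q" "A * D \<in> T 2 q" "x * D \<in> T 2 q" "z * D \<in> T 2 q"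
    using diff[OF scale[OF R(1)] scale[OF R(5)]] diff[OF scale[OF R(2)] scale[OF R(6)]]
      diff[OF scale[OF R(3)] scale[OF R(7)]] diff[OF scale[OF R(4)] scale[OF R(8)]] by (simp_all only:)
  have cop': "coprime (\<delta> A) (\<delta> B)" using cop unfolding spD(6)[OF sp, symmetric] by (simp add: hom_mult[OF \<delta>_hom] coprime_mult_right_iff)
  have "f * D \<in> T 2 q" if f: "f \<in> homog (m + (m - e))" for f
  proof -
    obtain u1 u2 u3 u4 where u: "f = A * u1 + B * u2 + x * u3 + z * u4"
      using irrelevant_power[OF A spD(2)[OF sp] cop' \<omega>_sp(2)[OF sp] f order_refl] by metis
    have "f * D = u1 * (A * D) + u2 * (B * D) + u3 * (x * D) + u4 * (z * D)" unfolding u by (simp add: algebra_simps)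
    also have "\<dots> \<in> T 2 q" by (rule ideal.subspace_add[OF subspace_T] scale D)+
    finally show ?thesis .
  qed
  then show ?thesis unfolding D_def[symmetric] by (rule saturateD[OF saturate_T[OF sp]])
qed

text \<open>The generators z^2, xz, x^2q, F go to zs, t\<tau>, x\<nu>, B\<nu> - q\<tau>, with t
  written as \<theta> / g^(2m). \<open>syzygy\<close> yields independence of the presentation and
  \<open>rep_unique\<close> agreement on overlaps. The conclusion allows arbitrary coefficients, so
  that the value on each generator can be read off; the error v accounts for the decomposition
  actually chosen.\<close>

lemma deformation_exists:
  assumes s: "s \<in> homog 1" and \<tau>: "\<tau> \<in> homog (m + 1 - e)" and \<nu>: "\<nu> \<in> homog (e + 1)"
    and rel: "\<kappa> (B * \<nu> - 2 * q * \<tau> - A * s) = 0"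
  obtains \<xi> where "\<xi> \<in> normal_sections (T 2 q)"
    "\<And>g d h1 h2 h3 h4 n. g \<in> basis_index \<Longrightarrow> g \<in> homog d \<Longrightarrow>
       z * z * h1 + x * z * h2 + x * x * q * h3 + F * h4 \<in> homog (n * d) \<Longrightarrow>
       \<exists>\<theta> v. rep (g ^ (2 * m)) \<theta> \<and> v \<in> T 2 q \<and>
         \<xi> g (Fract (z * z * h1 + x * z * h2 + x * x * q * h3 + F * h4) (g ^ n)) =
         Fract (g ^ (2 * m) * z * s * h1 + \<theta> * \<tau> * h2 + g ^ (2 * m) * x * \<nu> * h3 + g ^ (2 * m) * (B * \<nu> - q * \<tau>) * h4 + v)
           (g ^ (n + 2 * m)) +o sections g (T 2 q)"
proof -
  have e: "e \<le> m" by (rule spD(5)[OF sp])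
  define L where "L u \<theta> = (\<lambda>(h1, h2, h3, h4). u * z * s * h1 + \<theta> * \<tau> * h2 + u * x * \<nu> * h3 + u * (B * \<nu> - q * \<tau>) * h4)" for u \<theta>
  define dec where "dec h = (SOME d. dec_ok h d)" for h
  have dec: "dec_ok h (dec h)" if "h \<in> T 2 q" for h unfolding dec_def using someI_ex[OF dec_exists[OF that]] .
  define \<theta> where "\<theta> g = (SOME \<theta>. rep (g ^ (2 * m)) \<theta> \<and> (\<forall>d. g \<in> homog d \<longrightarrow> \<theta> \<in> homog (2 * m * d + 1 + e - m)))" for g
  have \<theta>: "rep (g ^ (2 * m)) (\<theta> g)" "g \<in> homog d \<Longrightarrow> \<theta> g \<in> homog (2 * m * d + 1 + e - m)" if "g \<in> basis_index" for g d
    using someI_ex[OF rep_exists[OF that], folded \<theta>_def] by auto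
  \<comment> \<open>The decomposition is an arbitrary choice for each h, so this map is additive and
    linear only modulo the ideal, as \<open>sheaf_hom_construct\<close> allows.\<close>
  define \<psi> where "\<psi> g h = L (g ^ (2 * m)) (\<theta> g) (dec h)" for g h
  have wd: "L u \<theta> (h1, h2, h3, h4) - L u \<theta> (k1, k2, k3, k4) \<in> T 2 q"
    if "rep u \<theta>" and eq: "z * z * h1 + x * z * h2 + x * x * q * h3 + F * h4 = z * z * k1 + x * z * k2 + x * x * q * k3 + F * k4"
    for u \<theta> h1 h2 h3 h4 k1 k2 k3 k4
  proof -
    have "z * z * (h1 - k1) + x * z * (h2 - k2) + x * x * q * (h3 - k3) + F * (h4 - k4) = 0"
      using eq by (simp add: algebra_simps)
    from syzygy[OF that(1) rel this] show ?thesis unfolding L_def by (simp add: algebra_simps)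
  qed
  have \<psi>_eq: "\<psi> g (z * z * h1 + x * z * h2 + x * x * q * h3 + F * h4) - L (g ^ (2 * m)) (\<theta> g) (h1, h2, h3, h4) \<in> T 2 q"
    if g: "g \<in> basis_index" for g h1 h2 h3 h4
  proof -
    let ?h = "z * z * h1 + x * z * h2 + x * x * q * h3 + F * h4"
    obtain k1 k2 k3 k4 where k: "dec ?h = (k1, k2, k3, k4)" by (cases "dec ?h")
    have "?h = z * z * k1 + x * z * k2 + x * x * q * k3 + F * k4" using dec[OF T_2_I[OF refl], of h1 h2 h3 h4] unfolding k dec_ok_def by simp
    then show ?thesis unfolding \<psi>_def k by (intro wd[OF \<theta>(1)[OF g]]) (rule sym)
  qed
  have E: "\<exists>h1 h2 h3 h4. h = z * z * h1 + x * z * h2 + x * x * q * h3 + F * h4 \<and> \<psi> g h = L (g ^ (2 * m)) (\<theta> g) (h1, h2, h3, h4)"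
    if "h \<in> T 2 q" for g h
  proof -
    obtain k1 k2 k3 k4 where k: "dec h = (k1, k2, k3, k4)" by (cases "dec h")
    show ?thesis using dec[OF that] unfolding \<psi>_def k dec_ok_def by auto
  qed
  note hI = T_homogeneous[OF spD(1)[OF sp], of 2]
  obtain \<xi> where \<xi>: "\<xi> \<in> sheaf_hom (T 2 q) (T 2 q)"
    "\<And>g d h n. g \<in> basis_index \<Longrightarrow> g \<in> homog d \<Longrightarrow> h \<in> T 2 q \<Longrightarrow> h \<in> homog (n * d) \<Longrightarrow>
      \<xi> g (Fract h (g ^ n)) = Fract (\<psi> g h) (g ^ (n + 2 * m)) +o sections g (T 2 q)"
  proof (rule sheaf_hom_construct[OF hI hI, of \<psi> "\<lambda>_. 2 * m"])
    fix g d h n assume g: "g \<in> basis_index" "g \<in> homog d" and h: "h \<in> T 2 q" "h \<in> homog n"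
    obtain k1 k2 k3 k4 where k: "dec h = (k1, k2, k3, k4)" by (cases "dec h")
    have v: "vanishes_or_homog n 2 k1" "vanishes_or_homog n 2 k2" "vanishes_or_homog n (2 + e) k3" "vanishes_or_homog n (Suc m) k4"
      using dec[OF h(1)] h(2) unfolding k dec_ok_def by auto
    have gp: "g ^ (2 * m) \<in> homog (2 * m * d)" by (rule homog_power[OF g(2)])
    obtain d0 where "g \<noteq> 0" "d0 > 0" "g \<in> homog d0" using g(1) by (rule basis_indexE)
    then have "d > 0" using homog_unique[OF _ g(2)] by blast
    then have le: "m \<le> 2 * m * d" by (cases d) (auto simp: algebra_simps)
    have "g ^ (2 * m) * z * s \<in> homog (2 * m * d + 1 + 1)" by (intro homog_mult gp linear s)
    then have 1: "g ^ (2 * m) * z * s \<in> homog (2 + 2 * m * d)" by (simp add: add.commute)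
    have "\<theta> g * \<tau> \<in> homog ((2 * m * d + 1 + e - m) + (m + 1 - e))" by (intro homog_mult \<theta> g \<tau>)
    moreover have "(N + 1 + e - m) + (m + 1 - e) = 2 + N" if "m \<le> N" for N using that e by simp
    note this[OF le]
    ultimately have 2: "\<theta> g * \<tau> \<in> homog (2 + 2 * m * d)" by (simp only:)
    have "g ^ (2 * m) * x * \<nu> \<in> homog (2 * m * d + 1 + (e + 1))" by (intro homog_mult gp linear \<nu>)
    then have 3: "g ^ (2 * m) * x * \<nu> \<in> homog ((2 + e) + 2 * m * d)" by (simp add: add_ac)
    have "B * \<nu> \<in> homog ((m - e) + (e + 1))" "q * \<tau> \<in> homog (e + (m + 1 - e))" by (intro homog_mult spD[OF sp] \<nu> \<tau>)+
    then have "B * \<nu> - q * \<tau> \<in> homog (Suc m)" using e by (intro homog_diff) simp_all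
    from homog_mult[OF gp this] have 4: "g ^ (2 * m) * (B * \<nu> - q * \<tau>) \<in> homog (Suc m + 2 * m * d)" by (simp add: add.commute)
    show "\<psi> g h \<in> homog (n + 2 * m * d)"
      unfolding \<psi>_def k L_def
      using vanishes_or_homog_mult[OF v(1) 1] vanishes_or_homog_mult[OF v(2) 2] vanishes_or_homog_mult[OF v(3) 3] vanishes_or_homog_mult[OF v(4) 4]
      by (simp only: prod.case) (intro homog_add)
  next
    fix g h h' assume g: "g \<in> basis_index" and h: "h \<in> T 2 q" "h' \<in> T 2 q"
    obtain h1 h2 h3 h4 where 1: "h = z * z * h1 + x * z * h2 + x * x * q * h3 + F * h4" "\<psi> g h = L (g ^ (2 * m)) (\<theta> g) (h1, h2, h3, h4)"
      using E[OF h(1)] by blast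
    obtain k1 k2 k3 k4 where 2: "h' = z * z * k1 + x * z * k2 + x * x * q * k3 + F * k4" "\<psi> g h' = L (g ^ (2 * m)) (\<theta> g) (k1, k2, k3, k4)"
      using E[OF h(2)] by blast
    have s: "h + h' = z * z * (h1 + k1) + x * z * (h2 + k2) + x * x * q * (h3 + k3) + F * (h4 + k4)"
      unfolding 1(1) 2(1) by (simp only: distrib_left add_ac)
    have "L u \<theta> (h1 + k1, h2 + k2, h3 + k3, h4 + k4) = L u \<theta> (h1, h2, h3, h4) + L u \<theta> (k1, k2, k3, k4)" for u \<theta>
      unfolding L_def prod.case by (simp only: distrib_left add_ac)
    with \<psi>_eq[OF g, of "h1 + k1" "h2 + k2" "h3 + k3" "h4 + k4"] show "\<psi> g (h + h') - (\<psi> g h + \<psi> g h') \<in> T 2 q"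
      unfolding 1(2) 2(2) s by (simp only:)
  next
    fix g p h assume g: "g \<in> basis_index" and h: "h \<in> T 2 q"
    obtain h1 h2 h3 h4 where 1: "h = z * z * h1 + x * z * h2 + x * x * q * h3 + F * h4" "\<psi> g h = L (g ^ (2 * m)) (\<theta> g) (h1, h2, h3, h4)"
      using E[OF h] by blast
    have s: "p * h = z * z * (p * h1) + x * z * (p * h2) + x * x * q * (p * h3) + F * (p * h4)"
      unfolding 1(1) by (simp only: distrib_left mult_ac)
    have "L u \<theta> (p * h1, p * h2, p * h3, p * h4) = p * L u \<theta> (h1, h2, h3, h4)" for u \<theta>
      unfolding L_def prod.case by (simp only: distrib_left mult_ac)
    with \<psi>_eq[OF g, of "p * h1" "p * h2" "p * h3" "p * h4"] show "\<psi> g (p * h) - p * \<psi> g h \<in> T 2 q"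
      unfolding 1(2) s by (simp only:)
  next
    fix g g' h assume g: "g \<in> basis_index" "g' \<in> basis_index" and h: "h \<in> T 2 q"
    obtain k1 k2 k3 k4 where k: "dec h = (k1, k2, k3, k4)" by (cases "dec h")
    have "g' ^ (2 * m) * \<psi> g h - g ^ (2 * m) * \<psi> g' h = (\<tau> * k2) * (g' ^ (2 * m) * \<theta> g - g ^ (2 * m) * \<theta> g')"
      unfolding \<psi>_def k L_def prod.case by (simp add: algebra_simps)
    then show "g' ^ (2 * m) * \<psi> g h - g ^ (2 * m) * \<psi> g' h \<in> T 2 q"
      using ideal.subspace_scale[OF subspace_T rep_unique[OF \<theta>(1)[OF g(1)] \<theta>(1)[OF g(2)]]] by (simp only:)
  qed blast
  show ?thesis
  proof (rule that[of \<xi>])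
    show "\<xi> \<in> normal_sections (T 2 q)" using \<xi>(1) by (simp add: normal_sections_def)
    fix g d h1 h2 h3 h4 n
    assume g: "g \<in> basis_index" "g \<in> homog d" and h: "z * z * h1 + x * z * h2 + x * x * q * h3 + F * h4 \<in> homog (n * d)"
    let ?h = "z * z * h1 + x * z * h2 + x * x * q * h3 + F * h4"
    let ?L = "g ^ (2 * m) * z * s * h1 + \<theta> g * \<tau> * h2 + g ^ (2 * m) * x * \<nu> * h3 + g ^ (2 * m) * (B * \<nu> - q * \<tau>) * h4"
    define v where "v = \<psi> g ?h - ?L"
    have "v \<in> T 2 q" using \<psi>_eq[OF g(1), of h1 h2 h3 h4] unfolding v_def L_def prod.case .
    moreover have "\<psi> g ?h = ?L + v" by (simp add: v_def)
    ultimately show "\<exists>\<theta> v. rep (g ^ (2 * m)) \<theta> \<and> v \<in> T 2 q \<and>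
         \<xi> g (Fract ?h (g ^ n)) = Fract (g ^ (2 * m) * z * s * h1 + \<theta> * \<tau> * h2 + g ^ (2 * m) * x * \<nu> * h3 + g ^ (2 * m) * (B * \<nu> - q * \<tau>) * h4 + v)
           (g ^ (n + 2 * m)) +o sections g (T 2 q)"
      using \<xi>(2)[OF g T_2_I[OF refl] h] \<theta>(1)[OF g(1)] by (intro exI[of _ "\<theta> g"] exI[of _ v]) (simp only:)
  qed
qed

end

end

section \<open>Obstruction to lifting\<close>

lemma to_fract_power: "to_fract (a ^ n) = to_fract a ^ n"
  by (induction n) simp_all

lemma Fract_power_conv: "Fract f (b ^ n) = to_fract f / to_fract b ^ n"
  by (simp add: Fract_conv_to_fract to_fract_power)

text \<open>This turns equations between cosets over the open set of b into membership in
  \<open>E\<close>, at the cost of a power of b.\<close>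

lemma clear_denominators:
  assumes b: "b \<in> homog d" "b \<noteq> 0" and E: "ideal.subspace E" and s: "s \<in> sections b E"
    and p: "to_fract b ^ M * s = to_fract p"
  obtains N where "b ^ N * p \<in> E"
proof -
  obtain f n where f: "s = Fract f (b ^ n)" "f \<in> E" using s b by (rule sectionsE)
  have b0: "to_fract b \<noteq> 0" using b(2) by simp
  have "to_fract (b ^ n * p) = to_fract b ^ n * (to_fract b ^ M * s)" by (simp only: p to_fract_mult to_fract_power)
  also have "\<dots> = to_fract (b ^ M * f)" using b0 by (simp add: f(1) Fract_power_conv to_fract_power)
  finally have "b ^ n * p = b ^ M * f" by (simp only: to_fract_eq_iff)
  then show ?thesis using that[of n] ideal.subspace_scale[OF E f(2), of "b ^ M"] by simp
qed

lemma coset_eqD: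
  assumes b: "b \<in> homog d" and E: "ideal.subspace E" and eq: "u +o sections b E = v +o sections b E"
  shows "u - v \<in> sections b E"
proof -
  have "u \<in> u +o sections b E" using sections_zero[OF b E] by (simp add: mem_coset_iff)
  then show ?thesis unfolding eq mem_coset_iff .
qed

lemma three_denominators:
  fixes a b c p q r :: "'a::field"
  assumes "a \<noteq> 0" "b \<noteq> 0" "c \<noteq> 0"
  shows "a * b * c * ((p / a + q / b) - r / c) = b * c * p + a * c * q - a * b * r"
  using assms by (simp add: field_simps)

text \<open>Write a = c gcd(a, f). Squarefreeness makes c coprime to the gcd and therefore to f, yet
  c divides a power of f; so c is a unit.\<close>

lemma squarefree_dvd_power:
  fixes a :: "'a :: {semiring_gcd, idom}"
  assumes a: "squarefree a" and dvd: "a dvd f ^ n" shows "a dvd f"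
proof -
  have "a \<noteq> 0" using a by auto
  then obtain c h where ch: "a = c * gcd a f" "f = h * gcd a f" "coprime c h"
    using gcd_coprime_exists[of a f] by auto
  have "coprime c (gcd a f)"
  proof (rule coprimeI)
    fix r assume "r dvd c" "r dvd gcd a f"
    then have "r * r dvd c * gcd a f" by (rule mult_dvd_mono)
    then show "r dvd 1" using a ch(1) by (intro squarefreeD[of a]) (simp_all add: power2_eq_square)
  qed
  with ch(3) have "coprime c (h * gcd a f)" by simp
  then have "coprime c f" using ch(2) by simp
  then have "coprime c (f ^ n)" by simp
  moreover have "c dvd f ^ n" using dvd ch(1) by (metis dvd_trans dvd_triv_left)
  ultimately have "c dvd 1" by (meson coprime_common_divisor dvd_refl)
  then have "a dvd gcd a f" using ch(1) by (metis mult_unit_dvd_iff' dvd_refl)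
  then show ?thesis by (rule dvd_trans) simp
qed

context
  fixes E :: "coord_ring set" and \<eta> assumes E: "ideal.subspace E" and \<eta>: "\<eta> \<in> sheaf_hom E E"
begin

lemma hom_value:
  assumes b: "b \<in> basis_index" "b \<in> homog d" and X: "X \<in> sections b E"
  obtains U k where "U \<in> homog (k * d)" "\<eta> b X = Fract U (b ^ k) +o sections b E"
proof -
  have "\<eta> b X \<in> subscheme_sections b E" using \<eta> b X unfolding sheaf_hom_def by (auto simp: PiE_iff)
  then obtain u where u: "u \<in> regular b" "\<eta> b X = u +o sections b E" by (auto simp: subscheme_sections_def)
  have "b \<noteq> 0" using b by (auto simp: basis_index_def)
  from u(1) b(2) this obtain U k where "u = Fract U (b ^ k)" "U \<in> homog (k * d)" by (elim sectionsE)
  with u(2) show ?thesis by (intro that[of U k]) simp_all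
qed

lemma hom_scale_value:
  assumes b: "b \<in> basis_index" "b \<in> homog d" and X: "X \<in> sections b E" "\<eta> b X = u +o sections b E" and r: "r \<in> regular b"
  shows "\<eta> b (r * X) = (r * u) +o sections b E"
proof -
  have b0: "b \<noteq> 0" using b by (auto simp: basis_index_def)
  have "\<eta> b (r * X) = (r *o \<eta> b X) + sections b E" using \<eta> b X r unfolding sheaf_hom_def by blast
  then show ?thesis unfolding X(2) coset_scale[OF b(2) b0 E r] .
qed

lemma hom_add_value:
  assumes b: "b \<in> basis_index" "b \<in> homog d" and X: "X \<in> sections b E" "\<eta> b X = u +o sections b E"
    and Y: "Y \<in> sections b E" "\<eta> b Y = v +o sections b E"
  shows "\<eta> b (X + Y) = (u + v) +o sections b E"
proof -
  have b0: "b \<noteq> 0" using b by (auto simp: basis_index_def)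
  have "\<eta> b (X + Y) = \<eta> b X + \<eta> b Y" using \<eta> b X Y unfolding sheaf_hom_def by blast
  then show ?thesis unfolding X(2) Y(2) coset_add[OF b(2) b0 E] .
qed

text \<open>The values in the charts of w and y are compared on the open set of wy. There a / y^j is
  (w/y)^j times a / w^j, and multiplication by (wy)^(k+k'+j) clears all denominators.\<close>

lemma overlap:
  assumes w: "w \<in> homog 1" "w \<noteq> 0" and y: "y \<in> homog 1" "y \<noteq> 0"
    and a: "a \<in> E" "a \<in> homog j"
    and U: "\<eta> w (Fract a (w ^ j)) = Fract U (w ^ k) +o sections w E"
    and U': "\<eta> y (Fract a (y ^ j)) = Fract U' (y ^ k') +o sections y E"
  obtains N where "(w * y) ^ N * (w ^ (k + k' + j) * y ^ (k + j) * U' - w ^ (k' + 2 * j) * y ^ (k + k') * U) \<in> E"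
proof -
  let ?c = "w * y"
  have c: "?c \<in> homog 2" "?c \<noteq> 0" using homog_mult[OF w(1) y(1)] w y by (simp_all add: numeral_2_eq_2)
  have basis: "w \<in> basis_index" "y \<in> basis_index" "?c \<in> basis_index"
    using w y c by (auto simp: basis_index_def intro: exI[of _ 1] exI[of _ 2])
  have Dw: "D_plus ?c \<subseteq> D_plus w" and Dy: "D_plus ?c \<subseteq> D_plus y"
  proof -
    have "w \<notin> p \<and> y \<notin> p" if p: "p \<in> proj_points" "?c \<notin> p" for p
    proof -
      have sp: "ideal.subspace p" using proj_pointsD(1)[OF p(1)] by (rule homogeneous_ideal_subspace)
      show ?thesis using p(2) ideal.subspace_scale[OF sp, of w y] ideal.subspace_scale[OF sp, of y w] by (auto simp: mult.commute)
    qed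
    then show "D_plus ?c \<subseteq> D_plus w" "D_plus ?c \<subseteq> D_plus y" by (auto simp: D_plus_def)
  qed
  have nz: "to_fract w \<noteq> 0" "to_fract y \<noteq> 0" using w y by simp_all
  have aw: "Fract a (w ^ j) \<in> sections w E" by (rule Fract_in_sections[OF w(1) a(1)]) (simp add: a(2))
  have ay: "Fract a (y ^ j) \<in> sections y E" by (rule Fract_in_sections[OF y(1) a(1)]) (simp add: a(2))
  have sub: "\<eta> w (Fract a (w ^ j)) \<subseteq> \<eta> ?c (Fract a (w ^ j))" "\<eta> y (Fract a (y ^ j)) \<subseteq> \<eta> ?c (Fract a (y ^ j))"
    using \<eta> basis aw ay Dw Dy unfolding sheaf_hom_def by blast+
  have u: "Fract U (w ^ k) \<in> \<eta> ?c (Fract a (w ^ j))" "Fract U' (y ^ k') \<in> \<eta> ?c (Fract a (y ^ j))"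
    using sub sections_zero[OF w(1) E] sections_zero[OF y(1) E] unfolding U U' by (auto simp: mem_coset_iff)
  have ac: "Fract a (w ^ j) \<in> sections ?c E"
  proof -
    have "y ^ j * a \<in> homog (j * 1 + j)" by (intro homog_mult homog_power y a)
    then have "Fract (y ^ j * a) (?c ^ j) \<in> sections ?c E"
      by (intro Fract_in_sections[OF c(1)] ideal.subspace_scale[OF E a(1)]) (simp add: mult_2_right)
    moreover have "Fract (y ^ j * a) (?c ^ j) = Fract a (w ^ j)"
      unfolding Fract_power_conv using nz by (simp add: to_fract_power power_mult_distrib)
    ultimately show ?thesis by simp
  qed
  \<comment> \<open>This is (w/y)^j, written with a power of wy as denominator to be visibly regular
    there.\<close>
  let ?r = "Fract (w ^ (2 * j)) (?c ^ j)"
  have r: "?r \<in> regular ?c"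
    using homog_power[OF w(1), of "2 * j"] by (intro Fract_in_sections[OF c(1)]) (simp_all add: mult.commute)
  have rX: "?r * Fract a (w ^ j) = Fract a (y ^ j)"
    unfolding Fract_power_conv using nz by (simp add: to_fract_power power_mult_distrib mult_2 power_add)
  obtain V l where V: "\<eta> ?c (Fract a (w ^ j)) = Fract V (?c ^ l) +o sections ?c E"
    using basis(3) c(1) ac by (rule hom_value)
  have "Fract U (w ^ k) - Fract V (?c ^ l) \<in> sections ?c E" using u(1) unfolding V mem_coset_iff .
  then have V': "\<eta> ?c (Fract a (w ^ j)) = Fract U (w ^ k) +o sections ?c E"
    unfolding V by (rule coset_eqI[OF c E, symmetric])
  have "\<eta> ?c (Fract a (y ^ j)) = (?r * Fract U (w ^ k)) +o sections ?c E"
    using hom_scale_value[OF basis(3) c(1) ac V' r] unfolding rX .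
  then have s: "Fract U' (y ^ k') - ?r * Fract U (w ^ k) \<in> sections ?c E" using u(2) unfolding mem_coset_iff[symmetric] by simp
  have p: "to_fract ?c ^ (k + k' + j) * (Fract U' (y ^ k') - ?r * Fract U (w ^ k)) =
    to_fract (w ^ (k + k' + j) * y ^ (k + j) * U' - w ^ (k' + 2 * j) * y ^ (k + k') * U)"
    unfolding Fract_power_conv using nz by (simp add: to_fract_power power_mult_distrib right_diff_distrib)
      (simp add: power_add mult_2 field_simps)
  show ?thesis using clear_denominators[OF c E s p] that by blast
qed

end

section \<open>The condition for a deformation to come from the reduced scheme\<close>

context surface
begin

context
  fixes q B e assumes sp: "splits q B e"
begin

definition \<E> :: "coord_ring set" where "\<E> = reduction (T 2 q)"

lemma subspace_\<E>: "ideal.subspace \<E>"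
  unfolding \<E>_def by (rule subspace_reduction[OF subspace_T])

lemma T_subset_\<E>: "T 2 q \<subseteq> \<E>"
  unfolding \<E>_def by (rule reduction_superset)

lemma \<E>_sufficient: assumes "[:0, 1:] * \<rho> q dvd \<rho> f" shows "f \<in> \<E>"
proof -
  have "i3 (\<rho> (x * q)) = x * q" by (simp add: hom_mult[OF i3_\<rho>_hom] i3_coords spD(3)[OF sp])
  moreover have "\<rho> (x * q) dvd \<rho> f" using assms by (simp only: hom_mult[OF \<rho>_hom] \<rho>_simps)
  ultimately obtain a b where f: "f = x * q * a + z * b" by (rule dvd_\<rho>E)
  have "f ^ 2 = z * z * (b * b) + x * z * (2 * q * a * b) + x * x * q * (q * a * a) + F * 0"
    unfolding f by (simp add: power2_eq_square algebra_simps)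
  then have "f ^ 2 \<in> T 2 q" by (rule T_2_I[OF sp])
  then show ?thesis unfolding \<E>_def reduction_def by blast
qed

lemma T_2_necessary: "f \<in> T 2 q \<Longrightarrow> [:0, 1:] * \<rho> q dvd \<rho> f"
proof -
  assume "f \<in> T 2 q"
  then obtain h1 h2 h3 h4 where f: "f = z * z * h1 + x * z * h2 + x * x * q * h3 + F * h4" by (rule T_2_E[OF sp])
  have "\<rho> f = [:0, 1:] * \<rho> q * ([:0, 1:] * \<rho> h3 + \<rho> B * \<rho> h4)"
    unfolding f by (simp only: hom_add[OF \<rho>_hom] hom_mult[OF \<rho>_hom] \<rho>_simps \<rho>_F \<rho>_sp(1)[OF sp]) (simp add: algebra_simps)
  then show ?thesis by (rule dvdI)
qed

lemma \<E>_necessary: "f \<in> \<E> \<Longrightarrow> \<exists>n. [:0, 1:] * \<rho> q dvd \<rho> f ^ n"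
  using T_2_necessary unfolding \<E>_def reduction_def by (auto simp flip: hom_power[OF \<rho>_hom])

lemma prime_X: "prime_elem ([:0, 1:] :: plane_ring)"
proof (rule prime_elemI)
  have d: "[:0, 1:] dvd p \<longleftrightarrow> coeff p 0 = 0" for p :: plane_ring
    using poly_eq_0_iff_dvd[of p 0] by (simp add: poly_0_coeff_0)
  show "\<not> [:0, 1:] dvd (1 :: plane_ring)" by (simp add: d)
  show "[:0, 1:] dvd p \<or> [:0, 1:] dvd q" if "[:0, 1:] dvd p * q" for p q :: plane_ring
    using that by (simp add: d coeff_mult_0)
qed simp

lemma X_not_dvd: "\<not> [:0, 1:] dvd \<rho> q"
  using \<rho>_sp(2)[OF sp] poly_eq_0_iff_dvd[of "\<rho> q" 0] by (simp add: poly_0_coeff_0)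

text \<open>The prime x does not divide q on the plane, so xq is squarefree too and divides f as
  soon as it divides a power of f.\<close>

lemma \<E>_squarefree:
  assumes sf: "squarefree (\<rho> q)" shows "f \<in> \<E> \<longleftrightarrow> [:0, 1:] * \<rho> q dvd \<rho> f"
proof
  assume "f \<in> \<E>"
  then obtain n where n: "[:0, 1:] * \<rho> q dvd \<rho> f ^ n" using \<E>_necessary by blast
  have cop: "coprime [:0, 1:] (\<rho> q)" using prime_X X_not_dvd by (intro prime_elem_imp_coprime)
  have "squarefree ([:0, 1:] :: plane_ring)" using prime_X by (rule squarefree_prime_elem)
  then have "squarefree ([:0, 1:] * \<rho> q)" using sf cop by (intro squarefree_mult_coprime)
  moreover have "\<rho> f ^ n dvd \<rho> f ^ Suc n" by simp
  then have "[:0, 1:] * \<rho> q dvd \<rho> f ^ Suc n" using n by (rule dvd_trans[rotated])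
  ultimately show "[:0, 1:] * \<rho> q dvd \<rho> f" by (rule squarefree_dvd_power)
qed (rule \<E>_sufficient)

lemma z_xq_in_\<E>: "z \<in> \<E>" "x * q \<in> \<E>"
  by (rule \<E>_sufficient, simp, rule \<E>_sufficient, simp only: hom_mult[OF \<rho>_hom] \<rho>_simps dvd_refl)

text \<open>Data of a deformation of \<open>C\<close>, as produced by \<open>deformation_exists\<close>, and of a deformation of the reduced scheme
  inducing the same section of \<open>\<N>\<^sub>C \<otimes> \<O>\<^sub>E\<close>.\<close>

context
  fixes s \<tau> \<nu> \<xi> \<eta>
  assumes deg: "s \<in> homog 1" "\<tau> \<in> homog (m + 1 - e)" "\<nu> \<in> homog (e + 1)"
    and \<xi>: "\<And>b d h1 h2 h3 h4 n. b \<in> basis_index \<Longrightarrow> b \<in> homog d \<Longrightarrow>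
       z * z * h1 + x * z * h2 + x * x * q * h3 + F * h4 \<in> homog (n * d) \<Longrightarrow>
       \<exists>\<theta> v. rep q B (b ^ (2 * m)) \<theta> \<and> v \<in> T 2 q \<and>
         \<xi> b (Fract (z * z * h1 + x * z * h2 + x * x * q * h3 + F * h4) (b ^ n)) =
         Fract (b ^ (2 * m) * z * s * h1 + \<theta> * \<tau> * h2 + b ^ (2 * m) * x * \<nu> * h3 + b ^ (2 * m) * (B * \<nu> - q * \<tau>) * h4 + v)
           (b ^ (n + 2 * m)) +o sections b (T 2 q)"
    and \<eta>: "\<eta> \<in> sheaf_hom \<E> \<E>" and eq: "Upsilon5 (T 2 q) \<E> \<xi> = Upsilon6 (T 2 q) \<E> \<eta>"
begin

text \<open>Equality of the two images in the sheaf on the reduced scheme determines \<eta> on the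
  ideal of C. The terms containing \<theta> and v vanish there, since both lie in
  \<open>\<E>\<close>.\<close>

lemma \<eta>_value:
  assumes b: "b \<in> basis_index" "b \<in> homog d" and h: "z * z * h1 + x * z * h2 + x * x * q * h3 + F * h4 \<in> homog (n * d)"
  obtains \<theta> v where "\<theta> \<in> \<E>" "v \<in> \<E>" "\<eta> b (Fract (z * z * h1 + x * z * h2 + x * x * q * h3 + F * h4) (b ^ n)) =
     Fract (b ^ (2 * m) * z * s * h1 + \<theta> * \<tau> * h2 + b ^ (2 * m) * x * \<nu> * h3 + b ^ (2 * m) * (B * \<nu> - q * \<tau>) * h4 + v)
           (b ^ (n + 2 * m)) +o sections b \<E>"
proof -
  let ?h = "z * z * h1 + x * z * h2 + x * x * q * h3 + F * h4"
  let ?X = "Fract ?h (b ^ n)"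
  have b0: "b \<noteq> 0" using b by (auto simp: basis_index_def)
  have X: "?X \<in> sections b (T 2 q)" by (rule Fract_in_sections[OF b(2) T_2_I[OF sp refl] h])
  obtain \<theta> v where tv: "rep q B (b ^ (2 * m)) \<theta>" "v \<in> T 2 q" "\<xi> b ?X =
     Fract (b ^ (2 * m) * z * s * h1 + \<theta> * \<tau> * h2 + b ^ (2 * m) * x * \<nu> * h3 + b ^ (2 * m) * (B * \<nu> - q * \<tau>) * h4 + v)
           (b ^ (n + 2 * m)) +o sections b (T 2 q)" using \<xi>[OF b h] by blast
  have "Upsilon5 (T 2 q) \<E> \<xi> b ?X = Upsilon6 (T 2 q) \<E> \<eta> b ?X" unfolding eq ..
  then have "\<eta> b ?X = \<xi> b ?X + sections b \<E>" using b(1) X by (simp add: Upsilon5_def Upsilon6_def)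
  then have "\<eta> b ?X = Fract (b ^ (2 * m) * z * s * h1 + \<theta> * \<tau> * h2 + b ^ (2 * m) * x * \<nu> * h3 + b ^ (2 * m) * (B * \<nu> - q * \<tau>) * h4 + v)
           (b ^ (n + 2 * m)) +o sections b \<E>"
    unfolding tv(3) coset_plus_sections[OF b(2) b0 subspace_T subspace_\<E> T_subset_\<E>] .
  moreover have "\<theta> \<in> \<E>" using tv(1) unfolding rep_def[OF sp] by (intro \<E>_sufficient) blast
  moreover have "v \<in> \<E>" using tv(2) T_subset_\<E> by blast
  ultimately show ?thesis using that by blast
qed

text \<open>The value on x^2 q = (x p)(x q') is computed in two ways. With p = 1 it compares V with
  \<nu> on l; with p a repeated factor of q it produces the contradiction of
  \<open>not_squarefree_contra\<close>.\<close>

lemma \<eta>_x2q: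
  assumes b: "b \<in> homog 1" "b \<noteq> 0" and pq: "p \<in> homog i" "q' \<in> homog (e - i)" "i \<le> e" "q = p * q'" "x * q' \<in> \<E>"
    and V: "\<eta> b (Fract (x * q') (b ^ (e - i + 1))) = Fract V (b ^ k) +o sections b \<E>"
  obtains N where "b ^ N * (x * (b ^ (e + 1) * (p * V) - b ^ (k + i) * \<nu>)) \<in> \<E>"
proof -
  have bb: "b \<in> basis_index" using b by (auto simp: basis_index_def intro: exI[of _ 1])
  have nz: "to_fract b \<noteq> 0" using b by simp
  let ?X = "Fract (x * q') (b ^ (e - i + 1))" and ?r = "Fract (x * p) (b ^ (i + 1))"
  have X: "?X \<in> sections b \<E>"
    using homog_mult[OF linear(1) pq(2)] by (intro Fract_in_sections[OF b(1) pq(5)]) simp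
  have r: "?r \<in> regular b" using homog_mult[OF linear(1) pq(1)] by (intro Fract_in_sections[OF b(1)]) simp_all
  have ie: "i + 1 + (e - i + 1) = e + 2" using pq(3) by simp
  have rX: "?r * ?X = Fract (x * x * q) (b ^ (e + 2))"
    unfolding ie[symmetric] power_add[of b "i + 1"] by (simp add: pq(4) mult_ac)
  have "x * x * q \<in> homog (1 + 1 + e)" by (intro homog_mult linear spD(1)[OF sp])
  then have "z * z * 0 + x * z * 0 + x * x * q * 1 + F * 0 \<in> homog ((e + 2) * 1)" by simp
  from \<eta>_value[OF bb b(1) this] obtain v where v: "v \<in> \<E>"
    "\<eta> b (Fract (x * x * q) (b ^ (e + 2))) = Fract (b ^ (2 * m) * x * \<nu> + v) (b ^ (e + 2 + 2 * m)) +o sections b \<E>"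
    by (auto simp: add_ac)
  have "\<eta> b (Fract (x * x * q) (b ^ (e + 2))) = (?r * Fract V (b ^ k)) +o sections b \<E>"
    using hom_scale_value[OF subspace_\<E> \<eta> bb b(1) X V r] unfolding rX .
  then have st: "?r * Fract V (b ^ k) - Fract (b ^ (2 * m) * x * \<nu> + v) (b ^ (e + 2 + 2 * m)) \<in> sections b \<E>"
    using v(2) by (intro coset_eqD[OF b(1) subspace_\<E>]) simp
  have "to_fract b ^ (i + 1 + k + (e + 2 + 2 * m)) * (?r * Fract V (b ^ k) - Fract (b ^ (2 * m) * x * \<nu> + v) (b ^ (e + 2 + 2 * m))) =
    to_fract (b ^ (e + 2 + 2 * m) * (x * p * V) - b ^ (i + 1 + k) * (b ^ (2 * m) * x * \<nu> + v))"
    unfolding Fract_power_conv to_fract_diff to_fract_mult to_fract_power power_add[of "to_fract b" "i + 1 + k"] using nz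
    by (simp add: power_add field_simps)
  from clear_denominators[OF b subspace_\<E> st this] obtain N where
    N: "b ^ N * (b ^ (e + 2 + 2 * m) * (x * p * V) - b ^ (i + 1 + k) * (b ^ (2 * m) * x * \<nu> + v)) \<in> \<E>" .
  have "(b ^ N * b ^ (i + 1 + k)) * v \<in> \<E>" by (rule ideal.subspace_scale[OF subspace_\<E> v(1)])
  from ideal.subspace_add[OF subspace_\<E> N this]
  have "b ^ (N + 2 * m + 1) * (x * (b ^ (e + 1) * (p * V) - b ^ (k + i) * \<nu>)) \<in> \<E>"
    by (simp add: power_add algebra_simps)
  then show ?thesis by (rule that)
qed

text \<open>\<eta> is determined by its values U and V on z and xq. Its values on xz, x^2q and F are
  prescribed, which fixes U and V modulo q on l and then \<tau>; the degree bounds come from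
  regularity in the second chart of l.\<close>

lemma squarefree_necessary:
  assumes sf: "squarefree (\<rho> q)"
  obtains c1 c2 where "degree c2 \<le> 1" "c1 = 0 \<or> degree c1 + e \<le> 1" "\<delta> \<tau> = \<delta> B * c2 - \<delta> A * c1"
proof -
  note [simp del] = \<rho>_simps
  have w: "w \<in> homog 1" "w \<noteq> 0" "w \<in> basis_index" and y: "y \<in> homog 1" "y \<noteq> 0" "y \<in> basis_index"
    using linear coords_nonzero by (auto simp: basis_index_def intro: exI[of _ 1])
  have nz: "to_fract w \<noteq> 0" using w by simp
  have \<delta>q: "\<delta> q \<noteq> 0" "degree (\<delta> q) = e" using degree_\<delta>[OF spD(1)[OF sp] \<omega>_sp(1)[OF sp]] by simp_all
  have \<delta>0: "\<delta> f = 0" if f: "f \<in> \<E>" for f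
    using f unfolding \<E>_squarefree[OF sf] by (elim dvdE) (simp add: \<delta>_def coeff_mult_0)
  \<comment> \<open>On the plane, x f in the ideal (xq) means f in (q); only then is f restricted to
    the line.\<close>
  have \<delta>dvd: "\<delta> q dvd \<delta> f" if f: "w ^ N * (x * f) \<in> \<E>" for f N
  proof -
    have "[:0, 1:] * \<rho> q dvd [:0, 1:] * \<rho> (w ^ N * f)"
      using f unfolding \<E>_squarefree[OF sf] by (simp add: hom_mult[OF \<rho>_hom] \<rho>_simps mult_ac)
    then have "\<rho> q dvd \<rho> (w ^ N * f)" by (subst (asm) dvd_mult_cancel_left) simp
    then have "\<delta> q dvd \<delta> (w ^ N * f)" by (elim dvdE) (simp add: \<delta>_def coeff_mult_0)
    then show ?thesis by (simp add: hom_simps[OF \<delta>_hom])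
  qed
  have xq: "x * q \<in> homog (e + 1)" using homog_mult[OF linear(1) spD(1)[OF sp]] by simp
  have sec: "Fract z (b ^ 1) \<in> sections b \<E>" "Fract (x * q) (b ^ (e + 1)) \<in> sections b \<E>" if b: "b \<in> homog 1" for b
    using Fract_in_sections[OF b z_xq_in_\<E>(1), of 1] Fract_in_sections[OF b z_xq_in_\<E>(2), of "e + 1"] linear(3) xq by simp_all
  note hv = hom_value[OF subspace_\<E> \<eta>]
  obtain U k where U: "U \<in> homog (k * 1)" "\<eta> w (Fract z (w ^ 1)) = Fract U (w ^ k) +o sections w \<E>"
    using hv[OF w(3) w(1) sec(1)[OF w(1)]] .
  obtain V k' where V: "V \<in> homog (k' * 1)" "\<eta> w (Fract (x * q) (w ^ (e + 1))) = Fract V (w ^ k') +o sections w \<E>"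
    using hv[OF w(3) w(1) sec(2)[OF w(1)]] .
  obtain U' j where U': "U' \<in> homog (j * 1)" "\<eta> y (Fract z (y ^ 1)) = Fract U' (y ^ j) +o sections y \<E>"
    using hv[OF y(3) y(1) sec(1)[OF y(1)]] .
  obtain V' j' where V': "V' \<in> homog (j' * 1)" "\<eta> y (Fract (x * q) (y ^ (e + 1))) = Fract V' (y ^ j') +o sections y \<E>"
    using hv[OF y(3) y(1) sec(2)[OF y(1)]] .
  let ?Y = "[:0, 1:] :: complex poly"
  \<comment> \<open>In the chart of y the numerator is a form of degree i', whose dehomogenization
    has degree at most i'. This is what bounds the degrees in the chart of w.\<close>
  have glue: "?Y ^ n * \<delta> b' = ?Y ^ i' * \<delta> b"
    if h: "a \<in> \<E>" "a \<in> homog n" "\<eta> w (Fract a (w ^ n)) = Fract b (w ^ i) +o sections w \<E>"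
      "\<eta> y (Fract a (y ^ n)) = Fract b' (y ^ i') +o sections y \<E>" for a b b' n i i'
  proof -
    obtain N where "(w * y) ^ N * (w ^ (i + i' + n) * y ^ (i + n) * b' - w ^ (i' + 2 * n) * y ^ (i + i') * b) \<in> \<E>"
      using overlap[OF subspace_\<E> \<eta> w(1,2) y(1,2) h] .
    then have "?Y ^ N * (?Y ^ (i + n) * \<delta> b' - ?Y ^ (i + i') * \<delta> b) = 0"
      using \<delta>0 by (fastforce simp: hom_simps[OF \<delta>_hom])
    then have "?Y ^ i * (?Y ^ n * \<delta> b' - ?Y ^ i' * \<delta> b) = 0" by (simp add: power_add algebra_simps)
    then show ?thesis by simp
  qed
  have gU: "?Y * \<delta> U' = ?Y ^ j * \<delta> U" using glue[OF z_xq_in_\<E>(1) linear(3) U(2) U'(2)] by simp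
  have gV: "?Y ^ (e + 1) * \<delta> V' = ?Y ^ j' * \<delta> V" by (rule glue[OF z_xq_in_\<E>(2) xq V(2) V'(2)])
  \<comment> \<open>The prescribed value t\<tau> on xz vanishes on the reduced scheme, so x U lies
    in its ideal up to a power of w.\<close>
  have "\<delta> q dvd \<delta> U"
  proof -
    have "x * z \<in> homog (1 + 1)" by (intro homog_mult linear)
    then have "z * z * 0 + x * z * 1 + x * x * q * 0 + F * 0 \<in> homog (2 * 1)" by (simp add: numeral_2_eq_2)
    from \<eta>_value[OF w(3) w(1) this] obtain \<theta> v where v: "\<theta> \<in> \<E>" "v \<in> \<E>"
      "\<eta> w (Fract (x * z) (w ^ 2)) = Fract (\<theta> * \<tau> + v) (w ^ (2 + 2 * m)) +o sections w \<E>"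
      by (auto simp: add_ac)
    let ?r = "Fract x (w ^ 1)"
    have r: "?r \<in> regular w" using Fract_in_sections[OF w(1), of x UNIV 1] linear(1) by simp
    have rX: "?r * Fract z (w ^ 1) = Fract (x * z) (w ^ 2)" by (simp add: power2_eq_square)
    have "\<eta> w (Fract (x * z) (w ^ 2)) = (?r * Fract U (w ^ k)) +o sections w \<E>"
      using hom_scale_value[OF subspace_\<E> \<eta> w(3) w(1) sec(1)[OF w(1)] U(2) r] unfolding rX .
    then have st: "?r * Fract U (w ^ k) - Fract (\<theta> * \<tau> + v) (w ^ (2 + 2 * m)) \<in> sections w \<E>"
      using v(3) by (intro coset_eqD[OF w(1) subspace_\<E>]) simp
    have "to_fract w ^ (1 + k + (2 + 2 * m)) * (?r * Fract U (w ^ k) - Fract (\<theta> * \<tau> + v) (w ^ (2 + 2 * m))) =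
      to_fract (w ^ (2 + 2 * m) * (x * U) - w ^ (1 + k) * (\<theta> * \<tau> + v))"
      unfolding Fract_power_conv to_fract_diff to_fract_mult to_fract_power power_add[of "to_fract w" "1 + k"] using nz
      by (simp add: power_add field_simps)
    from clear_denominators[OF w(1,2) subspace_\<E> st this] obtain N where
      N: "w ^ N * (w ^ (2 + 2 * m) * (x * U) - w ^ (1 + k) * (\<theta> * \<tau> + v)) \<in> \<E>" .
    have "(w ^ N * w ^ (1 + k)) * (\<tau> * \<theta> + v) \<in> \<E>"
      by (intro ideal.subspace_scale[OF subspace_\<E>] ideal.subspace_add[OF subspace_\<E>] v)
    from ideal.subspace_add[OF subspace_\<E> N this]
    have "w ^ (N + (2 + 2 * m)) * (x * U) \<in> \<E>" by (simp add: power_add algebra_simps)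
    then show ?thesis by (rule \<delta>dvd)
  qed
  then obtain c1 where c1: "\<delta> U = \<delta> q * c1" by (rule dvdE)
  have "\<delta> q dvd \<delta> V - \<delta> \<nu>"
  proof -
    have val: "\<eta> w (Fract (x * q) (w ^ (e - 0 + 1))) = Fract V (w ^ k') +o sections w \<E>" using V(2) by simp
    have one: "1 \<in> homog 0" using homog_power[OF w(1), of 0] by simp
    have q0: "q \<in> homog (e - 0)" "q = 1 * q" using spD(1)[OF sp] by simp_all
    from \<eta>_x2q[OF w(1,2) one q0(1) le0 q0(2) z_xq_in_\<E>(2) val] obtain N where
      "w ^ N * (x * (w ^ (e + 1) * (1 * V) - w ^ (k' + 0) * \<nu>)) \<in> \<E>" by auto
    from \<delta>dvd[OF this] show ?thesis by (simp add: hom_simps[OF \<delta>_hom])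
  qed
  then obtain c2 where c2: "\<delta> V - \<delta> \<nu> = \<delta> q * c2" by (rule dvdE)
  \<comment> \<open>Since F = A z + B (x q), linearity of \<eta> compares A U + B V with the value
    prescribed on F.\<close>
  have F_eq: "\<delta> A * \<delta> U + \<delta> B * \<delta> V = \<delta> B * \<delta> \<nu> - \<delta> q * \<delta> \<tau>"
  proof -
    have "z * z * 0 + x * z * 0 + x * x * q * 0 + F * 1 \<in> homog ((m + 1) * 1)" using F_homog by simp
    from \<eta>_value[OF w(3) w(1) this] obtain v where v: "v \<in> \<E>"
      "\<eta> w (Fract F (w ^ (m + 1))) = Fract (w ^ (2 * m) * (B * \<nu> - q * \<tau>) + v) (w ^ (m + 1 + 2 * m)) +o sections w \<E>"
      by (auto simp: add_ac)
    let ?r1 = "Fract A (w ^ m)" and ?r2 = "Fract B (w ^ (m - e))"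
    have r: "?r1 \<in> regular w" "?r2 \<in> regular w"
      using Fract_in_sections[OF w(1), of A UNIV m] Fract_in_sections[OF w(1), of B UNIV "m - e"] A spD(2)[OF sp] by simp_all
    have me: "m + 1 = (m - e) + (e + 1)" using spD(5)[OF sp] by simp
    have F': "F = A * z + B * (x * q)" unfolding F spD(6)[OF sp, symmetric] by (simp add: mult_ac)
    have e2: "w ^ (m + 1) = w ^ (m - e) * w ^ (e + 1)" unfolding power_add[symmetric] me[symmetric] ..
    have "Fract F (w ^ (m + 1)) = Fract (A * z) (w ^ m * w ^ 1) + Fract (B * (x * q)) (w ^ (m - e) * w ^ (e + 1))"
      unfolding e2[symmetric] F' power_add[symmetric] unfolding Fract_power_conv by (simp only: me[symmetric] to_fract_add add_divide_distrib)
    also have "\<dots> = ?r1 * Fract z (w ^ 1) + ?r2 * Fract (x * q) (w ^ (e + 1))" by simp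
    finally have rX: "Fract F (w ^ (m + 1)) = ?r1 * Fract z (w ^ 1) + ?r2 * Fract (x * q) (w ^ (e + 1))" .
    have sub: "ideal.subspace \<E>" by (rule subspace_\<E>)
    have s12: "?r1 * Fract z (w ^ 1) \<in> sections w \<E>" "?r2 * Fract (x * q) (w ^ (e + 1)) \<in> sections w \<E>"
      using sections_scale[OF w(1,2) sub r(1) sec(1)[OF w(1)]] sections_scale[OF w(1,2) sub r(2) sec(2)[OF w(1)]] by simp_all
    have "\<eta> w (Fract F (w ^ (m + 1))) = (?r1 * Fract U (w ^ k) + ?r2 * Fract V (w ^ k')) +o sections w \<E>"
      unfolding rX using hom_add_value[OF subspace_\<E> \<eta> w(3) w(1) s12(1)
        hom_scale_value[OF subspace_\<E> \<eta> w(3) w(1) sec(1)[OF w(1)] U(2) r(1)] s12(2)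
        hom_scale_value[OF subspace_\<E> \<eta> w(3) w(1) sec(2)[OF w(1)] V(2) r(2)]] .
    then have st: "(?r1 * Fract U (w ^ k) + ?r2 * Fract V (w ^ k')) - Fract (w ^ (2 * m) * (B * \<nu> - q * \<tau>) + v) (w ^ (m + 1 + 2 * m)) \<in> sections w \<E>"
      using v(2) by (intro coset_eqD[OF w(1) subspace_\<E>]) simp
    \<comment> \<open>The exponents of w in the three denominators, named so that clearing them is a
      plain field identity.\<close>
    define a1 where "a1 = m + k"
    define a2 where "a2 = (m - e) + k'"
    define a3 where "a3 = m + 1 + 2 * m"
    have "to_fract w ^ (a1 + a2 + a3) * ((?r1 * Fract U (w ^ k) + ?r2 * Fract V (w ^ k')) - Fract (w ^ (2 * m) * (B * \<nu> - q * \<tau>) + v) (w ^ a3))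
      = to_fract (w ^ (a2 + a3) * (A * U) + w ^ (a1 + a3) * (B * V) - w ^ (a1 + a2) * (w ^ (2 * m) * (B * \<nu> - q * \<tau>) + v))"
    proof -
      have "?r1 * Fract U (w ^ k) = to_fract (A * U) / to_fract w ^ a1" "?r2 * Fract V (w ^ k') = to_fract (B * V) / to_fract w ^ a2"
        unfolding a1_def a2_def by (simp_all add: Fract_power_conv power_add)
      then have "to_fract w ^ (a1 + a2 + a3) * ((?r1 * Fract U (w ^ k) + ?r2 * Fract V (w ^ k')) - Fract (w ^ (2 * m) * (B * \<nu> - q * \<tau>) + v) (w ^ a3))
        = to_fract w ^ a1 * to_fract w ^ a2 * to_fract w ^ a3 * ((to_fract (A * U) / to_fract w ^ a1 + to_fract (B * V) / to_fract w ^ a2)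
          - to_fract (w ^ (2 * m) * (B * \<nu> - q * \<tau>) + v) / to_fract w ^ a3)"
        by (simp only: power_add Fract_power_conv[of _ w a3])
      also have "\<dots> = to_fract w ^ a2 * to_fract w ^ a3 * to_fract (A * U) + to_fract w ^ a1 * to_fract w ^ a3 * to_fract (B * V)
        - to_fract w ^ a1 * to_fract w ^ a2 * to_fract (w ^ (2 * m) * (B * \<nu> - q * \<tau>) + v)"
        by (rule three_denominators) (use w(2) in simp_all)
      finally show ?thesis
        by (simp only: power_add to_fract_mult to_fract_add to_fract_diff to_fract_power)
    qed
    from clear_denominators[OF w(1,2) subspace_\<E> st[folded a3_def] this] obtain N where
      "w ^ N * (w ^ (a2 + a3) * (A * U) + w ^ (a1 + a3) * (B * V) - w ^ (a1 + a2) * (w ^ (2 * m) * (B * \<nu> - q * \<tau>) + v)) \<in> \<E>" .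
    from \<delta>0[OF this] show ?thesis using \<delta>0[OF v(1)] by (simp add: hom_simps[OF \<delta>_hom])
  qed
  have "\<delta> q * (\<delta> A * c1 + \<delta> B * c2 + \<delta> \<tau>) = 0"
    using F_eq c2 unfolding c1 by (simp add: algebra_simps)
  then have sum0: "\<delta> A * c1 + \<delta> B * c2 + \<delta> \<tau> = 0" using \<delta>q(1) by simp
  have "\<delta> \<tau> = (\<delta> A * c1 + \<delta> B * c2 + \<delta> \<tau>) - \<delta> B * c2 - \<delta> A * c1" by simp
  then have "\<delta> \<tau> = \<delta> B * (- c2) - \<delta> A * c1" unfolding sum0 by simp
  \<comment> \<open>By \<open>gU\<close>, y U' = y^j q c1 on l, where U' has degree at most j; so e
    + deg c1 \<le> 1.\<close>
  moreover have "c1 = 0 \<or> degree c1 + e \<le> 1"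
  proof (cases "c1 = 0")
    case False
    have "?Y * \<delta> U' = ?Y ^ j * (\<delta> q * c1)" using gU c1 by simp
    then have "degree (?Y * \<delta> U') = j + (e + degree c1)" using False \<delta>q by (simp add: degree_mult_eq degree_power_eq)
    moreover have "degree (?Y * \<delta> U') \<le> 1 + degree (\<delta> U')" using degree_mult_le[of ?Y "\<delta> U'"] by simp
    moreover have "degree (\<delta> U') \<le> j" using \<kappa>_homog(2)[OF U'(1)] by simp
    ultimately show ?thesis by simp
  qed simp
  moreover have "degree (- c2) \<le> 1"
  proof (cases "c2 = 0")
    case False
    have "?Y ^ (e + 1) * \<delta> V' - ?Y ^ j' * \<delta> \<nu> = ?Y ^ j' * (\<delta> q * c2)" unfolding gV c2[symmetric] by (simp add: right_diff_distrib)
    then have "degree (?Y ^ (e + 1) * \<delta> V' - ?Y ^ j' * \<delta> \<nu>) = j' + (e + degree c2)"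
      using False \<delta>q by (simp add: degree_mult_eq degree_power_eq)
    moreover have "degree (?Y ^ (e + 1) * \<delta> V') \<le> e + 1 + j'"
      by (rule order_trans[OF degree_mult_le]) (use \<kappa>_homog(2)[OF V'(1)] in \<open>simp add: degree_power_eq\<close>)
    moreover have "degree (?Y ^ j' * \<delta> \<nu>) \<le> e + 1 + j'"
      by (rule order_trans[OF degree_mult_le]) (use \<kappa>_homog(2)[OF deg(3)] in \<open>simp add: degree_power_eq\<close>)
    ultimately show ?thesis using degree_diff_le[of "?Y ^ (e + 1) * \<delta> V'" "e + 1 + j'" "?Y ^ j' * \<delta> \<nu>"] by simp
  qed simp
  ultimately show ?thesis using that[of "- c2" c1] by blast
qed

text \<open>For a repeated factor r of q, with lift p and q = p q', the form x q' lies in the ideal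
  of the reduced scheme, so \<eta> has a value V on it. Then x p V = x \<nu> there, up to powers of
  w. So r divides a power of a multiple of r minus a monomial in w and x, although r is coprime to
  both variables.\<close>

lemma not_squarefree_contra:
  assumes nsf: "\<not> squarefree (\<rho> q)" and \<nu>: "\<nu> = x ^ (e + 1)" shows False
proof -
  note [simp del] = \<rho>_simps
  let ?X = "[:0, 1:] :: plane_ring" and ?W = "[:[:0, 1:]:] :: plane_ring"
  have w: "w \<in> homog 1" "w \<noteq> 0" "w \<in> basis_index"
    using linear coords_nonzero by (auto simp: basis_index_def intro: exI[of _ 1])
  obtain r where r: "r ^ 2 dvd \<rho> q" "\<not> r dvd 1" using nsf by (rule not_squarefreeE)
  obtain t where t: "\<rho> q = r ^ 2 * t" using r(1) by (rule dvdE)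
  define p where "p = i3 r"
  define q' where "q' = p * i3 t"
  have "q = i3 (r ^ 2 * t)" using spD(3)[OF sp] t by simp
  then have q: "q = p * q'" by (simp add: p_def q'_def hom_mult[OF i_hom(3)] power2_eq_square mult.assoc)
  have qne: "q \<noteq> 0" "q \<in> homog e" using \<rho>_sp(5)[OF sp] spD(1)[OF sp] by simp_all
  obtain i where i: "p \<in> homog i" "i \<le> e" using factor_homog[of p q' e] qne q by auto
  obtain j where j: "q' \<in> homog j" using factor_homog[of q' p e] qne q by (auto simp: mult.commute)
  have "i + j = e" using homog_unique[of q "i + j" e] homog_mult[OF i(1) j] qne q by simp
  then have j': "q' \<in> homog (e - i)" using j by auto
  \<comment> \<open>q' = p t and q = p q', so q'^2 = q t: the square is a multiple of the generator
    x^2 q.\<close>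
  have "(x * q') ^ 2 = z * z * 0 + x * z * 0 + x * x * q * i3 t + F * 0"
    unfolding q q'_def by (simp add: power2_eq_square mult_ac)
  then have "(x * q') ^ 2 \<in> T 2 q" by (rule T_2_I[OF sp])
  then have xq': "x * q' \<in> \<E>" unfolding \<E>_def reduction_def by blast
  have "x * q' \<in> homog (e - i + 1)" using homog_mult[OF linear(1) j'] by simp
  then have sec: "Fract (x * q') (w ^ (e - i + 1)) \<in> sections w \<E>"
    using Fract_in_sections[OF w(1) xq', of "e - i + 1"] by simp
  obtain V k where V: "\<eta> w (Fract (x * q') (w ^ (e - i + 1))) = Fract V (w ^ k) +o sections w \<E>"
    using hom_value[OF subspace_\<E> \<eta> w(3) w(1) sec] .
  obtain N where N: "w ^ N * (x * (w ^ (e + 1) * (p * V) - w ^ (k + i) * \<nu>)) \<in> \<E>"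
    using \<eta>_x2q[OF w(1,2) i(1) j' i(2) q xq' V] .
  let ?f = "w ^ N * (x * (w ^ (e + 1) * (p * V) - w ^ (k + i) * \<nu>))"
  have "?f = p * (w ^ N * x * w ^ (e + 1) * V) - w ^ (N + k + i) * x ^ (e + 2)"
    by (simp add: \<nu> power_add algebra_simps)
  then have f: "\<rho> ?f = r * \<rho> (w ^ N * x * w ^ (e + 1) * V) - ?W ^ (N + k + i) * ?X ^ (e + 2)"
    unfolding p_def by (simp only: hom_simps[OF \<rho>_hom] \<rho>_i3 \<rho>_simps)
  obtain n where n: "?X * \<rho> q dvd \<rho> ?f ^ n" using \<E>_necessary[OF N] by blast
  have pW: "prime_elem ?W"
  proof (rule prime_elemI)
    show "\<not> ?W dvd 1" by (auto simp: W_dvd_iff intro!: exI[of _ 0])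
  qed (simp_all add: W_prime)
  have "\<omega> q \<noteq> 0" by (rule \<omega>_sp(1)[OF sp])
  then have "\<not> ?W dvd \<rho> q" by (auto simp: W_dvd_iff \<omega>_def)
  then have "\<not> ?W dvd r" "\<not> ?X dvd r" using X_not_dvd unfolding t by (auto simp: power2_eq_square)
  then have "coprime ?W r" "coprime ?X r" using pW prime_X prime_elem_imp_coprime by blast+
  then have cop: "coprime r (?W ^ (N + k + i) * ?X ^ (e + 2))"
    unfolding coprime_mult_right_iff coprime_power_right_iff by (simp add: coprime_commute)
  have "coprime r (\<rho> ?f)"
  proof (rule coprimeI)
    fix c assume c: "c dvd r" "c dvd \<rho> ?f"
    have "c dvd r * \<rho> (w ^ N * x * w ^ (e + 1) * V) - \<rho> ?f" using c by (intro dvd_diff dvd_mult2)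
    then have "c dvd ?W ^ (N + k + i) * ?X ^ (e + 2)" unfolding f by simp
    with c(1) show "c dvd 1" by (rule coprime_common_divisor[OF cop])
  qed
  then have "coprime r (\<rho> ?f ^ n)" by simp
  moreover have "r dvd \<rho> ?f ^ n"
  proof (rule dvd_trans[OF _ n])
    show "r dvd ?X * \<rho> q" unfolding t power2_eq_square by (intro dvd_mult dvd_mult2 dvd_refl)
  qed
  ultimately show False using r(2) coprime_common_divisor[of r "\<rho> ?f ^ n" r] by simp
qed

end

lemma deformation_not_lifting:
  assumes e: "1 \<le> e" "e + 2 \<le> m"
  shows "\<exists>\<xi>\<in>normal_sections (T 2 q). Upsilon5 (T 2 q) \<E> \<xi> \<notin> Upsilon6 (T 2 q) \<E> ` normal_sections \<E>"
proof (cases "squarefree (\<rho> q)")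
  case True
  have dq: "degree (\<delta> q) = e" "degree (\<delta> B) = m - e"
    using degree_\<delta>[OF spD(1)[OF sp] \<omega>_sp(1)[OF sp]] degree_\<delta>[OF spD(2)[OF sp] \<omega>_sp(2)[OF sp]] by simp_all
  have dA: "degree (\<delta> A) \<le> e + (m - e)" using \<kappa>_homog(2)[OF A] e by simp
  have co: "coprime (\<delta> A) (\<delta> q * \<delta> B)" using cop spD(6)[OF sp] by (simp flip: hom_mult[OF \<delta>_hom])
  have me: "2 \<le> m - e" using e by simp
  show ?thesis
  proof (rule nonliftable_exists[OF dq(1) e(1) dq(2) me dA co])
    fix s \<tau> \<nu> assume st: "degree s \<le> 1" "degree \<tau> \<le> m - e + 1" "degree \<nu> \<le> e + 1" "\<delta> A * s = \<delta> B * \<nu> - 2 * \<delta> q * \<tau>"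
      and non: "\<And>c1 c2. c1 = 0 \<or> degree c1 + e \<le> 1 \<Longrightarrow> degree c2 \<le> 1 \<Longrightarrow> \<tau> \<noteq> \<delta> B * c2 - \<delta> A * c1"
    define s' where "s' = H 1 s"
    define \<tau>' where "\<tau>' = H (m + 1 - e) \<tau>"
    define \<nu>' where "\<nu>' = H (e + 1) \<nu>"
    have me1: "m - e + 1 = m + 1 - e" using e by simp
    have h: "s' \<in> homog 1" "\<tau>' \<in> homog (m + 1 - e)" "\<nu>' \<in> homog (e + 1)"
      unfolding s'_def \<tau>'_def \<nu>'_def by (rule H_homog)+
    have d: "\<delta> s' = s" "\<delta> \<tau>' = \<tau>" "\<delta> \<nu>' = \<nu>"
      unfolding s'_def \<tau>'_def \<nu>'_def using st(1-3)[unfolded me1] by (simp_all add: \<delta>_H)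
    have n: "m - e + (e + 1) = m + 1" "e + (m + 1 - e) = m + 1" using e by simp_all
    have two: "B * \<nu>' - 2 * q * \<tau>' - A * s' = B * \<nu>' - (q * \<tau>' + q * \<tau>') - A * s'"
      by (simp only: mult_2 distrib_right)
    have "B * \<nu>' - (q * \<tau>' + q * \<tau>') - A * s' \<in> homog (m + 1)"
      using homog_mult[OF spD(2)[OF sp] h(3)] homog_mult[OF spD(1)[OF sp] h(2)] homog_mult[OF A h(1)]
      unfolding n by (intro homog_diff homog_add)
    moreover have "\<delta> (B * \<nu>' - (q * \<tau>' + q * \<tau>') - A * s') = 0"
      unfolding hom_simps[OF \<delta>_hom] d st(4) by (simp only: mult_2 distrib_right diff_self)
    \<comment> \<open>All terms are forms of degree m + 1, so their relation on l may be checked in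
      the chart w = 1.\<close>
    ultimately have rel: "\<kappa> (B * \<nu>' - 2 * q * \<tau>' - A * s') = 0" unfolding two using homog_\<delta>_eq_0 by blast
    show ?thesis
    proof (rule deformation_exists[OF sp h rel])
      fix \<xi> assume \<xi>: "\<xi> \<in> normal_sections (T 2 q)"
        and val: "\<And>b d h1 h2 h3 h4 n. b \<in> basis_index \<Longrightarrow> b \<in> homog d \<Longrightarrow>
           z * z * h1 + x * z * h2 + x * x * q * h3 + F * h4 \<in> homog (n * d) \<Longrightarrow>
           \<exists>\<theta> v. rep q B (b ^ (2 * m)) \<theta> \<and> v \<in> T 2 q \<and>
             \<xi> b (Fract (z * z * h1 + x * z * h2 + x * x * q * h3 + F * h4) (b ^ n)) =
             Fract (b ^ (2 * m) * z * s' * h1 + \<theta> * \<tau>' * h2 + b ^ (2 * m) * x * \<nu>' * h3 + b ^ (2 * m) * (B * \<nu>' - q * \<tau>') * h4 + v)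
               (b ^ (n + 2 * m)) +o sections b (T 2 q)"
      have "Upsilon5 (T 2 q) \<E> \<xi> \<noteq> Upsilon6 (T 2 q) \<E> \<eta>" if \<eta>: "\<eta> \<in> normal_sections \<E>" for \<eta>
      proof
        assume eq: "Upsilon5 (T 2 q) \<E> \<xi> = Upsilon6 (T 2 q) \<E> \<eta>"
        obtain c1 c2 where "degree c2 \<le> 1" "c1 = 0 \<or> degree c1 + e \<le> 1" "\<delta> \<tau>' = \<delta> B * c2 - \<delta> A * c1"
          using squarefree_necessary[OF h val \<eta>[unfolded normal_sections_def] eq True] .
        then show False using non d by blast
      qed
      with \<xi> show ?thesis by blast
    qed
  qed
next
  case False
  define s' :: coord_ring where "s' = 0"
  define \<tau>' :: coord_ring where "\<tau>' = 0"
  \<comment> \<open>It vanishes on l, so the relation holds with s = \<tau> = 0, but it has no zero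
    in the plane off l, in particular none on a multiple component there.\<close>
  define \<nu>' where "\<nu>' = x ^ (e + 1)"
  have h: "s' \<in> homog 1" "\<tau>' \<in> homog (m + 1 - e)" "\<nu>' \<in> homog (e + 1)"
    using homog_power[OF linear(1), of "e + 1"] by (simp_all add: s'_def \<tau>'_def \<nu>'_def homog_zero)
  have rel: "\<kappa> (B * \<nu>' - 2 * q * \<tau>' - A * s') = 0"
    by (simp add: s'_def \<tau>'_def \<nu>'_def hom_simps[OF \<kappa>_hom])
  show ?thesis
  proof (rule deformation_exists[OF sp h rel])
    fix \<xi> assume \<xi>: "\<xi> \<in> normal_sections (T 2 q)"
      and val: "\<And>b d h1 h2 h3 h4 n. b \<in> basis_index \<Longrightarrow> b \<in> homog d \<Longrightarrow>
         z * z * h1 + x * z * h2 + x * x * q * h3 + F * h4 \<in> homog (n * d) \<Longrightarrow>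
         \<exists>\<theta> v. rep q B (b ^ (2 * m)) \<theta> \<and> v \<in> T 2 q \<and>
           \<xi> b (Fract (z * z * h1 + x * z * h2 + x * x * q * h3 + F * h4) (b ^ n)) =
           Fract (b ^ (2 * m) * z * s' * h1 + \<theta> * \<tau>' * h2 + b ^ (2 * m) * x * \<nu>' * h3 + b ^ (2 * m) * (B * \<nu>' - q * \<tau>') * h4 + v)
             (b ^ (n + 2 * m)) +o sections b (T 2 q)"
    have "Upsilon5 (T 2 q) \<E> \<xi> \<noteq> Upsilon6 (T 2 q) \<E> \<eta>" if \<eta>: "\<eta> \<in> normal_sections \<E>" for \<eta>
    proof
      assume eq: "Upsilon5 (T 2 q) \<E> \<xi> = Upsilon6 (T 2 q) \<E> \<eta>"
      show False by (rule not_squarefree_contra[OF h val \<eta>[unfolded normal_sections_def] eq False \<nu>'_def])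
    qed
    with \<xi> show ?thesis by blast
  qed
qed

end

lemma nonlift:
  assumes "splits q B e" "1 \<le> e" "e + 2 \<le> m"
  shows "\<exists>\<xi>\<in>normal_sections (T 2 q). Upsilon5 (T 2 q) (reduction (T 2 q)) \<xi>
    \<notin> Upsilon6 (T 2 q) (reduction (T 2 q)) ` normal_sections (reduction (T 2 q))"
  using deformation_not_lifting[OF assms] unfolding \<E>_def[OF assms(1)] .

end

section \<open>Gradients\<close>

lemma partial_deriv_superset:
  assumes "finite S" "Poly_Mapping.keys f \<subseteq> S"
  shows "partial_deriv i f = (\<Sum>m\<in>S. Poly_Mapping.single (m - Poly_Mapping.single i 1)
     (Poly_Mapping.lookup f m * of_nat (Poly_Mapping.lookup m i)))"
  unfolding partial_deriv_def using assms by (intro sum.mono_neutral_left) (auto simp: in_keys_iff)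

lemma partial_deriv_add: "partial_deriv i (f + g) = partial_deriv i f + partial_deriv i g"
proof -
  let ?S = "Poly_Mapping.keys f \<union> Poly_Mapping.keys g"
  have S: "finite ?S" "Poly_Mapping.keys (f + g) \<subseteq> ?S" "Poly_Mapping.keys f \<subseteq> ?S" "Poly_Mapping.keys g \<subseteq> ?S"
    using keys_add[of f g] by auto
  show ?thesis
    unfolding partial_deriv_superset[OF S(1,2)] partial_deriv_superset[OF S(1,3)] partial_deriv_superset[OF S(1,4)]
    by (simp add: lookup_add distrib_right single_add sum.distrib)
qed

lemma partial_deriv_zero: "partial_deriv i 0 = 0"
  by (simp add: partial_deriv_def)

lemma partial_deriv_single:
  "partial_deriv i (Poly_Mapping.single m c) = Poly_Mapping.single (m - Poly_Mapping.single i 1) (c * of_nat (Poly_Mapping.lookup m i))"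
  by (subst partial_deriv_superset[of "{m}"]) auto

lemma mpoly_monomial_induct:
  assumes "\<And>m c. P (Poly_Mapping.single m c)" "\<And>f g. P f \<Longrightarrow> P g \<Longrightarrow> P (f + g)"
  shows "P (f :: 'v mpoly)"
proof -
  have P0: "P 0" using assms(1)[of 0 0] by simp
  have "P (\<Sum>m\<in>S. Poly_Mapping.single m (Poly_Mapping.lookup f m))" if "finite S" for S
    using that by (induction S) (simp_all add: P0 assms)
  then show ?thesis using mpoly_sum_monomials[of f] by (metis finite_keys)
qed

lemma partial_deriv_cst: "partial_deriv i (cst c) = 0"
  unfolding cst_def partial_deriv_single by simp

lemma partial_deriv_cst_mult: "partial_deriv i (cst c * f) = cst c * partial_deriv i f"
proof (induction f rule: mpoly_monomial_induct)
  case (1 m k)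
  then show ?case by (simp add: cst_def mult_single partial_deriv_single mult.assoc)
qed (simp_all add: distrib_left partial_deriv_add)

lemma partial_deriv_var_mult: "partial_deriv i (var j * f) = var j * partial_deriv i f + (if i = j then f else 0)"
proof (induction f rule: mpoly_monomial_induct)
  case (1 m c)
  let ?s = "\<lambda>i. Poly_Mapping.single i (1 :: nat)"
  have l: "Poly_Mapping.lookup (?s j) i = (if i = j then 1 else 0)" by (simp add: lookup_single when_def)
  have e: "?s j + m - ?s i = ?s j + (m - ?s i)" if "Poly_Mapping.lookup m i \<noteq> 0"
    by (rule poly_mapping_eqI) (use that in \<open>auto simp: lookup_add lookup_minus lookup_single when_def\<close>)
  have L: "partial_deriv i (var j * Poly_Mapping.single m c) =
    Poly_Mapping.single (?s j + m - ?s i) (c * of_nat (Poly_Mapping.lookup (?s j) i + Poly_Mapping.lookup m i))"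
    by (simp add: var_def mult_single partial_deriv_single lookup_add)
  have R: "var j * partial_deriv i (Poly_Mapping.single m c) = Poly_Mapping.single (?s j + (m - ?s i)) (c * of_nat (Poly_Mapping.lookup m i))"
    by (simp add: var_def mult_single partial_deriv_single)
  have c: "?s i + m - ?s i = m" by simp
  show ?case
  proof (cases "Poly_Mapping.lookup m i = 0")
    case True
    then show ?thesis unfolding L R l using c by (cases "i = j") simp_all
  next
    case False
    then show ?thesis unfolding L R l e[OF False, symmetric] using c
      by (cases "i = j") (simp_all add: distrib_left single_add)
  qed
qed (simp_all add: distrib_left partial_deriv_add)

lemma partial_deriv_mult:
  fixes f g :: "'v::finite mpoly"
  shows "partial_deriv i (f * g) = f * partial_deriv i g + partial_deriv i f * g"
proof (induction f arbitrary: g rule: mpoly_induct)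
  case (var j)
  show ?case using partial_deriv_var_mult[of i j g] partial_deriv_var_mult[of i j 1] partial_deriv_cst[of i 1]
    by (simp add: cst_def)
next
  case (mult f h)
  show ?case by (simp only: mult.assoc mult.IH distrib_left distrib_right add.assoc)
qed (simp_all add: partial_deriv_cst partial_deriv_cst_mult partial_deriv_add distrib_right add_ac)

lemma gradient_add: "gradient (f + g) p = gradient f p + gradient g p"
  by (simp add: gradient_def partial_deriv_add hom_add[OF ring_hom1_eval_mpoly] vec_eq_iff)

lemma gradient_mult: "gradient (f * g) p = eval_mpoly (($) p) f *s gradient g p + eval_mpoly (($) p) g *s gradient f p"
  by (simp add: gradient_def partial_deriv_mult hom_add[OF ring_hom1_eval_mpoly] hom_mult[OF ring_hom1_eval_mpoly] vec_eq_iff mult.commute)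

lemma dim_gradients_le:
  assumes "finite W" "\<And>f. f \<in> I \<Longrightarrow> gradient f p \<in> vec.span W" shows "vec.dim ((\<lambda>f. gradient f p) ` I) \<le> card W"
  using assms by (intro vec.dim_le_card) auto

lemma eval_mpoly_linear_0: assumes "f \<in> homog 1" shows "eval_mpoly (($) (0 :: complex ^ 4)) f = 0"
proof -
  have "f \<in> cvs.span (range (var :: 4 \<Rightarrow> coord_ring))" using assms homog_1_eq_span by blast
  then show ?thesis
  proof (induction rule: cvs.span_induct_alt)
    case base then show ?case by (rule hom_zero[OF ring_hom1_eval_mpoly])
  next
    case (step c x y)
    then show ?case
      by (auto simp: hom_add[OF ring_hom1_eval_mpoly] hom_cscale[OF ring_hom1_eval_mpoly] eval_mpoly_var)
  qed
qed

section \<open>Choice of coordinates\<close>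

lemma inj_var: "inj (var :: 'v \<Rightarrow> 'v mpoly)"
proof (rule injI)
  fix i j :: 'v assume "var i = var j"
  then have "Poly_Mapping.lookup (var i) (Poly_Mapping.single i 1) = Poly_Mapping.lookup (var j :: 'v mpoly) (Poly_Mapping.single i 1)" by simp
  then have "Poly_Mapping.single j (1 :: nat) = Poly_Mapping.single i 1" by (simp add: var_def lookup_single when_def split: if_splits)
  then have "Poly_Mapping.lookup (Poly_Mapping.single j (1 :: nat)) i = 1" by simp
  then show "i = j" by (simp add: lookup_single when_def split: if_splits)
qed

lemma independent_vars: "\<not> cvs.dependent (range (var :: 4 \<Rightarrow> coord_ring))"
proof
  assume "cvs.dependent (range (var :: 4 \<Rightarrow> coord_ring))"
  then obtain u where u: "\<exists>v\<in>range (var :: 4 \<Rightarrow> coord_ring). u v \<noteq> 0" "(\<Sum>v\<in>range (var :: 4 \<Rightarrow> coord_ring). cscale (u v) v) = 0"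
    by (auto simp: cvs.dependent_finite)
  then obtain j :: 4 where j: "u (var j) \<noteq> 0" by blast
  let ?s = "\<lambda>i. Poly_Mapping.single i (1 :: nat)"
  have s: "?s i = ?s j \<longleftrightarrow> i = j" for i
    by (metis lookup_single_eq lookup_single_not_eq one_neq_zero)
  have "0 = (\<Sum>i\<in>UNIV. cscale (u (var i)) (var i :: coord_ring))" using u(2) by (simp add: sum.reindex[OF inj_var])
  then have "0 = Poly_Mapping.lookup (\<Sum>i\<in>UNIV. cscale (u (var i)) (var i :: coord_ring)) (?s j)" by simp
  also have "\<dots> = (\<Sum>i\<in>UNIV. if i = j then u (var i) else 0)"
    unfolding lookup_sum by (intro sum.cong) (auto simp: cscale_def var_def mult_single lookup_single when_def s[unfolded One_nat_def])
  also have "\<dots> = u (var j)" by simp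
  finally show False using j by simp
qed

lemma coords_extend:
  assumes xz: "x \<in> homog 1" "z \<in> homog 1" "x \<noteq> z" "\<not> cvs.dependent {x, z}"
  obtains y w where "coords x y z w"
proof -
  obtain B where B: "{x, z} \<subseteq> B" "B \<subseteq> homog 1" "\<not> cvs.dependent B" "homog 1 \<subseteq> cvs.span B"
    using cvs.maximal_independent_subset_extend[of "{x, z}" "homog 1"] xz by auto
  let ?V = "range (var :: 4 \<Rightarrow> coord_ring)"
  have "finite B" using cvs.independent_span_bound[of ?V B] B homog_1_eq_span by auto
  have "cvs.span B = homog 1" using B(2,4) cvs.span_minimal[OF B(2) subspace_homog] by blast
  then have "card B = card ?V"
    using cvs.dim_span_eq_card_independent[OF B(3)] cvs.dim_span_eq_card_independent[OF independent_vars] homog_1_eq_span by simp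
  then have c4: "card B = 4" by (simp add: card_image[OF inj_var])
  then have "card (B - {x, z}) = 2" using B(1) \<open>finite B\<close> xz(3) by (simp add: card_Diff_subset)
  then obtain y w where yw: "B - {x, z} = {y, w}" "y \<noteq> w" by (auto simp: card_2_iff)
  have eq: "B = {x, y, z, w}" using yw(1) B(1) by auto
  have "coords x y z w" using B(2,3) c4 unfolding eq by unfold_locales auto
  then show ?thesis by (rule that)
qed

lemma ideal_span_pair: "ideal.span {f, g} = {f * a + g * b | a b. True}"
proof -
  have "h \<in> ideal.span {f, g} \<longleftrightarrow> (\<exists>a b. h = f * a + g * b)" for h
  proof -
    have "h \<in> ideal.span {f, g} \<longleftrightarrow> (\<exists>a. h - a * f \<in> ideal.span {g})" by (simp add: ideal.span_insert)
    also have "\<dots> \<longleftrightarrow> (\<exists>a b. h - a * f = b * g)" by (auto simp: ideal.span_singleton)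
    also have "\<dots> \<longleftrightarrow> (\<exists>a b. h = f * a + g * b)" by (metis add.commute diff_add_cancel add_diff_cancel mult.commute)
    finally show ?thesis .
  qed
  then show ?thesis by blast
qed

lemma line_through_linear_form:
  assumes fg: "f \<in> homog 1" "g \<in> homog 1" "f \<noteq> g" "\<not> cvs.dependent {f, g}"
    and h: "h = cst c * f + cst d * g" "d \<noteq> 0"
  obtains y w where "coords f y h w" "ideal.span {f, g} = {f * a + h * b | a b. True}"
proof -
  have d: "cst d * cst (1 / d) = (1 :: coord_ring)" using h(2) by (simp add: cst_def mult_single)
  have gh: "g = cst (1 / d) * h - cst (1 / d) * cst c * f"
    unfolding h(1) using d by (simp add: distrib_left) (metis mult.assoc mult.commute mult_1)
  have gn: "g \<notin> cvs.span {f}" using fg(3,4) cvs.independent_insert[of g "{f}"] by (auto simp: insert_commute)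
  have hn: "h \<notin> cvs.span {f}"
  proof
    assume "h \<in> cvs.span {f}"
    then have "cscale (1 / d) h - cscale (1 / d * c) f \<in> cvs.span {f}"
      by (intro cvs.span_diff cvs.span_scale cvs.span_base[of f]) simp_all
    moreover have "cscale (1 / d) h - cscale (1 / d * c) f = g"
      unfolding gh[of] by (simp add: cscale_eq) (simp add: cst_def mult_single)
    ultimately show False using gn by simp
  qed
  have "\<not> cvs.dependent {f}" using fg(4) cvs.dependent_mono[of "{f}" "{f, g}"] by blast
  then have ind: "\<not> cvs.dependent {f, h}" using hn cvs.independent_insert[of h "{f}"] by (auto simp: insert_commute)
  have "f \<noteq> h" using hn cvs.span_base[of f "{f}"] by auto
  moreover have "h \<in> homog 1" unfolding h(1) by (intro homog_add homog_cst_mult fg)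
  ultimately obtain y w where yw: "coords f y h w" using coords_extend[OF fg(1) _ _ ind] by blast
  have "(\<exists>a b. u = f * a + g * b) \<longleftrightarrow> (\<exists>a b. u = f * a + h * b)" for u
  proof
    assume "\<exists>a b. u = f * a + g * b"
    then obtain a b where u: "u = f * a + g * b" by blast
    have "u = f * (a - cst (1 / d) * cst c * b) + h * (cst (1 / d) * b)"
      unfolding u by (subst gh) (simp add: algebra_simps)
    then show "\<exists>a b. u = f * a + h * b" by blast
  next
    assume "\<exists>a b. u = f * a + h * b"
    then obtain a b where u: "u = f * a + h * b" by blast
    have "u = f * (a + cst c * b) + g * (cst d * b)" unfolding u h(1) by (simp add: algebra_simps)
    then show "\<exists>a b. u = f * a + g * b" by blast
  qed
  then have "ideal.span {f, g} = {f * a + h * b | a b. True}" unfolding ideal_span_pair by blast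
  with yw show ?thesis by (rule that)
qed

text \<open>The degree 1 component of a presentation of h exhibits it as a linear combination of the
  two equations of the line, so h can replace one of them.\<close>

lemma line_coords:
  assumes l: "is_line l" and h: "h \<in> l" "h \<in> homog 1" "h \<noteq> 0"
  obtains x y w where "coords x y h w" "l = {x * a + h * b | a b. True}"
proof -
  obtain f g where fg: "f \<in> homog 1" "g \<in> homog 1" "f \<noteq> g" "\<not> cvs.dependent {f, g}" "l = ideal.span {f, g}"
    using l unfolding is_line_def by auto
  obtain a b where ab: "h = f * a + g * b" using h(1) unfolding fg(5) ideal_span_pair by blast
  have "h = hcomp 1 h" using h(2) by (simp add: hcomp_of_homog)
  also have "\<dots> = f * hcomp 0 a + g * hcomp 0 b"
    unfolding ab hcomp_add using hcomp_mult_homog[OF fg(1), of 0 a] hcomp_mult_homog[OF fg(2), of 0 b] by simp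
  finally have h': "h = f * hcomp 0 a + g * hcomp 0 b" .
  obtain c d where cd: "hcomp 0 a = cst c" "hcomp 0 b = cst d" using homog_0_cst hcomp_homog by metis
  have hc: "h = cst c * f + cst d * g" using h' unfolding cd by (simp only: mult.commute)
  show ?thesis
  proof (cases "d = 0")
    case False
    show ?thesis by (rule line_through_linear_form[OF fg(1-4) hc False]) (use that fg(5) in blast)
  next
    case True
    then have "c \<noteq> 0" using hc h(3) by (auto simp: cst_def)
    moreover have "h = cst d * g + cst c * f" using hc by (simp only: add.commute)
    moreover have "g \<noteq> f" "\<not> cvs.dependent {g, f}" using fg(3,4) by (auto simp: insert_commute)
    ultimately obtain y w where "coords g y h w" "ideal.span {g, f} = {g * a + h * b | a b. True}"
      using line_through_linear_form[OF fg(2,1)] by blast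
    then show ?thesis using that fg(5) by (simp add: insert_commute)
  qed
qed

text \<open>The old w becomes the second coordinate and y - c w the last one. This moves the
  distinguished point of the line, where the last coordinate vanishes, to the point y = c w.\<close>

lemma (in coords) change_coords: "coords x w z (y - cst c * w)"
proof -
  let ?y = "y - cst c * w"
  have d: "y \<notin> {x, z, w}"
  proof
    assume "y \<in> {x, z, w}"
    then have "{x, y, z, w} = {x, z, w}" by auto
    then show False using dist card_length[of "[x, z, w]"] by simp
  qed
  have c3: "card {x, z, w} = 3" using dist d by (simp add: insert_commute[of x y])
  have ind: "y \<notin> cvs.span {x, z, w}" "\<not> cvs.dependent {x, z, w}"
    using indep d cvs.independent_insert[of y "{x, z, w}"] by (simp_all add: insert_commute[of x y])
  have n: "?y \<notin> cvs.span {x, z, w}"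
  proof
    assume "?y \<in> cvs.span {x, z, w}"
    then have "?y + cscale c w \<in> cvs.span {x, z, w}" by (intro cvs.span_add cvs.span_scale cvs.span_base[of w]) simp_all
    then show False using ind(1) by (simp add: cscale_eq)
  qed
  have eq: "{x, w, z, ?y} = insert ?y {x, z, w}" by auto
  show ?thesis
  proof
    have n': "?y \<notin> {x, z, w}" using n cvs.span_base[of ?y "{x, z, w}"] by blast
    have "finite {x, z, w}" by simp
    from card_insert_disjoint[OF this n'] show "card {x, w, z, ?y} = 4" unfolding eq c3 by simp
    show "\<not> cvs.dependent {x, w, z, ?y}" unfolding eq using n ind(2) by (simp add: cvs.independent_insert)
    show "?y \<in> homog 1" by (intro homog_diff homog_cst_mult linear)
  qed (rule linear)+
qed

section \<open>Surfaces containing a line\<close>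

lemma not_coprime_common_root:
  fixes a b :: "complex poly"
  assumes "\<not> coprime a b" obtains t where "poly a t = 0" "poly b t = 0"
proof -
  obtain c where c: "c dvd a" "c dvd b" "\<not> c dvd 1" using assms by (auto simp: coprime_def)
  obtain t where "poly c t = 0"
  proof (cases "c = 0")
    case False
    then have "degree c \<noteq> 0" using c(3) is_unit_iff_degree[of c] by simp
    then have "\<not> constant (poly c)" by (simp add: constant_degree)
    then show ?thesis using fundamental_theorem_of_algebra that by blast
  qed (use that in simp)
  then show ?thesis using c(1,2) that[of t] by (auto elim!: dvdE)
qed

lemma dim_gradients_zero:
  assumes "\<And>f. f \<in> I \<Longrightarrow> gradient f p = 0" shows "vec.dim ((\<lambda>f. gradient f p) ` I) = 0"
  using dim_gradients_le[of "{}" I p] assms by simp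

lemma prime_ideal_zero: "prime_ideal ({0} :: coord_ring set)"
  unfolding prime_ideal_def
proof (intro conjI allI impI)
  show "ideal.subspace ({0} :: coord_ring set)" by (rule ideal.subspace_single_0)
  show "({0} :: coord_ring set) \<noteq> UNIV" by (metis UNIV_I one_neq_zero singletonD)
  show "f \<in> {0} \<or> g \<in> {0}" if "f * g \<in> {0}" for f g :: coord_ring
    using that by (simp only: singleton_iff mult_eq_0_iff)
qed

context coords
begin

lemma eval_eq_0_iff_line:
  assumes "eval_mpoly (($) p) x = 0" "eval_mpoly (($) p) z = 0"
  shows "eval_mpoly (($) p) (x * a + z * b) = 0"
  using assms by (simp add: hom_simps[OF ring_hom1_eval_mpoly])

text \<open>Purity makes the ideal principal, and containment of the line lets the restriction of F
  to z = 0 be divided by x. The final condition is the Jacobian criterion along the line.\<close>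

lemma surface_equation:
  assumes sm: "smooth_surface d Y" and d: "1 \<le> d" and Yl: "Y \<subseteq> {x * a + z * b | a b. True}"
  obtains A g F where "A \<in> homog (d - 1)" "g \<in> plane_homog (d - 1)" "F = z * A + x * g" "Y = {f. F dvd f}"
    "\<And>p. p \<noteq> 0 \<Longrightarrow> eval_mpoly (($) p) x = 0 \<Longrightarrow> eval_mpoly (($) p) z = 0 \<Longrightarrow>
       eval_mpoly (($) p) A \<noteq> 0 \<or> eval_mpoly (($) p) g \<noteq> 0"
proof -
  have sm2: "smooth_of_dim 2 Y" and deg: "has_degree Y d" using sm by (auto simp: smooth_surface_def)
  have cl: "closed_subscheme Y" "Y \<noteq> UNIV" and pure: "\<And>p. p \<in> associated_points Y \<Longrightarrow> point_dim p = enat 2"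
    using sm2 unfolding smooth_of_dim_def pure_dim_def by blast+
  have jac: "vec.dim ((\<lambda>f. gradient f p) ` Y) + 2 = 3" if "p \<noteq> 0" "\<And>f. f \<in> Y \<Longrightarrow> eval_mpoly (($) p) f = 0" for p
    using sm2 that unfolding smooth_of_dim_def by blast
  have sub: "ideal.subspace Y" using cl(1) homogeneous_ideal_subspace unfolding closed_subscheme_def by blast
  have \<Theta>0: "\<Theta> f = 0 \<longleftrightarrow> f = 0" for f using i4_\<Theta>[of f] hom_zero[OF i_hom(4)] hom_zero[OF \<Theta>(1)] by auto
  have prime0: "prime_ideal ({0} :: coord_ring set)" by (rule prime_ideal_zero)
  obtain F e where F: "F \<in> homog e" "i4 (\<Theta> F) = F" "Y = {f. \<Theta> F dvd \<Theta> f}"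
  proof (rule pure_codim_one_principal[OF \<Theta>(1) i_hom(4) \<Theta>_i4 _ cl _ pure, where j = 0 and c = "\<lambda>_. {0}"])
    show "{0} = {f. \<Theta> f = 0}" by (simp add: \<Theta>0)
    show "\<And>f n. f \<in> homog n \<Longrightarrow> i4 (\<Theta> f) \<in> homog n" by (simp add: i4_\<Theta>)
    show "\<And>f. \<Theta> f = 0 \<Longrightarrow> f \<in> Y" using ideal.subspace_0[OF sub] by (simp add: \<Theta>0)
  qed (use prime0 in simp_all)
  have Y: "Y = {f. F dvd f}"
  proof -
    have "\<Theta> F dvd \<Theta> f \<longleftrightarrow> F dvd f" for f
    proof
      assume "\<Theta> F dvd \<Theta> f"
      then obtain k where "\<Theta> f = \<Theta> F * k" by (rule dvdE)
      then have "i4 (\<Theta> f) = i4 (\<Theta> F) * i4 k" by (simp add: hom_mult[OF i_hom(4)])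
      then show "F dvd f" by (simp add: i4_\<Theta>)
    qed (auto elim!: dvdE simp: hom_mult[OF \<Theta>(1)])
    then show ?thesis unfolding F(3) by simp
  qed
  \<comment> \<open>Otherwise \<open>Y\<close> is the zero ideal and the Jacobian rank at the
    nonzero point \<open>1\<close> is 0 instead of 1.\<close>
  have F0: "F \<noteq> 0"
  proof
    assume "F = 0"
    then have Y0: "Y = {0}" unfolding Y by auto
    have "gradient 0 (1 :: complex ^ 4) = 0"
      by (simp add: gradient_def partial_deriv_zero hom_zero[OF ring_hom1_eval_mpoly] vec_eq_iff)
    then have z: "vec.dim ((\<lambda>f. gradient f (1 :: complex ^ 4)) ` Y) = 0" by (intro dim_gradients_zero) (simp add: Y0)
    have "vec.dim ((\<lambda>f. gradient f (1 :: complex ^ 4)) ` Y) + 2 = 3"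
      by (rule jac) (simp_all add: Y0 hom_zero[OF ring_hom1_eval_mpoly])
    then show False unfolding z by simp
  qed
  have ed: "e = d" using degree_hypersurface[OF F(1) F0] deg unfolding Y by blast
  have "F \<in> Y" unfolding Y by simp
  then obtain a b where ab: "F = x * a + z * b" using Yl by blast
  obtain h where h: "F = i3 (\<rho> F) + z * h" by (rule z_decomp)
  have \<rho>F: "\<rho> F = [:0, 1:] * \<rho> a" unfolding ab by (simp add: hom_simps[OF \<rho>_hom])
  define g where "g = i3 (\<rho> a)"
  have xg: "i3 (\<rho> F) = x * g" unfolding \<rho>F g_def by (simp only: hom_mult[OF i_hom(3)] i3_coords)
  have d1: "1 + (d - 1) = d" using d by simp
  have "x * g \<in> homog (1 + (d - 1))" using i3_\<rho>_homog[OF F(1)] unfolding xg d1 ed .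
  then have "g \<in> homog (d - 1)" by (rule homog_cancel[OF linear(1) coords_nonzero(1)])
  then have g: "g \<in> plane_homog (d - 1)" unfolding plane_homog_def by (simp add: g_def)
  have "z * h = F - x * g" using h unfolding xg by (simp add: algebra_simps)
  then have "z * h \<in> homog (1 + (d - 1))" using F(1) \<open>x * g \<in> homog (1 + (d - 1))\<close> unfolding d1 ed by (simp add: homog_diff)
  then have hh: "h \<in> homog (d - 1)" by (rule homog_cancel[OF linear(3) coords_nonzero(3)])
  have Fe: "F = z * h + x * g" using h unfolding xg by (simp add: add.commute)
  have "eval_mpoly (($) p) h \<noteq> 0 \<or> eval_mpoly (($) p) g \<noteq> 0"
    if p: "p \<noteq> 0" "eval_mpoly (($) p) x = 0" "eval_mpoly (($) p) z = 0" for p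
  proof (rule ccontr)
    assume n: "\<not> ?thesis"
    have eF: "eval_mpoly (($) p) F = 0" unfolding Fe using p by (simp add: hom_simps[OF ring_hom1_eval_mpoly])
    \<comment> \<open>On the line the gradient of F is A times that of z plus g times that of x, so
      it vanishes at a common zero of A and g.\<close>
    have gF: "gradient F p = 0" unfolding Fe gradient_add gradient_mult using p n by simp
    have "gradient f p = 0" if "f \<in> Y" for f
      using that eF gF unfolding Y by (auto elim!: dvdE simp: gradient_mult)
    then have z: "vec.dim ((\<lambda>f. gradient f p) ` Y) = 0" by (rule dim_gradients_zero)
    have "vec.dim ((\<lambda>f. gradient f p) ` Y) + 2 = 3"
      by (rule jac[OF p(1)]) (use eF in \<open>auto simp: Y hom_mult[OF ring_hom1_eval_mpoly] elim!: dvdE\<close>)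
    then show False unfolding z by simp
  qed
  with hh g Fe Y show ?thesis by (rule that)
qed

end

text \<open>The coordinate \<open>w\<close> is chosen so that \<open>g\<close> does not vanish at the point \<open>x = z = w = 0\<close>.\<close>

lemma surface_coords:
  assumes co: "coords x y z w" and sm: "smooth_surface d Y" and d: "2 \<le> d" and Yl: "Y \<subseteq> {x * a + z * b | a b. True}"
  obtains y' w' A g F where "surface x y' z w' A g F (d - 1)" "Y = {f. F dvd f}"
proof -
  interpret C: coords x y z w by (rule co)
  have d1: "1 \<le> d" using d by simp
  obtain A0 g0 F0 where A0: "A0 \<in> homog (d - 1)" "g0 \<in> C.plane_homog (d - 1)" "F0 = z * A0 + x * g0" "Y = {f. F0 dvd f}"
    and nv: "\<And>p. p \<noteq> 0 \<Longrightarrow> eval_mpoly (($) p) x = 0 \<Longrightarrow> eval_mpoly (($) p) z = 0 \<Longrightarrow>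
       eval_mpoly (($) p) A0 \<noteq> 0 \<or> eval_mpoly (($) p) g0 \<noteq> 0"
    using C.surface_equation[OF sm d1 Yl] by metis
  have ne: "p \<noteq> 0" if "eval_mpoly (($) p) u \<noteq> 0" "u \<in> homog 1" for u and p :: "complex ^ 4"
    using that eval_mpoly_linear_0[of u] by auto
  have g0: "g0 \<in> homog (d - 1)" using A0(2) C.plane_homog_sub by blast
  have \<delta>g0: "C.\<delta> g0 \<noteq> 0"
  proof
    assume z0: "C.\<delta> g0 = 0"
    then have \<kappa>g0: "C.\<kappa> g0 = 0" using C.homog_\<delta>_eq_0[OF g0] by simp
    have eg: "eval_mpoly (($) p) g0 = 0" if "eval_mpoly (($) p) x = 0" "eval_mpoly (($) p) z = 0" for p :: "complex ^ 4"
    proof -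
      obtain a b where "g0 = x * a + z * b" using \<kappa>g0 unfolding C.\<kappa>_eq_0_iff by blast
      then show ?thesis using C.eval_eq_0_iff_line[OF that] by simp
    qed
    show False
    \<comment> \<open>If g vanished on the line, every zero of A there would be singular. Without a
      zero in the chart w = 1, A restricts to a multiple of w^(d-1), which vanishes at w = 0 because
      d \<ge> 2.\<close>
    proof (cases "\<exists>t. poly (C.\<delta> A0) t = 0")
      case True
      then obtain t where t: "poly (C.\<delta> A0) t = 0" by blast
      obtain p where p: "eval_mpoly (($) p) x = 0" "eval_mpoly (($) p) y = t" "eval_mpoly (($) p) z = 0" "eval_mpoly (($) p) w = 1"
        using C.point_exists[of 0 t 0 1] by metis
      have "p \<noteq> 0" using ne[of p w] p(4) C.linear(4) by simp
      then show False using nv[OF _ p(1,3)] eg[OF p(1,3)] C.eval_\<delta>[OF p(1,3,4), of A0] t p(2) by simp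
    next
      case False
      then have "constant (poly (C.\<delta> A0))" using fundamental_theorem_of_algebra by blast
      then have "degree (C.\<delta> A0) = 0" by (simp add: constant_degree)
      then obtain c where c: "C.\<delta> A0 = [:c:]" by (rule degree_eq_zeroE)
      have "C.\<delta> (A0 - cst c * w ^ (d - 1)) = 0" by (simp add: hom_simps[OF C.\<delta>_hom] c)
      moreover have "A0 - cst c * w ^ (d - 1) \<in> homog (d - 1)"
        using homog_power[OF C.linear(4), of "d - 1"] A0(1) by (intro homog_diff homog_cst_mult) simp_all
      ultimately have "C.\<kappa> (A0 - cst c * w ^ (d - 1)) = 0" using C.homog_\<delta>_eq_0 by blast
      then obtain a b where ab: "A0 - cst c * w ^ (d - 1) = x * a + z * b" unfolding C.\<kappa>_eq_0_iff by blast
      obtain p where p: "eval_mpoly (($) p) x = 0" "eval_mpoly (($) p) y = 1" "eval_mpoly (($) p) z = 0" "eval_mpoly (($) p) w = 0"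
        using C.point_exists[of 0 1 0 0] by metis
      have "p \<noteq> 0" using ne[of p y] p(2) C.linear(2) by simp
      moreover have "A0 = cst c * w ^ (d - 1) + (x * a + z * b)" using ab by (simp add: algebra_simps)
      then have "eval_mpoly (($) p) A0 = 0" using p d by (simp add: hom_simps[OF ring_hom1_eval_mpoly])
      ultimately show False using nv[OF _ p(1,3)] eg[OF p(1,3)] by simp
    qed
  qed
  obtain c where c: "poly (C.\<delta> g0) c \<noteq> 0" using \<delta>g0 poly_all_0_iff_0 by blast
  obtain p where p: "eval_mpoly (($) p) x = 0" "eval_mpoly (($) p) y = c" "eval_mpoly (($) p) z = 0" "eval_mpoly (($) p) w = 1"
    using C.point_exists[of 0 c 0 1] by metis
  define v where "v = y - cst c * w"
  have ev: "eval_mpoly (($) p) v = 0" using p by (simp add: v_def hom_simps[OF ring_hom1_eval_mpoly] eval_mpoly_cst)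
  \<comment> \<open>In these coordinates p, where g is nonzero, is the point at which x, z and the
    last coordinate vanish.\<close>
  interpret D: coords x w z v unfolding v_def by (rule C.change_coords)
  obtain A g F where A: "A \<in> homog (d - 1)" "g \<in> D.plane_homog (d - 1)" "F = z * A + x * g" "Y = {f. F dvd f}"
    and nv': "\<And>p. p \<noteq> 0 \<Longrightarrow> eval_mpoly (($) p) x = 0 \<Longrightarrow> eval_mpoly (($) p) z = 0 \<Longrightarrow>
       eval_mpoly (($) p) A \<noteq> 0 \<or> eval_mpoly (($) p) g \<noteq> 0"
    using D.surface_equation[OF sm d1 Yl] by metis
  have "F0 \<in> Y" unfolding A0(4) by simp
  then have "F dvd F0" unfolding A(4) by simp
  then obtain k where k: "F0 = F * k" by (auto elim: dvdE)
  \<comment> \<open>The new coordinates change the splitting of the equation. Modulo z the two forms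
    g agree up to the factor k between the equations, so nonvanishing at p carries over.\<close>
  have "z * (A0 - A * k) = x * (g * k - g0)"
    using k unfolding A(3) A0(3) by (simp add: algebra_simps)
  then have "C.\<rho> (z * (A0 - A * k)) = C.\<rho> (x * (g * k - g0))" by simp
  then have "C.\<rho> (g * k - g0) = 0" by (simp add: hom_mult[OF C.\<rho>_hom])
  then have "C.\<delta> (g * k) = C.\<delta> g0" unfolding C.\<delta>_def by (simp add: hom_simps[OF C.\<rho>_hom])
  then have "eval_mpoly (($) p) (g * k) \<noteq> 0" using C.eval_\<delta>[OF p(1,3,4)] c p(2) by simp
  then have gp: "eval_mpoly (($) p) g \<noteq> 0" by (simp add: hom_mult[OF ring_hom1_eval_mpoly])
  have ev1: "eval_mpoly (($) p) f = poly (D.\<omega> f) 1" for f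
    by (rule D.hom_eqI_coords[OF ring_hom1_eval_mpoly ring_hom1_comp[OF ring_hom1_poly D.\<omega>_hom]])
      (simp_all add: p ev eval_mpoly_cst D.\<omega>_simps)
  have \<omega>: "D.\<omega> g \<noteq> 0" using gp ev1[of g] by auto
  have cop: "coprime (D.\<delta> A) (D.\<delta> g)"
  proof (rule ccontr)
    assume "\<not> ?thesis"
    then obtain t where t: "poly (D.\<delta> A) t = 0" "poly (D.\<delta> g) t = 0" by (rule not_coprime_common_root)
    obtain r where r: "eval_mpoly (($) r) x = 0" "eval_mpoly (($) r) w = t" "eval_mpoly (($) r) z = 0" "eval_mpoly (($) r) v = 1"
      using D.point_exists[of 0 t 0 1] by metis
    have "r \<noteq> 0" using ne[of r v] r(4) D.linear(4) by simp
    then show False using nv'[OF _ r(1,3)] D.eval_\<delta>[OF r(1,3,4), of A] D.eval_\<delta>[OF r(1,3,4), of g] t r(2) by simp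
  qed
  have "surface x w z v A g F (d - 1)"
    by unfold_locales (rule A cop \<omega>)+
  then show ?thesis using A(4) by (rule that)
qed

context surface
begin

text \<open>Modulo z the ideal is principal, by \<open>pure_codim_one_principal\<close> with the
  chain from 0 to (z). Since F lies in \<open>D\<close>, the generator divides xg. Either x is not a
  factor and the generator divides g, or the curve contains the line and the cofactor of x divides
  g.\<close>

lemma plane_curve:
  assumes pure: "pure_dim 1 D" and deg: "has_degree D a" and zD: "z \<in> D" and FD: "F \<in> D"
  obtains q B where "D = {f. \<rho> q dvd \<rho> f}" "splits q B a"
  | p B where "D = {f. \<rho> (x * p) dvd \<rho> f}" "1 \<le> a" "splits p B (a - 1)"
proof -
  have cl: "closed_subscheme D" "D \<noteq> UNIV" and pd: "\<And>p. p \<in> associated_points D \<Longrightarrow> point_dim p = enat 1"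
    using pure unfolding pure_dim_def by blast+
  have sub: "ideal.subspace D" using cl(1) homogeneous_ideal_subspace unfolding closed_subscheme_def by blast
  have prime0: "prime_ideal ({0} :: coord_ring set)" by (rule prime_ideal_zero)
  have prime1: "prime_ideal {f. \<rho> f = 0}"
  proof -
    have "\<rho> 1 \<noteq> 0" using hom_one[OF \<rho>_hom] by simp
    then have "{f. \<rho> f = 0} \<noteq> UNIV" by blast
    then show ?thesis
      unfolding prime_ideal_def ideal.subspace_def by (auto simp: hom_simps[OF \<rho>_hom])
  qed
  obtain q e where q: "q \<in> homog e" "i3 (\<rho> q) = q" "D = {f. \<rho> q dvd \<rho> f}"
  proof (rule pure_codim_one_principal[OF \<rho>_hom i_hom(3) \<rho>_i3 i3_\<rho>_homog cl _ pd,
        where j = 1 and c = "\<lambda>i. if i = 0 then {0} else {f. \<rho> f = 0}"])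
    show "f \<in> D" if "\<rho> f = 0" for f
      using that ideal.subspace_scale[OF sub zD] unfolding \<rho>_eq_0_iff by (auto simp: mult.commute)
    show "prime_ideal (if i = 0 then {0} else {f. \<rho> f = 0})" for i :: nat using prime0 prime1 by simp
    have "{0} \<subset> {f. \<rho> f = 0}" using coords_nonzero(3) hom_zero[OF \<rho>_hom] \<rho>_simps(3) by blast
    then show "(if i = 0 then {0} else {f. \<rho> f = 0}) \<subset> (if Suc i = 0 then {0} else {f. \<rho> f = 0})" if "i < 1" for i :: nat
      using that by simp
  qed simp_all
  have g': "i3 (\<rho> g) = g" "g \<in> homog m" "\<rho> g \<noteq> 0"
    using g \<omega>g hom_zero[OF \<omega>_hom] by (auto simp: plane_homog_def \<omega>_def)
  have g0: "g \<noteq> 0" using g'(3) hom_zero[OF \<rho>_hom] by auto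
  have dF: "\<rho> q dvd [:0, 1:] * \<rho> g" using FD unfolding q(3) F by (simp add: hom_simps[OF \<rho>_hom])
  have q0: "q \<noteq> 0" using dF g'(3) hom_zero[OF \<rho>_hom] by auto
  have qp: "q \<in> plane_homog e" using q by (simp add: plane_homog_def)
  have ea: "e = a" using degree_plane_curve[OF qp q0] deg unfolding q(3) by blast
  have sp: "splits p (i3 t) k" if "\<rho> g = \<rho> p * t" "i3 (\<rho> p) = p" "p \<in> homog k" "p \<noteq> 0" for p t k
  proof -
    have "i3 (\<rho> g) = i3 (\<rho> p) * i3 t" unfolding that(1) by (rule hom_mult[OF i_hom(3)])
    then have gp: "g = p * i3 t" using g'(1) that(2) by simp
    obtain k' where k': "k' \<le> m" "p \<in> homog k'" using factor_homog[of p "i3 t" m] g'(2) g0 gp by auto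
    have "k' = k" by (rule homog_unique[OF k'(2) that(3,4)])
    then have km: "k \<le> m" using k'(1) by simp
    have "p * i3 t \<in> homog (k + (m - k))" using g'(2) gp km by simp
    then have "i3 t \<in> homog (m - k)" by (rule homog_cancel[OF that(3,4)])
    then show ?thesis using that(2,3) km gp[symmetric] by (simp add: splits_def plane_homog_def)
  qed
  show ?thesis
  proof (cases "[:0, 1:] dvd \<rho> q")
    case False
    obtain t where t: "[:0, 1:] * \<rho> g = \<rho> q * t" using dF by (rule dvdE)
    have "([:0, 1:] :: plane_ring) dvd \<rho> q * t" unfolding t[symmetric] by (rule dvd_triv_left)
    then have "[:0, 1:] dvd t" using False prime_X[OF splits_1] prime_elem_dvd_mult_iff by blast
    then obtain r where "t = [:0, 1:] * r" by (rule dvdE)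
    then have "[:0, 1:] * \<rho> g = [:0, 1:] * (\<rho> q * r)" using t by (simp only: mult.left_commute)
    then have "\<rho> g = \<rho> q * r" by (subst (asm) mult_cancel_left) simp
    then show ?thesis using that(1)[OF q(3)] sp[OF _ q(2) q(1) q0] ea by blast
  next
    case True
    then obtain r where r: "\<rho> q = [:0, 1:] * r" by (rule dvdE)
    have "i3 (\<rho> q) = i3 ([:0, 1:] * r)" using r by simp
    then have qx: "q = x * i3 r" using q(2) by (simp only: hom_mult[OF i_hom(3)] i3_coords)
    have "i3 r \<noteq> 0" using q0 qx by auto
    obtain k where k: "k \<le> e" "i3 r \<in> homog k" using factor_homog[of "i3 r" x e] q(1) q0 qx by (auto simp: mult.commute)
    have "e = 1 + k" using homog_unique[OF q(1) _ q0] homog_mult[OF linear(1) k(2)] unfolding qx[symmetric] by blast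
    then have a1: "1 \<le> a" "k = a - 1" using ea by simp_all
    have "[:0, 1:] * r dvd [:0, 1:] * \<rho> g" using dF unfolding r .
    then have "r dvd \<rho> g" by (subst (asm) dvd_mult_cancel_left) simp
    then obtain t where "\<rho> g = r * t" by (rule dvdE)
    then have "\<rho> g = \<rho> (i3 r) * t" by simp
    from sp[OF this _ k(2) \<open>i3 r \<noteq> 0\<close>] have "splits (i3 r) (i3 t) (a - 1)" unfolding a1(2) by simp
    then show ?thesis using that(2)[of "i3 r"] q(3) a1(1) unfolding qx by blast
  qed
qed

text \<open>A residual curve p = 0 of positive degree would meet the line. There the gradient of xp
  vanishes, so only that of z remains, while a smooth curve needs rank 2. Hence p is
  constant.\<close>

lemma smooth_curve_containing_line:
  assumes sm: "smooth_of_dim 1 D" and D: "D = {f. \<rho> (x * p) dvd \<rho> f}" and p: "splits p B k"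
  shows "D = {x * a + z * b | a b. True}"
proof (cases k)
  case 0
  then obtain c where c: "p = cst c" using homog_0_cst spD(1)[OF p] by blast
  then have "c \<noteq> 0" using \<rho>_sp(5)[OF p] by (auto simp: cst_def)
  have u: "\<rho> (x * p) dvd \<rho> f \<longleftrightarrow> \<kappa> f = 0" for f
  proof -
    have unit: "\<rho> p dvd 1"
    proof (rule dvdI)
      have "\<rho> (cst c * cst (1 / c)) = 1" using \<open>c \<noteq> 0\<close> hom_one[OF \<rho>_hom] by (simp add: cst_def mult_single)
      then show "1 = \<rho> p * \<rho> (cst (1 / c))" unfolding c hom_mult[OF \<rho>_hom] by (rule sym)
    qed
    have "\<rho> (x * p) dvd \<rho> f \<longleftrightarrow> [:0, 1:] dvd \<rho> f"
      unfolding hom_mult[OF \<rho>_hom] \<rho>_simps using unit by (rule mult_unit_dvd_iff)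
    also have "\<dots> \<longleftrightarrow> coeff (\<rho> f) 0 = 0" using poly_eq_0_iff_dvd[of "\<rho> f" 0] by (simp add: poly_0_coeff_0)
    also have "\<dots> \<longleftrightarrow> \<kappa> f = 0"
    proof
      assume "\<kappa> f = 0"
      then have "\<rho> (\<kappa> f) = 0" using hom_zero[OF \<rho>_hom] by simp
      then show "coeff (\<rho> f) 0 = 0" unfolding \<rho>_\<kappa> by simp
    qed (simp add: \<kappa>_def hom_zero[OF i_hom(2)])
    finally show ?thesis .
  qed
  show ?thesis unfolding D u \<kappa>_eq_0_iff by blast
next
  case (Suc j)
  have "degree (\<delta> p) = k" using degree_\<delta>[OF spD(1)[OF p] \<omega>_sp(1)[OF p]] by simp
  then have "\<not> constant (poly (\<delta> p))" using Suc by (simp add: constant_degree)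
  then obtain t where t: "poly (\<delta> p) t = 0" using fundamental_theorem_of_algebra by blast
  obtain r where r: "eval_mpoly (($) r) x = 0" "eval_mpoly (($) r) y = t" "eval_mpoly (($) r) z = 0" "eval_mpoly (($) r) w = 1"
    using point_exists[of 0 t 0 1] by metis
  have r0: "r \<noteq> 0" using r(4) eval_mpoly_linear_0[OF linear(4)] by auto
  have pr: "eval_mpoly (($) r) p = 0" using eval_\<delta>[OF r(1,3,4), of p] t r(2) by simp
  have xp: "i3 (\<rho> (x * p)) = x * p" by (simp add: hom_mult[OF i3_\<rho>_hom] i3_coords spD(3)[OF p])
  have form: "\<exists>a b. f = x * p * a + z * b" if f: "f \<in> D" for f
  proof -
    have "\<rho> (x * p) dvd \<rho> f" using f unfolding D by simp
    from dvd_\<rho>E[OF xp this] show ?thesis by blast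
  qed
  have "eval_mpoly (($) r) f = 0" if f: "f \<in> D" for f
    using form[OF f] r by (auto simp: hom_simps[OF ring_hom1_eval_mpoly])
  then have "vec.dim ((\<lambda>f. gradient f r) ` D) + 1 = 3"
    using sm r0 unfolding smooth_of_dim_def by blast
  moreover have "vec.dim ((\<lambda>f. gradient f r) ` D) \<le> card {gradient z r}"
  proof (rule dim_gradients_le)
    fix f assume "f \<in> D"
    then obtain a b where f: "f = x * p * a + z * b" using form by blast
    have "gradient f r = eval_mpoly (($) r) b *s gradient z r"
      unfolding f gradient_add gradient_mult using r pr by (simp add: hom_simps[OF ring_hom1_eval_mpoly])
    then show "gradient f r \<in> vec.span {gradient z r}" by (simp add: vec.span_scale vec.span_base)
  qed simp
  ultimately show ?thesis by simp
qed

end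

section \<open>Comparison of Hilbert polynomials\<close>

lemma surface_through_line:
  assumes l: "is_line l" and cop: "coplanar_subschemes l D" and Y: "smooth_surface d Y" "contained_in l Y" and d: "2 \<le> d"
  obtains x y z w A g F where "surface x y z w A g F (d - 1)" "Y = {f. F dvd f}" "l = {x * a + z * b | a b. True}" "z \<in> D"
proof -
  obtain h where h: "h \<in> homog 1" "h \<noteq> 0" "ideal.span {h} \<subseteq> l" "ideal.span {h} \<subseteq> D"
    using cop unfolding coplanar_subschemes_def is_plane_def contained_in_def by blast
  have "h \<in> ideal.span {h}" by (rule ideal.span_base) simp
  then have hl: "h \<in> l" "h \<in> D" using h(3,4) by blast+
  obtain x y w where co: "coords x y h w" "l = {x * a + h * b | a b. True}"
    using line_coords[OF l hl(1) h(1,2)] by blast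
  have Yl: "Y \<subseteq> {x * a + h * b | a b. True}" using Y(2) unfolding contained_in_def co(2) .
  obtain y' w' A g F where "surface x y' h w' A g F (d - 1)" "Y = {f. F dvd f}"
    by (rule surface_coords[OF co(1) Y(1) d Yl])
  then show ?thesis using co(2) hl(2) by (rule that)
qed

text \<open>A smooth curve of this kind containing the line equals it, so the first alternative of
  \<open>plane_curve\<close> applies. The dimension obtained is the reference value for the Hilbert
  polynomial.\<close>

lemma dim_smooth_case:
  assumes l: "is_line l" "coplanar_subschemes l D" and Y: "smooth_surface d Y" "contained_in l Y" "contained_in D Y" and d: "2 \<le> d"
    and D: "smooth_of_dim 1 D" "has_degree D a" "D \<noteq> l" and n: "d + 2 \<le> n"
  shows "2 * real (cvs.dim (divisor_add Y (divisor_add Y l l) D \<inter> homog n)) =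
    (real n - 1 - real a) * (real n - real a) + 2 * (real n - real (d - 1)) + 2 * real (cvs.dim (homog (n - 1) :: coord_ring set)) - 2 * real n"
proof -
  obtain x y z w A g F where s: "surface x y z w A g F (d - 1)" and YF: "Y = {f. F dvd f}"
    and lxz: "l = {x * a + z * b | a b. True}" and zD: "z \<in> D"
    by (rule surface_through_line[OF l Y(1,2) d])
  interpret surface x y z w A g F "d - 1" by (rule s)
  have l\<kappa>: "l = {f. \<kappa> f = 0}" unfolding lxz \<kappa>_eq_0_iff by blast
  have FD: "F \<in> D" using Y(3) unfolding contained_in_def YF by auto
  have pure: "pure_dim 1 D" using D(1) unfolding smooth_of_dim_def by blast
  from pure D(2) zD FD show ?thesis
  proof (cases rule: plane_curve)
    case (1 q B)
    show ?thesis
      unfolding YF l\<kappa> 1(1) divisor_eq_T[OF 1(2)] using n d by (intro dim_T_2_formula[OF 1(2)]) simp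
  next
    case (2 p B)
    then show ?thesis using smooth_curve_containing_line[OF D(1) 2(1,3)] D(3) lxz by simp
  qed
qed

text \<open>The plane curve is only of pure dimension one here and may contain the line. Then
  \<open>C\<close> lies in the ideal of a divisor with a triple line, which has too small a
  dimension in every large degree.\<close>

lemma nonlift_or_small_dim:
  assumes l: "is_line l" "coplanar_subschemes l D" and Y: "smooth_surface d Y" "contained_in l Y" "contained_in D Y"
    and D: "pure_dim 1 D" "has_degree D a" and a: "1 \<le> a" "a + 3 \<le> d" and C: "C = divisor_add Y (divisor_add Y l l) D"
  shows "(\<exists>\<xi>\<in>normal_sections C. Upsilon5 C (reduction C) \<xi> \<notin> Upsilon6 C (reduction C) ` normal_sections (reduction C)) \<or>
    (\<forall>n\<ge>d + 2. 2 * real (cvs.dim (C \<inter> homog n)) <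
      (real n - 1 - real a) * (real n - real a) + 2 * (real n - real (d - 1)) + 2 * real (cvs.dim (homog (n - 1) :: coord_ring set)) - 2 * real n)"
proof -
  have d: "2 \<le> d" using a by simp
  obtain x y z w A g F where s: "surface x y z w A g F (d - 1)" and YF: "Y = {f. F dvd f}"
    and lxz: "l = {x * a + z * b | a b. True}" and zD: "z \<in> D"
    by (rule surface_through_line[OF l Y(1,2) d])
  interpret surface x y z w A g F "d - 1" by (rule s)
  have l\<kappa>: "l = {f. \<kappa> f = 0}" unfolding lxz \<kappa>_eq_0_iff by blast
  have FD: "F \<in> D" using Y(3) unfolding contained_in_def YF by auto
  from D zD FD show ?thesis
  proof (cases rule: plane_curve)
    case (1 q B)
    have C': "C = T 2 q" unfolding C YF l\<kappa> 1(1) by (rule divisor_eq_T[OF 1(2)])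
    show ?thesis unfolding C' using a by (intro disjI1 nonlift[OF 1(2)]) simp_all
  next
    case (2 p B)
    have sub: "C \<subseteq> T 3 p" unfolding C YF l\<kappa>
    proof (rule divisor_subset)
      show "D \<subseteq> {f. \<rho> (x * p) dvd \<rho> f}" using 2(1) by simp
      show "splits p B (a - 1)" by (rule 2(3))
      show "k * c \<in> T 3 p" if "k \<in> T 2 1" "\<rho> (x * p) dvd \<rho> c" for k c
        by (rule T_2_times_x_subset[OF that(1) spD(3)[OF 2(3)] that(2)])
    qed
    have "2 * real (cvs.dim (C \<inter> homog n)) <
      (real n - 1 - real a) * (real n - real a) + 2 * (real n - real (d - 1)) + 2 * real (cvs.dim (homog (n - 1) :: coord_ring set)) - 2 * real n"
      (is "_ < ?R") if n: "d + 2 \<le> n" for n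
    proof -
      define k where "k = n - 2"
      have k: "n - 1 = Suc k" "n - 2 = k" "real n = real k + 2" using n unfolding k_def by auto
      have "2 * cvs.dim (homog (Suc k) :: coord_ring set) = 2 * cvs.dim (homog k :: coord_ring set) + (Suc k + 1) * (Suc k + 2)"
        unfolding dim_homog_Suc distrib_left dim_plane_homog ..
      then have "real (2 * cvs.dim (homog (Suc k) :: coord_ring set)) = real (2 * cvs.dim (homog k :: coord_ring set) + (Suc k + 1) * (Suc k + 2))"
        by (simp only:)
      then have S: "2 * real (cvs.dim (homog (Suc k) :: coord_ring set)) = 2 * real (cvs.dim (homog k :: coord_ring set)) + (real k + 2) * (real k + 3)"
        by (simp add: algebra_simps)
      have ra: "real (a - 1) = real a - 1" using a(1) by (simp add: of_nat_diff)
      have "cvs.dim (C \<inter> homog n) \<le> cvs.dim (T 3 p \<inter> homog n)"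
        using sub by (intro dim_mono_homog[where n = n]) auto
      then have "2 * real (cvs.dim (C \<inter> homog n)) \<le> 2 * real (cvs.dim (T 3 p \<inter> homog n))" by simp
      also have "\<dots> \<le> (real n - 1 - real (a - 1)) * (real n - real (a - 1)) + 2 * (real n - real (d - 1))
          + ((real n - 2) * (real n - 1) + 2 * (real n - 1 - real (d - 1))
          + 2 * real (cvs.dim (homog (n - 2) :: coord_ring set)) - 2 * (real n - 1))"
        using n d by (intro dim_T_3_bound[OF 2(3)]) simp
      \<comment> \<open>The gap, doubled, between the two dimension formulas; it equals 2(a + d -
        2), which is positive.\<close>
      also have "\<dots> + (2 * real a + 2 * real (d - 1) - 2) = ?R"
        unfolding k S ra by (simp add: algebra_simps)
      finally have le: "2 * real (cvs.dim (C \<inter> homog n)) + (2 * real a + 2 * real (d - 1) - 2) \<le> ?R" by simp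
      have "0 < 2 * real a + 2 * real (d - 1) - 2" using a by simp
      then show ?thesis by (intro less_le_trans[OF _ le]) (simp only: less_add_same_cancel1)
    qed
    then show ?thesis by blast
  qed
qed

theorem theorem1p1:
  fixes a d :: nat
    and l C\<^sub>2 X :: "coord_ring set"
    and P :: "rat poly"
    and L :: "coord_ring set set"
  assumes "a > 0" and "d > a + 6"
    and "is_line l"
    and "smooth_of_dim 1 C\<^sub>2" and "has_degree C\<^sub>2 a" and "C\<^sub>2 \<noteq> l" and "coplanar_subschemes l C\<^sub>2"
    and "smooth_surface d X" and "contained_in l X" and "contained_in C\<^sub>2 X"
    and "has_hilbert_poly (divisor_add X (divisor_add X l l) C\<^sub>2) P"
    and "hilb_component P L"
    and "for_general_point P L (\<lambda>C\<^sub>g. \<exists>Y l\<^sub>g C\<^sub>2\<^sub>g.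
           smooth_surface d Y \<and> effective_divisor Y C\<^sub>g \<and>
           is_line l\<^sub>g \<and> effective_divisor Y l\<^sub>g \<and>
           pure_dim 1 C\<^sub>2\<^sub>g \<and> has_degree C\<^sub>2\<^sub>g a \<and> effective_divisor Y C\<^sub>2\<^sub>g \<and>
           coplanar_subschemes l\<^sub>g C\<^sub>2\<^sub>g \<and>
           C\<^sub>g = divisor_add Y (divisor_add Y l\<^sub>g l\<^sub>g) C\<^sub>2\<^sub>g)"
  shows "for_general_point P L (\<lambda>C\<^sub>g. \<exists>\<xi>\<^sub>0 \<in> normal_sections C\<^sub>g.
           Upsilon5 C\<^sub>g (reduction C\<^sub>g) \<xi>\<^sub>0
             \<notin> Upsilon6 C\<^sub>g (reduction C\<^sub>g) ` normal_sections (reduction C\<^sub>g))"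
proof -
  let ?D = "divisor_add X (divisor_add X l l) C\<^sub>2"
  have d: "2 \<le> d" "1 \<le> a" "a + 3 \<le> d" using assms(1,2) by simp_all
  have nonlift: "\<exists>\<xi>\<in>normal_sections C. Upsilon5 C (reduction C) \<xi> \<notin> Upsilon6 C (reduction C) ` normal_sections (reduction C)"
    if CL: "C \<in> L" and Y: "smooth_surface d Y" "is_line l'" "effective_divisor Y l'" "pure_dim 1 D" "has_degree D a"
      "effective_divisor Y D" "coplanar_subschemes l' D" "C = divisor_add Y (divisor_add Y l' l') D" for C Y l' D
  proof -
    have "C \<in> hilb P" using assms(12) CL unfolding hilb_component_def hilb_irreducible_def by blast
    then have CP: "has_hilbert_poly C P" unfolding hilb_def by blast
    \<comment> \<open>Both schemes have Hilbert polynomial P, so in some large degree their ideals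
      have equal dimension, which rules out the triple line.\<close>
    have "\<forall>\<^sub>F n in sequentially. d + 2 \<le> n \<and> cvs.dim (C \<inter> homog n) = cvs.dim (?D \<inter> homog n)"
      using CP assms(11) eventually_ge_at_top[of "d + 2"] unfolding has_hilbert_poly_def by eventually_elim simp
    then obtain n where n: "d + 2 \<le> n" "cvs.dim (C \<inter> homog n) = cvs.dim (?D \<inter> homog n)"
      using eventually_happens'[OF sequentially_bot] by blast
    have con: "contained_in l' Y" "contained_in D Y" using Y(3,6) unfolding effective_divisor_def by blast+
    show ?thesis
      using nonlift_or_small_dim[OF Y(2,7,1) con Y(4,5) d(2,3) Y(8)] n
        dim_smooth_case[OF assms(3,7-10) d(1) assms(4-6) n(1)] by auto
  qed
  obtain \<Z> where Z: "finite \<Z>" "\<forall>Z\<in>\<Z>. hilb_closed P Z \<and> \<not> L \<subseteq> Z"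
    and gen: "\<forall>C\<in>L - \<Union>\<Z>. \<exists>Y l\<^sub>g C\<^sub>2\<^sub>g.
           smooth_surface d Y \<and> effective_divisor Y C \<and>
           is_line l\<^sub>g \<and> effective_divisor Y l\<^sub>g \<and>
           pure_dim 1 C\<^sub>2\<^sub>g \<and> has_degree C\<^sub>2\<^sub>g a \<and> effective_divisor Y C\<^sub>2\<^sub>g \<and>
           coplanar_subschemes l\<^sub>g C\<^sub>2\<^sub>g \<and>
           C = divisor_add Y (divisor_add Y l\<^sub>g l\<^sub>g) C\<^sub>2\<^sub>g"
    using assms(13) unfolding for_general_point_def by blast
  \<comment> \<open>The exceptional closed sets are those of the hypothesis: outside them the
    property follows for each curve separately.\<close>
  show ?thesis
    unfolding for_general_point_def
  proof (intro exI[of _ \<Z>] conjI Z ballI)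
    fix C assume C: "C \<in> L - \<Union>\<Z>"
    then have CL: "C \<in> L" by blast
    from bspec[OF gen C] show "\<exists>\<xi>\<in>normal_sections C. Upsilon5 C (reduction C) \<xi> \<notin> Upsilon6 C (reduction C) ` normal_sections (reduction C)"
      by (elim exE conjE) (rule nonlift[OF CL]; assumption)
  qed
qed

end
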